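(* Let the data satisfy $u^0\in D(A^2)$, $v^0\in D(A^{3/2})$, $f(0)\in D(A)$, $f_t(0)\in D(A^{1/2})$, $f_{tt}(0)\in L^2(\Omega)$, $f,f_t,f_{tt},f_{ttt}\in L^2(0,T;L^2(\Omega))$, so that the weak solution $u$ of the biharmonic wave problem has $u,u_t,u_{tt}\in L^\infty(0,T;H^{2+\gamma_0}(\Omega))$ and $u_{tt},u_{ttt},u_{tttt}\in L^\infty(0,T;L^2(\Omega))$. Let $U^0,\dots,U^N\in V_h$ be given by the implicit scheme $U^0=\mathcal R_hu^0$, $$2k^{-1}(\bar\partial_tU^{1/2},v_h)+a_h(U^{1/2},v_h)=(f^{1/2}+2k^{-1}v^0,v_h)\quad\text{for all }v_h\in V_h,$$ $$(\bar\partial_t^2U^n,v_h)+a_h(U^{n,1/4},v_h)=(f^{n,1/4},v_h)\quad\text{for all }v_h\in V_h,\ n=1,\dots,N-1 .$$ Then there is a constant $C>0$, depending on $\alpha,\beta,T,C_1,C_2$ but independent of $h$ and $k$, such that for $1\le m\le N-1$ $$\|\bar\partial_tu^{m+1/2}-\bar\partial_tU^{m+1/2}\|+\|u^{m+1/2}-U^{m+1/2}\|_h\le C\big(h^{\gamma_0}L_{(f,u)}+k^2M_{(u)}\big),$$ where $$L_{(f,u)}=\|f\|_{L^\infty(L^2)}+\|f_t\|_{L^2(L^2)}+\|u\|_{L^\infty(H^{2+\gamma_0})}+\|u_t\|_{L^\infty(H^{2+\gamma_0})}+\|u_{tt}\|_{L^\infty(L^2)}+\|u_{tt}\|_{L^2(H^{2+\gamma_0})}+\|u_{ttt}\|_{L^2(L^2)},$$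 $$M_{(u)}=\|u_{ttt}\|_{L^\infty(L^2)}+\|u_{tttt}\|_{L^2(L^2)} .$$
   Context: Time grid: $N$ is a positive integer, $k=T/N$, $t_n=nk$. For a function of time $\phi$ (or a sequence $\phi^n$): $\phi^n=\phi(t_n)$, $\phi^{n+1/2}=\frac12(\phi^{n+1}+\phi^n)$, $\phi^{n,1/4}=\frac14(\phi^{n+1}+2\phi^n+\phi^{n-1})$, $\bar\partial_t\phi^{n+1/2}=(\phi^{n+1}-\phi^n)/k$, $\bar\partial_t^2\phi^n=(\phi^{n+1}-2\phi^n+\phi^{n-1})/k^2$. $\Omega\subset\mathbb R^2$ is a bounded polygonal Lipschitz domain, $T>0$; $(\cdot,\cdot)$ and $\|\cdot\|$ are the $L^2(\Omega)$ inner product and norm; $a(w,v)=\int_\Omega D^2w:D^2v\,dx$; $L^p(X)$ abbreviates $L^p(0,T;X)$ with $X=L^2(\Omega)$ or $H^{2+\gamma_0}(\Omega)$. The weak solution $u\in C^0([0,T];H^2_0(\Omega))\cap C^1([0,T];L^2(\Omega))$ satisfies $(u_{tt},v)+a(u,v)=(f,v)$ for all $v\in H^2_0(\Omega)$, $u(0)=u^0$, $u_t(0)=v^0$. $A\psi=\Delta^2\psi$ with $D(A)=\{\psi\in H^2_0(\Omega):\Delta^2\psi\in L^2(\Omega)\}$, and $D(A^r)=\{w\in L^2(\Omega):\sum_n\lambda_n^{2r}|(w,\psi_n)|^2<\infty\}$, where $(\lambda_n,\psi_n)$ are the eigenpairs of $A$, with $\{\psi_n\}$ an orthonormal basis of $L^2(\Omega)$.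 $\gamma_0\in(1/2,1]$ is the elliptic regularity index of the clamped biharmonic operator; $D(A)\subset H^{2+\gamma_0}(\Omega)$ continuously. Mesh: $\mathcal T$ is a shape-regular triangulation of $\overline\Omega$ (not necessarily quasi-uniform) with mesh-size $h=\max_{K\in\mathcal T}\mathrm{diam}(K)$, edges $\mathcal E$, vertices $\mathcal V$; $\mathcal V(e)$ is the set of endpoints of edge $e$ and $h_e$ its length; $[\![\cdot]\!]$ is the jump across an interior edge and the trace on a boundary edge; $\{\!\{\cdot\}\!\}$ is the average across an interior edge; $H^m(\mathcal T)$ is the space of piecewise $H^m$ functions; $P_r(\mathcal T)$ is the space of piecewise polynomials of degree at most $r$. Discrete space and form: $\mathrm M(\mathcal T)\subset P_2(\mathcal T)$ is the Morley space: piecewise quadratics continuous at interior vertices, with normal derivatives continuous at midpoints of interior edges, vanishing at boundary vertices and with normal derivatives vanishing at midpoints of boundary edges. $V_h\subset H^2(\mathcal T)$ is a finite-dimensional subspace; on $H^2_0(\Omega)+V_h$ one uses $$\|v\|_h^2=\sum_{K\in\mathcal T}|v|_{H^2(K)}^2+\sum_{e\in\mathcal E}\sum_{z\in\mathcal V(e)}h_e^{-2}\big|[\![v]\!](z)\big|^2+\sum_{e\in\mathcal E}\Big|\frac1{h_e}\int_e\Big[\!\Big[\frac{\partial v}{\partial n}\Big]\!\Big]ds\Big|^2 ,$$ and $a_h$ is a symmetric bilinear form on $V_h+\mathrm M(\mathcal T)$ such that, for all $w_h,v_h\in V_h$, $\alpha\|w_h\|_h^2\le a_h(w_h,w_h)$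 and $a_h(w_h,v_h)\le\beta\|w_h\|_h\|v_h\|_h$ with constants $\alpha,\beta>0$ independent of $h$. (The Morley, quadratic discontinuous Galerkin and quadratic $C^0$ interior penalty methods are instances.) Smoother: $I_{\mathrm M}:H^2(\mathcal T)\to\mathrm M(\mathcal T)$ is the extended Morley interpolation: at each interior vertex $z$, $(I_{\mathrm M}v)(z)$ is the average of the values $(v|_K)(z)$ over the triangles $K$ containing $z$, and on each interior edge $\int_e\partial_n(I_{\mathrm M}v)\,ds=\int_e\{\!\{\partial_nv\}\!\}\,ds$ (boundary degrees of freedom vanish). $J:\mathrm M(\mathcal T)\to H^2_0(\Omega)$ is a fixed linear companion operator, with values in the sum of the Hsieh–Clough–Tocher space and $P_8(\mathcal T)$, such that for $w\in\mathrm M(\mathcal T)$: $Jw=w$ at all vertices, $\nabla(Jw)(z)$ is the average of $(\nabla w|_K)(z)$ over the triangles $K$ containing $z$ at every interior vertex $z$, and $\int_e\partial_n(Jw)\,ds=\int_e\partial_nw\,ds$ for every edge $e$. $Q:=J I_{\mathrm M}:V_h\to H^2_0(\Omega)$ satisfies, with $C_1>0$ independent of $h$, $$\|v_h-Qv_h\|_{H^s(\mathcal T)}\le C_1h^{2-s}\min_{v\in H^2_0(\Omega)}\|v-v_h\|_h,\qquad v_h\in V_h,\ 0\le s\le2 .$$ Modified Ritz projection $\mathcal R_h:H^2_0(\Omega)\to V_h$: $a_h(\mathcal R_hw,v_h)=a(w,Qv_h)$ for all $v_h\in V_h$. It satisfies, with $C_2>0$ independent of $h$, $\|v-\mathcal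 R_hv\|+h^{\gamma_0}\|v-\mathcal R_hv\|_h\le C_2h^{2\gamma_0}\|v\|_{H^{2+\gamma_0}(\Omega)}$ for all $v\in H^2_0(\Omega)\cap H^{2+\gamma_0}(\Omega)$. *)

theory Defs
  imports "HOL-Analysis.Analysis"
begin

text \<open>Elements of \<open>L\<^sup>2(\<Omega>)\<close> and of the other function spaces are represented by functions on the
  whole plane. Only their values in \<open>\<Omega>\<close>, up to null sets, matter: equality of elements is
  \<open>ae_eq\<close>, and values at points and on edges are values of continuous representatives and
  traces.\<close>

type_synonym pt = "real ^ 2"
type_synonym fld = "pt \<Rightarrow> real"


section \<open>Square integrable functions and weak derivatives\<close>

definition L2 :: "'a measure \<Rightarrow> ('a \<Rightarrow> real) set" where
  "L2 M = {f \<in> borel_measurable M. integrable M (\<lambda>x. (f x)\<^sup>2)}"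

abbreviation L2S :: "pt set \<Rightarrow> fld set" where
  "L2S S \<equiv> L2 (lebesgue_on S)"

definition ip :: "pt set \<Rightarrow> fld \<Rightarrow> fld \<Rightarrow> real" where
  "ip S f g = integral\<^sup>L (lebesgue_on S) (\<lambda>x. f x * g x)"

definition L2norm :: "pt set \<Rightarrow> fld \<Rightarrow> real" where
  "L2norm S f = sqrt (ip S f f)"

definition ae_eq :: "pt set \<Rightarrow> fld \<Rightarrow> fld \<Rightarrow> bool" where
  "ae_eq S f g \<longleftrightarrow> (AE x in lebesgue_on S. f x = g x)"

text \<open>A multi-index of order \<open>m\<close> is a list of \<open>m\<close> coordinate directions. Sums over all such lists
  give the Frobenius norm of the \<open>m\<close>-th derivative tensor, so mixed derivatives are counted with
  multiplicity; this matches \<open>a(v,v) = |v|\<^sup>2\<close> in \<open>H\<^sup>2\<close>.\<close>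

definition pd :: "'a::euclidean_space \<Rightarrow> ('a \<Rightarrow> real) \<Rightarrow> 'a \<Rightarrow> real" where
  "pd b \<phi> = (\<lambda>x. frechet_derivative \<phi> (at x) b)"

definition pds :: "'a::euclidean_space list \<Rightarrow> ('a \<Rightarrow> real) \<Rightarrow> 'a \<Rightarrow> real" where
  "pds bs \<phi> = foldr pd bs \<phi>"

definition smooth :: "('a::euclidean_space \<Rightarrow> real) \<Rightarrow> bool" where
  "smooth \<phi> \<longleftrightarrow> (\<forall>bs x. set bs \<subseteq> Basis \<longrightarrow> pds bs \<phi> differentiable (at x))"

definition test_fun :: "'a::euclidean_space set \<Rightarrow> ('a \<Rightarrow> real) \<Rightarrow> bool" where
  "test_fun S \<phi> \<longleftrightarrow> smooth \<phi> \<and> compact (closure {x. \<phi> x \<noteq> 0}) \<and> closure {x. \<phi> x \<noteq> 0} \<subseteq> S"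

definition dirs :: "nat \<Rightarrow> pt list set" where
  "dirs m = {bs. set bs \<subseteq> Basis \<and> length bs = m}"

definition weak_deriv :: "pt set \<Rightarrow> pt list \<Rightarrow> fld \<Rightarrow> fld \<Rightarrow> bool" where
  "weak_deriv S bs f g \<longleftrightarrow>
     (\<forall>\<phi>. test_fun S \<phi> \<longrightarrow> ip S f (pds bs \<phi>) = (-1) ^ length bs * ip S g \<phi>)"

definition wderiv :: "pt set \<Rightarrow> pt list \<Rightarrow> fld \<Rightarrow> fld" where
  "wderiv S bs f = (SOME g. g \<in> L2S S \<and> weak_deriv S bs f g)"


section \<open>Sobolev spaces\<close>

text \<open>Squared Sobolev--Slobodeckij seminorm of order \<open>\<sigma> \<in> (0,1)\<close> in the plane.\<close>
definition slob :: "pt set \<Rightarrow> real \<Rightarrow> fld \<Rightarrow> ennreal" where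
  "slob S \<sigma> f = (if \<sigma> = 0 then 0 else
     (\<integral>\<^sup>+x. (\<integral>\<^sup>+y. ennreal ((f x - f y)\<^sup>2 / norm (x - y) powr (2 + 2 * \<sigma>)) \<partial>lebesgue_on S)
        \<partial>lebesgue_on S))"

definition Hs :: "pt set \<Rightarrow> real \<Rightarrow> fld set" where
  "Hs S s = {v \<in> L2S S.
     (\<forall>j \<le> nat \<lfloor>s\<rfloor>. \<forall>bs \<in> dirs j. \<exists>g \<in> L2S S. weak_deriv S bs v g) \<and>
     (\<forall>bs \<in> dirs (nat \<lfloor>s\<rfloor>). slob S (frac s) (wderiv S bs v) < \<infinity>)}"

definition Hnorm :: "pt set \<Rightarrow> real \<Rightarrow> fld \<Rightarrow> real" where
  "Hnorm S s v = sqrt (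
     (\<Sum>j \<le> nat \<lfloor>s\<rfloor>. \<Sum>bs \<in> dirs j. (L2norm S (wderiv S bs v))\<^sup>2) +
     (\<Sum>bs \<in> dirs (nat \<lfloor>s\<rfloor>). enn2real (slob S (frac s) (wderiv S bs v))))"

definition H2semi :: "pt set \<Rightarrow> fld \<Rightarrow> real" where
  "H2semi S v = sqrt (\<Sum>bs \<in> dirs 2. (L2norm S (wderiv S bs v))\<^sup>2)"

definition H20 :: "pt set \<Rightarrow> fld set" where
  "H20 \<Omega> = {v \<in> Hs \<Omega> 2. \<exists>\<phi> :: nat \<Rightarrow> fld. (\<forall>j. test_fun \<Omega> (\<phi> j)) \<and>
     (\<lambda>j. Hnorm \<Omega> 2 (\<lambda>x. \<phi> j x - v x)) \<longlonglongrightarrow> 0}"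

definition a_form :: "pt set \<Rightarrow> fld \<Rightarrow> fld \<Rightarrow> real" where
  "a_form \<Omega> w v = (\<Sum>bs \<in> dirs 2. ip \<Omega> (wderiv \<Omega> bs w) (wderiv \<Omega> bs v))"


section \<open>The domain and the clamped biharmonic operator\<close>

definition lipschitz_boundary :: "pt set \<Rightarrow> bool" where
  "lipschitz_boundary \<Omega> \<longleftrightarrow> (\<forall>p \<in> frontier \<Omega>. \<exists>(a::pt) (b::pt) (r::real) (L::real) (g::real \<Rightarrow> real).
     norm a = 1 \<and> norm b = 1 \<and> a \<bullet> b = 0 \<and> 0 < r \<and> L-lipschitz_on UNIV g \<and>
     (\<forall>x. \<bar>a \<bullet> (x - p)\<bar> < r \<and> \<bar>b \<bullet> (x - p)\<bar> < r \<longrightarrow> (x \<in> \<Omega> \<longleftrightarrow> b \<bullet> (x - p) > g (a \<bullet> (x - p)))))"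

definition polygonal_lipschitz_domain :: "pt set \<Rightarrow> bool" where
  "polygonal_lipschitz_domain \<Omega> \<longleftrightarrow>
     open \<Omega> \<and> connected \<Omega> \<and> \<Omega> \<noteq> {} \<and> bounded \<Omega> \<and> lipschitz_boundary \<Omega> \<and>
     (\<exists>S :: (pt \<times> pt) set. finite S \<and> frontier \<Omega> = (\<Union>(p, q) \<in> S. closed_segment p q))"

definition bilaplacian :: "fld \<Rightarrow> fld" where
  "bilaplacian \<phi> x = (\<Sum>b \<in> Basis. \<Sum>c \<in> Basis. pds [b, b, c, c] \<phi> x)"

text \<open>\<open>\<Delta>\<^sup>2\<psi> = g\<close> in the sense of distributions, with \<open>g \<in> L\<^sup>2(\<Omega>)\<close>.\<close>
definition has_bilaplacian :: "pt set \<Rightarrow> fld \<Rightarrow> fld \<Rightarrow> bool" where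
  "has_bilaplacian \<Omega> \<psi> g \<longleftrightarrow>
     g \<in> L2S \<Omega> \<and> (\<forall>\<phi>. test_fun \<Omega> \<phi> \<longrightarrow> ip \<Omega> \<psi> (bilaplacian \<phi>) = ip \<Omega> g \<phi>)"

definition DA :: "pt set \<Rightarrow> fld set" where
  "DA \<Omega> = {\<psi> \<in> H20 \<Omega>. \<exists>g. has_bilaplacian \<Omega> \<psi> g}"

definition eigensystem :: "pt set \<Rightarrow> (nat \<Rightarrow> real) \<Rightarrow> (nat \<Rightarrow> fld) \<Rightarrow> bool" where
  "eigensystem \<Omega> lam psi \<longleftrightarrow>
     (\<forall>n. psi n \<in> DA \<Omega> \<and> has_bilaplacian \<Omega> (psi n) (\<lambda>x. lam n * psi n x)) \<and>
     (\<forall>m n. ip \<Omega> (psi m) (psi n) = (if m = n then 1 else 0)) \<and>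
     (\<forall>w \<in> L2S \<Omega>. (\<lambda>N. L2norm \<Omega> (\<lambda>x. w x - (\<Sum>n<N. ip \<Omega> w (psi n) * psi n x))) \<longlonglongrightarrow> 0)"

definition DA_pow :: "pt set \<Rightarrow> (nat \<Rightarrow> real) \<Rightarrow> (nat \<Rightarrow> fld) \<Rightarrow> real \<Rightarrow> fld set" where
  "DA_pow \<Omega> lam psi r =
     {w \<in> L2S \<Omega>. summable (\<lambda>n. lam n powr (2 * r) * (ip \<Omega> w (psi n))\<^sup>2)}"

text \<open>\<open>D(A)\<close>, with the graph norm, embeds continuously into \<open>H\<close> of order \<open>2 + \<gamma>\<^sub>0\<close>.\<close>
definition elliptic_regularity :: "pt set \<Rightarrow> real \<Rightarrow> bool" where
  "elliptic_regularity \<Omega> \<gamma>\<^sub>0 \<longleftrightarrow> (\<exists>c. \<forall>\<psi> \<in> DA \<Omega>. \<psi> \<in> Hs \<Omega> (2 + \<gamma>\<^sub>0) \<and>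
     (\<forall>g. has_bilaplacian \<Omega> \<psi> g \<longrightarrow> Hnorm \<Omega> (2 + \<gamma>\<^sub>0) \<psi> \<le> c * (L2norm \<Omega> \<psi> + L2norm \<Omega> g)))"


section \<open>Functions of time with values in a function space\<close>

abbreviation tm :: "real \<Rightarrow> real measure" where
  "tm T \<equiv> lebesgue_on {0<..<T}"

text \<open>A space is given by its set \<open>X\<close> of elements and its norm \<open>\<nu>\<close>; measurability is strong
  (Bochner) measurability.\<close>

definition bochner_measurable ::
    "real \<Rightarrow> fld set \<Rightarrow> (fld \<Rightarrow> real) \<Rightarrow> (real \<Rightarrow> fld) \<Rightarrow> bool" where
  "bochner_measurable T X \<nu> g \<longleftrightarrow> (AE t in tm T. g t \<in> X) \<and>
     (\<exists>s :: nat \<Rightarrow> real \<Rightarrow> fld. (\<forall>j. simple_function (tm T) (s j) \<and> (\<forall>t. s j t \<in> X)) \<and>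
        (AE t in tm T. (\<lambda>j. \<nu> (\<lambda>x. s j t x - g t x)) \<longlonglongrightarrow> 0))"

definition LT2 :: "real \<Rightarrow> fld set \<Rightarrow> (fld \<Rightarrow> real) \<Rightarrow> (real \<Rightarrow> fld) set" where
  "LT2 T X \<nu> = {g. bochner_measurable T X \<nu> g \<and> integrable (tm T) (\<lambda>t. (\<nu> (g t))\<^sup>2)}"

definition LTinf :: "real \<Rightarrow> fld set \<Rightarrow> (fld \<Rightarrow> real) \<Rightarrow> (real \<Rightarrow> fld) set" where
  "LTinf T X \<nu> = {g. bochner_measurable T X \<nu> g \<and> (\<exists>c. AE t in tm T. \<nu> (g t) \<le> c)}"

definition LT2norm :: "real \<Rightarrow> (fld \<Rightarrow> real) \<Rightarrow> (real \<Rightarrow> fld) \<Rightarrow> real" where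
  "LT2norm T \<nu> g = sqrt (integral\<^sup>L (tm T) (\<lambda>t. (\<nu> (g t))\<^sup>2))"

definition LTinfnorm :: "real \<Rightarrow> (fld \<Rightarrow> real) \<Rightarrow> (real \<Rightarrow> fld) \<Rightarrow> real" where
  "LTinfnorm T \<nu> g = Inf {c. 0 \<le> c \<and> (AE t in tm T. \<nu> (g t) \<le> c)}"

definition time_continuous ::
    "real \<Rightarrow> fld set \<Rightarrow> (fld \<Rightarrow> real) \<Rightarrow> (real \<Rightarrow> fld) \<Rightarrow> bool" where
  "time_continuous T X \<nu> g \<longleftrightarrow> (\<forall>t \<in> {0..T}. g t \<in> X \<and>
     ((\<lambda>s. \<nu> (\<lambda>x. g s x - g t x)) \<longlongrightarrow> 0) (at t within {0..T}))"

definition time_deriv ::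
    "real \<Rightarrow> (fld \<Rightarrow> real) \<Rightarrow> (real \<Rightarrow> fld) \<Rightarrow> (real \<Rightarrow> fld) \<Rightarrow> bool" where
  "time_deriv T \<nu> g g' \<longleftrightarrow> (\<forall>t \<in> {0..T}.
     ((\<lambda>s. \<nu> (\<lambda>x. (g s x - g t x) / (s - t) - g' t x)) \<longlongrightarrow> 0) (at t within {0..T}))"

text \<open>\<open>\<integral> g \<eta>' dt = - \<integral> g' \<eta> dt\<close> as an identity of Bochner integrals in \<open>L\<^sup>2(\<Omega>)\<close>, which is
  expressed by pairing with every element of \<open>L\<^sup>2(\<Omega>)\<close>.\<close>
definition weak_time_deriv ::
    "pt set \<Rightarrow> real \<Rightarrow> (real \<Rightarrow> fld) \<Rightarrow> (real \<Rightarrow> fld) \<Rightarrow> bool" where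
  "weak_time_deriv \<Omega> T g g' \<longleftrightarrow> (\<forall>v \<in> L2S \<Omega>. \<forall>\<eta>. test_fun {0<..<T} \<eta> \<longrightarrow>
     integral\<^sup>L (tm T) (\<lambda>t. ip \<Omega> (g t) v * deriv \<eta> t) =
     - integral\<^sup>L (tm T) (\<lambda>t. ip \<Omega> (g' t) v * \<eta> t))"

text \<open>\<open>u\<close> lies in \<open>C\<^sup>0([0,T]; H\<^sup>2\<^sub>0) \<inter> C\<^sup>1([0,T]; L\<^sup>2)\<close> and \<open>ut\<close> is its time derivative; the
  equation \<open>(u\<^sub>t\<^sub>t, v) + a(u, v) = (f, v)\<close> holds in the sense of distributions on \<open>(0,T)\<close>.\<close>
definition weak_solution ::
    "pt set \<Rightarrow> real \<Rightarrow> fld \<Rightarrow> fld \<Rightarrow> (real \<Rightarrow> fld) \<Rightarrow> (real \<Rightarrow> fld) \<Rightarrow> (real \<Rightarrow> fld) \<Rightarrow> bool" where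
  "weak_solution \<Omega> T u0 v0 f u ut \<longleftrightarrow>
     time_continuous T (H20 \<Omega>) (Hnorm \<Omega> 2) u \<and>
     time_continuous T (L2S \<Omega>) (L2norm \<Omega>) ut \<and> time_deriv T (L2norm \<Omega>) u ut \<and>
     (\<forall>v \<in> H20 \<Omega>. \<forall>\<eta>. test_fun {0<..<T} \<eta> \<longrightarrow>
        - integral\<^sup>L (tm T) (\<lambda>t. ip \<Omega> (ut t) v * deriv \<eta> t)
        + integral\<^sup>L (tm T) (\<lambda>t. a_form \<Omega> (u t) v * \<eta> t)
        = integral\<^sup>L (tm T) (\<lambda>t. ip \<Omega> (f t) v * \<eta> t)) \<and>
     ae_eq \<Omega> (u 0) u0 \<and> ae_eq \<Omega> (ut 0) v0"

text \<open>\<open>f\<close> and its first two time derivatives are the continuous representatives, which exist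
  because \<open>f \<in> H\<^sup>3(0,T; L\<^sup>2)\<close>; these are the ones evaluated at grid points and at time \<open>0\<close>.\<close>
definition smooth_data ::
    "pt set \<Rightarrow> real \<Rightarrow> (nat \<Rightarrow> real) \<Rightarrow> (nat \<Rightarrow> fld) \<Rightarrow> fld \<Rightarrow> fld \<Rightarrow>
     (real \<Rightarrow> fld) \<Rightarrow> (real \<Rightarrow> fld) \<Rightarrow> (real \<Rightarrow> fld) \<Rightarrow> (real \<Rightarrow> fld) \<Rightarrow> bool" where
  "smooth_data \<Omega> T lam psi u0 v0 f ft ftt fttt \<longleftrightarrow>
     u0 \<in> DA_pow \<Omega> lam psi 2 \<and> v0 \<in> DA_pow \<Omega> lam psi (3/2) \<and>
     f 0 \<in> DA \<Omega> \<and> ft 0 \<in> DA_pow \<Omega> lam psi (1/2) \<and> ftt 0 \<in> L2S \<Omega> \<and>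
     (\<forall>g \<in> {f, ft, ftt, fttt}. g \<in> LT2 T (L2S \<Omega>) (L2norm \<Omega>)) \<and>
     weak_time_deriv \<Omega> T f ft \<and> weak_time_deriv \<Omega> T ft ftt \<and> weak_time_deriv \<Omega> T ftt fttt \<and>
     (\<forall>g \<in> {f, ft, ftt}. time_continuous T (L2S \<Omega>) (L2norm \<Omega>) g)"

definition regular_solution ::
    "pt set \<Rightarrow> real \<Rightarrow> real \<Rightarrow> (real \<Rightarrow> fld) \<Rightarrow> (real \<Rightarrow> fld) \<Rightarrow> (real \<Rightarrow> fld) \<Rightarrow>
     (real \<Rightarrow> fld) \<Rightarrow> (real \<Rightarrow> fld) \<Rightarrow> bool" where
  "regular_solution \<Omega> T \<gamma>\<^sub>0 u ut utt uttt utttt \<longleftrightarrow>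
     weak_time_deriv \<Omega> T ut utt \<and> weak_time_deriv \<Omega> T utt uttt \<and>
     weak_time_deriv \<Omega> T uttt utttt \<and>
     (\<forall>g \<in> {u, ut, utt}. g \<in> LTinf T (Hs \<Omega> (2 + \<gamma>\<^sub>0)) (Hnorm \<Omega> (2 + \<gamma>\<^sub>0))) \<and>
     (\<forall>g \<in> {utt, uttt, utttt}. g \<in> LTinf T (L2S \<Omega>) (L2norm \<Omega>))"

definition L_fu :: "pt set \<Rightarrow> real \<Rightarrow> real \<Rightarrow> (real \<Rightarrow> fld) \<Rightarrow> (real \<Rightarrow> fld) \<Rightarrow>
    (real \<Rightarrow> fld) \<Rightarrow> (real \<Rightarrow> fld) \<Rightarrow> (real \<Rightarrow> fld) \<Rightarrow> (real \<Rightarrow> fld) \<Rightarrow> real" where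
  "L_fu \<Omega> T \<gamma>\<^sub>0 f ft u ut utt uttt =
     LTinfnorm T (L2norm \<Omega>) f + LT2norm T (L2norm \<Omega>) ft +
     LTinfnorm T (Hnorm \<Omega> (2 + \<gamma>\<^sub>0)) u + LTinfnorm T (Hnorm \<Omega> (2 + \<gamma>\<^sub>0)) ut +
     LTinfnorm T (L2norm \<Omega>) utt + LT2norm T (Hnorm \<Omega> (2 + \<gamma>\<^sub>0)) utt +
     LT2norm T (L2norm \<Omega>) uttt"

definition M_u :: "pt set \<Rightarrow> real \<Rightarrow> (real \<Rightarrow> fld) \<Rightarrow> (real \<Rightarrow> fld) \<Rightarrow> real" where
  "M_u \<Omega> T uttt utttt = LTinfnorm T (L2norm \<Omega>) uttt + LT2norm T (L2norm \<Omega>) utttt"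


section \<open>Triangulations\<close>

text \<open>A triangle is represented by its set of three vertices, an edge by its set of two
  endpoints. A conforming triangulation is one in which two triangles meet exactly in the convex
  hull of their common vertices.\<close>

definition mesh_triangulation :: "pt set \<Rightarrow> pt set set \<Rightarrow> bool" where
  "mesh_triangulation \<Omega> \<T> \<longleftrightarrow> finite \<T> \<and>
     (\<forall>t \<in> \<T>. card t = 3 \<and> \<not> affine_dependent t) \<and>
     (\<Union>t \<in> \<T>. convex hull t) = closure \<Omega> \<and>
     (\<forall>s \<in> \<T>. \<forall>t \<in> \<T>. convex hull s \<inter> convex hull t = convex hull (s \<inter> t))"

definition shape_regular :: "real \<Rightarrow> pt set set \<Rightarrow> bool" where
  "shape_regular \<kappa> \<T> \<longleftrightarrow> (\<forall>t \<in> \<T>. \<exists>z r. 0 < r \<and> ball z r \<subseteq> convex hull t \<and>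
     diameter (convex hull t) \<le> \<kappa> * r)"

definition mesh_size :: "pt set set \<Rightarrow> real" where
  "mesh_size \<T> = Max ((\<lambda>t. diameter (convex hull t)) ` \<T>)"

abbreviation itri :: "pt set \<Rightarrow> pt set" where
  "itri t \<equiv> interior (convex hull t)"

definition edges :: "pt set set \<Rightarrow> pt set set" where
  "edges \<T> = {e. card e = 2 \<and> (\<exists>t \<in> \<T>. e \<subseteq> t)}"

definition interior_edges :: "pt set set \<Rightarrow> pt set set" where
  "interior_edges \<T> = {e \<in> edges \<T>. \<exists>s \<in> \<T>. \<exists>t \<in> \<T>. s \<noteq> t \<and> e \<subseteq> s \<and> e \<subseteq> t}"

definition edge_len :: "pt set \<Rightarrow> real" where
  "edge_len e = diameter e"

definition edge_mid :: "pt set \<Rightarrow> pt" where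
  "edge_mid e = (1/2) *\<^sub>R (\<Sum>z \<in> e. z)"

definition edge_param :: "pt set \<Rightarrow> real \<Rightarrow> pt" where
  "edge_param e = (SOME \<gamma>. \<exists>p q. e = {p, q} \<and> \<gamma> = (\<lambda>s. (1 - s) *\<^sub>R p + s *\<^sub>R q))"

definition edge_int :: "pt set \<Rightarrow> fld \<Rightarrow> real" where
  "edge_int e \<tau> = edge_len e * integral\<^sup>L (lebesgue_on {0..1}) (\<lambda>s. \<tau> (edge_param e s))"

text \<open>The orientations of the normal and of the jump across an edge are arbitrary but fixed.\<close>

definition edge_normal :: "pt set \<Rightarrow> pt" where
  "edge_normal e = (SOME n. norm n = 1 \<and> (\<forall>p \<in> e. \<forall>q \<in> e. n \<bullet> (q - p) = 0))"

definition tri_plus :: "pt set set \<Rightarrow> pt set \<Rightarrow> pt set" where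
  "tri_plus \<T> e = (SOME t. t \<in> \<T> \<and> e \<subseteq> t)"

definition tri_minus :: "pt set set \<Rightarrow> pt set \<Rightarrow> pt set" where
  "tri_minus \<T> e = (SOME t. t \<in> \<T> \<and> e \<subseteq> t \<and> t \<noteq> tri_plus \<T> e)"

text \<open>Jump and average over an edge of a quantity \<open>q t\<close> taken from each adjacent triangle \<open>t\<close>.\<close>

definition jump :: "pt set set \<Rightarrow> pt set \<Rightarrow> (pt set \<Rightarrow> real) \<Rightarrow> real" where
  "jump \<T> e q = (if e \<in> interior_edges \<T> then q (tri_plus \<T> e) - q (tri_minus \<T> e)
                 else q (tri_plus \<T> e))"

definition edge_average :: "pt set set \<Rightarrow> pt set \<Rightarrow> (pt set \<Rightarrow> real) \<Rightarrow> real" where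
  "edge_average \<T> e q = (q (tri_plus \<T> e) + q (tri_minus \<T> e)) / 2"

definition vertex_average :: "pt set set \<Rightarrow> pt \<Rightarrow> (pt set \<Rightarrow> real) \<Rightarrow> real" where
  "vertex_average \<T> z q = (\<Sum>t \<in> {t \<in> \<T>. z \<in> t}. q t) / real (card {t \<in> \<T>. z \<in> t})"


section \<open>Piecewise functions, their point values and traces\<close>

definition Hpw :: "pt set set \<Rightarrow> real \<Rightarrow> fld set" where
  "Hpw \<T> s = {v. \<forall>t \<in> \<T>. v \<in> Hs (itri t) s}"

definition Hpw_norm :: "pt set set \<Rightarrow> real \<Rightarrow> fld \<Rightarrow> real" where
  "Hpw_norm \<T> s v = sqrt (\<Sum>t \<in> \<T>. (Hnorm (itri t) s v)\<^sup>2)"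

definition poly2 :: "nat \<Rightarrow> fld set" where
  "poly2 r = {p. \<exists>c :: nat \<Rightarrow> nat \<Rightarrow> real.
     \<forall>x. p x = (\<Sum>i \<le> r. \<Sum>j \<le> r - i. c i j * (x $ 1) ^ i * (x $ 2) ^ j)}"

definition pw_poly :: "nat \<Rightarrow> pt set set \<Rightarrow> fld set" where
  "pw_poly r \<T> = {v. \<forall>t \<in> \<T>. \<exists>p \<in> poly2 r. ae_eq (itri t) v p}"

text \<open>Value at \<open>z\<close> of the continuous representative of \<open>v\<close> on the closed triangle \<open>t\<close>.\<close>
definition pt_val :: "pt set \<Rightarrow> fld \<Rightarrow> pt \<Rightarrow> real" where
  "pt_val t v = (SOME g. continuous_on (convex hull t) g \<and> ae_eq (itri t) v g)"

text \<open>Trace in \<open>L\<^sup>2(e)\<close> of \<open>g \<in> H\<^sup>1\<close> on the triangle \<open>t\<close>, obtained by approximating \<open>g\<close> by smooth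
  functions.\<close>
definition edge_trace :: "pt set \<Rightarrow> pt set \<Rightarrow> fld \<Rightarrow> fld" where
  "edge_trace t e g = (SOME \<tau>.
     (\<lambda>s. \<tau> (edge_param e s)) \<in> L2 (lebesgue_on {0..1}) \<and>
     (\<exists>\<phi> :: nat \<Rightarrow> fld. (\<forall>j. smooth (\<phi> j)) \<and>
        (\<lambda>j. Hnorm (itri t) 1 (\<lambda>x. \<phi> j x - g x)) \<longlonglongrightarrow> 0 \<and>
        (\<lambda>j. edge_int e (\<lambda>x. (\<phi> j x - \<tau> x)\<^sup>2)) \<longlonglongrightarrow> 0))"

definition normal_deriv :: "pt set \<Rightarrow> pt set \<Rightarrow> fld \<Rightarrow> fld" where
  "normal_deriv t e v = (\<lambda>x. \<Sum>b \<in> Basis. (edge_normal e \<bullet> b) * wderiv (itri t) [b] v x)"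

definition h_norm :: "pt set set \<Rightarrow> fld \<Rightarrow> real" where
  "h_norm \<T> v = sqrt (
     (\<Sum>t \<in> \<T>. (H2semi (itri t) v)\<^sup>2) +
     (\<Sum>e \<in> edges \<T>. \<Sum>z \<in> e. \<bar>jump \<T> e (\<lambda>t. pt_val t v z)\<bar>\<^sup>2 / (edge_len e)\<^sup>2) +
     (\<Sum>e \<in> edges \<T>. \<bar>(1 / edge_len e) *
        edge_int e (\<lambda>x. jump \<T> e (\<lambda>t. edge_trace t e (normal_deriv t e v) x))\<bar>\<^sup>2))"


section \<open>Morley space, extended Morley interpolation and companion operator\<close>

definition morley :: "pt set \<Rightarrow> pt set set \<Rightarrow> fld set" where
  "morley \<Omega> \<T> = {v \<in> pw_poly 2 \<T>.
     (\<forall>z \<in> \<Union>\<T>. z \<in> \<Omega> \<longrightarrow>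
        (\<forall>s \<in> \<T>. \<forall>t \<in> \<T>. z \<in> s \<and> z \<in> t \<longrightarrow> pt_val s v z = pt_val t v z)) \<and>
     (\<forall>z \<in> \<Union>\<T>. z \<notin> \<Omega> \<longrightarrow> (\<forall>t \<in> \<T>. z \<in> t \<longrightarrow> pt_val t v z = 0)) \<and>
     (\<forall>e \<in> interior_edges \<T>. \<forall>s \<in> \<T>. \<forall>t \<in> \<T>. e \<subseteq> s \<and> e \<subseteq> t \<longrightarrow>
        pt_val s (normal_deriv s e v) (edge_mid e) = pt_val t (normal_deriv t e v) (edge_mid e)) \<and>
     (\<forall>e \<in> edges \<T> - interior_edges \<T>. \<forall>t \<in> \<T>. e \<subseteq> t \<longrightarrow>
        pt_val t (normal_deriv t e v) (edge_mid e) = 0)}"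

text \<open>The degrees of freedom at the boundary vanish because the values lie in \<open>morley\<close>.\<close>
definition morley_interpolation :: "pt set \<Rightarrow> pt set set \<Rightarrow> (fld \<Rightarrow> fld) \<Rightarrow> bool" where
  "morley_interpolation \<Omega> \<T> IM \<longleftrightarrow> (\<forall>v \<in> Hpw \<T> 2. IM v \<in> morley \<Omega> \<T> \<and>
     (\<forall>z \<in> \<Union>\<T>. z \<in> \<Omega> \<longrightarrow> (\<forall>t \<in> \<T>. z \<in> t \<longrightarrow>
        pt_val t (IM v) z = vertex_average \<T> z (\<lambda>K. pt_val K v z))) \<and>
     (\<forall>e \<in> interior_edges \<T>. \<forall>t \<in> \<T>. e \<subseteq> t \<longrightarrow>
        edge_int e (edge_trace t e (normal_deriv t e (IM v))) =
        edge_int e (\<lambda>x. edge_average \<T> e (\<lambda>K. edge_trace K e (normal_deriv K e v) x))))"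

text \<open>Each triangle is split into three by joining its vertices to its centroid.\<close>
definition hct_split :: "pt set set \<Rightarrow> pt set set" where
  "hct_split \<T> = {insert ((1/3) *\<^sub>R (\<Sum>y \<in> t. y)) (t - {z}) | t z. t \<in> \<T> \<and> z \<in> t}"

definition HCT :: "pt set \<Rightarrow> pt set set \<Rightarrow> fld set" where
  "HCT \<Omega> \<T> = H20 \<Omega> \<inter> pw_poly 3 (hct_split \<T>)"

definition companion :: "pt set \<Rightarrow> pt set set \<Rightarrow> (fld \<Rightarrow> fld) \<Rightarrow> bool" where
  "companion \<Omega> \<T> J \<longleftrightarrow>
     (\<forall>w \<in> morley \<Omega> \<T>. J w \<in> H20 \<Omega> \<and>
        (\<exists>p \<in> HCT \<Omega> \<T>. \<exists>q \<in> pw_poly 8 \<T>. ae_eq \<Omega> (J w) (\<lambda>x. p x + q x))) \<and>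
     (\<forall>w \<in> morley \<Omega> \<T>. \<forall>w' \<in> morley \<Omega> \<T>. ae_eq \<Omega> w w' \<longrightarrow> ae_eq \<Omega> (J w) (J w')) \<and>
     (\<forall>w \<in> morley \<Omega> \<T>. \<forall>w' \<in> morley \<Omega> \<T>. \<forall>c.
        ae_eq \<Omega> (J (\<lambda>x. c * w x + w' x)) (\<lambda>x. c * J w x + J w' x)) \<and>
     (\<forall>w \<in> morley \<Omega> \<T>. \<forall>t \<in> \<T>. \<forall>z \<in> t. pt_val t (J w) z = pt_val t w z) \<and>
     (\<forall>w \<in> morley \<Omega> \<T>. \<forall>t \<in> \<T>. \<forall>z \<in> t. z \<in> \<Omega> \<longrightarrow> (\<forall>b \<in> Basis.
        pt_val t (wderiv (itri t) [b] (J w)) z =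
        vertex_average \<T> z (\<lambda>K. pt_val K (wderiv (itri K) [b] w) z))) \<and>
     (\<forall>w \<in> morley \<Omega> \<T>. \<forall>e \<in> edges \<T>. \<forall>t \<in> \<T>. e \<subseteq> t \<longrightarrow>
        edge_int e (edge_trace t e (normal_deriv t e (J w))) =
        edge_int e (edge_trace t e (normal_deriv t e w)))"


section \<open>Discrete space, form, and projections\<close>

definition fin_dim_space :: "fld set \<Rightarrow> bool" where
  "fin_dim_space V \<longleftrightarrow>
     (\<exists>B. finite B \<and> V = {v. \<exists>c :: fld \<Rightarrow> real. v = (\<lambda>x. \<Sum>b \<in> B. c b * b x)})"

definition sum_space :: "fld set \<Rightarrow> fld set \<Rightarrow> fld set" where
  "sum_space V W = {\<lambda>x. v x + w x | v w. v \<in> V \<and> w \<in> W}"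

definition discrete_form ::
    "pt set \<Rightarrow> pt set set \<Rightarrow> fld set \<Rightarrow> (fld \<Rightarrow> fld \<Rightarrow> real) \<Rightarrow> real \<Rightarrow> real \<Rightarrow> bool" where
  "discrete_form \<Omega> \<T> V ah \<alpha> \<beta> \<longleftrightarrow>
     (\<forall>v \<in> sum_space V (morley \<Omega> \<T>). \<forall>w \<in> sum_space V (morley \<Omega> \<T>). ah v w = ah w v) \<and>
     (\<forall>v \<in> sum_space V (morley \<Omega> \<T>). \<forall>v' \<in> sum_space V (morley \<Omega> \<T>).
        \<forall>w \<in> sum_space V (morley \<Omega> \<T>). \<forall>c.
          ah (\<lambda>x. c * v x + v' x) w = c * ah v w + ah v' w) \<and>
     (\<forall>w \<in> V. \<alpha> * (h_norm \<T> w)\<^sup>2 \<le> ah w w) \<and>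
     (\<forall>w \<in> V. \<forall>v \<in> V. ah w v \<le> \<beta> * h_norm \<T> w * h_norm \<T> v)"

definition smoother_estimate ::
    "pt set \<Rightarrow> pt set set \<Rightarrow> fld set \<Rightarrow> (fld \<Rightarrow> fld) \<Rightarrow> (real \<Rightarrow> real) \<Rightarrow> bool" where
  "smoother_estimate \<Omega> \<T> V Q C1 \<longleftrightarrow> (\<forall>w \<in> V. \<forall>s \<in> {0..2}.
     Hpw_norm \<T> s (\<lambda>x. w x - Q w x) \<le>
       C1 s * mesh_size \<T> powr (2 - s) * (INF v \<in> H20 \<Omega>. h_norm \<T> (\<lambda>x. v x - w x)))"

definition ritz_projection ::
    "pt set \<Rightarrow> fld set \<Rightarrow> (fld \<Rightarrow> fld \<Rightarrow> real) \<Rightarrow> (fld \<Rightarrow> fld) \<Rightarrow> (fld \<Rightarrow> fld) \<Rightarrow> bool" where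
  "ritz_projection \<Omega> V ah Q Rh \<longleftrightarrow>
     (\<forall>w \<in> H20 \<Omega>. Rh w \<in> V \<and> (\<forall>v \<in> V. ah (Rh w) v = a_form \<Omega> w (Q v)))"

definition ritz_estimate ::
    "pt set \<Rightarrow> pt set set \<Rightarrow> real \<Rightarrow> (fld \<Rightarrow> fld) \<Rightarrow> real \<Rightarrow> bool" where
  "ritz_estimate \<Omega> \<T> \<gamma>\<^sub>0 Rh C2 \<longleftrightarrow> (\<forall>v \<in> H20 \<Omega> \<inter> Hs \<Omega> (2 + \<gamma>\<^sub>0).
     L2norm \<Omega> (\<lambda>x. v x - Rh v x) +
       mesh_size \<T> powr \<gamma>\<^sub>0 * h_norm \<T> (\<lambda>x. v x - Rh v x)
     \<le> C2 * mesh_size \<T> powr (2 * \<gamma>\<^sub>0) * Hnorm \<Omega> (2 + \<gamma>\<^sub>0) v)"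


section \<open>The fully discrete scheme\<close>

definition grid :: "real \<Rightarrow> (real \<Rightarrow> fld) \<Rightarrow> nat \<Rightarrow> fld" where
  "grid k \<phi> n = \<phi> (real n * k)"

definition half :: "(nat \<Rightarrow> fld) \<Rightarrow> nat \<Rightarrow> fld" where
  "half \<phi> n = (\<lambda>x. (1/2) * (\<phi> (Suc n) x + \<phi> n x))"

definition quarter :: "(nat \<Rightarrow> fld) \<Rightarrow> nat \<Rightarrow> fld" where
  "quarter \<phi> n = (\<lambda>x. (1/4) * (\<phi> (Suc n) x + 2 * \<phi> n x + \<phi> (n - 1) x))"

definition dt_half :: "real \<Rightarrow> (nat \<Rightarrow> fld) \<Rightarrow> nat \<Rightarrow> fld" where
  "dt_half k \<phi> n = (\<lambda>x. (\<phi> (Suc n) x - \<phi> n x) / k)"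

definition dt2 :: "real \<Rightarrow> (nat \<Rightarrow> fld) \<Rightarrow> nat \<Rightarrow> fld" where
  "dt2 k \<phi> n = (\<lambda>x. (\<phi> (Suc n) x - 2 * \<phi> n x + \<phi> (n - 1) x) / k\<^sup>2)"

definition implicit_scheme ::
    "pt set \<Rightarrow> fld set \<Rightarrow> (fld \<Rightarrow> fld \<Rightarrow> real) \<Rightarrow> (fld \<Rightarrow> fld) \<Rightarrow> real \<Rightarrow> nat \<Rightarrow>
     fld \<Rightarrow> fld \<Rightarrow> (real \<Rightarrow> fld) \<Rightarrow> (nat \<Rightarrow> fld) \<Rightarrow> bool" where
  "implicit_scheme \<Omega> V ah Rh k N u0 v0 f U \<longleftrightarrow>
     (\<forall>n \<le> N. U n \<in> V) \<and>
     ae_eq \<Omega> (U 0) (Rh u0) \<and>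
     (\<forall>v \<in> V. 2 / k * ip \<Omega> (dt_half k U 0) v + ah (half U 0) v
        = ip \<Omega> (\<lambda>x. half (grid k f) 0 x + 2 / k * v0 x) v) \<and>
     (\<forall>n \<in> {1..N - 1}. \<forall>v \<in> V.
        ip \<Omega> (dt2 k U n) v + ah (quarter U n) v = ip \<Omega> (quarter (grid k f) n) v)"

end

theory Submission
imports Defs "HOL-Computational_Algebra.Polynomial"
begin

text \<open>The error is split as \<open>u - U = (u - R\<^sub>h u) + (R\<^sub>h u - U)\<close>. The second part satisfies the scheme
  with a right-hand side consisting of the time discretisation defect, of differences of the
  projection error in time, and of \<open>(f - u\<^sub>t\<^sub>t, v - Q v)\<close>, which arises because the projection is
  defined through the smoother. An energy argument with summation by parts bounds it. As the
  projection is determined by \<open>a(\<cdot>, Q v)\<close>, its error paired with a fixed function is an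
  \<open>L\<^sup>2\<close> pairing with \<open>u\<close>, \<open>f\<close> and \<open>u\<^sub>t\<^sub>t\<close>, hence differentiable in time; the regularity
  \<open>u\<^sub>t, u\<^sub>t\<^sub>t \<in> H\<^sup>2\<^sub>0\<close> needed to estimate the derivatives by the projection error
  follows from the eigenfunction expansion.\<close>

text \<open>Two obstacles shape the proof. The discrete norm is built from point values and normal
  traces that \<open>SOME\<close> selects, so it is a seminorm only once these are known to exist
  and to be linear in the function; smooth approximation, the embedding of \<open>H^2\<close> into
  the continuous functions and the trace inequality on a single triangle serve this purpose. In
  time, \<open>utt\<close>, \<open>uttt\<close> and \<open>utttt\<close> are known only for almost
  every \<open>t\<close>, whereas the scheme evaluates at grid points, which form a null set.
  Pairing with a fixed function gives scalar functions with continuous representatives, and vector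
  estimates are recovered by pairing a difference with itself. For the same reason the bound of
  \<open>u\<close> in the space of order \<open>2 + ga\<close> at a grid point comes from elliptic
  regularity and not from the essential supremum. In the energy estimate the smoother and the
  projection enter with the factors \<open>H^2\<close> and \<open>H powr (2 * ga)\<close>; the rate
  \<open>H powr ga\<close> is that of the projection error in the discrete norm.\<close>

abbreviation (input) seq_lim (infix "---->" 60) where "f ----> l \<equiv> f \<longlonglongrightarrow> l"

section \<open>Semidefinite forms on spaces of functions\<close>

text \<open>Elements are functions, not classes, so the forms vanish on functions that are zero
  almost everywhere and are only semidefinite; the carrier is a set, so linearity is assumed on it
  alone. The same locale serves \<open>L^2\<close>, \<open>H^1\<close>, \<open>H^2\<close>, the
  biharmonic form, the discrete norm and \<open>ah\<close>.\<close>

locale semidef_form =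
fixes V ::"('a=>real)set"and B ::"('a=>real)=>('a=>real)=>real"
assumes zero_mem:"(%x. 0)\<in>V"
and lin_mem:"!!v w c. v\<in>V==>w\<in>V==>(%x. c * v x + w x)\<in>V"
and lin_left:"!!v w z c. v\<in>V==>w\<in>V==>z\<in>V==>
 B(%x. c * v x + w x)z = c * B v z + B w z"
and sym:"!!v w. v\<in>V==>w\<in>V==>B v w = B w v"
and nonneg:"!!v. v\<in>V==>0\<le>B v v"
begin

definition nrm ::"('a=>real)=>real"where
"nrm v = sqrt(B v v)"

lemma cmult_mem:"v\<in>V==>(%x. c * v x)\<in>V"
using lin_mem[OF _ zero_mem,of v c]by simp

lemma add_mem:"v\<in>V==>w\<in>V==>(%x. v x + w x)\<in>V"
using lin_mem[of v w 1]by simp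

lemma diff_mem:"v\<in>V==>w\<in>V==>(%x. v x - w x)\<in>V"
using lin_mem[of w v "-1"]by simp

lemma sum_mem:"(!!i. i\<in>I==>v i\<in>V)==>(%x. \<Sum>i\<in>I. v i x)\<in>V"
by(induction I rule: infinite_finite_induct)(auto simp: zero_mem add_mem)

lemma zero_left:"z\<in>V==>B(%x. 0)z = 0"
using lin_left[OF zero_mem zero_mem,of z 1]by simp

lemma cmult_left:"v\<in>V==>z\<in>V==>B(%x. c * v x)z = c * B v z"
using lin_left[OF _ zero_mem,of v z c]zero_left by simp

lemma add_left:"v\<in>V==>w\<in>V==>z\<in>V==>B(%x. v x + w x)z = B v z + B w z"
using lin_left[of v w z 1]by simp

lemma diff_left:"v\<in>V==>w\<in>V==>z\<in>V==>B(%x. v x - w x)z = B v z - B w z"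
using lin_left[of w v z "-1"]by simp

lemma sum_left:"(!!i. i\<in>I==>v i\<in>V)==>z\<in>V==>B(%x. \<Sum>i\<in>I. v i x)z = (\<Sum>i\<in>I. B(v i)z)"
by(induction I rule: infinite_finite_induct)(auto simp: zero_left add_left sum_mem)

lemma cmult_right:"v\<in>V==>z\<in>V==>B z(%x. c * v x) = c * B z v"
using cmult_left sym cmult_mem by metis

lemma add_right:"v\<in>V==>w\<in>V==>z\<in>V==>B z(%x. v x + w x) = B z v + B z w"
using add_left[of v w z]sym add_mem by metis

lemma diff_right:"v\<in>V==>w\<in>V==>z\<in>V==>B z(%x. v x - w x) = B z v - B z w"
using diff_left[of v w z]sym diff_mem by metis

lemma sum_right:"(!!i. i\<in>I==>v i\<in>V)==>z\<in>V==>B z(%x. \<Sum>i\<in>I. v i x) = (\<Sum>i\<in>I. B z(v i))"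
by(induction I rule: infinite_finite_induct)(auto simp: zero_left add_right sum_mem sym[OF _ zero_mem])

lemma nrm_nonneg:"v\<in>V==>0\<le>nrm v"
by(simp add: nrm_def nonneg)

lemma nrm_square:"v\<in>V==>(nrm v)\<^sup>2 = B v v"
by(simp add: nrm_def nonneg)

lemma nrm_cmult:"v\<in>V==>nrm(%x. c * v x) = \<bar>c\<bar> * nrm v"
by(simp add: nrm_def cmult_left cmult_right cmult_mem real_sqrt_mult power2_eq_square[symmetric]
 mult.assoc[symmetric])

lemma square_lin:"v\<in>V==>w\<in>V==>
B(%x. c * v x + w x)(%x. c * v x + w x) = c\<^sup>2 * B v v + 2 * c * B v w + B w w"
using lin_left[of v w "%x. c * v x + w x"c]lin_left[of v w v c]lin_left[of v w w c]
lin_mem[of v w c]sym[of v "%x. c * v x + w x"]sym[of w "%x. c * v x + w x"]sym[of w v]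
by(simp add: power2_eq_square algebra_simps del: mult_cancel_left)

lemma cauchy_schwarz: assumes "v\<in>V""w\<in>V"shows "\<bar>B v w\<bar>\<le>nrm v * nrm w"
proof -
have *:"0\<le>c\<^sup>2 * B v v + 2 * c * B v w + B w w"for c
using nonneg[OF lin_mem[OF assms,of c]]square_lin[OF assms]by simp
have "(B v w)\<^sup>2\<le>B v v * B w w"
proof(cases "B v v = 0")
case True
have "B v w = 0"
proof(rule ccontr)
 assume "B v w\<noteq>0"
 \<comment> \<open>With \<open>B v v = 0\<close> the quadratic is affine in \<open>c\<close>; this
   choice of \<open>c\<close> gives it the value -1.\<close>
 thus False using *[of "- (B w w + 1) / (2 * B v w)"]True by(simp add: field_simps)
qed
thus ?thesis using True by simp
next
case False
hence "0 < B v v"using nonneg[OF assms(1)]by simp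
moreover have "(- B v w / B v v)\<^sup>2 * B v v = (B v w)\<^sup>2 / B v v"
 using False by(simp add: power2_eq_square)
ultimately show ?thesis using *[of "- B v w / B v v"]
 by(simp add: power2_eq_square field_simps)
qed
hence "sqrt((B v w)\<^sup>2)\<le>sqrt(B v v * B w w)"by(rule real_sqrt_le_mono)
thus ?thesis by(simp add: nrm_def real_sqrt_mult)
qed

lemma nrm_add: assumes "v\<in>V""w\<in>V"shows "nrm(%x. v x + w x)\<le>nrm v + nrm w"
proof -
have "B(%x. v x + w x)(%x. v x + w x) = B v v + 2 * B v w + B w w"
using square_lin[OF assms,of 1]by simp
also have "...\<le>(nrm v + nrm w)\<^sup>2"
using cauchy_schwarz[OF assms]assms by(simp add: power2_sum nrm_square)
finally show ?thesis using nrm_nonneg assms by(auto simp: nrm_def[of "%x. v x + w x"]intro!: real_le_lsqrt)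
qed

lemma nrm_diff: assumes "v\<in>V""w\<in>V"shows "nrm(%x. v x - w x)\<le>nrm v + nrm w"
using nrm_add[OF assms(1)cmult_mem[OF assms(2),of "-1"]]nrm_cmult[OF assms(2),of "-1"]by simp

lemma nrm_commute: assumes "v\<in>V""w\<in>V"shows "nrm(%x. v x - w x) = nrm(%x. w x - v x)"
using nrm_cmult[OF diff_mem[OF assms],of "-1"]by simp

lemma nrm_triangle: assumes "v\<in>V""w\<in>V""z\<in>V"
shows "nrm(%x. v x - w x)\<le>nrm(%x. v x - z x) + nrm(%x. z x - w x)"
using nrm_add[OF diff_mem[of v z]diff_mem[of z w]]assms by simp

lemma nrm_triangle_rev: assumes "v\<in>V""w\<in>V"
shows "\<bar>nrm v - nrm w\<bar>\<le>nrm(%x. v x - w x)"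
using nrm_add[OF diff_mem[of v w]assms(2)]nrm_add[OF diff_mem[of w v]assms(1)]nrm_commute[OF assms]assms
by simp

lemma tendsto_form:
assumes "!!n. v n\<in>V""w\<in>V""z\<in>V""(%n. nrm(%x. v n x - w x))---->0"
shows "(%n. B(v n)z)---->B w z"
proof(rule LIM_zero_cancel,rule Lim_null_comparison)
show "\<forall>\<^sub>F n in sequentially. norm(B(v n)z - B w z)\<le>nrm(%x. v n x - w x) * nrm z"
using cauchy_schwarz[OF diff_mem assms(3)]assms by(auto simp: diff_left)
show "(%n. nrm(%x. v n x - w x) * nrm z)---->0"
using tendsto_mult_right[OF assms(4),of "nrm z"]by simp
qed

lemma tendsto_nrm:
assumes "!!n. v n\<in>V""w\<in>V""(%n. nrm(%x. v n x - w x))---->0"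
shows "(%n. nrm(v n))---->nrm w"
proof(rule LIM_zero_cancel,rule Lim_null_comparison[OF _ assms(3)])
show "\<forall>\<^sub>F n in sequentially. norm(nrm(v n) - nrm w)\<le>nrm(%x. v n x - w x)"
using nrm_triangle_rev[OF assms(1,2)]by simp
qed

text \<open>Riesz representation in finite dimensions for a possibly degenerate form, by successively
  adding the part of the next spanning element that is orthogonal to the span.\<close>
lemma riesz_finite_span:
assumes "finite S""S\<subseteq>V"
and "!!v w c. v\<in>V==>w\<in>V==>L(%x. c * v x + w x) = c * L v + L w"
and "!!v. v\<in>V==>B v v = 0==>L v = 0"
shows "\<exists>g\<in>V. \<forall>c. B(%x. \<Sum>b\<in>S. c b * b x)g = L(%x. \<Sum>b\<in>S. c b * b x)"
proof -
\<comment> \<open>\<open>L\<close> is quantified inside the induction because the hypothesis is used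
  for two functionals: for \<open>B\<close> against the new element \<open>s\<close>, which gives
  the projection of \<open>s\<close> onto the span, and for the functional to be
  represented.\<close>
have "\<forall>L. (\<forall>v\<in>V. \<forall>w\<in>V. \<forall>c. L(%x. c * v x + w x) = c * L v + L w)-->
 (\<forall>v\<in>V. B v v = 0-->L v = 0)-->
 (\<exists>e. \<forall>c. B(%x. \<Sum>b\<in>S. c b * b x)(%x. \<Sum>b\<in>S. e b * b x) = L(%x. \<Sum>b\<in>S. c b * b x))"
using assms(1,2)
proof(induction S)
case empty
thus ?case by(auto simp: zero_left zero_mem)
next
case(insert s S)
hence sV:"s\<in>V""S\<subseteq>V"by auto
have mem:"(%x. \<Sum>b\<in>S. c b * b x)\<in>V"for c
 using sV by(intro sum_mem cmult_mem)auto
have "\<exists>e. \<forall>c. B(%x. \<Sum>b\<in>S. c b * b x)(%x. \<Sum>b\<in>S. e b * b x) = B(%x. \<Sum>b\<in>S. c b * b x)s"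
proof(rule insert.IH[OF sV(2),rule_format,of "%v. B v s"])
 fix v assume "v\<in>V""B v v = 0"
 thus "B v s = 0"using cauchy_schwarz[of v s]sV by(simp add: nrm_def)
qed(use lin_left sV in auto)
then obtain p where p:"!!c. B(%x. \<Sum>b\<in>S. c b * b x)(%x. \<Sum>b\<in>S. p b * b x) = B(%x. \<Sum>b\<in>S. c b * b x)s"
 by auto
define P where "P = (%x. \<Sum>b\<in>S. p b * b x)"
define s' where "s' = (%x. s x - P x)"
have PV:"P\<in>V"and s'V:"s' \<in>V"unfolding s'_def P_def using mem sV diff_mem by auto
have orth:"B(%x. \<Sum>b\<in>S. c b * b x)s' = 0"for c
 unfolding s'_def using p[of c]mem PV sV by(simp add: diff_right P_def)
show ?case
proof(intro allI impI)
 fix L assume L:"\<forall>v\<in>V. \<forall>w\<in>V. \<forall>c. L(%x. c * v x + w x) = c * L v + L w"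
 "\<forall>v\<in>V. B v v = 0-->L v = 0"
 obtain e where e:"!!c. B(%x. \<Sum>b\<in>S. c b * b x)(%x. \<Sum>b\<in>S. e b * b x) = L(%x. \<Sum>b\<in>S. c b * b x)"
 using insert.IH[OF sV(2),rule_format,of L]L by auto
 define E where "E = (%x. \<Sum>b\<in>S. e b * b x)"
 have EV:"E\<in>V"unfolding E_def by(rule mem)
 \<comment> \<open>If \<open>s'\<close> is a null vector, then \<open>L s'\<close> vanishes as well
   and the coefficient may be 0.\<close>
 define r where "r = (if B s' s' = 0 then 0 else L s' / B s' s')"
 have r:"r * B s' s' = L s'"unfolding r_def using L(2)s'V by auto
 define e' where "e' = (%b. if b = s then r else e b - r * p b)"
 have e'sum:"(%x. \<Sum>b\<in>insert s S. e' b * b x) = (%x. r * s' x + E x)"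
 proof
 fix x
 have "(\<Sum>b\<in>S. e' b * b x) = (\<Sum>b\<in>S. e b * b x - r * (p b * b x))"
  using insert.hyps by(intro sum.cong)(auto simp: e'_def algebra_simps)
 also have "... = E x - r * P x"by(simp add: E_def P_def sum_subtractf sum_distrib_left)
 finally show "(\<Sum>b\<in>insert s S. e' b * b x) = r * s' x + E x"
  using insert.hyps by(simp add: e'_def s'_def algebra_simps)
 qed
 show "\<exists>e. \<forall>c. B(%x. \<Sum>b\<in>insert s S. c b * b x)(%x. \<Sum>b\<in>insert s S. e b * b x) = L(%x. \<Sum>b\<in>insert s S. c b * b x)"
 proof(intro exI allI)
 fix c
 define D where "D = (%x. \<Sum>b\<in>S. (c b + c s * p b) * b x)"
 have DV:"D\<in>V"unfolding D_def by(rule mem)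
 have csum:"(%x. \<Sum>b\<in>insert s S. c b * b x) = (%x. c s * s' x + D x)"
  using insert.hyps by(auto simp: s'_def D_def P_def algebra_simps sum.distrib sum_distrib_left)
 have g:"(%x. r * s' x + E x)\<in>V"using s'V EV by(rule lin_mem)
 have "B s' E = 0"using sym[OF s'V EV]orth[of e]by(simp add: E_def)
 hence s'g:"B s' (%x. r * s' x + E x) = L s'"
  using add_right[OF cmult_mem[OF s'V]EV s'V]cmult_right[OF s'V s'V]r by simp
 have "B D s' = 0"unfolding D_def by(rule orth)
 hence Dg:"B D(%x. r * s' x + E x) = L D"
  using add_right[OF cmult_mem[OF s'V]EV DV]cmult_right[OF s'V DV]e[of "%b. c b + c s * p b"]
  by(simp add: D_def E_def)
 show "B(%x. \<Sum>b\<in>insert s S. c b * b x)(%x. \<Sum>b\<in>insert s S. e' b * b x) = L(%x. \<Sum>b\<in>insert s S. c b * b x)"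
  unfolding e'sum csum using lin_left[OF s'V DV g]s'g Dg L(1)s'V DV by simp
 qed
qed
qed
hence "\<exists>e. \<forall>c. B(%x. \<Sum>b\<in>S. c b * b x)(%x. \<Sum>b\<in>S. e b * b x) = L(%x. \<Sum>b\<in>S. c b * b x)"
by(rule spec[where x = L,THEN mp,THEN mp])(simp_all add: assms(3,4))
then obtain e where "!!c. B(%x. \<Sum>b\<in>S. c b * b x)(%x. \<Sum>b\<in>S. e b * b x) = L(%x. \<Sum>b\<in>S. c b * b x)"
by auto
moreover have "(%x. \<Sum>b\<in>S. e b * b x)\<in>V"using assms(2)by(intro sum_mem cmult_mem)auto
ultimately show ?thesis by blast
qed

end

section \<open>The space \<open>L\<^sup>2\<close> of a measure\<close>

text \<open>A general measure is needed besides \<open>ip\<close>: the same space is used on the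
  domain, on the time interval, on the unit interval that parametrizes an edge, and on the product
  measure of the Slobodeckij seminorm.\<close>

definition inner2 ::"'a measure=>('a=>real)=>('a=>real)=>real"where
"inner2 M f g = integral\<^sup>L M(%x. f x * g x)"

definition norm2 ::"'a measure=>('a=>real)=>real"where
"norm2 M f = sqrt(inner2 M f f)"

lemma ip_eq_inner2:"ip S = inner2(lebesgue_on S)"
by(auto simp: fun_eq_iff ip_def inner2_def)

lemma L2norm_eq_norm2:"L2norm S = norm2(lebesgue_on S)"
by(auto simp: fun_eq_iff L2norm_def norm2_def ip_eq_inner2)

lemma L2_measurable:"f\<in>L2 M==>f\<in>borel_measurable M"
and L2_square_integrable:"f\<in>L2 M==>integrable M(%x. (f x)\<^sup>2)"
by(auto simp: L2_def)

lemma L2_mult_integrable: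
assumes "f\<in>L2 M""g\<in>L2 M"shows "integrable M(%x. f x * g x)"
proof(rule Bochner_Integration.integrable_bound)
show "integrable M(%x. (f x)\<^sup>2 + (g x)\<^sup>2)"
using assms by(auto dest: L2_square_integrable)
show "(%x. f x * g x)\<in>borel_measurable M"
using assms by(auto dest!: L2_measurable)
have "\<bar>f x * g x\<bar>\<le>(f x)\<^sup>2 + (g x)\<^sup>2"for x
proof -
have "2 * \<bar>f x * g x\<bar>\<le>(f x)\<^sup>2 + (g x)\<^sup>2"
 using sum_squares_bound[of "\<bar>f x\<bar>""\<bar>g x\<bar>"]by(simp add: abs_mult mult.assoc)
thus ?thesis using abs_ge_zero[of "f x * g x"]by linarith
qed
thus "AE x in M. norm(f x * g x)\<le>norm((f x)\<^sup>2 + (g x)\<^sup>2)"by auto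
qed

interpretation L2: semidef_form "L2 M""inner2 M"
rewrites "semidef_form.nrm(inner2 M) = norm2 M"
proof -
show "semidef_form(L2 M)(inner2 M)"
proof
show "(%x. 0)\<in>L2 M"by(simp add: L2_def)
fix v w ::"'a=>real"and c :: real
assume v:"v\<in>L2 M"and w:"w\<in>L2 M"
have "integrable M(%x. c\<^sup>2 * (v x)\<^sup>2 + 2 * c * (v x * w x) + (w x)\<^sup>2)"
 using L2_square_integrable[OF v]L2_square_integrable[OF w]L2_mult_integrable[OF v w]
 by(intro Bochner_Integration.integrable_add integrable_mult_right)
hence "integrable M(%x. (c * v x + w x)\<^sup>2)"
 by(rule back_subst[of "integrable M"])(auto simp: power2_eq_square algebra_simps)
thus "(%x. c * v x + w x)\<in>L2 M"using v w by(auto simp: L2_def)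
{fix z assume z:"z\<in>L2 M"
 show "inner2 M(%x. c * v x + w x)z = c * inner2 M v z + inner2 M w z"
 using L2_mult_integrable[OF v z]L2_mult_integrable[OF w z]
 by(simp add: inner2_def algebra_simps)}
show "inner2 M v w = inner2 M w v"by(simp add: inner2_def mult.commute)
show "0\<le>inner2 M v v"by(simp add: inner2_def)
qed
then interpret semidef_form "L2 M""inner2 M" .
show "nrm = norm2 M"by(simp add: fun_eq_iff nrm_def norm2_def)
qed

lemma norm2_nonneg[simp]:"0\<le>norm2 M f"
by(simp add: norm2_def inner2_def)

lemma norm2_square:"(norm2 M f)\<^sup>2 = integral\<^sup>L M(%x. (f x)\<^sup>2)"
by(simp add: norm2_def inner2_def power2_eq_square)

lemma inner2_cong_AE:
assumes "f\<in>borel_measurable M""f' \<in>borel_measurable M""g\<in>borel_measurable M""g' \<in>borel_measurable M"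
"AE x in M. f x = f' x""AE x in M. g x = g' x"
shows "inner2 M f g = inner2 M f' g'"
unfolding inner2_def using assms by(intro integral_cong_AE)auto

lemma norm2_cong_AE:
assumes "f\<in>borel_measurable M""f' \<in>borel_measurable M""AE x in M. f x = f' x"
shows "norm2 M f = norm2 M f'"
unfolding norm2_def using inner2_cong_AE[OF assms(1,2)assms(1,2)assms(3,3)]by simp

lemma norm2_eq_0_iff:"f\<in>L2 M==>norm2 M f = 0\<longleftrightarrow>(AE x in M. f x = 0)"
unfolding norm2_def inner2_def
by(subst real_sqrt_eq_zero_cancel_iff,subst integral_nonneg_eq_0_iff_AE)(auto simp: L2_mult_integrable)

lemma L2_cong_AE:
assumes "f\<in>L2 M""g\<in>borel_measurable M""AE x in M. f x = g x"shows "g\<in>L2 M"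
proof -
have "integrable M(%x. (g x)\<^sup>2)"
using assms by(intro Bochner_Integration.integrable_bound[OF L2_square_integrable[OF assms(1)]])auto
thus ?thesis using assms by(simp add: L2_def)
qed

lemma L2_bounded:
assumes "finite_measure M""f\<in>borel_measurable M""AE x in M. \<bar>f x\<bar>\<le>c"shows "f\<in>L2 M"
proof -
interpret finite_measure M by fact
have "integrable M(%x. (f x)\<^sup>2)"
proof(rule integrable_const_bound)
show "AE x in M. norm((f x)\<^sup>2)\<le>c\<^sup>2"using assms(3)
proof eventually_elim
 case(elim x)
 hence "\<bar>f x\<bar>\<^sup>2\<le>c\<^sup>2"by(intro power_mono)auto
 thus ?case by simp
qed
qed(use assms in auto)
thus ?thesis using assms by(simp add: L2_def)
qed

lemma norm2_bounded:
assumes "finite_measure M""f\<in>borel_measurable M""AE x in M. \<bar>f x\<bar>\<le>c""0\<le>c"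
shows "norm2 M f\<le>c * sqrt(measure M(space M))"
proof -
interpret finite_measure M by fact
have "(norm2 M f)\<^sup>2\<le>integral\<^sup>L M(%x. c\<^sup>2)"unfolding norm2_square
proof(rule integral_mono_AE)
show "AE x in M. (f x)\<^sup>2\<le>c\<^sup>2"using assms(3)
proof eventually_elim
 case(elim x)
 hence "\<bar>f x\<bar>\<^sup>2\<le>c\<^sup>2"by(intro power_mono)auto
 thus ?case by simp
qed
qed(use L2_bounded[OF assms(1-3)]in "auto simp: L2_def")
also have "... = (c * sqrt(measure M(space M)))\<^sup>2"by(simp add: power_mult_distrib)
finally show ?thesis using assms(4)by(intro power2_le_imp_le[of "norm2 M f"])auto
qed

lemma L2_const:"finite_measure M==>(%x. c)\<in>L2 M"
by(rule L2_bounded[of _ _ "\<bar>c\<bar>"])auto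

lemma L2_integrable:
assumes "finite_measure M""f\<in>L2 M"shows "integrable M f"
using L2_mult_integrable[OF assms(2)L2_const[OF assms(1),of 1]]by simp

lemma abs_integral_le_norm2:
assumes "finite_measure M""f\<in>L2 M"
shows "integral\<^sup>L M(%x. \<bar>f x\<bar>)\<le>norm2 M f * sqrt(measure M(space M))"
proof -
have a:"(%x. \<bar>f x\<bar>)\<in>L2 M"using assms by(auto simp: L2_def)
have "\<bar>inner2 M(%x. \<bar>f x\<bar>)(%x. 1)\<bar>\<le>norm2 M(%x. \<bar>f x\<bar>) * norm2 M(%x. 1)"
by(rule L2.cauchy_schwarz[OF a L2_const[OF assms(1)]])
thus ?thesis by(simp add: inner2_def norm2_def)
qed

lemma nn_integral_norm2:"f\<in>L2 M==>(\<integral>\<^sup>+x. ennreal((f x)\<^sup>2)\<partial>M) = ennreal((norm2 M f)\<^sup>2)"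
by(simp add: norm2_square L2_square_integrable nn_integral_eq_integral)

lemma L2I_nn_integral:
assumes "f\<in>borel_measurable M""(\<integral>\<^sup>+x. ennreal((f x)\<^sup>2)\<partial>M)\<le>ennreal(c\<^sup>2)""0\<le>c"
shows "f\<in>L2 M""norm2 M f\<le>c"
proof -
show f:"f\<in>L2 M"
using assms by(auto simp: L2_def intro!: integrableI_nonneg elim: le_less_trans)
show "norm2 M f\<le>c"
using assms(2,3)unfolding nn_integral_norm2[OF f]by(intro power2_le_imp_le[OF _ assms(3)])simp
qed

text \<open>Along a subsequence whose consecutive distances are below \<open>(1/4)^k\<close>, the
  series of squared increments with weights \<open>4^k\<close> has a finite integral. Hence at
  almost every point the increments are eventually below \<open>(1/2)^k\<close> and the subsequence
  converges. Fatou's lemma then transfers the Cauchy bound to the limit.\<close>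

lemma L2_complete_AE:
assumes f:"!!n. f n\<in>L2 M"
and cauchy:"!!e. 0 < e==>\<exists>N. \<forall>m\<ge>N. \<forall>n\<ge>N. norm2 M(%x. f m x - f n x) < e"
obtains g r where "g\<in>L2 M""strict_mono(r :: nat=>nat)""(%n. norm2 M(%x. f n x - g x))---->0"
"AE x in M. (%n. f(r n)x)---->g x"
proof -
note[measurable] = L2_measurable[OF f]
have "\<exists>N. \<forall>m\<ge>N. \<forall>n\<ge>N. norm2 M(%x. f m x - f n x) < (1/4) ^ k"for k :: nat
by(rule cauchy)simp
then obtain N where N:"!!k m n. m\<ge>N k==>n\<ge>N k==>norm2 M(%x. f m x - f n x) < (1/4) ^ k"
by metis
\<comment> \<open>Adding \<open>Suc i\<close> to \<open>N (Suc k)\<close> makes \<open>r\<close>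
  strictly increasing and keeps \<open>r k\<close> above \<open>N k\<close>.\<close>
define r where "r = rec_nat(N 0)(%k i. Suc i + N(Suc k))"
have r_Suc:"r(Suc k) = Suc(r k) + N(Suc k)"for k by(simp add: r_def)
have "strict_mono r"by(rule strict_monoI_Suc)(simp add: r_Suc)
have rN:"r k\<ge>N k"for k by(cases k)(simp_all add: r_def)
have fd:"(%x. f m x - f n x)\<in>L2 M"for m n using f by(intro L2.diff_mem)
define q where "q k x = 4 ^ k * (f(r(Suc k))x - f(r k)x)\<^sup>2"for k x
have[measurable]:"q k\<in>borel_measurable M"for k unfolding q_def by measurable
have "(\<integral>\<^sup>+x. (\<Sum>k. ennreal(q k x))\<partial>M) = (\<Sum>k. \<integral>\<^sup>+x. ennreal(q k x)\<partial>M)"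
by(rule nn_integral_suminf)measurable
also have "...\<le>(\<Sum>k. ennreal((1/4) ^ k))"
proof(intro suminf_le summableI)
fix k
have "(\<integral>\<^sup>+x. ennreal(q k x)\<partial>M) = ennreal(4 ^ k) * (\<integral>\<^sup>+x. ennreal((f(r(Suc k))x - f(r k)x)\<^sup>2)\<partial>M)"
 by(subst nn_integral_cmult[symmetric])(auto simp: q_def ennreal_mult')
also have "... = ennreal(4 ^ k * (norm2 M(%x. f(r(Suc k))x - f(r k)x))\<^sup>2)"
 by(subst nn_integral_norm2[OF fd])(simp add: ennreal_mult')
also have "...\<le>ennreal(4 ^ k * ((1/4) ^ k)\<^sup>2)"
 using N[of k "r(Suc k)""r k"]rN[of k]strict_mono_leD[OF \<open>strict_mono r\<close>,of k "Suc k"]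
 by(intro ennreal_leI mult_left_mono power_mono)auto
also have "4 ^ k * ((1/4) ^ k)\<^sup>2 = (1/4::real) ^ k"
 by(simp add: power2_eq_square power_divide)
finally show "(\<integral>\<^sup>+x. ennreal(q k x)\<partial>M)\<le>ennreal((1/4) ^ k)" .
qed
also have "... < \<infinity>"
by(subst suminf_ennreal2)(auto intro!: summable_geometric)
finally have "AE x in M. (\<Sum>k. ennreal(q k x))\<noteq>\<infinity>"
by(intro nn_integral_PInf_AE)auto
hence conv:"AE x in M. convergent(%n. f(r n)x)"
proof eventually_elim
case(elim x)
have "summable(%k. q k x)"
 using elim by(intro summable_suminf_not_top)(auto simp: q_def)
from \<open>summable(%k. q k x)\<close> have "(%k. q k x)---->0"by(rule summable_LIMSEQ_zero)
hence "\<forall>\<^sub>F k in sequentially. q k x < 1"by(rule order_tendstoD)simp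
hence "\<forall>\<^sub>F k in sequentially. norm(f(r(Suc k))x - f(r k)x)\<le>(1/2) ^ k"
proof eventually_elim
 case(elim k)
 hence "(2 ^ k * \<bar>f(r(Suc k))x - f(r k)x\<bar>)\<^sup>2\<le>1\<^sup>2"
 by(simp add: q_def power_mult_distrib power_mult[symmetric]mult.commute[of k]power_mult[of 2 2 k,simplified])
 hence "2 ^ k * \<bar>f(r(Suc k))x - f(r k)x\<bar>\<le>1"by(rule power2_le_imp_le)simp
 thus ?case by(simp add: power_divide field_simps)
qed
hence "summable(%k. f(r(Suc k))x - f(r k)x)"
 by(rule summable_comparison_test_ev)(simp add: summable_geometric)
hence "convergent(%n. \<Sum>k<n. f(r(Suc k))x - f(r k)x)"
 by(simp add: summable_iff_convergent)
hence "convergent(%n. f(r n)x - f(r 0)x)"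
 by(simp only: sum_lessThan_telescope[of "%k. f(r k)x"])
thus ?case by(simp add: convergent_diff_const_right_iff)
qed
define g where "g x = lim(%n. f(r n)x)"for x
have g[measurable]:"g\<in>borel_measurable M"unfolding g_def by measurable
have lim:"AE x in M. (%n. f(r n)x)---->g x"
using conv by eventually_elim(simp add: g_def convergent_LIMSEQ_iff)
have bound:"(%x. f m x - g x)\<in>L2 M&norm2 M(%x. f m x - g x)\<le>e"
if e:"0 < e"and m:"!!n. n\<ge>m==>norm2 M(%x. f m x - f n x)\<le>e"for m e
proof -
have "(\<integral>\<^sup>+x. ennreal((f m x - g x)\<^sup>2)\<partial>M) = (\<integral>\<^sup>+x. liminf(%n. ennreal((f m x - f(r n)x)\<^sup>2))\<partial>M)"
proof(rule nn_integral_cong_AE,use lim in eventually_elim)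
 case(elim x)
 have "(%n. ennreal((f m x - f(r n)x)\<^sup>2))---->ennreal((f m x - g x)\<^sup>2)"
 by(intro tendsto_ennrealI tendsto_intros elim)
 from lim_imp_Liminf[OF _ this]show ?case by simp
qed
also have "...\<le>liminf(%n. \<integral>\<^sup>+x. ennreal((f m x - f(r n)x)\<^sup>2)\<partial>M)"
 by(rule nn_integral_liminf)measurable
also have "...\<le>liminf(%n. ennreal(e\<^sup>2))"
proof(rule Liminf_mono,rule eventually_sequentiallyI[of m])
 fix n assume "n\<ge>m"
 hence "r n\<ge>m"using seq_suble[OF \<open>strict_mono r\<close>,of n]by linarith
 thus "(\<integral>\<^sup>+x. ennreal((f m x - f(r n)x)\<^sup>2)\<partial>M)\<le>ennreal(e\<^sup>2)"
 unfolding nn_integral_norm2[OF fd]using m[of "r n"]by(intro ennreal_leI power_mono)auto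
qed
finally have "(\<integral>\<^sup>+x. ennreal((f m x - g x)\<^sup>2)\<partial>M)\<le>ennreal(e\<^sup>2)"by(simp add: Liminf_const)
thus ?thesis using L2I_nn_integral[of "%x. f m x - g x"M e]e by auto
qed
have "\<forall>\<^sub>F m in sequentially. (%x. f m x - g x)\<in>L2 M&norm2 M(%x. f m x - g x)\<le>e"if "0 < e"for e
proof -
obtain K where "\<forall>m\<ge>K. \<forall>n\<ge>K. norm2 M(%x. f m x - f n x) < e"using cauchy[OF \<open>0 < e\<close>]by blast
thus ?thesis using that by(intro eventually_sequentiallyI[of K]bound)(auto intro: less_imp_le)
qed
note ev = this
then obtain m where "(%x. f m x - g x)\<in>L2 M"
by(metis(mono_tags,lifting)eventually_sequentially order_refl zero_less_one)
hence "g\<in>L2 M"using L2.diff_mem[OF f[of m],of "%x. f m x - g x"]by simp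
moreover have "(%n. norm2 M(%x. f n x - g x))---->0"
proof(rule order_tendstoI)
fix e :: real assume "0 < e"
thus "\<forall>\<^sub>F n in sequentially. norm2 M(%x. f n x - g x) < e"
 using eventually_mono[OF ev[of "e/2"]]by force
qed(auto intro!: always_eventually intro: less_le_trans)
ultimately show thesis using that \<open>strict_mono r\<close> lim by blast
qed

lemma L2_complete:
assumes "!!n. f n\<in>L2 M"
and "!!e. 0 < e==>\<exists>N. \<forall>m\<ge>N. \<forall>n\<ge>N. norm2 M(%x. f m x - f n x) < e"
obtains g where "g\<in>L2 M""(%n. norm2 M(%x. f n x - g x))---->0"
by(rule L2_complete_AE[of f M,OF assms])(assumption | rule that)+

text \<open>Riesz--Fischer: square summable coefficients determine an element of \<open>L\<^sup>2\<close>.\<close>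
lemma orthonormal_series:
assumes p:"!!n. p n\<in>L2 M"and orth:"!!m n. inner2 M(p m)(p n) = (if m = n then 1 else 0)"
and c:"summable(%n. (c n)\<^sup>2)"
obtains g where "g\<in>L2 M""(%N. norm2 M(%x. (\<Sum>n<N. c n * p n x) - g x))---->0"
"!!n. inner2 M g(p n) = c n"
proof -
define S where "S N = (%x. \<Sum>n<N. c n * p n x)"for N
have S:"S N\<in>L2 M"for N unfolding S_def using p by(intro L2.sum_mem L2.cmult_mem)
have inn:"inner2 M(%x. \<Sum>n\<in>I. c n * p n x)(p m) = (if m\<in>I then c m else 0)"if "finite I"for I m
using p that by(simp add: L2.sum_left L2.cmult_mem L2.cmult_left orth if_distrib cong: if_cong)
have dist:"norm2 M(%x. S n x - S m x) = sqrt(\<Sum>i\<in>{m..<n}. (c i)\<^sup>2)"if "m\<le>n"for m n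
proof -
have "(%x. S n x - S m x) = (%x. \<Sum>i\<in>{m..<n}. c i * p i x)"
 using that by(auto simp: S_def sum_diff_nat_ivl lessThan_atLeast0)
moreover have "inner2 M(%x. \<Sum>i\<in>{m..<n}. c i * p i x)(%x. \<Sum>i\<in>{m..<n}. c i * p i x) = (\<Sum>i\<in>{m..<n}. (c i)\<^sup>2)"
proof -
 have "(%x. \<Sum>i\<in>{m..<n}. c i * p i x)\<in>L2 M"using p by(intro L2.sum_mem L2.cmult_mem)
 thus ?thesis using p
 by(subst L2.sum_right)(auto simp: L2.cmult_mem L2.cmult_right inn power2_eq_square)
qed
ultimately show ?thesis by(simp add: norm2_def)
qed
have "\<exists>N. \<forall>m\<ge>N. \<forall>n\<ge>N. norm2 M(%x. S m x - S n x) < e"if e:"0 < e"for e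
proof -
obtain N where N:"!!m n. m\<ge>N==>norm(\<Sum>i\<in>{m..<n}. (c i)\<^sup>2) < e\<^sup>2"
 using c e unfolding summable_Cauchy by(metis zero_less_power)
have *:"norm2 M(%x. S n x - S m x) < e"if "N\<le>m""m\<le>n"for m n
 using N[OF that(1),of n]e real_sqrt_less_mono[of "\<Sum>i\<in>{m..<n}. (c i)\<^sup>2""e\<^sup>2"]
 by(simp add: dist[OF that(2)]sum_nonneg)
have "norm2 M(%x. S m x - S n x) < e"if "N\<le>m""N\<le>n"for m n
 using *[of m n] *[of n m]that L2.nrm_commute[OF S S,of m n]by(cases "m\<le>n")auto
thus ?thesis by blast
qed
note cauchy = this
obtain g where g:"g\<in>L2 M""(%n. norm2 M(%x. S n x - g x))---->0"
by(rule L2_complete[of S M,OF S cauchy])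
have "inner2 M g(p n) = c n"for n
proof(rule LIMSEQ_unique)
show "(%N. inner2 M(S N)(p n))---->inner2 M g(p n)"
 by(rule L2.tendsto_form[OF S g(1)p g(2)])
have "\<forall>\<^sub>F N in sequentially. inner2 M(S N)(p n) = c n"
 by(rule eventually_sequentiallyI[of "Suc n"])(simp add: S_def inn)
thus "(%N. inner2 M(S N)(p n))---->c n"by(rule tendsto_eventually)
qed
thus thesis using that g unfolding S_def by blast
qed

section \<open>Smooth functions and test functions\<close>

lemma pds_Nil[simp]:"pds[]f = f"
and pds_Cons[simp]:"pds(b # bs)f = pd b(pds bs f)"
by(simp_all add: pds_def)

lemma pds_append:"pds(as @ bs)f = pds as(pds bs f)"
by(simp add: pds_def)

lemma pd_eq:"(f has_derivative f')(at x)==>pd b f x = f' b"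
by(simp add: pd_def frechet_derivative_at[symmetric])

lemma has_derivative_pd:
assumes "f differentiable at x"
shows "(f has_derivative(%v. \<Sum>b\<in>Basis. (v\<bullet>b) * pd b f x))(at x)"
proof -
have D:"(f has_derivative frechet_derivative f(at x))(at x)"
using assms by(simp add: frechet_derivative_works)
then interpret bounded_linear "frechet_derivative f(at x)"by(rule has_derivative_bounded_linear)
have "frechet_derivative f(at x)v = (\<Sum>b\<in>Basis. (v\<bullet>b) * pd b f x)"for v
using sum[of "%b. (v\<bullet>b) *\<^sub>R b"Basis]by(simp add: euclidean_representation pd_def scaleR)
hence "frechet_derivative f(at x) = (%v. \<Sum>b\<in>Basis. (v\<bullet>b) * pd b f x)"by(simp add: fun_eq_iff)
thus ?thesis using D by simp
qed

lemma smooth_differentiable:"smooth f==>f differentiable at x"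
unfolding smooth_def by(metis empty_iff empty_set pds_Nil subsetI)

lemma smooth_pd: assumes "smooth f""b\<in>Basis"shows "smooth(pd b f)"
unfolding smooth_def
proof(intro allI impI)
fix bs ::"'a list"and x assume "set bs\<subseteq>Basis"
thus "pds bs(pd b f)differentiable at x"
using assms pds_append[of bs "[b]"f]unfolding smooth_def by(metis(no_types)Un_subset_iff empty_subsetI
 insert_subset list.simps(15)pds_Cons pds_Nil set_append set_empty)
qed

lemma smooth_pds:"smooth f==>set bs\<subseteq>Basis==>smooth(pds bs f)"
by(induction bs)(auto simp: smooth_pd)

text \<open>\<open>smooth\<close> speaks of all iterated partial derivatives, so a class of
  differentiable functions that is stable under \<open>pd\<close> consists of smooth functions. This
  replaces an induction over lists of directions in each application.\<close>

lemma smooth_coinduct: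
assumes "X f"and "!!f x. X f==>f differentiable at x"and "!!f b. X f==>b\<in>Basis==>X(pd b f)"
shows "smooth f"
proof -
have "X(pds bs f)"if "set bs\<subseteq>Basis"for bs
using that by(induction bs)(auto simp: assms(1,3))
thus ?thesis using assms(2)by(auto simp: smooth_def)
qed

lemma pd_add:"f differentiable at x==>g differentiable at x==>pd b(%x. f x + g x)x = pd b f x + pd b g x"
using pd_eq[OF has_derivative_add]unfolding frechet_derivative_works pd_def by blast

lemma pd_mult:"f differentiable at x==>g differentiable at x==>
pd b(%x. f x * g x)x = f x * pd b g x + pd b f x * g x"
using pd_eq[OF has_derivative_mult]unfolding frechet_derivative_works pd_def by blast

lemma pd_const[simp]:"pd b(%x. c) = (%x. 0)"
by(auto simp: fun_eq_iff intro!: pd_eq[THEN trans]derivative_eq_intros)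

lemma pd_cmult:"f differentiable at x==>pd b(%x. c * f x)x = c * pd b f x"
by(subst pd_mult)auto

lemma smooth_const[simp]:"smooth(%x. c)"
by(rule smooth_coinduct[where X = "%f. \<exists>c. f = (%x. c)"])auto

lemma smooth_inner[simp]:"smooth(%x. x\<bullet>v)"
proof -
have pd:"pd b(%x. x\<bullet>v) = (%x. b\<bullet>v)"for b
by(auto simp: fun_eq_iff intro!: pd_eq[THEN trans]derivative_eq_intros)
show ?thesis
by(rule smooth_coinduct[where X = "%f. f = (%x. x\<bullet>v)\<or>smooth f"])
 (auto simp: pd smooth_differentiable smooth_pd)
qed

text \<open>The functions \<open>p(1/t) e\<^sup>-\<^sup>1\<^sup>/\<^sup>t\<close>, extended by zero to \<open>t \<le> 0\<close>, are closed under differentiation.\<close>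
definition flat_exp ::"real poly=>real=>real"where
"flat_exp p t = (if t > 0 then poly p(1 / t) * exp(- (1 / t))else 0)"

text \<open>The power \<open>k\<close> is general because peeling the constant coefficient off a
  polynomial moves one factor \<open>s\<close> into the power.\<close>

lemma tendsto_power_poly_div_exp:
"((%s::real. s ^ k * poly p s / exp s)\<longlongrightarrow>0)at_top"
proof(induction p arbitrary: k rule: pCons_induct)
case(pCons a p)
have "((%s. a * (s ^ k / exp s) + s ^ Suc k * poly p s / exp s)\<longlongrightarrow>a * 0 + 0)at_top"
by(intro tendsto_intros pCons.IH tendsto_power_div_exp_0)
thus ?case by(simp add: field_simps)
qed simp

lemma flat_exp_at_right:"(flat_exp p\<longlongrightarrow>0)(at_right 0)"
proof -
have "((%t::real. poly p(inverse t) / exp(inverse t))\<longlongrightarrow>0)(at_right 0)"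
by(rule filterlim_compose[OF _ filterlim_inverse_at_top_right])
 (use tendsto_power_poly_div_exp[of 0 p]in simp)
thus ?thesis
by(rule Lim_transform_eventually)
 (auto simp: eventually_at_filter flat_exp_def field_simps exp_minus intro!: always_eventually)
qed

text \<open>With \<open>s = 1/t\<close> the chain rule gives the factor \<open>s^2\<close> and
  replaces \<open>p\<close> by \<open>p - p'\<close>; the list \<open>[:0,0,1:]\<close> is the
  monomial of degree two. At 0 the difference quotient from the right is again a flat exponential,
  with polynomial \<open>[:0,1:] * p\<close>, and so tends to 0.\<close>

lemma flat_exp_derivative:
"(flat_exp p has_real_derivative flat_exp([:0,0,1:] * (p - pderiv p))t)(at t)"
proof -
consider "t > 0" | "t < 0" | "t = 0"by linarith
thus ?thesis
proof cases
case 1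
have "((%t. poly p(1 / t) * exp(- (1 / t)))has_real_derivative
 flat_exp([:0,0,1:] * (p - pderiv p))t)(at t)"
 using 1 by(auto intro!: derivative_eq_intros DERIV_chain2[OF poly_DERIV]
  simp: flat_exp_def power2_eq_square field_simps)
moreover have "\<forall>\<^sub>F s in nhds t. poly p(1 / s) * exp(- (1 / s)) = flat_exp p s"
 using eventually_nhds_in_open[of "{0<..}"t]1 by(auto simp: flat_exp_def elim: eventually_mono)
ultimately show ?thesis by(subst DERIV_cong_ev[OF refl _ refl,symmetric])
next
case 2
have "\<forall>\<^sub>F s in nhds t. 0 = flat_exp p s"
 using eventually_nhds_in_open[of "{..<0}"t]2 by(auto simp: flat_exp_def elim: eventually_mono)
moreover have "((%s. 0)has_real_derivative flat_exp([:0,0,1:] * (p - pderiv p))t)(at t)"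
 using 2 by(simp add: flat_exp_def)
ultimately show ?thesis by(subst DERIV_cong_ev[OF refl _ refl,symmetric])
next
case 3
have "((%s. (flat_exp p s - flat_exp p 0) / (s - 0))\<longlongrightarrow>0)(at_right 0)"
 by(rule Lim_transform_eventually[OF flat_exp_at_right[of "[:0,1:] * p"]])
 (auto simp: eventually_at_filter flat_exp_def field_simps intro!: always_eventually)
moreover have "((%s. (flat_exp p s - flat_exp p 0) / (s - 0))\<longlongrightarrow>0)(at_left 0)"
 by(rule tendsto_eventually)(auto simp: eventually_at_filter flat_exp_def intro!: always_eventually)
ultimately show ?thesis using 3
 by(simp add: has_field_derivative_iff filterlim_at_split flat_exp_def)
qed
qed

text \<open>The derivative of a product is a sum of products, and that of \<open>flat_exp p\<close>
  after \<open>f\<close> is a product, so no single operation yields a class stable under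
  \<open>pd\<close>. The closure under all three operations at once does.\<close>

inductive smooth_alg ::"('a::euclidean_space=>real)=>bool"where
base:"smooth f==>smooth_alg f"
| plus:"smooth_alg f==>smooth_alg g==>smooth_alg(%x. f x + g x)"
| times:"smooth_alg f==>smooth_alg g==>smooth_alg(%x. f x * g x)"
| flat:"smooth_alg f==>smooth_alg(%x. flat_exp p(f x))"

lemma smooth_alg_pd:
"smooth_alg f==>(\<forall>x. f differentiable at x)&(\<forall>b\<in>Basis. smooth_alg(pd b f))"
proof(induction rule: smooth_alg.induct)
case(base f)
thus ?case by(auto intro: smooth_alg.base smooth_pd simp: smooth_differentiable)
next
case(plus f g)
hence "pd b(%x. f x + g x) = (%x. pd b f x + pd b g x)"for b by(auto simp: fun_eq_iff pd_add)
thus ?case using plus by(auto intro: smooth_alg.plus)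
next
case(times f g)
hence "pd b(%x. f x * g x) = (%x. f x * pd b g x + pd b f x * g x)"for b by(auto simp: fun_eq_iff pd_mult)
thus ?case using times by(auto intro!: smooth_alg.plus smooth_alg.times)
next
case(flat f p)
let ?q = "[:0,0,1:] * (p - pderiv p)"
have D:"((%x. flat_exp p(f x))has_derivative(%v. flat_exp ?q(f x) * frechet_derivative f(at x)v))(at x)"for x
using flat by(intro has_derivative_compose[OF _ flat_exp_derivative[THEN has_field_derivative_imp_has_derivative]])
 (simp add: frechet_derivative_works[symmetric])
hence "pd b(%x. flat_exp p(f x)) = (%x. flat_exp ?q(f x) * pd b f x)"for b
using pd_eq[OF D,of b]by(simp only: fun_eq_iff pd_def[of b f]simp_thms)
moreover have "(%x. flat_exp p(f x))differentiable at x"for x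
using D by(auto simp: differentiable_def)
ultimately show ?case using flat by(auto intro!: smooth_alg.times smooth_alg.flat simp del: mult_pCons_left)
qed

lemma smooth_alg_smooth:"smooth_alg f==>smooth f"
by(rule smooth_coinduct[where X = smooth_alg])(auto dest: smooth_alg_pd)

lemma smooth_add:"smooth f==>smooth g==>smooth(%x. f x + g x)"
and smooth_mult:"smooth f==>smooth g==>smooth(%x. f x * g x)"
and smooth_flat_exp:"smooth f==>smooth(%x. flat_exp p(f x))"
by(auto intro!: smooth_alg_smooth intro: smooth_alg.intros)

lemma smooth_cmult:"smooth f==>smooth(%x. c * f x)"
by(rule smooth_mult)auto

lemma smooth_diff:"smooth f==>smooth g==>smooth(%x. f x - g x)"
using smooth_add[OF _ smooth_cmult[of g "-1"]]by simp

lemma smooth_sum:"(!!i. i\<in>I==>smooth(f i))==>smooth(%x. \<Sum>i\<in>I. f i x)"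
by(induction I rule: infinite_finite_induct)(auto intro: smooth_add)

lemma smooth_affine:
fixes f ::"'a::euclidean_space=>real"
assumes "smooth f"shows "smooth(%x. f(c *\<^sub>R x + d))"
and pd_affine:"pd b(%x. f(c *\<^sub>R x + d)) = (%x. c * pd b f(c *\<^sub>R x + d))"
proof -
have D:"((%x. f(c *\<^sub>R x + d))has_derivative(%v. frechet_derivative f(at(c *\<^sub>R x + d))(c *\<^sub>R v)))(at x)"
if "smooth f"for f ::"'a=>real"and x
proof(rule has_derivative_compose[where g = f])
show "((%x. c *\<^sub>R x + d)has_derivative(%v. c *\<^sub>R v))(at x)"by(auto intro!: derivative_eq_intros)
show "(f has_derivative frechet_derivative f(at(c *\<^sub>R x + d)))(at(c *\<^sub>R x + d))"
 using smooth_differentiable[OF that]by(simp add: frechet_derivative_works[symmetric])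
qed
have pd:"pd b(%x. f(c *\<^sub>R x + d)) = (%x. c * pd b f(c *\<^sub>R x + d))"if "smooth f"for f ::"'a=>real"and b
proof
fix x
have "linear(frechet_derivative f(at(c *\<^sub>R x + d)))"
 using smooth_differentiable[OF that]by(simp add: linear_frechet_derivative)
thus "pd b(%x. f(c *\<^sub>R x + d))x = c * pd b f(c *\<^sub>R x + d)"
 using pd_eq[OF D[OF that]]by(simp add: pd_def linear_cmul)
qed
show "pd b(%x. f(c *\<^sub>R x + d)) = (%x. c * pd b f(c *\<^sub>R x + d))"using pd assms by blast
have dif:"(%x. f(c *\<^sub>R x + d))differentiable at x"if "smooth f"for f ::"'a=>real"and x
using D[OF that]by(auto simp: differentiable_def)
show "smooth(%x. f(c *\<^sub>R x + d))"
proof(rule smooth_coinduct[where X = "%g. \<exists>f k. smooth f&g = (%x. k * f(c *\<^sub>R x + d))"])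
show "\<exists>f' k. smooth f' &(%x. f(c *\<^sub>R x + d)) = (%x. k * f' (c *\<^sub>R x + d))"
 using assms by(intro exI[of _ f]exI[of _ 1])auto
next
fix g ::"'a=>real"and x assume "\<exists>f k. smooth f&g = (%x. k * f(c *\<^sub>R x + d))"
then obtain f k where "smooth f"and g:"g = (%x. k * f(c *\<^sub>R x + d))"by blast
thus "g differentiable at x"unfolding g by(intro differentiable_mult differentiable_const dif)
next
fix g ::"'a=>real"and b :: 'a assume "\<exists>f k. smooth f&g = (%x. k * f(c *\<^sub>R x + d))"and b:"b\<in>Basis"
then obtain f k where f:"smooth f"and g:"g = (%x. k * f(c *\<^sub>R x + d))"by blast
have "pd b g = (%x. (k * c) * pd b f(c *\<^sub>R x + d))"
 unfolding g by(auto simp: fun_eq_iff pd_cmult[OF dif[OF f]]pd[OF f])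
thus "\<exists>f k. smooth f&pd b g = (%x. k * f(c *\<^sub>R x + d))"using smooth_pd[OF f b]by blast
qed
qed

lemma pd_add_smooth:"smooth f==>smooth g==>pd b(%x. f x + g x) = (%x. pd b f x + pd b g x)"
and pd_cmult_smooth:"smooth f==>pd b(%x. c * f x) = (%x. c * pd b f x)"
and pd_mult_smooth:"smooth f==>smooth g==>pd b(%x. f x * g x) = (%x. f x * pd b g x + pd b f x * g x)"
by(auto simp: fun_eq_iff pd_add pd_mult pd_cmult smooth_differentiable)

lemma pds_cmult:"smooth f==>set bs\<subseteq>Basis==>pds bs(%x. c * f x) = (%x. c * pds bs f x)"
by(induction bs)(auto simp: pd_cmult_smooth smooth_pds)

lemma pds_affine:"smooth f==>set bs\<subseteq>Basis==>
pds bs(%x. f(c *\<^sub>R x + d)) = (%x. c ^ length bs * pds bs f(c *\<^sub>R x + d))"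
by(induction bs)(auto simp: pd_cmult_smooth smooth_affine smooth_pds pd_affine mult.assoc)

lemma smooth_isCont:"smooth f==>isCont f x"
by(intro differentiable_imp_continuous_within smooth_differentiable)

lemma smooth_continuous_on:"smooth f==>continuous_on S f"
using smooth_isCont continuous_at_imp_continuous_on by blast

lemma smooth_measurable[measurable_dest]:"smooth f==>f\<in>borel_measurable borel"
by(intro borel_measurable_continuous_onI smooth_continuous_on)

lemma smooth_line_derivative:
assumes "smooth f"
shows "((%t. f(x + t *\<^sub>R v))has_real_derivative(\<Sum>b\<in>Basis. (v\<bullet>b) * pd b f(x + t *\<^sub>R v)))(at t)"
proof -
have "((%t. f(x + t *\<^sub>R v))has_derivative(%h. \<Sum>b\<in>Basis. ((h *\<^sub>R v)\<bullet>b) * pd b f(x + t *\<^sub>R v)))(at t)"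
by(intro has_derivative_compose[OF _ has_derivative_pd[OF smooth_differentiable[OF assms]]])
 (auto intro!: derivative_eq_intros)
thus ?thesis unfolding has_field_derivative_def
by(rule has_derivative_eq_rhs)(auto simp: fun_eq_iff sum_distrib_left sum_distrib_right algebra_simps)
qed

lemma smooth_line_derivative_Basis:
assumes "smooth f""b\<in>Basis"
shows "((%t. f(x + t *\<^sub>R b))has_real_derivative pd b f(x + t *\<^sub>R b))(at t)"
proof -
have "(\<Sum>c\<in>Basis. (b\<bullet>c) * pd c f(x + t *\<^sub>R b)) = (\<Sum>c\<in>Basis. if c = b then pd c f(x + t *\<^sub>R b)else 0)"
using assms by(intro sum.cong)(auto simp: inner_Basis)
thus ?thesis using smooth_line_derivative[OF assms(1),of x b t]assms by simp
qed

text \<open>Two applications of the mean value theorem show that the mixed second difference over a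
  square of side \<open>h\<close> is \<open>h * h\<close> times either mixed derivative at some
  point within distance \<open>2 * h\<close>. Continuity of the mixed derivatives gives the
  limit.\<close>

lemma pd_commute:
assumes f:"smooth f"and ab:"a\<in>Basis""b\<in>Basis"
shows "pd a(pd b f) = pd b(pd a f)"
proof
fix x
have mvt:"\<exists>p. dist p x\<le>2 * h&
 f(x + h *\<^sub>R a + h *\<^sub>R b) - f(x + h *\<^sub>R a) - f(x + h *\<^sub>R b) + f x = h * h * pd b(pd a f)p"
if h:"0 < h"and ab:"a\<in>Basis""b\<in>Basis"for h a b
proof -
let ?g = "%t. f((x + h *\<^sub>R b) + t *\<^sub>R a) - f(x + t *\<^sub>R a)"
have "\<exists>z>0. z < h&?g h - ?g 0 = (h - 0) * (pd a f((x + h *\<^sub>R b) + z *\<^sub>R a) - pd a f(x + z *\<^sub>R a))"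
 using h by(intro MVT2)(auto intro!: DERIV_diff smooth_line_derivative_Basis f ab)
then obtain z where z:"0 < z""z < h""?g h - ?g 0 = h * (pd a f((x + h *\<^sub>R b) + z *\<^sub>R a) - pd a f(x + z *\<^sub>R a))"
 by auto
have "\<exists>w>0. w < h&pd a f((x + z *\<^sub>R a) + h *\<^sub>R b) - pd a f((x + z *\<^sub>R a) + 0 *\<^sub>R b)
 = (h - 0) * pd b(pd a f)((x + z *\<^sub>R a) + w *\<^sub>R b)"
 using h by(intro MVT2)(auto intro!: smooth_line_derivative_Basis smooth_pd f ab)
then obtain w where w:"0 < w""w < h""pd a f((x + z *\<^sub>R a) + h *\<^sub>R b) - pd a f(x + z *\<^sub>R a)
 = h * pd b(pd a f)((x + z *\<^sub>R a) + w *\<^sub>R b)"by auto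
have "dist((x + z *\<^sub>R a) + w *\<^sub>R b)x\<le>norm(z *\<^sub>R a) + norm(w *\<^sub>R b)"
 by(simp add: dist_norm norm_triangle_ineq add.assoc del: norm_scaleR)
also have "...\<le>2 * h"using z w ab by simp
finally show ?thesis using z(3)w(3)h
 by(intro exI[of _ "(x + z *\<^sub>R a) + w *\<^sub>R b"])(simp add: algebra_simps)
qed
define h where "h n = 1 / real(Suc n)"for n
have h0:"h---->0"unfolding h_def by(rule LIMSEQ_Suc[OF lim_1_over_n])
have hp:"0 < h n"for n by(simp add: h_def)
have "\<exists>p q. dist p x\<le>2 * h n&dist q x\<le>2 * h n&pd b(pd a f)p = pd a(pd b f)q"for n
proof -
obtain p where p:"dist p x\<le>2 * h n"
 "f(x + h n *\<^sub>R a + h n *\<^sub>R b) - f(x + h n *\<^sub>R a) - f(x + h n *\<^sub>R b) + f x = h n * h n * pd b(pd a f)p"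
 using mvt[OF hp ab]by blast
obtain q where q:"dist q x\<le>2 * h n"
 "f(x + h n *\<^sub>R b + h n *\<^sub>R a) - f(x + h n *\<^sub>R b) - f(x + h n *\<^sub>R a) + f x = h n * h n * pd a(pd b f)q"
 using mvt[OF hp ab(2,1)]by blast
have "h n * h n * pd b(pd a f)p = h n * h n * pd a(pd b f)q"
proof -
 have "x + h n *\<^sub>R b + h n *\<^sub>R a = x + h n *\<^sub>R a + h n *\<^sub>R b"by simp
 with q(2)have "f(x + h n *\<^sub>R a + h n *\<^sub>R b) - f(x + h n *\<^sub>R b) - f(x + h n *\<^sub>R a) + f x = h n * h n * pd a(pd b f)q"
 by(rule back_subst[where P = "%y. f y - _ - _ + _ = _"])
 with p(2)show ?thesis by linarith
qed
hence "pd b(pd a f)p = pd a(pd b f)q"using hp[of n]by simp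
thus ?thesis using p(1)q(1)by blast
qed
then obtain p q where pq:"!!n. dist(p n)x\<le>2 * h n""!!n. dist(q n)x\<le>2 * h n"
"!!n. pd b(pd a f)(p n) = pd a(pd b f)(q n)"by metis
have *:"r---->x"if "!!n. dist(r n)x\<le>2 * h n"for r
proof(rule tendsto_dist_iff[THEN iffD2],rule Lim_null_comparison[of _ "%n. 2 * h n"])
show "(%n. 2 * h n)---->0"using tendsto_mult_right_zero[OF h0,of 2] .
qed(simp add: that)
have "(%n. pd b(pd a f)(p n))---->pd b(pd a f)x""(%n. pd a(pd b f)(q n))---->pd a(pd b f)x"
by(rule isCont_tendsto_compose[OF smooth_isCont[OF smooth_pd[OF smooth_pd[OF f ab(1)]ab(2)]] *[OF pq(1)]],
 rule isCont_tendsto_compose[OF smooth_isCont[OF smooth_pd[OF smooth_pd[OF f ab(2)]ab(1)]] *[OF pq(2)]])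
moreover have "(%n. pd b(pd a f)(p n)) = (%n. pd a(pd b f)(q n))"
by(rule ext)(rule pq(3))
ultimately show "pd a(pd b f)x = pd b(pd a f)x"using LIMSEQ_unique by metis
qed

lemma pd_pds_commute:"smooth f==>b\<in>Basis==>set bs\<subseteq>Basis==>pd b(pds bs f) = pds bs(pd b f)"
by(induction bs)(auto simp: pd_commute[of _ b]smooth_pds)

section \<open>Test functions: closure properties, bounds and integrability\<close>

lemma test_fun_smooth:"test_fun S ph==>smooth ph"
by(simp add: test_fun_def)

lemma test_funI:
assumes "smooth ph""compact K""K\<subseteq>S""!!x. x\<notin>K==>ph x = 0"
shows "test_fun S ph"
proof -
have "closure{x. ph x\<noteq>0}\<subseteq>K"
using assms by(intro closure_minimal compact_imp_closed)auto
moreover from this have "compact(closure{x. ph x\<noteq>0})"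
using bounded_subset[OF compact_imp_bounded[OF assms(2)]]by(simp add: compact_eq_bounded_closed)
ultimately show ?thesis using assms by(auto simp: test_fun_def)
qed

lemma test_funE:
assumes "test_fun S ph"
obtains K where "smooth ph""compact K""K\<subseteq>S""\<forall>x. x\<notin>K-->ph x = 0"
proof(rule that[of "closure{x. ph x\<noteq>0}"])
show "\<forall>x. x\<notin>closure{x. ph x\<noteq>0}-->ph x = 0"
using closure_subset[of "{x. ph x\<noteq>0}"]by blast
qed(use assms in "auto simp: test_fun_def")

lemma test_fun_mono:"test_fun S ph==>S\<subseteq>S' ==>test_fun S' ph"
unfolding test_fun_def by blast

lemma test_fun_outside:"test_fun S ph==>x\<notin>S==>ph x = 0"
proof -
assume "test_fun S ph"and x:"x\<notin>S"
then obtain K where "smooth ph""compact K""K\<subseteq>S""\<forall>x. x\<notin>K-->ph x = 0"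
by(elim test_funE)
thus "ph x = 0"using x by blast
qed

lemma test_fun_pd: assumes "test_fun S ph""b\<in>Basis"shows "test_fun S(pd b ph)"
proof -
from assms(1)obtain K where K:"smooth ph""compact K""K\<subseteq>S""\<forall>x. x\<notin>K-->ph x = 0"
by(rule test_funE)
show ?thesis
proof(rule test_funI[OF smooth_pd[OF K(1)assms(2)]K(2,3)])
fix x assume "x\<notin>K"
have "(ph has_derivative(%v. 0))(at x)"
 by(rule has_derivative_transform_within_open[OF has_derivative_const,of "- K"])
 (use K(2,4) \<open>x\<notin>K\<close> in "auto simp: compact_imp_closed open_Compl")
thus "pd b ph x = 0"by(simp add: pd_eq)
qed
qed

lemma test_fun_pds:"test_fun S ph==>set bs\<subseteq>Basis==>test_fun S(pds bs ph)"
by(induction bs)(auto simp: test_fun_pd)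

lemma test_fun_zero[simp]:"test_fun S(%x. 0)"
by(rule test_funI[of _ "{}"])auto

lemma test_fun_add: assumes "test_fun S ph""test_fun S psz"shows "test_fun S(%x. ph x + psz x)"
proof -
obtain K where K:"smooth ph""compact K""K\<subseteq>S""\<forall>x. x\<notin>K-->ph x = 0"
using assms(1)by(rule test_funE)
obtain L where L:"smooth psz""compact L""L\<subseteq>S""\<forall>x. x\<notin>L-->psz x = 0"
using assms(2)by(rule test_funE)
show ?thesis by(rule test_funI[of _ "K\<union>L"])(use K L in "auto intro: smooth_add compact_Un")
qed

lemma test_fun_mult: assumes "smooth f""test_fun S ph"shows "test_fun S(%x. f x * ph x)"
proof -
obtain K where K:"smooth ph""compact K""K\<subseteq>S""\<forall>x. x\<notin>K-->ph x = 0"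
using assms(2)by(rule test_funE)
show ?thesis by(rule test_funI[of _ "K"])(use K assms in "auto intro: smooth_mult")
qed

lemma test_fun_cmult:"test_fun S ph==>test_fun S(%x. c * ph x)"
using test_fun_mult[OF smooth_const] .

lemma test_fun_diff:"test_fun S ph==>test_fun S psz==>test_fun S(%x. ph x - psz x)"
using test_fun_add[OF _ test_fun_cmult[of S psz "-1"]]by simp

lemma test_fun_bounded:
assumes "test_fun S ph"obtains B where "0\<le>B""\<forall>x. \<bar>ph x\<bar>\<le>B"
proof -
obtain K where K:"smooth ph""compact K""K\<subseteq>S""\<forall>x. x\<notin>K-->ph x = 0"
using assms by(rule test_funE)
have "bounded(ph ` K)"
by(intro compact_imp_bounded compact_continuous_image smooth_continuous_on K)
then obtain B where "!!x. x\<in>K==>\<bar>ph x\<bar>\<le>B"by(auto simp: bounded_iff)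
hence "\<bar>ph x\<bar>\<le>max B 0"for x using K(4)[rule_format,of x]by(cases "x\<in>K")fastforce+
thus thesis using that[of "max B 0"]by simp
qed

lemma test_fun_integrable_lborel: assumes "test_fun S ph"shows "integrable lborel ph"
proof -
obtain K where K:"smooth ph""compact K""K\<subseteq>S""\<forall>x. x\<notin>K-->ph x = 0"
using assms by(rule test_funE)
have "integrable lborel(%x. indicator K x *\<^sub>R ph x)"
by(intro borel_integrable_compact K smooth_continuous_on)
also have "(%x. indicator K x *\<^sub>R ph x) = ph"by(rule ext)(use K(4)in "auto simp: indicator_def")
finally show ?thesis .
qed

text \<open>Both sides integrate over the whole space; the middle measure is the restriction to \<open>S\<close>.\<close>
lemma integral_lebesgue_on_eq_lborel:
fixes f ::"'a::euclidean_space=>real"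
assumes "S\<in>sets lebesgue""f\<in>borel_measurable borel""!!x. x\<notin>S==>f x = 0"
shows "integral\<^sup>L(lebesgue_on S)f = integral\<^sup>L lborel f"
and "integrable(lebesgue_on S)f\<longleftrightarrow>integrable lborel f"
proof -
have i:"(%x. indicator S x * f x) = f"by(rule ext)(use assms(3)in "auto simp: indicator_def")
show "integral\<^sup>L(lebesgue_on S)f = integral\<^sup>L lborel f"
using assms integral_restrict_space[of S lebesgue f]by(simp add: i integral_completion)
show "integrable(lebesgue_on S)f\<longleftrightarrow>integrable lborel f"
using assms integrable_restrict_space[of S lebesgue f]by(simp add: i integrable_completion)
qed

lemma test_fun_integrable:
assumes "S\<in>sets lebesgue""test_fun S ph"
shows "integrable(lebesgue_on S)ph"
using integral_lebesgue_on_eq_lborel(2)[OF assms(1),of ph]assms test_fun_integrable_lborel[OF assms(2)]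
test_fun_outside[OF assms(2)]smooth_measurable[OF test_fun_smooth[OF assms(2)]]by blast

lemma borel_measurable_lebesgue_on:"f\<in>borel_measurable borel==>f\<in>borel_measurable(lebesgue_on S)"
by(intro measurable_restrict_space1 measurable_completion)simp

lemma smooth_measurable_on:"smooth f==>f\<in>borel_measurable(lebesgue_on S)"
by(intro borel_measurable_lebesgue_on smooth_measurable)

lemma test_fun_L2:
assumes "S\<in>sets lebesgue""test_fun S ph"
shows "ph\<in>L2(lebesgue_on S)"
proof -
have "test_fun S(%x. ph x * ph x)"by(intro test_fun_mult test_fun_smooth[OF assms(2)]assms)
thus ?thesis using test_fun_integrable[OF assms(1)]smooth_measurable_on[OF test_fun_smooth[OF assms(2)]]
by(auto simp: L2_def power2_eq_square)
qed

lemma test_fun_lipschitz: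
fixes ph ::"'a::euclidean_space=>real"
assumes "test_fun S ph"obtains B where "0\<le>B""\<forall>x y. \<bar>ph x - ph y\<bar>\<le>B * norm(x - y)"
proof -
have "\<exists>B. \<forall>x. \<bar>pd b ph x\<bar>\<le>B"if "b\<in>Basis"for b
using test_fun_bounded[OF test_fun_pd[OF assms that]]by blast
then obtain B where B:"!!b x. b\<in>Basis==>\<bar>pd b ph x\<bar>\<le>B b"by metis
have "\<bar>ph x - ph y\<bar>\<le>(\<Sum>b\<in>Basis. B b) * norm(x - y)"for x y
proof -
have "norm(ph x - ph y)\<le>(\<Sum>b\<in>Basis. B b) * norm(x - y)"
proof(rule differentiable_bound[of UNIV])
 show "(ph has_derivative(%v. \<Sum>b\<in>Basis. (v\<bullet>b) * pd b ph x))(at x within UNIV)"for x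
 using has_derivative_pd[OF smooth_differentiable[OF test_fun_smooth[OF assms]]]by simp
 show "onorm(%v. \<Sum>b\<in>Basis. (v\<bullet>b) * pd b ph x)\<le>(\<Sum>b\<in>Basis. B b)"for x
 proof(rule onorm_le)
 fix v
 have "norm(\<Sum>b\<in>Basis. (v\<bullet>b) * pd b ph x)\<le>(\<Sum>b\<in>Basis. norm v * B b)"
  by(rule sum_norm_le)(auto simp: abs_mult intro!: mult_mono B Basis_le_norm)
 thus "norm(\<Sum>b\<in>Basis. (v\<bullet>b) * pd b ph x)\<le>(\<Sum>b\<in>Basis. B b) * norm v"
  by(simp add: sum_distrib_left mult.commute)
 qed
qed auto
thus ?thesis by simp
qed
moreover have "0\<le>(\<Sum>b\<in>Basis. B b)"by(rule sum_nonneg)(meson B abs_ge_zero order_trans)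
ultimately show thesis using that[of "\<Sum>b\<in>Basis. B b"]by simp
qed

section \<open>Integration by parts and the mollifier\<close>

lemma lborel_integral_translate:
fixes f ::"'a::euclidean_space=>real"
assumes "f\<in>borel_measurable borel"
shows "(\<integral>x. f(x + a)\<partial>lborel) = (\<integral>x. f x\<partial>lborel)"
proof -
have "(\<integral>x. f x\<partial>lborel) = (\<integral>x. f x\<partial>distr lborel borel((+)a))"by(simp add: lborel_distr_plus)
also have "... = (\<integral>x. f(a + x)\<partial>lborel)"using assms by(subst integral_distr)auto
finally show ?thesis by(simp add: add.commute)
qed

text \<open>Difference quotients have integral zero because Lebesgue measure is invariant under
  translation, and they converge to the derivative under the integral. The steps are at most 1, so
  the quotients are dominated by a Lipschitz constant on the supporting ball enlarged by 1.\<close>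

lemma integral_pd_test_fun:
fixes ph ::"'a::euclidean_space=>real"
assumes t:"test_fun S ph"and b:"b\<in>Basis"
shows "(\<integral>x. pd b ph x\<partial>lborel) = 0"
proof -
obtain K where K:"smooth ph""compact K""K\<subseteq>S""\<forall>x. x\<notin>K-->ph x = 0"
using t by(rule test_funE)
obtain B where B:"0\<le>B""\<forall>x y. \<bar>ph x - ph y\<bar>\<le>B * norm(x - y)"by(rule test_fun_lipschitz[OF t])
obtain r where r:"!!x. x\<in>K==>norm x\<le>r"using compact_imp_bounded[OF K(2)]by(auto simp: bounded_iff)
define h where "h n = 1 / real(Suc n)"for n
have h0:"h---->0"unfolding h_def by(rule LIMSEQ_Suc[OF lim_1_over_n])
have hp:"0 < h n""h n\<le>1"for n by(auto simp: h_def)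
note[measurable] = smooth_measurable[OF K(1)]
have[measurable]:"pd b ph\<in>borel_measurable borel"using smooth_measurable[OF smooth_pd[OF K(1)b]] .
have shift:"integrable lborel(%x. ph(x + a))"for a
by(rule test_fun_integrable_lborel[of UNIV],rule test_funI[of _ "(%x. x - a) ` K"])
 (use smooth_affine[OF K(1),where c = 1 and d = a]K in "auto intro!: compact_continuous_image continuous_intros
 simp: image_iff algebra_simps")

have "(%n. \<integral>x. (ph(x + h n *\<^sub>R b) - ph x) / h n\<partial>lborel)---->(\<integral>x. pd b ph x\<partial>lborel)"
proof(rule integral_dominated_convergence[where w = "%x. indicator(cball 0(r + 1))x *\<^sub>R B"])
show "integrable lborel(%x::'a. indicator(cball 0(r + 1))x *\<^sub>R B)"
 by(intro borel_integrable_compact)auto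
show "AE x in lborel. (%n. (ph(x + h n *\<^sub>R b) - ph x) / h n)---->pd b ph x"
proof(rule AE_I2)
 fix x
 have "((%t. (ph(x + t *\<^sub>R b) - ph x) / t)\<longlongrightarrow>pd b ph x)(at 0)"
 using smooth_line_derivative_Basis[OF K(1)b,of x 0]by(simp add: DERIV_def)
 moreover have "filterlim h(at 0)sequentially"
 using h0 hp by(auto simp: filterlim_at intro!: always_eventually)(metis less_irrefl)
 ultimately show "(%n. (ph(x + h n *\<^sub>R b) - ph x) / h n)---->pd b ph x"
 by(rule filterlim_compose)
qed
show "AE x in lborel. norm((ph(x + h n *\<^sub>R b) - ph x) / h n)\<le>indicator(cball 0(r + 1))x *\<^sub>R B"for n
proof(rule AE_I2)
 fix x
 show "norm((ph(x + h n *\<^sub>R b) - ph x) / h n)\<le>indicator(cball 0(r + 1))x *\<^sub>R B"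
 proof(cases "norm x\<le>r + 1")
 case True
 thus ?thesis using B(2)[rule_format,of "x + h n *\<^sub>R b"x]hp[of n]b by(simp add: field_simps)
 next
 case False
 have "norm x\<le>norm(x + h n *\<^sub>R b) + norm(h n *\<^sub>R b)"
  using norm_triangle_ineq4[of "x + h n *\<^sub>R b""h n *\<^sub>R b"]by(simp del: norm_scaleR)
 hence "norm(x + h n *\<^sub>R b) > r"using False hp[of n]b by simp
 hence "x + h n *\<^sub>R b\<notin>K""x\<notin>K"using r False by force+
 thus ?thesis using K(4)False by simp
 qed
qed
qed measurable
moreover have "(\<integral>x. (ph(x + h n *\<^sub>R b) - ph x) / h n\<partial>lborel) = 0"for n
using shift[of "h n *\<^sub>R b"]test_fun_integrable_lborel[OF t]lborel_integral_translate[of ph "h n *\<^sub>R b"]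
by simp
ultimately have "(%n. 0)---->(\<integral>x. pd b ph x\<partial>lborel)"by(simp only:)
thus ?thesis by(simp add: LIMSEQ_const_iff)
qed

lemma integration_by_parts:
assumes S:"S\<in>sets lebesgue"and f:"smooth f"and t:"test_fun S ph"and b:"b\<in>Basis"
shows "inner2(lebesgue_on S)f(pd b ph) = - inner2(lebesgue_on S)(pd b f)ph"
proof -
have t1:"test_fun S(%x. f x * pd b ph x)"and t2:"test_fun S(%x. pd b f x * ph x)"
by(intro test_fun_mult f smooth_pd test_fun_pd t b)+
have t3:"test_fun S(%x. f x * ph x)"by(intro test_fun_mult f t)
have "(\<integral>x. f x * pd b ph x + pd b f x * ph x\<partial>lborel) = 0"
using integral_pd_test_fun[OF t3 b]pd_mult_smooth[OF f test_fun_smooth[OF t],of b]by simp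
hence "(\<integral>x. f x * pd b ph x\<partial>lborel) = - (\<integral>x. pd b f x * ph x\<partial>lborel)"
using t1 t2 by(simp add: test_fun_integrable_lborel)
moreover have "inner2(lebesgue_on S)f(pd b ph) = (\<integral>x. f x * pd b ph x\<partial>lborel)"
unfolding inner2_def using test_fun_outside[OF t1]smooth_measurable[OF test_fun_smooth[OF t1]]
by(intro integral_lebesgue_on_eq_lborel S)blast+
moreover have "inner2(lebesgue_on S)(pd b f)ph = (\<integral>x. pd b f x * ph x\<partial>lborel)"
unfolding inner2_def using test_fun_outside[OF t2]smooth_measurable[OF test_fun_smooth[OF t2]]
by(intro integral_lebesgue_on_eq_lborel S)blast+
ultimately show ?thesis by simp
qed

lemma integration_by_parts_pds:
assumes S:"S\<in>sets lebesgue"and t:"test_fun S ph"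
shows "smooth f==>set bs\<subseteq>Basis==>
inner2(lebesgue_on S)f(pds bs ph) = (-1) ^ length bs * inner2(lebesgue_on S)(pds bs f)ph"
proof(induction bs arbitrary: f)
case(Cons b bs)
hence "inner2(lebesgue_on S)f(pds(b # bs)ph) = - inner2(lebesgue_on S)(pd b f)(pds bs ph)"
using integration_by_parts[OF S Cons.prems(1)test_fun_pds[OF t],of bs b]by simp
also have "... = - ((-1) ^ length bs * inner2(lebesgue_on S)(pds bs(pd b f))ph)"
using Cons by(simp add: smooth_pd)
finally show ?case using Cons.prems by(simp add: pd_pds_commute)
qed simp

text \<open>The bump is \<open>flat_exp 1\<close> of \<open>1/4 - |x|^2\<close>, positive exactly in
  the open ball of radius \<open>1/2\<close>, divided by its integral.\<close>

lemma mollifier_exists: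
obtains etz ::"'a::euclidean_space=>real"where "smooth etz""!!x. 0\<le>etz x""!!x. 1/2\<le>norm x==>etz x = 0"
"(\<integral>x. etz x\<partial>lborel) = 1"
proof -
define g where "g x = flat_exp 1(1/4 - x\<bullet>x)"for x :: 'a
have "smooth(%x::'a. x\<bullet>x)"
using smooth_sum[of Basis "%b x::'a. (x\<bullet>b) * (x\<bullet>b)"]
by(subst euclidean_inner)(simp add: smooth_mult)
hence g:"smooth g"unfolding g_def by(intro smooth_flat_exp smooth_diff smooth_const)
have nonneg:"0\<le>g x"for x by(simp add: g_def flat_exp_def)
have inn:"x\<bullet>x = (norm x)\<^sup>2"for x :: 'a by(simp add: power2_norm_eq_inner)
have zero:"g x = 0"if "1/2\<le>norm x"for x
using power_mono[OF that,of 2]by(simp add: g_def flat_exp_def inn power2_eq_square)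
have pos:"0 < g x"if "norm x < 1/2"for x
using power_strict_mono[OF that,of 2]by(simp add: g_def flat_exp_def inn power2_eq_square)
have "test_fun UNIV g"by(rule test_funI[OF g,of "cball 0(1/2)"])(auto intro: zero)
hence int:"integrable lborel g"by(rule test_fun_integrable_lborel)
have "integral\<^sup>L lborel g\<noteq>0"
proof
assume "integral\<^sup>L lborel g = 0"
hence "AE x in lborel. g x = 0"using integral_nonneg_eq_0_iff_AE[OF int]nonneg by simp
hence "AE x in lborel. x\<notin>ball(0::'a)(1/2)"
proof eventually_elim
 case(elim x)
 thus ?case using pos[of x]by auto
qed
hence "negligible(ball(0::'a)(1/2))"
 unfolding negligible_iff_null_sets by(intro null_sets_completionI)(subst AE_iff_null_sets,auto)
thus False using open_not_negligible[of "ball(0::'a)(1/2)"]by auto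
qed
hence c:"integral\<^sup>L lborel g > 0"using Bochner_Integration.integral_nonneg[of lborel g]nonneg by(simp add: less_le)
show thesis
by(rule that[of "%x. (1 / integral\<^sup>L lborel g) * g x"])(use smooth_cmult[OF g,of "1 / integral\<^sup>L lborel g"]nonneg zero c in auto)
qed

section \<open>Regularization on convex sets\<close>

lemma lborel_integral_affine:
fixes f ::"'a::euclidean_space=>real"
assumes[measurable]:"f\<in>borel_measurable borel"and c:"c\<noteq>0"
shows "(\<integral>x. f(c *\<^sub>R x + t)\<partial>lborel) = (\<integral>x. f x\<partial>lborel) / \<bar>c\<bar> ^ DIM('a)"
proof -
have "(\<integral>x. f x\<partial>lborel) = (\<integral>x. f x\<partial>density(distr lborel borel(%x. t + c *\<^sub>R x))(%_. ennreal(\<bar>c\<bar>^DIM('a))))"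
using lborel_affine[OF c,of t]by(simp add: ennreal_power)
also have "... = (\<integral>x. \<bar>c\<bar>^DIM('a) *\<^sub>R f x\<partial>distr lborel borel(%x. t + c *\<^sub>R x))"
by(intro integral_density)auto
also have "... = (\<integral>x. \<bar>c\<bar>^DIM('a) *\<^sub>R f(t + c *\<^sub>R x)\<partial>lborel)"
by(intro integral_distr)auto
finally show ?thesis using c by(simp add: add.commute)
qed

text \<open>Differentiation under the integral sign for kernels \<open>psz (a x + p w)\<close>. The
  scale \<open>a\<close> covers mollification combined with a contraction, and both the Lipschitz
  constant and the derivative bounds of \<open>psz\<close> enter the dominating function.\<close>

lemma integral_kernel_derivative:
fixes psz ::"'b::euclidean_space=>real"and a :: real
assumes g:"integrable M g"and p:"p\<in>borel_measurable M"and t:"test_fun UNIV psz"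
defines "F\<equiv>%x. \<integral>w. g w * psz(a *\<^sub>R x + p w)\<partial>M"
shows "F differentiable at x"and "pd b F x = (\<Sum>c\<in>Basis. (b\<bullet>c) * (a * (\<integral>w. g w * pd c psz(a *\<^sub>R x + p w)\<partial>M)))"
proof -
have sm:"smooth psz"using t by(rule test_fun_smooth)
note[measurable] = p borel_measurable_integrable[OF g]
have int:"integrable M(%w. g w * ph(a *\<^sub>R x + p w))"if t:"test_fun UNIV ph"for ph ::"'b=>real"and x
proof -
obtain B where B:"0\<le>B""\<forall>x. \<bar>ph x\<bar>\<le>B"by(rule test_fun_bounded[OF t])
note[measurable] = smooth_measurable[OF test_fun_smooth[OF t]]
have "AE w in M. norm(g w * ph(a *\<^sub>R x + p w))\<le>norm(B *\<^sub>R g w)"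
 using B by(auto simp: abs_mult mult.commute[of B]intro!: mult_left_mono)
thus ?thesis
 by(rule Bochner_Integration.integrable_bound[OF integrable_scaleR_right[OF g],rotated])measurable
qed
define L where "L v = (\<Sum>c\<in>Basis. (v\<bullet>c) * (a * (\<integral>w. g w * pd c psz(a *\<^sub>R x + p w)\<partial>M)))"for v
have bl:"bounded_linear L"unfolding L_def
by(intro bounded_linear_sum bounded_linear_mult_left[THEN bounded_linear_compose]bounded_linear_inner_left)
obtain B where B:"0\<le>B""\<forall>x y. \<bar>psz x - psz y\<bar>\<le>B * norm(x - y)"by(rule test_fun_lipschitz[OF t])
have "\<forall>c\<in>Basis. \<exists>C. \<forall>x. \<bar>pd c psz x\<bar>\<le>C"
using test_fun_bounded[OF test_fun_pd[OF t]]by metis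
then obtain C where C:"!!c x. c\<in>Basis==>\<bar>pd c psz x\<bar>\<le>C c"by metis
have C0:"0\<le>sum C Basis"by(rule sum_nonneg)(meson C abs_ge_zero order_trans)
define D where "D w v = (\<Sum>c\<in>Basis. ((a *\<^sub>R v)\<bullet>c) * pd c psz(a *\<^sub>R x + p w))"for w v
have D_bound:"\<bar>D w v\<bar>\<le>\<bar>a\<bar> * norm v * sum C Basis"for w v
proof -
have "norm(D w v)\<le>(\<Sum>c\<in>Basis. \<bar>a\<bar> * norm v * C c)"unfolding D_def
proof(rule sum_norm_le)
 fix c :: 'b assume c:"c\<in>Basis"
 have "\<bar>a *\<^sub>R v\<bullet>c\<bar>\<le>\<bar>a\<bar> * norm v"using Basis_le_norm[OF c,of "a *\<^sub>R v"]by simp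
 thus "norm(a *\<^sub>R v\<bullet>c * pd c psz(a *\<^sub>R x + p w))\<le>\<bar>a\<bar> * norm v * C c"
 unfolding real_norm_def abs_mult by(intro mult_mono C c)auto
qed
thus ?thesis by(simp add: sum_distrib_left)
qed
have meas_pd:"c\<in>Basis==>pd c psz\<in>borel_measurable borel"for c
by(intro smooth_measurable smooth_pd sm)
have[measurable]:"psz\<in>borel_measurable borel"using smooth_measurable[OF sm] .
have D_meas:"(%w. D w v)\<in>borel_measurable M"for v unfolding D_def
by(intro borel_measurable_sum borel_measurable_times borel_measurable_const measurable_compose[OF _ meas_pd])measurable
have intD:"integrable M(%w. g w * D w v)"and L_eq:"L v = (\<integral>w. g w * D w v\<partial>M)"for v
proof -
have i:"integrable M(%w. (a * (v\<bullet>c)) * (g w * pd c psz(a *\<^sub>R x + p w)))"if "c\<in>Basis"for c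
 by(intro integrable_mult_right int test_fun_pd t that)
have eq:"(%w. g w * D w v) = (%w. \<Sum>c\<in>Basis. (a * (v\<bullet>c)) * (g w * pd c psz(a *\<^sub>R x + p w)))"
 by(auto simp: D_def sum_distrib_left fun_eq_iff algebra_simps intro!: sum.cong)
show "integrable M(%w. g w * D w v)"unfolding eq using i by(rule Bochner_Integration.integrable_sum)
have "(\<integral>w. g w * D w v\<partial>M) = (\<Sum>c\<in>Basis. \<integral>w. (a * (v\<bullet>c)) * (g w * pd c psz(a *\<^sub>R x + p w))\<partial>M)"
 unfolding eq by(rule Bochner_Integration.integral_sum[OF i])
thus "L v = (\<integral>w. g w * D w v\<partial>M)"unfolding L_def
 by(simp only: integral_mult_right_zero)(simp add: ac_simps)
qed
\<comment> \<open>The limit is taken along arbitrary sequences, for which dominated convergence is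
  available.\<close>
have "((%v. norm(F(x + v) - F x - L v) / norm v)\<longlongrightarrow>0)(at 0)"
proof(subst tendsto_at_iff_sequentially,intro allI impI)
fix X ::"nat=> 'b"assume X:"\<forall>i. X i\<in>UNIV - {0}"and X0:"X---->0"
define q where "q n w = g w * ((psz(a *\<^sub>R(x + X n) + p w) - psz(a *\<^sub>R x + p w) - D w(X n)) / norm(X n))"for n w
have "(%n. \<integral>w. q n w\<partial>M)---->(\<integral>w. 0\<partial>M)"
proof(rule integral_dominated_convergence[where w = "%w. (\<bar>a\<bar> * (B + sum C Basis)) * norm(g w)"])
 show "integrable M(%w. (\<bar>a\<bar> * (B + sum C Basis)) * norm(g w))"using g by auto
 show "(%w. q n w)\<in>borel_measurable M"for n unfolding q_def
 using D_meas[of "X n"]by measurable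
 show "AE w in M. norm(q n w)\<le>(\<bar>a\<bar> * (B + sum C Basis)) * norm(g w)"for n
 proof(rule AE_I2)
 fix w
 have Xn:"0 < norm(X n)"using X by auto
 have "\<bar>psz(a *\<^sub>R(x + X n) + p w) - psz(a *\<^sub>R x + p w)\<bar>\<le>B * (\<bar>a\<bar> * norm(X n))"
  using B(2)[rule_format,of "a *\<^sub>R(x + X n) + p w""a *\<^sub>R x + p w"]by(simp add: algebra_simps)
 hence "\<bar>psz(a *\<^sub>R(x + X n) + p w) - psz(a *\<^sub>R x + p w) - D w(X n)\<bar>\<le>\<bar>a\<bar> * (B + sum C Basis) * norm(X n)"
  using D_bound[of w "X n"]by(simp add: algebra_simps)
 hence "\<bar>(psz(a *\<^sub>R(x + X n) + p w) - psz(a *\<^sub>R x + p w) - D w(X n)) / norm(X n)\<bar>\<le>\<bar>a\<bar> * (B + sum C Basis)"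
  using Xn by(simp add: divide_le_eq)
 thus "norm(q n w)\<le>(\<bar>a\<bar> * (B + sum C Basis)) * norm(g w)"
  unfolding q_def real_norm_def abs_mult[of "g w"]mult.commute[of "\<bar>a\<bar> * (B + sum C Basis)"]
  by(intro mult_left_mono)auto
 qed
 show "AE w in M. (%n. q n w)---->0"
 proof(rule AE_I2)
 fix w
 have "((%v. psz(a *\<^sub>R v + p w))has_derivative(%v. D w v))(at x)"unfolding D_def
  by(rule has_derivative_compose[where g = psz,OF _ has_derivative_pd[OF smooth_differentiable[OF sm]]])
  (auto intro!: derivative_eq_intros)
 hence "((%v. norm(psz(a *\<^sub>R(x + v) + p w) - psz(a *\<^sub>R x + p w) - D w v) / norm v)\<longlongrightarrow>0)(at 0)"
  by(simp add: has_derivative_at)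
 hence "(%n. norm(psz(a *\<^sub>R(x + X n) + p w) - psz(a *\<^sub>R x + p w) - D w(X n)) / norm(X n))---->0"
  using X X0 by(simp add: tendsto_at_iff_sequentially o_def)
 hence "(%n. (psz(a *\<^sub>R(x + X n) + p w) - psz(a *\<^sub>R x + p w) - D w(X n)) / norm(X n))---->0"
  by(subst tendsto_norm_zero_iff[symmetric])(simp add: abs_divide)
 thus "(%n. q n w)---->0"unfolding q_def by(rule tendsto_mult_right_zero)
 qed
qed simp
moreover have "(\<integral>w. q n w\<partial>M) = (F(x + X n) - F x - L(X n)) / norm(X n)"for n
proof -
 have "(%w. q n w) = (%w. (g w * psz(a *\<^sub>R(x + X n) + p w) - g w * psz(a *\<^sub>R x + p w) - g w * D w(X n)) / norm(X n))"
 by(auto simp: q_def field_simps)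
 thus ?thesis unfolding F_def L_eq using int[OF t]intD by simp
qed
ultimately have "(%n. (F(x + X n) - F x - L(X n)) / norm(X n))---->0"by simp
thus "((%v. norm(F(x + v) - F x - L v) / norm v)\<circ>X)---->0"
 by(subst(asm)tendsto_norm_zero_iff[symmetric])(simp add: abs_divide o_def)
qed
hence "(F has_derivative L)(at x)"using bl by(simp add: has_derivative_at)
thus "F differentiable at x""pd b F x = (\<Sum>c\<in>Basis. (b\<bullet>c) * (a * (\<integral>w. g w * pd c psz(a *\<^sub>R x + p w)\<partial>M)))"
by(auto simp: differentiable_def pd_eq L_def)
qed

lemma integral_kernel_smooth:
fixes psz ::"'b::euclidean_space=>real"and a :: real
assumes g:"integrable M g"and p:"p\<in>borel_measurable M"and t:"test_fun UNIV psz"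
shows "smooth(%x. \<integral>w. g w * psz(a *\<^sub>R x + p w)\<partial>M)"
and "set bs\<subseteq>Basis==>pds bs(%x. \<integral>w. g w * psz(a *\<^sub>R x + p w)\<partial>M) =
 (%x. a ^ length bs * (\<integral>w. g w * pds bs psz(a *\<^sub>R x + p w)\<partial>M))"
proof -
define F where "F psz = (%x. \<integral>w. g w * psz(a *\<^sub>R x + p w)\<partial>M)"for psz ::"'b=>real"
have dif:"F ph differentiable at x"if "test_fun UNIV ph"for ph x
unfolding F_def by(rule integral_kernel_derivative[OF g p that])
have pd:"pd b(F ph) = (%x. a * F(pd b ph)x)"if "test_fun UNIV ph""b\<in>Basis"for ph b
proof
fix x
have "pd b(F ph)x = (\<Sum>c\<in>Basis. (b\<bullet>c) * (a * F(pd c ph)x))"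
 unfolding F_def by(rule integral_kernel_derivative[OF g p that(1)])
also have "... = (\<Sum>c\<in>Basis. if c = b then a * F(pd c ph)x else 0)"
 using that by(intro sum.cong)(auto simp: inner_Basis)
finally show "pd b(F ph)x = a * F(pd b ph)x"using that by simp
qed
have pd':"pd b(%x. k * F ph x) = (%x. (k * a) * F(pd b ph)x)"if "test_fun UNIV ph""b\<in>Basis"for ph b k
using pd_cmult[OF dif[OF that(1)]]pd[OF that]by(auto simp: fun_eq_iff)
show "smooth(%x. \<integral>w. g w * psz(a *\<^sub>R x + p w)\<partial>M)"
proof(rule smooth_coinduct[where X = "%f. \<exists>ph k. test_fun UNIV ph&f = (%x. k * F ph x)"])
show "\<exists>ph k. test_fun UNIV ph&(%x. \<integral>w. g w * psz(a *\<^sub>R x + p w)\<partial>M) = (%x. k * F ph x)"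
 using t by(intro exI[of _ psz]exI[of _ 1])(simp add: F_def)
next
fix f ::"'b=>real"and x assume "\<exists>ph k. test_fun UNIV ph&f = (%x. k * F ph x)"
then obtain ph k where "test_fun UNIV ph""f = (%x. k * F ph x)"by blast
thus "f differentiable at x"by(simp add: dif)
next
fix f ::"'b=>real"and b :: 'b assume "\<exists>ph k. test_fun UNIV ph&f = (%x. k * F ph x)"and b:"b\<in>Basis"
then obtain ph k where "test_fun UNIV ph""f = (%x. k * F ph x)"by blast
thus "\<exists>ph k. test_fun UNIV ph&pd b f = (%x. k * F ph x)"
 using pd'[of ph b k]test_fun_pd[of UNIV ph b]b by blast
qed
have "pds bs(F psz) = (%x. a ^ length bs * F(pds bs psz)x)"if "set bs\<subseteq>Basis"for bs
using that by(induction bs)(auto simp: pd' test_fun_pds t mult.commute)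
thus "set bs\<subseteq>Basis==>pds bs(%x. \<integral>w. g w * psz(a *\<^sub>R x + p w)\<partial>M) =
 (%x. a ^ length bs * (\<integral>w. g w * pds bs psz(a *\<^sub>R x + p w)\<partial>M))"by(simp add: F_def)
qed

text \<open>Truncating at level \<open>n\<close> reduces the claim to a bounded function. That
  function is an almost everywhere limit of continuous functions, and truncating these at the same
  level keeps them continuous and dominated by a constant, so both approximations are instances of
  dominated convergence.\<close>

lemma L2_dense_continuous:
fixes S ::"'a::euclidean_space set"
assumes S:"S\<in>lmeasurable"and g:"g\<in>L2(lebesgue_on S)"and e:"0 < e"
obtains f where "continuous_on UNIV f""f\<in>L2(lebesgue_on S)""norm2(lebesgue_on S)(%x. g x - f x) < e"
proof -
let ?M = "lebesgue_on S"
have Ss:"S\<in>sets lebesgue"using S by(simp add: fmeasurableD)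
interpret finite_measure ?M using S by(rule finite_measure_lebesgue_on)
have fin:"finite_measure ?M"using S by(rule finite_measure_lebesgue_on)
have gm[measurable]:"g\<in>borel_measurable ?M"using g by(rule L2_measurable)
define clip where "clip c y = max(- c)(min c y)"for c y :: real
have clip_le:"\<bar>clip c y\<bar>\<le>c"if "0\<le>c"for c y using that by(auto simp: clip_def)
have clip_cont:"continuous_on UNIV(clip c)"for c unfolding clip_def by(intro continuous_intros)
have clip_m[measurable]:"clip c\<in>borel_measurable borel"for c
by(intro borel_measurable_continuous_onI clip_cont)
define G where "G n x = clip(real n)(g x)"for n x
have Gm[measurable]:"G n\<in>borel_measurable ?M"for n unfolding G_def by measurable
have GL2:"G n\<in>L2 ?M"for n
by(rule L2_bounded[OF fin Gm,of _ "real n"])(auto simp: G_def clip_le)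
have "(%n. integral\<^sup>L ?M(%x. (g x - G n x)\<^sup>2))---->integral\<^sup>L ?M(%x. 0)"
proof(rule integral_dominated_convergence[where w = "%x. (g x)\<^sup>2"])
show "AE x in ?M. (%n. (g x - G n x)\<^sup>2)---->0"
proof(rule AE_I2,rule tendsto_eventually)
 fix x
 obtain N :: nat where "\<bar>g x\<bar>\<le>real N"using real_arch_simple by blast
 thus "\<forall>\<^sub>F n in sequentially. (g x - G n x)\<^sup>2 = 0"
 by(intro eventually_sequentiallyI[of N])(auto simp: G_def clip_def)
qed
show "AE x in ?M. norm((g x - G n x)\<^sup>2)\<le>(g x)\<^sup>2"for n
proof(rule AE_I2)
 fix x
 have "\<bar>g x - G n x\<bar>\<le>\<bar>g x\<bar>"by(auto simp: G_def clip_def)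
 hence "\<bar>g x - G n x\<bar>\<^sup>2\<le>\<bar>g x\<bar>\<^sup>2"by(rule power_mono)simp
 thus "norm((g x - G n x)\<^sup>2)\<le>(g x)\<^sup>2"by simp
qed
qed(use L2_square_integrable[OF g]in auto)
hence "(%n. norm2 ?M(%x. g x - G n x))---->0"
using tendsto_real_sqrt by(fastforce simp: norm2_def inner2_def power2_eq_square)
then obtain n where n:"norm2 ?M(%x. g x - G n x) < e / 2"
using order_tendstoD(2)[of _ 0 _ "e/2"]e by(metis(no_types,lifting)eventually_sequentially half_gt_zero order_refl)
have "(%x. if x\<in>S then g x else 0)\<in>borel_measurable lebesgue"
using gm Ss by(simp add: borel_measurable_if)
hence "(%x. if x\<in>S then g x else 0)measurable_on UNIV"
by(rule lebesgue_measurable_imp_measurable_on)simp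
then obtain N h where N:"negligible N"and hc:"!!i. continuous_on UNIV(h i)"
and h:"!!x. x\<notin>N==>(%i. h i x)---->(if x\<in>S then g x else 0)"
unfolding measurable_on_def by auto
define H where "H i x = clip(real n)(h i x)"for i :: nat and x
have Hc:"continuous_on UNIV(H i)"for i unfolding H_def
using continuous_on_compose2[OF clip_cont hc]by simp
have Hm[measurable]:"H i\<in>borel_measurable ?M"for i
by(intro borel_measurable_lebesgue_on borel_measurable_continuous_onI Hc)
have HL2:"H i\<in>L2 ?M"for i
by(rule L2_bounded[OF fin Hm,of _ "real n"])(auto simp: H_def clip_le)
have aeN:"AE x in ?M. x\<notin>N"
using N Ss by(subst AE_restrict_space_iff)(auto simp: negligible_iff_null_sets intro: AE_not_in eventually_mono)
have "(%i. integral\<^sup>L ?M(%x. (G n x - H i x)\<^sup>2))---->integral\<^sup>L ?M(%x. 0)"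
proof(rule integral_dominated_convergence[where w = "%x. (2 * real n)\<^sup>2"])
show "AE x in ?M. (%i. (G n x - H i x)\<^sup>2)---->0"
 using aeN AE_space
proof eventually_elim
 case(elim x)
 have "(%i. H i x)---->clip(real n)(g x)"unfolding H_def
 using h[OF elim(1)]elim(2)clip_cont[of "real n"]
 by(intro isCont_tendsto_compose[of "g x""clip(real n)"])(auto simp: continuous_on_eq_continuous_at)
 hence "(%i. (G n x - H i x)\<^sup>2)---->(G n x - G n x)\<^sup>2"unfolding G_def by(intro tendsto_intros)
 thus ?case by simp
qed
show "AE x in ?M. norm((G n x - H i x)\<^sup>2)\<le>(2 * real n)\<^sup>2"for i
proof(rule AE_I2)
 fix x
 have "\<bar>G n x - H i x\<bar>\<le>2 * real n"using clip_le[of "real n""g x"]clip_le[of "real n""h i x"]by(simp add: G_def H_def)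
 hence "\<bar>G n x - H i x\<bar>\<^sup>2\<le>(2 * real n)\<^sup>2"by(rule power_mono)simp
 thus "norm((G n x - H i x)\<^sup>2)\<le>(2 * real n)\<^sup>2"by simp
qed
qed auto
hence "(%i. norm2 ?M(%x. G n x - H i x))---->0"
using tendsto_real_sqrt by(fastforce simp: norm2_def inner2_def power2_eq_square)
then obtain i where i:"norm2 ?M(%x. G n x - H i x) < e / 2"
using order_tendstoD(2)[of _ 0 _ "e/2"]e by(metis(no_types,lifting)eventually_sequentially half_gt_zero order_refl)
have "norm2 ?M(%x. g x - H i x) < e"
using L2.nrm_triangle[OF g HL2[of i]GL2[of n]]n i by simp
thus thesis using that Hc HL2 by blast
qed

lemma measurable_ident_lebesgue_on[measurable]:"(%x. x)\<in>borel_measurable(lebesgue_on S)"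
by(rule borel_measurable_lebesgue_on)simp

lemma AE_lebesgue_on_negligible:
assumes "S\<in>sets lebesgue""negligible N"shows "AE x in lebesgue_on S. x\<notin>N"
using assms by(subst AE_restrict_space_iff)(auto simp: negligible_iff_null_sets intro: AE_not_in eventually_mono)

lemma nn_integral_lebesgue_on_le_lborel:
assumes[measurable]:"f\<in>borel_measurable borel"and S:"S\<in>sets lebesgue"
shows "(\<integral>\<^sup>+x. f x\<partial>lebesgue_on S)\<le>(\<integral>\<^sup>+x. f x\<partial>lborel)"
proof -
have "(\<integral>\<^sup>+x. f x\<partial>lebesgue_on S) = (\<integral>\<^sup>+x. f x * indicator S x\<partial>lebesgue)"
using S by(simp add: nn_integral_restrict_space)
also have "...\<le>(\<integral>\<^sup>+x. f x\<partial>lebesgue)"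
by(intro nn_integral_mono)(auto simp: indicator_def)
also have "... = (\<integral>\<^sup>+x. f x\<partial>lborel)"by(simp add: nn_integral_completion)
finally show ?thesis .
qed

text \<open>The regularization \<open>T th g\<close> is \<open>g\<close>, contracted towards \<open>z\<close> and mollified at a scale for which the
  values of \<open>T \<theta> g\<close> on \<open>closure S\<close> involve only values of \<open>g\<close> on \<open>S\<close>.\<close>

locale regularization =
fixes S ::"'a::euclidean_space set"and z :: 'a and r :: real and etz ::"'a=>real"
assumes open_S:"open S"and convex_S:"convex S"and bounded_S:"bounded S"
and r_pos:"0 < r"and ball_S:"ball z r\<subseteq>S"
and smooth_etz:"smooth etz"and etz_nonneg:"!!x. 0\<le>etz x"
and etz_outside:"!!x. 1/2\<le>norm x==>etz x = 0"and etz_integral:"(\<integral>x. etz x\<partial>lborel) = 1"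
begin

abbreviation M where "M\<equiv>lebesgue_on S"

text \<open>The contraction moves \<open>x\<close> to \<open>z + th (x - z)\<close>; by convexity a
  ball of radius \<open>(1 - th) * r\<close> around that point stays in \<open>S\<close>. The bump
  vanishes from radius \<open>1/2\<close> on, so the kernel occupies only half of this ball.\<close>

definition ep ::"real=>real"where "ep th = (1 - th) * r"

definition kern ::"real=> 'a=> 'a=>real"where
"kern th x w = (1 / ep th) ^ DIM('a) * etz((1 / ep th) *\<^sub>R(z + th *\<^sub>R(x - z) - w))"

definition T ::"real=>('a=>real)=> 'a=>real"where
"T th g x = (\<integral>w. g w * kern th x w\<partial>M)"

lemma S_lmeasurable:"S\<in>lmeasurable"
using bounded_S open_S by(rule lmeasurable_open)

lemma S_sets:"S\<in>sets lebesgue"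
using S_lmeasurable by(simp add: fmeasurableD)

lemma finite_M:"finite_measure M"
by(rule finite_measure_lebesgue_on[OF S_lmeasurable])

lemma etz_test:"test_fun UNIV etz"
by(rule test_funI[OF smooth_etz,of "cball 0(1/2)"])(auto intro: etz_outside)

lemma etz_measurable[measurable]:"etz\<in>borel_measurable borel"
by(rule smooth_measurable[OF smooth_etz])

lemma ep_pos:"th < 1==>0 < ep th"
using r_pos by(simp add: ep_def)

lemma kern_nonneg:"th < 1==>0\<le>kern th x w"
using ep_pos[of th]by(simp add: kern_def etz_nonneg)

text \<open>Written as a rescaled bump in \<open>w\<close>, and next in \<open>x\<close>, the kernel
  has derivatives in the two variables that differ only by the factor \<open>- th\<close> per order.
  This is what carries derivatives from \<open>T th g\<close> to \<open>g\<close>.\<close>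

lemma kern_w:"kern th x = (%w. (1 / ep th) ^ DIM('a) * etz((- (1 / ep th)) *\<^sub>R w + (1 / ep th) *\<^sub>R(z + th *\<^sub>R(x - z))))"
by(auto simp: kern_def fun_eq_iff scaleR_diff_right)

lemma kern_x:"kern th x w = (1 / ep th) ^ DIM('a) * etz((th / ep th) *\<^sub>R x + (1 / ep th) *\<^sub>R(z - th *\<^sub>R z - w))"
proof -
have "(1 / ep th) *\<^sub>R(z + th *\<^sub>R(x - z) - w) = (th / ep th) *\<^sub>R x + (1 / ep th) *\<^sub>R(z - th *\<^sub>R z - w)"
by(simp add: algebra_simps divide_inverse)
thus ?thesis by(simp only: kern_def)
qed

lemma kern_measurable[measurable]:"kern th x\<in>borel_measurable borel""kern th x\<in>borel_measurable M"
proof -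
show "kern th x\<in>borel_measurable borel"unfolding kern_def by measurable
thus "kern th x\<in>borel_measurable M"by(rule borel_measurable_lebesgue_on)
qed

lemma kern_pair_measurable[measurable]:"(%p. kern th(fst p)(snd p))\<in>borel_measurable(M\<Otimes>\<^sub>M M)"
unfolding kern_def by measurable

lemma kern_support:
assumes "0 < th""th < 1""x\<in>closure S""kern th x w\<noteq>0"
shows "w\<in>S""norm(w - (z + th *\<^sub>R(x - z)))\<le>ep th / 2"
proof -
have "norm((1 / ep th) *\<^sub>R(z + th *\<^sub>R(x - z) - w)) < 1/2"
using etz_outside[of "(1 / ep th) *\<^sub>R(z + th *\<^sub>R(x - z) - w)"]assms(4)unfolding kern_def by fastforce
hence "norm(z + th *\<^sub>R(x - z) - w) / ep th < 1/2"
using ep_pos[OF assms(2)]by simp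
hence n:"norm(w - (z + th *\<^sub>R(x - z))) < ep th / 2"
using ep_pos[OF assms(2)]by(subst norm_minus_commute)(simp add: divide_less_eq del: scaleR_diff_right)
thus "norm(w - (z + th *\<^sub>R(x - z)))\<le>ep th / 2"by simp
\<comment> \<open>\<open>w\<close> becomes a convex combination of \<open>x\<close> in the closure
  and the interior point \<open>z + v\<close>, hence an interior point of the convex set.\<close>
define v where "v = (1 / (1 - th)) *\<^sub>R(w - (z + th *\<^sub>R(x - z)))"
have "(1 - th) *\<^sub>R v = w - (z + th *\<^sub>R(x - z))"using assms(2)by(simp add: v_def)
hence v:"w = x - (1 - th) *\<^sub>R(x - (z + v))"by(simp add: algebra_simps)
have "norm v = norm(w - (z + th *\<^sub>R(x - z))) / (1 - th)"using assms(2)by(simp add: v_def)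
also have "...\<le>r / 2"using n assms(2)by(simp add: pos_divide_le_eq ep_def mult.commute)
finally have "norm v < r"using r_pos by simp
hence "z + v\<in>interior S"using ball_S open_S by(auto simp: interior_open dist_norm)
hence "w\<in>interior S"unfolding v
using assms by(intro mem_interior_closure_convex_shrink convex_S)auto
thus "w\<in>S"using interior_subset by blast
qed

lemma kern_test: assumes "0 < th""th < 1""x\<in>closure S"shows "test_fun S(kern th x)"
proof(rule test_funI)
show "smooth(kern th x)"unfolding kern_w by(intro smooth_cmult smooth_affine smooth_etz)
let ?c = "z + th *\<^sub>R(x - z)"
show "compact(cball ?c(ep th / 2))"by simp
show "cball ?c(ep th / 2)\<subseteq>S"
proof
fix w assume w:"w\<in>cball ?c(ep th / 2)"
define v where "v = (1 / (1 - th)) *\<^sub>R(w - ?c)"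
have "(1 - th) *\<^sub>R v = w - ?c"using assms(2)by(simp add: v_def)
hence v:"w = x - (1 - th) *\<^sub>R(x - (z + v))"by(simp add: algebra_simps)
have "norm(w - ?c)\<le>(1 - th) * r / 2"using w by(simp add: dist_norm norm_minus_commute ep_def)
moreover have "norm v = norm(w - ?c) / (1 - th)"using assms(2)by(simp add: v_def)
ultimately have "norm v\<le>r / 2"using assms(2)by(simp add: pos_divide_le_eq mult.commute)
hence "z + v\<in>interior S"using ball_S open_S r_pos by(auto simp: interior_open dist_norm)
hence "w\<in>interior S"unfolding v
 using assms by(intro mem_interior_closure_convex_shrink convex_S)auto
thus "w\<in>S"using interior_subset by blast
qed
fix w assume "w\<notin>cball ?c(ep th / 2)"
thus "kern th x w = 0"using kern_support(2)[OF assms,of w]by(auto simp: dist_norm norm_minus_commute)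
qed

lemma kern_integral_w:
assumes "0 < th""th < 1""x\<in>closure S"shows "(\<integral>w. kern th x w\<partial>M) = 1"
proof -
note e = ep_pos[OF assms(2)]
have "(\<integral>w. kern th x w\<partial>M) = (\<integral>w. kern th x w\<partial>lborel)"
by(intro integral_lebesgue_on_eq_lborel S_sets kern_measurable test_fun_outside[OF kern_test[OF assms]])
also have "... = (1 / ep th) ^ DIM('a) * ((\<integral>x. etz x\<partial>lborel) / \<bar>- (1 / ep th)\<bar> ^ DIM('a))"
unfolding kern_w using e by(simp only: integral_mult_right_zero)(subst lborel_integral_affine,auto)
also have "... = 1"using e by(simp add: etz_integral power_divide)
finally show ?thesis .
qed

lemma kern_integrable_w: assumes "0 < th""th < 1""x\<in>closure S"shows "integrable M(kern th x)""kern th x\<in>L2 M"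
using test_fun_integrable[OF S_sets kern_test[OF assms]]test_fun_L2[OF S_sets kern_test[OF assms]] .

text \<open>Over the whole space the mass in \<open>x\<close> is exactly this value, by an affine
  substitution. Together with mass one in \<open>w\<close> it bounds the operator
  \<open>T th\<close> on \<open>L^2\<close>.\<close>

lemma kern_nn_integral_x:
assumes "0 < th""th < 1"shows "(\<integral>\<^sup>+x. ennreal(kern th x w)\<partial>M)\<le>ennreal(1 / th ^ DIM('a))"
proof -
let ?d = "(1 / ep th) *\<^sub>R(z - th *\<^sub>R z - w)"
let ?k = "%x. (1 / ep th) ^ DIM('a) * etz((th / ep th) *\<^sub>R x + ?d)"
note e = ep_pos[OF assms(2)]
have "test_fun UNIV(%x. etz((th / ep th) *\<^sub>R x + ?d))"
proof(rule test_funI)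
show "smooth(%x. etz((th / ep th) *\<^sub>R x + ?d))"by(intro smooth_affine smooth_etz)
show "compact((%y. (ep th / th) *\<^sub>R(y - ?d)) ` cball 0(1/2))"
 by(intro compact_continuous_image continuous_intros compact_cball)
fix x assume x:"x\<notin>(%y. (ep th / th) *\<^sub>R(y - ?d)) ` cball 0(1/2)"
have "x = (ep th / th) *\<^sub>R(((th / ep th) *\<^sub>R x + ?d) - ?d)"using e assms by simp
hence "(th / ep th) *\<^sub>R x + ?d\<notin>cball 0(1/2)"using x by blast
thus "etz((th / ep th) *\<^sub>R x + ?d) = 0"by(intro etz_outside)simp
qed simp
hence int:"integrable lborel ?k"by(intro integrable_mult_right test_fun_integrable_lborel)
have[measurable]:"?k\<in>borel_measurable borel"by measurable
have "(\<integral>\<^sup>+x. ennreal(kern th x w)\<partial>M) = (\<integral>\<^sup>+x. ennreal(?k x)\<partial>M)"by(simp only: kern_x)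
also have "...\<le>(\<integral>\<^sup>+x. ennreal(?k x)\<partial>lborel)"
by(intro nn_integral_lebesgue_on_le_lborel S_sets)measurable
also have "... = ennreal(\<integral>x. ?k x\<partial>lborel)"
using e by(intro nn_integral_eq_integral int)(auto simp: etz_nonneg)
also have "(\<integral>x. ?k x\<partial>lborel) = (1 / ep th) ^ DIM('a) * ((\<integral>x. etz x\<partial>lborel) / \<bar>th / ep th\<bar> ^ DIM('a))"
using e assms by(simp only: integral_mult_right_zero)(subst lborel_integral_affine,auto)
also have "... = 1 / th ^ DIM('a)"using e assms by(simp add: etz_integral power_divide)
finally show ?thesis .
qed

lemma T_smooth: assumes "integrable M g"shows "smooth(T th g)"
and T_pds:"set bs\<subseteq>Basis==>pds bs(T th g) = (%x. (1 / ep th) ^ DIM('a) * ((th / ep th) ^ length bs *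
 (\<integral>w. g w * pds bs etz((th / ep th) *\<^sub>R x + (1 / ep th) *\<^sub>R(z - th *\<^sub>R z - w))\<partial>M)))"
proof -
let ?p = "%w. (1 / ep th) *\<^sub>R(z - th *\<^sub>R z - w)"
have eq:"T th g = (%x. (1 / ep th) ^ DIM('a) * (\<integral>w. g w * etz((th / ep th) *\<^sub>R x + ?p w)\<partial>M))"
by(rule ext)(simp only: T_def kern_x mult.left_commute[of "g _"]integral_mult_right_zero)
have p:"?p\<in>borel_measurable M"by measurable
note K = integral_kernel_smooth[OF assms p etz_test]
show "smooth(T th g)"unfolding eq by(intro smooth_cmult K)
show "pds bs(T th g) = (%x. (1 / ep th) ^ DIM('a) * ((th / ep th) ^ length bs *
 (\<integral>w. g w * pds bs etz((th / ep th) *\<^sub>R x + ?p w)\<partial>M)))"if "set bs\<subseteq>Basis"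
unfolding eq using that by(simp add: pds_cmult K)
qed

text \<open>For \<open>x\<close> in the closure of \<open>S\<close> the kernel is a test function of
  \<open>w\<close> in \<open>S\<close>, so its derivatives can be moved to \<open>g\<close>. The
  sign of the weak derivative cancels that of the inner substitution, and one factor
  \<open>th\<close> per derivative remains.\<close>

lemma T_pds_weak:
assumes g:"integrable M g"and bs:"set bs\<subseteq>Basis"and th:"0 < th""th < 1"and x:"x\<in>closure S"
and weak:"!!ph. test_fun S ph==>inner2 M g(pds bs ph) = (-1) ^ length bs * inner2 M g' ph"
shows "pds bs(T th g)x = th ^ length bs * T th g' x"
proof -
let ?n = "DIM('a)"and ?e = "1 / ep th"
have "inner2 M g(pds bs(kern th x)) = (-1) ^ length bs * T th g' x"
using weak[OF kern_test[OF th x]]by(simp add: inner2_def T_def)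
moreover have "pds bs(kern th x) = (%w. ?e ^ ?n * ((- ?e) ^ length bs * pds bs etz((- ?e) *\<^sub>R w + ?e *\<^sub>R(z + th *\<^sub>R(x - z)))))"
unfolding kern_w by(subst pds_cmult[OF smooth_affine(1)[OF smooth_etz]bs],subst pds_affine[OF smooth_etz bs],rule refl)
moreover have "(- ?e) *\<^sub>R w + ?e *\<^sub>R(z + th *\<^sub>R(x - z)) = (th / ep th) *\<^sub>R x + ?e *\<^sub>R(z - th *\<^sub>R z - w)"for w
by(simp add: algebra_simps divide_inverse)
ultimately have "?e ^ ?n * ((- ?e) ^ length bs * (\<integral>w. g w * pds bs etz((th / ep th) *\<^sub>R x + ?e *\<^sub>R(z - th *\<^sub>R z - w))\<partial>M))
 = (-1) ^ length bs * T th g' x"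
by(simp only: inner2_def mult.left_commute[of "g _"]integral_mult_right_zero)
moreover have "pds bs(T th g)x = (- th) ^ length bs *
 (?e ^ ?n * ((- ?e) ^ length bs * (\<integral>w. g w * pds bs etz((th / ep th) *\<^sub>R x + ?e *\<^sub>R(z - th *\<^sub>R z - w))\<partial>M)))"
proof -
have "(th / ep th) ^ length bs = (- th) ^ length bs * (- ?e) ^ length bs"
 by(simp add: power_mult_distrib[symmetric]del: power_one_over)
thus ?thesis unfolding T_pds[OF g bs]by(simp add: ac_simps)
qed
ultimately have "pds bs(T th g)x = (- th) ^ length bs * ((-1) ^ length bs * T th g' x)"by(simp only:)
also have "... = th ^ length bs * T th g' x"
by(simp add: mult.assoc[symmetric]power_mult_distrib[symmetric])
finally show ?thesis .
qed

text \<open>Jensen's inequality for the probability density \<open>kern th x\<close>, obtained from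
  the nonnegativity of the variance.\<close>

lemma T_square_le:
assumes "0 < th""th < 1""x\<in>closure S"and g:"g\<in>L2 M"
shows "ennreal((T th g x)\<^sup>2)\<le>(\<integral>\<^sup>+w. ennreal((g w)\<^sup>2 * kern th x w)\<partial>M)"
proof -
note k0 = kern_nonneg[OF assms(2)]
obtain B where B:"0\<le>B""\<forall>w. \<bar>kern th x w\<bar>\<le>B"by(rule test_fun_bounded[OF kern_test[OF assms(1-3)]])
have[measurable]:"g\<in>borel_measurable M"using g by(rule L2_measurable)
have i2:"integrable M(%w. (g w)\<^sup>2 * kern th x w)"
proof(rule Bochner_Integration.integrable_bound)
show "integrable M(%w. (g w)\<^sup>2 * B)"using L2_square_integrable[OF g]by simp
show "AE w in M. norm((g w)\<^sup>2 * kern th x w)\<le>norm((g w)\<^sup>2 * B)"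
 using B by(auto simp: abs_mult intro!: mult_left_mono)
qed measurable
have i1:"integrable M(%w. g w * kern th x w)"
by(intro L2_mult_integrable g kern_integrable_w assms)
let ?t = "T th g x"
have "0\<le>(\<integral>w. (g w - ?t)\<^sup>2 * kern th x w\<partial>M)"
by(intro Bochner_Integration.integral_nonneg)(simp add: k0)
also have "(%w. (g w - ?t)\<^sup>2 * kern th x w) = (%w. (g w)\<^sup>2 * kern th x w - 2 * ?t * (g w * kern th x w) + ?t\<^sup>2 * kern th x w)"
by(auto simp: power2_eq_square algebra_simps)
also have "(\<integral>w. ...w\<partial>M) = (\<integral>w. (g w)\<^sup>2 * kern th x w\<partial>M) - 2 * ?t * ?t + ?t\<^sup>2"
using i1 i2 kern_integrable_w(1)[OF assms(1-3)]kern_integral_w[OF assms(1-3)]by(simp add: T_def)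
finally have "?t\<^sup>2\<le>(\<integral>w. (g w)\<^sup>2 * kern th x w\<partial>M)"by(simp add: power2_eq_square)
hence "ennreal(?t\<^sup>2)\<le>ennreal(\<integral>w. (g w)\<^sup>2 * kern th x w\<partial>M)"by(rule ennreal_leI)
also have "... = (\<integral>\<^sup>+w. ennreal((g w)\<^sup>2 * kern th x w)\<partial>M)"
using i2 by(intro nn_integral_eq_integral[symmetric])(auto simp: k0)
finally show ?thesis .
qed

text \<open>Jensen's inequality in \<open>w\<close>, exchange of the integrals, and the mass bound
  in \<open>x\<close>.\<close>

lemma T_L2:
assumes th:"0 < th""th < 1"and g:"g\<in>L2 M"
shows "T th g\<in>L2 M""norm2 M(T th g)\<le>sqrt(1 / th ^ DIM('a)) * norm2 M g"
proof -
have[measurable]:"g\<in>borel_measurable M"using g by(rule L2_measurable)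
have int:"integrable M g"by(rule L2_integrable[OF finite_M g])
have Tm:"T th g\<in>borel_measurable M"by(rule smooth_measurable_on[OF T_smooth(1)[OF int]])
interpret finite_measure M by(rule finite_M)
interpret P: pair_sigma_finite M M ..
note k0 = kern_nonneg[OF th(2)]
have "(\<integral>\<^sup>+x. ennreal((T th g x)\<^sup>2)\<partial>M)\<le>(\<integral>\<^sup>+x. (\<integral>\<^sup>+w. ennreal((g w)\<^sup>2 * kern th x w)\<partial>M)\<partial>M)"
using T_square_le[OF th _ g]closure_subset by(intro nn_integral_mono)auto
also have "... = (\<integral>\<^sup>+w. (\<integral>\<^sup>+x. ennreal((g w)\<^sup>2 * kern th x w)\<partial>M)\<partial>M)"
proof(rule P.Fubini'[symmetric])
show "(%(x,w). ennreal((g w)\<^sup>2 * kern th x w))\<in>borel_measurable(M\<Otimes>\<^sub>M M)"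
 unfolding case_prod_beta by measurable
qed
also have "... = (\<integral>\<^sup>+w. ennreal((g w)\<^sup>2) * (\<integral>\<^sup>+x. ennreal(kern th x w)\<partial>M)\<partial>M)"
proof(rule nn_integral_cong)
fix w
have[measurable]:"(%x. kern th x w)\<in>borel_measurable M"unfolding kern_def by measurable
show "(\<integral>\<^sup>+x. ennreal((g w)\<^sup>2 * kern th x w)\<partial>M) = ennreal((g w)\<^sup>2) * (\<integral>\<^sup>+x. ennreal(kern th x w)\<partial>M)"
 by(subst nn_integral_cmult[symmetric])(auto simp: ennreal_mult' k0)
qed
also have "...\<le>(\<integral>\<^sup>+w. ennreal((g w)\<^sup>2) * ennreal(1 / th ^ DIM('a))\<partial>M)"
by(intro nn_integral_mono mult_left_mono kern_nn_integral_x th)auto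
also have "... = ennreal((norm2 M g)\<^sup>2) * ennreal(1 / th ^ DIM('a))"
by(subst nn_integral_multc)(auto simp: nn_integral_norm2[OF g])
also have "... = ennreal((sqrt(1 / th ^ DIM('a)) * norm2 M g)\<^sup>2)"
using th by(subst ennreal_mult[symmetric])(auto simp: power_mult_distrib mult.commute)
finally have *:"(\<integral>\<^sup>+x. ennreal((T th g x)\<^sup>2)\<partial>M)\<le>ennreal((sqrt(1 / th ^ DIM('a)) * norm2 M g)\<^sup>2)" .
show "T th g\<in>L2 M""norm2 M(T th g)\<le>sqrt(1 / th ^ DIM('a)) * norm2 M g"
using L2I_nn_integral[OF Tm *]th by simp_all
qed

text \<open>The parameters tend to 1 from below and never drop under \<open>1/2\<close>, so the
  operator bound in \<open>T_L2\<close> is uniform along the sequence.\<close>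

definition ths ::"nat=>real"where "ths j = 1 - 1 / real(j + 2)"

lemma ths:"0 < ths j""ths j < 1""1/2\<le>ths j"
by(auto simp: ths_def field_simps)

lemma ths_tendsto:"ths---->1"
proof -
have "(%j. 1 - 1 / real(j + 2))---->1 - 0"
by(intro tendsto_intros LIMSEQ_ignore_initial_segment[OF lim_1_over_n])
thus ?thesis by(simp add: ths_def[abs_def])
qed

lemma T_tendsto_continuous:
assumes f:"continuous_on UNIV f"and fL2:"f\<in>L2 M"and e:"0 < e"
shows "\<forall>\<^sub>F j in sequentially. norm2 M(%x. T(ths j)f x - f x)\<le>e * sqrt(measure M(space M))"
proof -
have "uniformly_continuous_on(closure S)f"
using bounded_S by(intro compact_uniformly_continuous continuous_on_subset[OF f])(auto simp: compact_closure)
then obtain d where d:"d > 0""!!x y. x\<in>closure S==>y\<in>closure S==>dist y x < d==>dist(f y)(f x) < e"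
unfolding uniformly_continuous_on_def using e by metis
obtain D where D:"!!x. x\<in>S==>norm x\<le>D"using bounded_S by(auto simp: bounded_iff)
have "(%j. (1 - ths j) * (norm z + D + r))---->(1 - 1) * (norm z + D + r)"
by(intro tendsto_intros ths_tendsto)
hence "\<forall>\<^sub>F j in sequentially. (1 - ths j) * (norm z + D + r) < d"
using d(1)by(intro order_tendstoD)auto
thus ?thesis
proof eventually_elim
case(elim j)
note th = ths(1,2)[of j]
have int:"integrable M f"by(rule L2_integrable[OF finite_M fL2])
have pt:"\<bar>T(ths j)f x - f x\<bar>\<le>e"if x:"x\<in>S"for x
proof -
 have xc:"x\<in>closure S"using x closure_subset by blast
 let ?k = "kern(ths j)x"
 have i1:"integrable M(%w. f w * ?k w)"by(intro L2_mult_integrable fL2 kern_integrable_w th xc)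
 have i2:"integrable M(%w. f x * ?k w)"using kern_integrable_w(1)[OF th xc]by simp
 have "\<bar>(\<integral>w. f w * ?k w - f x * ?k w\<partial>M)\<bar>\<le>(\<integral>w. e * ?k w\<partial>M)"
 proof(rule integral_abs_bound[THEN order_trans],rule integral_mono)
 show "integrable M(%w. \<bar>f w * ?k w - f x * ?k w\<bar>)"using i1 i2 by auto
 show "integrable M(%w. e * ?k w)"using kern_integrable_w(1)[OF th xc]by simp
 fix w
 show "\<bar>f w * ?k w - f x * ?k w\<bar>\<le>e * ?k w"
 proof(cases "?k w = 0")
  case False
  note w = kern_support[OF th xc False]
  have "norm(w - x)\<le>norm(w - (z + ths j *\<^sub>R(x - z))) + norm((1 - ths j) *\<^sub>R(z - x))"
  using norm_triangle_ineq[of "w - (z + ths j *\<^sub>R(x - z))""(1 - ths j) *\<^sub>R(z - x)"]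
  by(simp add: algebra_simps)
  also have "...\<le>(1 - ths j) * r / 2 + (1 - ths j) * (norm z + D)"
  proof(rule add_mono)
  have "norm(z - x)\<le>norm z + D"using norm_triangle_ineq4[of z x]D[OF x]by linarith
  thus "norm((1 - ths j) *\<^sub>R(z - x))\<le>(1 - ths j) * (norm z + D)"
  using th by(auto intro!: mult_left_mono)
  qed(use w(2)in "simp add: ep_def")
  also have "...\<le>(1 - ths j) * (norm z + D + r)"
  using th r_pos mult_nonneg_nonneg[of "1 - ths j"r]by(simp add: distrib_left)
  finally have "dist w x < d"using elim by(simp add: dist_norm)
  hence "\<bar>f w - f x\<bar> < e"using d(2)[OF xc,of w]w(1)closure_subset[of S]by(auto simp: dist_norm)
  thus ?thesis using kern_nonneg[OF th(2),of x w]
  by(simp add: left_diff_distrib[symmetric]abs_mult mult_right_mono)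
 qed simp
 qed
 thus ?thesis using i1 i2 kern_integral_w[OF th xc]by(simp add: T_def)
qed
have m:"(%x. T(ths j)f x - f x)\<in>borel_measurable M"
 using L2_measurable[OF fL2]smooth_measurable_on[OF T_smooth(1)[OF int]]by measurable
have "AE x in M. \<bar>T(ths j)f x - f x\<bar>\<le>e"
 using AE_space by eventually_elim(use pt in auto)
thus ?case using norm2_bounded[OF finite_M m,of e]e by simp
qed
qed

lemma T_diff: assumes "0 < th""th < 1""x\<in>closure S""f\<in>L2 M""g\<in>L2 M"
shows "T th(%x. f x - g x)x = T th f x - T th g x"
using L2.diff_left[OF assms(4,5)kern_integrable_w(2)[OF assms(1-3)]]by(simp add: T_def inner2_def)

text \<open>The operators are uniformly bounded on \<open>L^2\<close> and converge on the dense set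
  of continuous functions, where uniform continuity on the compact closure applies.\<close>

theorem T_tendsto:
assumes g:"g\<in>L2 M"
shows "(%j. norm2 M(%x. T(ths j)g x - g x))---->0"
proof(rule order_tendstoI)
fix e :: real assume e:"0 < e"
define c where "c = sqrt(2 ^ DIM('a)) + 2 + sqrt(measure M(space M))"
have c:"c > 0"unfolding c_def by(intro add_pos_nonneg add_nonneg_pos)auto
define e' where "e' = e / (2 * c)"
have e':"0 < e'"using e c by(simp add: e'_def)
obtain f where f:"continuous_on UNIV f""f\<in>L2 M""norm2 M(%x. g x - f x) < e'"
using L2_dense_continuous[OF S_lmeasurable g e']by blast
have gf:"(%x. g x - f x)\<in>L2 M"by(intro L2.diff_mem g f)
from T_tendsto_continuous[OF f(1,2)e']
show "\<forall>\<^sub>F j in sequentially. norm2 M(%x. T(ths j)g x - g x) < e"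
proof eventually_elim
case(elim j)
note th = ths[of j]
have Tg:"T(ths j)g\<in>L2 M"and Tf:"T(ths j)f\<in>L2 M"and Tgf:"T(ths j)(%x. g x - f x)\<in>L2 M"
 by(intro T_L2 th g f gf)+
have "norm2 M(%x. T(ths j)g x - T(ths j)f x) = norm2 M(T(ths j)(%x. g x - f x))"
proof(rule norm2_cong_AE)
 show "AE x in M. T(ths j)g x - T(ths j)f x = T(ths j)(%x. g x - f x)x"
 using AE_space by eventually_elim(use T_diff[OF th(1,2)_ g f(2)]closure_subset[of S]in auto)
qed(use L2_measurable[OF Tg]L2_measurable[OF Tf]L2_measurable[OF Tgf]in auto)
also have "...\<le>sqrt(1 / (ths j) ^ DIM('a)) * norm2 M(%x. g x - f x)"by(rule T_L2[OF th(1,2)gf])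
also have "...\<le>sqrt(2 ^ DIM('a)) * e'"
proof(rule mult_mono)
 have "(1/2) ^ DIM('a)\<le>(ths j) ^ DIM('a)"using th by(intro power_mono)auto
 thus "sqrt(1 / (ths j) ^ DIM('a))\<le>sqrt(2 ^ DIM('a))"
 using th by(simp add: field_simps power_divide)
qed(use f(3)in auto)
finally have 1:"norm2 M(%x. T(ths j)g x - T(ths j)f x)\<le>sqrt(2 ^ DIM('a)) * e'" .
have "norm2 M(%x. T(ths j)g x - g x)\<le>norm2 M(%x. T(ths j)g x - T(ths j)f x) + norm2 M(%x. T(ths j)f x - g x)"
 by(rule L2.nrm_triangle[OF Tg g Tf])
also have "norm2 M(%x. T(ths j)f x - g x)\<le>norm2 M(%x. T(ths j)f x - f x) + norm2 M(%x. f x - g x)"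
 by(rule L2.nrm_triangle[OF Tf g f(2)])
also have "norm2 M(%x. f x - g x) = norm2 M(%x. g x - f x)"by(rule L2.nrm_commute[OF f(2)g])
finally have "norm2 M(%x. T(ths j)g x - g x)\<le>sqrt(2 ^ DIM('a)) * e' + (e' * sqrt(measure M(space M)) + e')"
 using 1 elim f(3)by simp
also have "... < c * e' * 2"using e' c by(simp add: c_def algebra_simps)
 (smt(verit)mult_nonneg_nonneg real_sqrt_ge_zero measure_nonneg zero_le_power)
also have "... = e"using c by(simp add: e'_def)
finally show ?case .
qed
qed(auto intro!: always_eventually intro: less_le_trans)

end

lemma regularization_exists:
fixes S ::"'a::euclidean_space set"
assumes "open S""convex S""bounded S""S\<noteq>{}"
obtains z r and etz ::"'a=>real"where "regularization S z r etz"
proof -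
obtain z where "z\<in>S"using assms by blast
then obtain r where "0 < r""ball z r\<subseteq>S"using assms(1)by(meson openE)
moreover obtain etz ::"'a=>real"where "smooth etz""!!x. 0\<le>etz x""!!x. 1/2\<le>norm x==>etz x = 0"
"(\<integral>x. etz x\<partial>lborel) = 1"using mollifier_exists by blast
ultimately show thesis using assms by(intro that[of z r etz])unfold_locales
qed

section \<open>Restriction to subsets and functions orthogonal to all test functions\<close>

lemma lebesgue_on_subset:
fixes f ::"'a::euclidean_space=>real"
assumes S:"S\<in>sets lebesgue"and B:"B\<in>sets lebesgue""B\<subseteq>S"and f:"!!x. x\<in>S - B==>f x = 0"
shows "integral\<^sup>L(lebesgue_on S)f = integral\<^sup>L(lebesgue_on B)f"
proof -
have "(%x. indicator S x *\<^sub>R f x) = (%x. indicator B x *\<^sub>R f x)"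
using B f by(auto simp: indicator_def fun_eq_iff)
thus ?thesis using S B by(simp add: integral_restrict_space)
qed

lemma borel_measurable_lebesgue_on_mono:
"f\<in>borel_measurable(lebesgue_on S)==>B\<subseteq>S==>f\<in>borel_measurable(lebesgue_on B)"
by(rule measurable_restrict_mono)

lemma L2_lebesgue_on_mono:
assumes S:"S\<in>sets lebesgue"and B:"B\<in>sets lebesgue""B\<subseteq>S"and f:"f\<in>L2(lebesgue_on S)"
shows "f\<in>L2(lebesgue_on B)"
proof -
have "integrable lebesgue(%x. indicator S x *\<^sub>R(f x)\<^sup>2)"
using f S by(simp add: L2_def integrable_restrict_space)
from integrable_mult_indicator[OF B(1)this]
have "integrable lebesgue(%x. indicator B x *\<^sub>R indicator S x *\<^sub>R(f x)\<^sup>2)" .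
also have "(%x. indicator B x *\<^sub>R indicator S x *\<^sub>R(f x)\<^sup>2) = (%x. indicator B x *\<^sub>R(f x)\<^sup>2)"
using B(2)by(auto simp: indicator_def fun_eq_iff)
finally show ?thesis using f B borel_measurable_lebesgue_on_mono
by(auto simp: L2_def integrable_restrict_space)
qed

text \<open>The fundamental lemma of the calculus of variations, on each ball contained in the open set.\<close>
lemma test_fun_separating:
fixes S ::"'a::euclidean_space set"
assumes S:"open S"and g:"g\<in>L2(lebesgue_on S)"
and 0:"!!ph. test_fun S ph==>inner2(lebesgue_on S)g ph = 0"
shows "AE x in lebesgue_on S. g x = 0"
proof -
have ball0:"AE x in lebesgue. x\<in>ball a r-->g x = 0"if B:"0 < r""ball a r\<subseteq>S"for a r
proof -
obtain z q etz where "regularization(ball a r)z q etz"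
 by(rule regularization_exists[of "ball a r"])(use B in auto)
then interpret regularization "ball a r"z q etz .
have Ss:"S\<in>sets lebesgue"using S by(simp add: lmeasurable_iff_integrable borel_open)
have gB:"g\<in>L2 M"by(rule L2_lebesgue_on_mono[OF Ss S_sets B(2)g])
\<comment> \<open>The kernel is a test function in the ball, so every regularization of
  \<open>g\<close> vanishes there and hence so does the limit.\<close>
have T0:"T(ths j)g x = 0"if "x\<in>ball a r"for j x
proof -
 have t:"test_fun(ball a r)(kern(ths j)x)"
 using closure_subset that by(intro kern_test ths)blast
 have "inner2(lebesgue_on S)g(kern(ths j)x) = 0"by(rule 0)(rule test_fun_mono[OF t B(2)])
 moreover have "inner2(lebesgue_on S)g(kern(ths j)x) = T(ths j)g x"
 unfolding inner2_def T_def by(rule lebesgue_on_subset[OF Ss S_sets B(2)])(simp add: test_fun_outside[OF t])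
 ultimately show ?thesis by simp
qed
have "norm2 M(%x. T(ths j)g x - g x) = norm2 M g"for j
 unfolding norm2_def inner2_def by(intro arg_cong[where f = sqrt]Bochner_Integration.integral_cong)(auto simp: T0)
hence "norm2 M g = 0"using T_tendsto[OF gB]by(simp add: LIMSEQ_const_iff)
hence "AE x in M. g x = 0"using norm2_eq_0_iff[OF gB]by simp
thus ?thesis using S_sets by(simp add: AE_restrict_space_iff)
qed
\<comment> \<open>Only countably many balls may be used, so that the union of the exceptional sets
  is null.\<close>
obtain F where F:"F\<subseteq>{ball a r |a r. 0 < r&ball a r\<subseteq>S}""countable F"
 "\<Union>F = \<Union>{ball a r |a r. 0 < r&ball a r\<subseteq>S}"
by(rule Lindelof[of "{ball a r |a r. 0 < r&ball a r\<subseteq>S}"])auto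
have "S\<subseteq>\<Union>F"
proof
fix x assume x:"x\<in>S"
then obtain r where "0 < r""ball x r\<subseteq>S"using S by(meson openE)
thus "x\<in>\<Union>F"unfolding F(3)by(intro UnionI[of "ball x r"])auto
qed
moreover have "AE x in lebesgue. \<forall>B\<in>F. x\<in>B-->g x = 0"
proof(subst AE_ball_countable[OF F(2)],rule ballI)
fix B assume "B\<in>F"
then obtain a r where "B = ball a r""0 < r""ball a r\<subseteq>S"using F(1)by blast
thus "AE x in lebesgue. x\<in>B-->g x = 0"using ball0 by simp
qed
ultimately have "AE x in lebesgue. x\<in>S-->g x = 0"by(auto elim!: eventually_mono)
thus ?thesis using S by(subst AE_restrict_space_iff)(auto simp: borel_open)
qed

section \<open>Weak derivatives and Sobolev spaces in the plane\<close>

lemma finite_dirs[simp]:"finite(dirs m)"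
using finite_lists_length_eq[of Basis m]by(simp add: dirs_def conj_commute)

lemma dirs_0[simp]:"dirs 0 = {[]}"
by(auto simp: dirs_def)

lemma dirsD:"bs\<in>dirs m==>set bs\<subseteq>Basis""bs\<in>dirs m==>length bs = m"
by(auto simp: dirs_def)

lemma open_sets_lebesgue:"open S==>S\<in>sets lebesgue"
by(simp add: borel_open)

definition has_wderiv ::"pt set=>pt list=>fld=>bool"where
"has_wderiv S bs f\<longleftrightarrow>(\<exists>g\<in>L2S S. weak_deriv S bs f g)"

text \<open>Polarization of the squared \<open>Hnorm\<close> at integer order, where the Slobodeckij
  part is zero.\<close>

definition Hinner ::"nat=>pt set=>fld=>fld=>real"where
"Hinner m S v w = (\<Sum>j\<le>m. \<Sum>bs\<in>dirs j. ip S(wderiv S bs v)(wderiv S bs w))"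

lemma Hs_nat:"Hs S(real m) = {v\<in>L2S S. \<forall>j\<le>m. \<forall>bs\<in>dirs j. has_wderiv S bs v}"
by(auto simp: Hs_def has_wderiv_def slob_def)

lemma L2norm_square:"(L2norm S v)\<^sup>2 = ip S v v"
by(simp add: L2norm_def ip_def)

lemma L2norm_nonneg[simp]:"0\<le>L2norm S v"
by(simp add: L2norm_def ip_def)

lemma Hnorm_nat:"Hnorm S(real m)v = sqrt(Hinner m S v v)"
by(simp add: Hnorm_def Hinner_def slob_def L2norm_square)

lemma HsD:
assumes "v\<in>Hs S s""j\<le>nat\<lfloor>s\<rfloor>""bs\<in>dirs j"
shows "has_wderiv S bs v"
using assms by(auto simp: Hs_def has_wderiv_def)

lemma Hs_L2:"v\<in>Hs S s==>v\<in>L2S S"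
by(simp add: Hs_def)

lemma Hnorm_nonneg[simp]:"0\<le>Hnorm S s v"
by(simp add: Hnorm_def sum_nonneg)

lemma L2norm_wderiv_le_Hnorm:
assumes "j\<le>nat\<lfloor>s\<rfloor>""bs\<in>dirs j"
shows "L2norm S(wderiv S bs v)\<le>Hnorm S s v"
proof -
have "(L2norm S(wderiv S bs v))\<^sup>2\<le>(\<Sum>bs\<in>dirs j. (L2norm S(wderiv S bs v))\<^sup>2)"
using assms by(intro member_le_sum)auto
also have "...\<le>(\<Sum>j\<le>nat\<lfloor>s\<rfloor>. \<Sum>bs\<in>dirs j. (L2norm S(wderiv S bs v))\<^sup>2)"
using assms by(intro member_le_sum[of j _ "%j. \<Sum>bs\<in>dirs j. (L2norm S(wderiv S bs v))\<^sup>2"])(auto intro: sum_nonneg)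
also have "...\<le>(Hnorm S s v)\<^sup>2"by(simp add: Hnorm_def sum_nonneg)
finally show ?thesis by(rule power2_le_imp_le)simp
qed

lemma H2semi_eq:"H2semi S v = sqrt(a_form S v v)"
by(simp add: H2semi_def a_form_def L2norm_square)

lemma nrm_inner2:"semidef_form.nrm(inner2 M) = norm2 M"
by(simp add: fun_eq_iff semidef_form.nrm_def[OF L2.semidef_form_axioms]norm2_def)

locale open_plane =
fixes S ::"pt set"
assumes open_S:"open S"
begin

sublocale L2: semidef_form "L2S S""ip S"
rewrites "semidef_form.nrm(ip S) = L2norm S"
unfolding ip_eq_inner2 L2norm_eq_norm2 by(rule L2.semidef_form_axioms,rule nrm_inner2)

lemma S_sets:"S\<in>sets lebesgue"
by(rule open_sets_lebesgue[OF open_S])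

lemma test_L2:"test_fun S ph==>ph\<in>L2S S"
by(rule test_fun_L2[OF S_sets])

lemma test_pds_L2:"test_fun S ph==>set bs\<subseteq>Basis==>pds bs ph\<in>L2S S"
by(intro test_L2 test_fun_pds)

lemma ae_eq_L2:"f\<in>L2S S==>g\<in>L2S S==>ae_eq S f g\<longleftrightarrow>L2norm S(%x. f x - g x) = 0"
unfolding ae_eq_def L2norm_eq_norm2 using norm2_eq_0_iff[OF L2.diff_mem[of f g]]by simp

lemma ip_cong:"ae_eq S f f' ==>ae_eq S g g' ==>f\<in>L2S S==>f' \<in>L2S S==>g\<in>L2S S==>g' \<in>L2S S==>
ip S f g = ip S f' g'"
unfolding ip_eq_inner2 ae_eq_def by(intro inner2_cong_AE L2_measurable)

lemma L2norm_cong:"ae_eq S f f' ==>f\<in>L2S S==>f' \<in>L2S S==>L2norm S f = L2norm S f'"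
unfolding L2norm_eq_norm2 ae_eq_def by(intro norm2_cong_AE L2_measurable)

lemma ae_eq_refl[simp]:"ae_eq S f f"by(simp add: ae_eq_def)

lemma ae_eq_sym:"ae_eq S f g==>ae_eq S g f"
unfolding ae_eq_def by(erule eventually_mono)simp

lemma ae_eq_trans: assumes "ae_eq S f g""ae_eq S g k"shows "ae_eq S f k"
using assms unfolding ae_eq_def by eventually_elim simp

lemma ae_eq_lin: assumes "ae_eq S f f'""ae_eq S g g'"shows "ae_eq S(%x. c * f x + g x)(%x. c * f' x + g' x)"
using assms unfolding ae_eq_def by eventually_elim simp

text \<open>The function that \<open>wderiv\<close> selects is thereby determined up to a null set,
  which is all that inner products and norms see. Identities between weak derivatives are stated
  with \<open>ae_eq\<close> throughout.\<close>

lemma weak_deriv_unique: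
assumes "g\<in>L2S S""g' \<in>L2S S""weak_deriv S bs f g""weak_deriv S bs f g'"
shows "ae_eq S g g'"
proof -
have "AE x in lebesgue_on S. g x - g' x = 0"
proof(rule test_fun_separating[OF open_S])
show "(%x. g x - g' x)\<in>L2S S"by(intro L2.diff_mem assms)
fix ph assume t:"test_fun S ph"
hence "(-1) ^ length bs * ip S g ph = (-1) ^ length bs * ip S g' ph"
 using assms(3,4)by(metis weak_deriv_def)
thus "inner2(lebesgue_on S)(%x. g x - g' x)ph = 0"
 using L2.diff_left[OF assms(1,2)test_L2[OF t]]by(simp add: ip_eq_inner2)
qed
thus ?thesis unfolding ae_eq_def by eventually_elim simp
qed

lemma wderiv: assumes "has_wderiv S bs f"shows "wderiv S bs f\<in>L2S S""weak_deriv S bs f(wderiv S bs f)"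
proof -
have "\<exists>g. g\<in>L2S S&weak_deriv S bs f g"using assms by(auto simp: has_wderiv_def)
from someI_ex[OF this]show "wderiv S bs f\<in>L2S S""weak_deriv S bs f(wderiv S bs f)"
by(auto simp: wderiv_def)
qed

lemma wderiv_eq:
assumes "g\<in>L2S S""weak_deriv S bs f g"
shows "has_wderiv S bs f""ae_eq S(wderiv S bs f)g"
proof -
show h:"has_wderiv S bs f"using assms by(auto simp: has_wderiv_def)
show "ae_eq S(wderiv S bs f)g"by(rule weak_deriv_unique[OF wderiv(1)[OF h]assms(1)wderiv(2)[OF h]assms(2)])
qed

lemma weak_deriv_cong:
assumes "ae_eq S f f'""f\<in>borel_measurable(lebesgue_on S)""f' \<in>borel_measurable(lebesgue_on S)""set bs\<subseteq>Basis"
shows "weak_deriv S bs f g\<longleftrightarrow>weak_deriv S bs f' g"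
proof -
have "ip S f(pds bs ph) = ip S f' (pds bs ph)"if "test_fun S ph"for ph
unfolding ip_eq_inner2 using assms that
by(intro inner2_cong_AE)(auto simp: ae_eq_def intro!: smooth_measurable_on smooth_pds dest: test_fun_smooth)
thus ?thesis by(simp add: weak_deriv_def)
qed

text \<open>The two derivatives are equal as functions and not only almost everywhere, because the
  predicates from which \<open>SOME\<close> selects coincide.\<close>

lemma wderiv_cong:
assumes "ae_eq S f f'""f\<in>borel_measurable(lebesgue_on S)""f' \<in>borel_measurable(lebesgue_on S)""set bs\<subseteq>Basis"
shows "wderiv S bs f = wderiv S bs f'""has_wderiv S bs f = has_wderiv S bs f'"
using weak_deriv_cong[OF assms]by(simp_all add: wderiv_def has_wderiv_def)

lemma weak_deriv_lin:
assumes "f\<in>L2S S""f' \<in>L2S S""g\<in>L2S S""g' \<in>L2S S""weak_deriv S bs f g""weak_deriv S bs f' g'""set bs\<subseteq>Basis"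
shows "weak_deriv S bs(%x. c * f x + f' x)(%x. c * g x + g' x)"
unfolding weak_deriv_def
proof(intro allI impI)
fix ph assume t:"test_fun S ph"
show "ip S(%x. c * f x + f' x)(pds bs ph) = (-1) ^ length bs * ip S(%x. c * g x + g' x)ph"
using L2.lin_left[OF assms(1,2)test_pds_L2[OF t assms(7)],of c]
 L2.lin_left[OF assms(3,4)test_L2[OF t],of c]assms(5,6)t
by(simp add: weak_deriv_def algebra_simps)
qed

lemma wderiv_lin:
assumes "f\<in>L2S S""f' \<in>L2S S""has_wderiv S bs f""has_wderiv S bs f'""set bs\<subseteq>Basis"
shows "has_wderiv S bs(%x. c * f x + f' x)"
"ae_eq S(wderiv S bs(%x. c * f x + f' x))(%x. c * wderiv S bs f x + wderiv S bs f' x)"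
using wderiv_eq[OF L2.lin_mem[of "wderiv S bs f""wderiv S bs f'"c]weak_deriv_lin[of f f' "wderiv S bs f""wderiv S bs f'"bs c]]
wderiv[OF assms(3)]wderiv[OF assms(4)]assms by blast+

lemma weak_deriv_mono: assumes "weak_deriv S bs f g""open B""B\<subseteq>S""set bs\<subseteq>Basis"shows "weak_deriv B bs f g"
unfolding weak_deriv_def
proof(intro allI impI)
fix ph assume t:"test_fun B ph"
have B:"B\<in>sets lebesgue"using assms(2)by(rule open_sets_lebesgue)
have "ip S f(pds bs ph) = ip B f(pds bs ph)""ip S g ph = ip B g ph"
unfolding ip_def using lebesgue_on_subset[OF S_sets B assms(3)]test_fun_outside[OF t]
 test_fun_outside[OF test_fun_pds[OF t assms(4)]]by auto
thus "ip B f(pds bs ph) = (-1) ^ length bs * ip B g ph"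
using assms(1)test_fun_mono[OF t assms(3)]by(simp add: weak_deriv_def)
qed

lemma weak_deriv_smooth:"smooth f==>set bs\<subseteq>Basis==>weak_deriv S bs f(pds bs f)"
using integration_by_parts_pds[OF S_sets]by(simp add: weak_deriv_def ip_eq_inner2)

lemma weak_deriv_closed:
assumes "!!n. f n\<in>L2S S""!!n. g n\<in>L2S S""F\<in>L2S S""G\<in>L2S S""set bs\<subseteq>Basis"
"(%n. L2norm S(%x. f n x - F x))---->0""(%n. L2norm S(%x. g n x - G x))---->0"
"!!n. weak_deriv S bs(f n)(g n)"
shows "weak_deriv S bs F G"
unfolding weak_deriv_def
proof(intro allI impI)
fix ph assume t:"test_fun S ph"
have "(%n. ip S(f n)(pds bs ph))---->ip S F(pds bs ph)"
by(rule L2.tendsto_form[OF assms(1,3)test_pds_L2[OF t assms(5)]assms(6)])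
moreover have "(%n. (-1) ^ length bs * ip S(g n)ph)---->(-1) ^ length bs * ip S G ph"
by(intro tendsto_intros L2.tendsto_form[OF assms(2,4)test_L2[OF t]assms(7)])
moreover have "ip S(f n)(pds bs ph) = (-1) ^ length bs * ip S(g n)ph"for n
using assms(8)t by(simp add: weak_deriv_def)
ultimately show "ip S F(pds bs ph) = (-1) ^ length bs * ip S G ph"
using LIMSEQ_unique by(simp add: LIMSEQ_unique)
qed

lemma weak_deriv_Nil:"weak_deriv S[]f f"
by(simp add: weak_deriv_def)

lemma wderiv_Nil: assumes "f\<in>L2S S"shows "has_wderiv S[]f""ae_eq S(wderiv S[]f)f"
using wderiv_eq[OF assms weak_deriv_Nil] .

text \<open>Testing the first derivative with \<open>pd c ph\<close> produces the second derivative
  of \<open>v\<close>. This places first derivatives of \<open>H^2\<close> functions in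
  \<open>H^1\<close>, where they have traces.\<close>

lemma weak_deriv_step:
assumes "weak_deriv S[b]v vb""weak_deriv S[b,c]v vbc""c\<in>Basis"
shows "weak_deriv S[c]vb vbc"
unfolding weak_deriv_def
proof(intro allI impI)
fix ph assume t:"test_fun S ph"
have "ip S v(pds[b] (pd c ph)) = - ip S vb(pd c ph)"
using assms(1)test_fun_pd[OF t assms(3)]by(simp add: weak_deriv_def)
moreover have "ip S v(pds[b,c]ph) = ip S vbc ph"
using assms(2)t by(simp add: weak_deriv_def)
ultimately show "ip S vb(pds[c]ph) = (-1) ^ length[c] * ip S vbc ph"by simp
qed

section \<open>Sobolev spaces of integer order as semidefinite forms\<close>

lemma semidef_wderiv_sum:
assumes "V\<subseteq>L2S S""!!bs v. bs\<in>D==>v\<in>V==>has_wderiv S bs v""!!bs. bs\<in>D==>set bs\<subseteq>Basis"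
and z:"(%x. 0)\<in>V"and l:"!!v w c. v\<in>V==>w\<in>V==>(%x. c * v x + w x)\<in>V"
shows "semidef_form V(%v w. \<Sum>bs\<in>D. ip S(wderiv S bs v)(wderiv S bs w))"
proof
note wd = wderiv[OF assms(2)]
fix v w u c assume v:"v\<in>V""w\<in>V""u\<in>V"
have "ip S(wderiv S bs(%x. c * v x + w x))(wderiv S bs u) =
 c * ip S(wderiv S bs v)(wderiv S bs u) + ip S(wderiv S bs w)(wderiv S bs u)"if bs:"bs\<in>D"for bs
proof -
have "ip S(wderiv S bs(%x. c * v x + w x))(wderiv S bs u) = ip S(%x. c * wderiv S bs v x + wderiv S bs w x)(wderiv S bs u)"
 using assms v bs wd l by(intro ip_cong wderiv_lin L2.lin_mem)auto
also have "... = c * ip S(wderiv S bs v)(wderiv S bs u) + ip S(wderiv S bs w)(wderiv S bs u)"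
 using v bs wd by(intro L2.lin_left)
finally show ?thesis .
qed
thus "(\<Sum>bs\<in>D. ip S(wderiv S bs(%x. c * v x + w x))(wderiv S bs u)) =
c * (\<Sum>bs\<in>D. ip S(wderiv S bs v)(wderiv S bs u)) + (\<Sum>bs\<in>D. ip S(wderiv S bs w)(wderiv S bs u))"
by(simp add: sum.distrib sum_distrib_left)
next
fix v w assume "v\<in>V""w\<in>V"
show "(\<Sum>bs\<in>D. ip S(wderiv S bs v)(wderiv S bs w)) = (\<Sum>bs\<in>D. ip S(wderiv S bs w)(wderiv S bs v))"
by(simp add: ip_def mult.commute)
qed(auto simp: z l ip_def intro!: sum_nonneg)

lemma Hs_nat_zero:"(%x. 0)\<in>Hs S(real m)"
unfolding Hs_nat has_wderiv_def using L2.zero_mem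
by(auto intro!: bexI[of _ "%x. 0"]simp: weak_deriv_def ip_def)

lemma Hs_nat_lin:"v\<in>Hs S(real m)==>w\<in>Hs S(real m)==>(%x. c * v x + w x)\<in>Hs S(real m)"
unfolding Hs_nat by(auto intro!: L2.lin_mem wderiv_lin(1)dest: dirsD)

lemma Hs_mem_wderiv:"v\<in>Hs S(real m)==>j\<le>m==>bs\<in>dirs j==>has_wderiv S bs v"
by(auto simp: Hs_nat)

lemma semidef_Hinner:"semidef_form(Hs S(real m))(Hinner m S)"
proof -
have "Hinner m S = (%v w. \<Sum>bs\<in>(\<Union>j\<le>m. dirs j). ip S(wderiv S bs v)(wderiv S bs w))"
unfolding Hinner_def by(intro ext,subst sum.UNION_disjoint)(auto dest: dirsD(2))
moreover have "semidef_form(Hs S(real m))..."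
by(rule semidef_wderiv_sum)(auto intro: Hs_L2 Hs_mem_wderiv Hs_nat_zero Hs_nat_lin dest: dirsD)
ultimately show ?thesis by simp
qed

lemma semidef_a_form:"semidef_form(Hs S 2)(a_form S)"
proof -
have "semidef_form(Hs S(real 2))(%v w. \<Sum>bs\<in>dirs 2. ip S(wderiv S bs v)(wderiv S bs w))"
by(rule semidef_wderiv_sum)(use Hs_nat_zero[of 2]Hs_nat_lin[of _ 2]in
 \<open>auto intro: Hs_L2 Hs_mem_wderiv[of _ 2 2,simplified]dest: dirsD\<close>)
thus ?thesis by(simp add: a_form_def[abs_def])
qed

sublocale H1: semidef_form "Hs S 1""Hinner 1 S"rewrites "semidef_form.nrm(Hinner 1 S) = Hnorm S 1"
proof -
show *:"semidef_form(Hs S 1)(Hinner 1 S)"using semidef_Hinner[of 1]by simp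
show "semidef_form.nrm(Hinner 1 S) = Hnorm S 1"
using Hnorm_nat[of S 1]by(simp only: fun_eq_iff semidef_form.nrm_def[OF *]of_nat_1 simp_thms)
qed

sublocale H2: semidef_form "Hs S 2""Hinner 2 S"rewrites "semidef_form.nrm(Hinner 2 S) = Hnorm S 2"
proof -
show *:"semidef_form(Hs S 2)(Hinner 2 S)"using semidef_Hinner[of 2]by simp
show "semidef_form.nrm(Hinner 2 S) = Hnorm S 2"
using Hnorm_nat[of S 2]by(simp only: fun_eq_iff semidef_form.nrm_def[OF *]of_nat_numeral simp_thms)
qed

sublocale A: semidef_form "Hs S 2""a_form S"rewrites "semidef_form.nrm(a_form S) = H2semi S"
proof -
show *:"semidef_form(Hs S 2)(a_form S)"by(rule semidef_a_form)
show "semidef_form.nrm(a_form S) = H2semi S"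
by(simp add: fun_eq_iff semidef_form.nrm_def[OF *]H2semi_eq)
qed

lemma Hs_2_wderiv:"v\<in>Hs S 2==>j\<le>2==>bs\<in>dirs j==>has_wderiv S bs v"
using Hs_mem_wderiv[of v 2]by simp

lemma Hs_cong:
assumes "ae_eq S f f'""f\<in>L2S S""f' \<in>L2S S"
shows "f\<in>Hs S s\<longleftrightarrow>f' \<in>Hs S s""Hnorm S s f = Hnorm S s f'""H2semi S f = H2semi S f'"
"a_form S f = a_form S f'"
proof -
note c = wderiv_cong[OF assms(1)L2_measurable[OF assms(2)]L2_measurable[OF assms(3)]]
have c1:"wderiv S bs f = wderiv S bs f'"if "bs\<in>dirs j"for bs j using c(1)dirsD(1)[OF that]by blast
have c2:"(\<exists>g\<in>L2S S. weak_deriv S bs f g) = (\<exists>g\<in>L2S S. weak_deriv S bs f' g)"if "bs\<in>dirs j"for bs j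
using c(2)dirsD(1)[OF that]by(simp add: has_wderiv_def)
show "f\<in>Hs S s\<longleftrightarrow>f' \<in>Hs S s"unfolding Hs_def using c1 c2 assms(2,3)
by(simp cong: ball_cong)
show "Hnorm S s f = Hnorm S s f'"unfolding Hnorm_def using c1 by(simp cong: sum.cong)
show "H2semi S f = H2semi S f'"unfolding H2semi_def using c1 by(simp cong: sum.cong)
show "a_form S f = a_form S f'"unfolding a_form_def using c1 by(simp cong: sum.cong)
qed

lemma L2norm_le_Hnorm: assumes "v\<in>L2S S"shows "L2norm S v\<le>Hnorm S s v"
using L2norm_cong[OF wderiv_Nil(2)[OF assms]wderiv(1)[OF wderiv_Nil(1)[OF assms]]assms]
L2norm_wderiv_le_Hnorm[of 0 s "[]"S v]by simp

lemma H2semi_le_Hnorm:"H2semi S v\<le>Hnorm S 2 v"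
proof -
have "a_form S v v\<le>Hinner 2 S v v"unfolding a_form_def Hinner_def
by(rule member_le_sum[of 2 _ "%j. \<Sum>bs\<in>dirs j. ip S(wderiv S bs v)(wderiv S bs v)"])(auto simp: ip_def intro!: sum_nonneg)
thus ?thesis using Hnorm_nat[of S 2 v]by(simp add: H2semi_eq)
qed

lemma wderiv_diff:
assumes "f\<in>L2S S""f' \<in>L2S S""has_wderiv S bs f""has_wderiv S bs f'""set bs\<subseteq>Basis"
shows "ae_eq S(wderiv S bs(%x. f x - f' x))(%x. wderiv S bs f x - wderiv S bs f' x)"
using wderiv_lin(2)[OF assms(2,1,4,3,5),of "-1"]by simp

lemma wderiv_smooth:
assumes "smooth ph""pds bs ph\<in>L2S S""set bs\<subseteq>Basis"
shows "has_wderiv S bs ph""ae_eq S(wderiv S bs ph)(pds bs ph)"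
using wderiv_eq[OF assms(2)weak_deriv_smooth[OF assms(1,3)]] .

lemma Hs_restrict:
assumes v:"v\<in>Hs S(real m)"and B:"open B""B\<subseteq>S"
shows "v\<in>Hs B(real m)"
and "!!j bs. j\<le>m==>bs\<in>dirs j==>ae_eq B(wderiv B bs v)(wderiv S bs v)"
proof -
interpret B: open_plane B by unfold_locales fact
have *:"wderiv S bs v\<in>L2S B""weak_deriv B bs v(wderiv S bs v)"if "j\<le>m""bs\<in>dirs j"for j bs
using wderiv[OF Hs_mem_wderiv[OF v that]]L2_lebesgue_on_mono[OF S_sets B.S_sets B(2)]
 weak_deriv_mono[OF _ B dirsD(1)[OF that(2)]]by blast+
show "v\<in>Hs B(real m)"unfolding Hs_nat
using L2_lebesgue_on_mono[OF S_sets B.S_sets B(2)Hs_L2[OF v]] * unfolding has_wderiv_def by blast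
show "ae_eq B(wderiv B bs v)(wderiv S bs v)"if "j\<le>m""bs\<in>dirs j"for j bs
by(rule B.wderiv_eq[OF *[OF that]])
qed

lemma Hnorm_tendsto_iff:
assumes "v\<in>Hs S(real m)""!!n. f n\<in>Hs S(real m)"
shows "(%n. Hnorm S(real m)(%x. f n x - v x))---->0\<longleftrightarrow>
(\<forall>j\<le>m. \<forall>bs\<in>dirs j. (%n. L2norm S(%x. wderiv S bs(f n)x - wderiv S bs v x))---->0)"(is "?l\<longleftrightarrow>?r")
proof -
have d:"L2norm S(wderiv S bs(%x. f n x - v x)) = L2norm S(%x. wderiv S bs(f n)x - wderiv S bs v x)"
if "j\<le>m""bs\<in>dirs j"for n j bs
proof(rule L2norm_cong)
interpret H: semidef_form "Hs S(real m)""Hinner m S"by(rule semidef_Hinner)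
show "ae_eq S(wderiv S bs(%x. f n x - v x))(%x. wderiv S bs(f n)x - wderiv S bs v x)"
 using assms that by(intro wderiv_diff)(auto intro: Hs_L2 Hs_mem_wderiv dest: dirsD)
show "wderiv S bs(%x. f n x - v x)\<in>L2S S"
 using H.diff_mem[OF assms(2,1),of n]by(intro wderiv Hs_mem_wderiv[OF _ that])
show "(%x. wderiv S bs(f n)x - wderiv S bs v x)\<in>L2S S"
 using assms that by(intro L2.diff_mem wderiv Hs_mem_wderiv)
qed
show ?thesis
proof
assume l: ?l
show ?r
proof(intro allI impI ballI)
 fix j bs assume j:"j\<le>m""bs\<in>dirs j"
 show "(%n. L2norm S(%x. wderiv S bs(f n)x - wderiv S bs v x))---->0"
 unfolding d[OF j,symmetric]
 by(rule Lim_null_comparison[OF _ l])(use L2norm_wderiv_le_Hnorm[of j "real m"bs]j in simp)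
qed
next
assume r: ?r
have "(%n. \<Sum>j\<le>m. \<Sum>bs\<in>dirs j. (L2norm S(%x. wderiv S bs(f n)x - wderiv S bs v x))\<^sup>2)---->(\<Sum>j\<le>m. \<Sum>bs\<in>dirs j. 0\<^sup>2)"
 using r by(intro tendsto_intros)auto
also have "(%n. \<Sum>j\<le>m. \<Sum>bs\<in>dirs j. (L2norm S(%x. wderiv S bs(f n)x - wderiv S bs v x))\<^sup>2) = (%n. Hinner m S(%x. f n x - v x)(%x. f n x - v x))"
 unfolding Hinner_def L2norm_square[symmetric]by(intro ext sum.cong)(auto simp: d)
finally have "(%n. sqrt(Hinner m S(%x. f n x - v x)(%x. f n x - v x)))---->sqrt 0"
 by(intro tendsto_real_sqrt)simp
thus ?l by(simp add: Hnorm_nat)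
qed
qed

end

lemma smooth_L2_bounded:
fixes S ::"'a::euclidean_space set"
assumes "open S""bounded S""smooth ph"
shows "ph\<in>L2(lebesgue_on S)"
proof -
have "bounded(ph ` closure S)"
using assms by(intro compact_imp_bounded compact_continuous_image smooth_continuous_on)
 (simp_all add: compact_eq_bounded_closed bounded_closure)
then obtain B where "!!x. x\<in>closure S==>\<bar>ph x\<bar>\<le>B"by(auto simp: bounded_iff)
thus ?thesis using closure_subset[of S]assms
by(intro L2_bounded[of _ _ B]finite_measure_lebesgue_on lmeasurable_open smooth_measurable_on)(auto intro!: AE_I2)
qed

section \<open>Density of smooth functions on bounded convex sets\<close>

locale bounded_plane = open_plane +
assumes bounded_S:"bounded S"
begin

lemma smooth_Hs: assumes "smooth ph"shows "ph\<in>Hs S(real m)"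
"set bs\<subseteq>Basis==>ae_eq S(wderiv S bs ph)(pds bs ph)"
"set bs\<subseteq>Basis==>pds bs ph\<in>L2S S"
using assms wderiv_smooth[OF assms]smooth_L2_bounded[OF open_S bounded_S]smooth_pds[OF assms]
by(auto simp: Hs_nat dest: dirsD)

lemma Hnorm_smooth_tendsto_iff:
assumes "v\<in>Hs S(real m)""!!n. smooth(ph n)"
shows "(%n. Hnorm S(real m)(%x. ph n x - v x))---->0\<longleftrightarrow>
(\<forall>j\<le>m. \<forall>bs\<in>dirs j. (%n. L2norm S(%x. pds bs(ph n)x - wderiv S bs v x))---->0)"
proof -
have "L2norm S(%x. wderiv S bs(ph n)x - wderiv S bs v x) = L2norm S(%x. pds bs(ph n)x - wderiv S bs v x)"
if "j\<le>m""bs\<in>dirs j"for j bs n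
proof(rule L2norm_cong)
note b = dirsD(1)[OF that(2)]
note s = smooth_Hs[OF assms(2)[of n]]
show "ae_eq S(%x. wderiv S bs(ph n)x - wderiv S bs v x)(%x. pds bs(ph n)x - wderiv S bs v x)"
 using s(2)[OF b]unfolding ae_eq_def by eventually_elim simp
have "wderiv S bs v\<in>L2S S""wderiv S bs(ph n)\<in>L2S S"
 using assms s that by(auto intro!: wderiv Hs_mem_wderiv)
thus "(%x. wderiv S bs(ph n)x - wderiv S bs v x)\<in>L2S S""(%x. pds bs(ph n)x - wderiv S bs v x)\<in>L2S S"
 using s(3)[OF b]by(auto intro: L2.diff_mem)
qed
thus ?thesis unfolding Hnorm_tendsto_iff[OF assms(1)smooth_Hs(1)[OF assms(2)]]by simp
qed

text \<open>By \<open>T_pds_weak\<close> a derivative of the regularized function is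
  \<open>ths n ^ j\<close> times the regularized weak derivative. The latter converges in
  \<open>L^2\<close> and the factor tends to 1, so one sequence approximates all derivatives at
  once.\<close>

theorem Hs_smooth_dense:
assumes S:"convex S""S\<noteq>{}"and v:"v\<in>Hs S(real m)"
obtains ph where "\<forall>n. smooth(ph n)""(%n. Hnorm S(real m)(%x. ph n x - v x))---->0"
proof -
obtain z r etz where "regularization S z r etz"
by(rule regularization_exists[OF open_S S(1)bounded_S S(2)])
then interpret R: regularization S z r etz .
have int:"integrable R.M v"by(rule L2_integrable[OF R.finite_M Hs_L2[OF v]])
have sm:"smooth(R.T(R.ths n)v)"for n by(rule R.T_smooth(1)[OF int])
have "(%n. Hnorm S(real m)(%x. R.T(R.ths n)v x - v x))---->0"
unfolding Hnorm_smooth_tendsto_iff[OF v sm]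
proof(intro allI impI ballI)
fix j bs assume j:"j\<le>m"and bs:"bs\<in>dirs j"
let ?g = "wderiv S bs v"
note wd = wderiv[OF Hs_mem_wderiv[OF v j bs]]
have weak:"inner2 R.M v(pds bs ph) = (-1) ^ length bs * inner2 R.M ?g ph"if "test_fun S ph"for ph
 using wd(2)that by(simp add: weak_deriv_def ip_eq_inner2)
have Tg:"R.T(R.ths n) ?g\<in>L2S S"for n by(rule R.T_L2[OF R.ths(1,2)wd(1)])
have d:"(%x. R.T(R.ths n) ?g x - ?g x)\<in>L2S S"for n by(rule L2.diff_mem[OF Tg wd(1)])
have "L2norm S(%x. pds bs(R.T(R.ths n)v)x - ?g x)\<le>
 \<bar>R.ths n ^ j\<bar> * L2norm S(%x. R.T(R.ths n) ?g x - ?g x) + \<bar>R.ths n ^ j - 1\<bar> * L2norm S ?g"for n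
proof -
 have "pds bs(R.T(R.ths n)v)x - ?g x = R.ths n ^ j * (R.T(R.ths n) ?g x - ?g x) + (R.ths n ^ j - 1) * ?g x"
 if "x\<in>S"for x
 proof -
 have x:"x\<in>closure S"using closure_subset that by blast
 have "pds bs(R.T(R.ths n)v)x = R.ths n ^ length bs * R.T(R.ths n) ?g x"
  by(rule R.T_pds_weak[OF int dirsD(1)[OF bs]R.ths(1,2)x weak])
 thus ?thesis unfolding dirsD(2)[OF bs]by(simp add: algebra_simps)
 qed
 hence "L2norm S(%x. pds bs(R.T(R.ths n)v)x - ?g x)
 = L2norm S(%x. R.ths n ^ j * (R.T(R.ths n) ?g x - ?g x) + (R.ths n ^ j - 1) * ?g x)"
 unfolding L2norm_def ip_def by(intro arg_cong[where f = sqrt]Bochner_Integration.integral_cong)auto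
 also have "...\<le>L2norm S(%x. R.ths n ^ j * (R.T(R.ths n) ?g x - ?g x)) + L2norm S(%x. (R.ths n ^ j - 1) * ?g x)"
 by(intro L2.nrm_add L2.cmult_mem d wd)
 finally show ?thesis by(simp only: L2.nrm_cmult[OF d]L2.nrm_cmult[OF wd(1)])
qed
note bd = this
have "(%n. \<bar>R.ths n ^ j\<bar> * L2norm S(%x. R.T(R.ths n) ?g x - ?g x) + \<bar>R.ths n ^ j - 1\<bar> * L2norm S ?g)
 ---->\<bar>1 ^ j\<bar> * 0 + \<bar>1 ^ j - 1\<bar> * L2norm S ?g"
 using R.T_tendsto[OF wd(1)]by(intro tendsto_intros R.ths_tendsto)(simp add: L2norm_eq_norm2)
hence lim:"(%n. \<bar>R.ths n ^ j\<bar> * L2norm S(%x. R.T(R.ths n) ?g x - ?g x) + \<bar>R.ths n ^ j - 1\<bar> * L2norm S ?g)---->0"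
 by simp
show "(%n. L2norm S(%x. pds bs(R.T(R.ths n)v)x - ?g x))---->0"
 by(rule Lim_null_comparison[OF _ lim])(simp only: real_norm_def abs_of_nonneg[OF L2norm_nonneg]bd eventually_True)
qed
thus thesis using sm by(intro that)auto
qed

end

declare measurable_ident_lebesgue_on[measurable del]

section \<open>Integrals over parallelograms\<close>

lemma vec2_measurable:"(%p::real\<times>real. vector[fst p,snd p] :: real ^ 2)\<in>borel_measurable borel"
proof -
have "(%p::real\<times>real. vector[fst p,snd p] :: real ^ 2) = (%p. fst p *\<^sub>R vector[1,0] + snd p *\<^sub>R vector[0,1])"
by(auto simp: fun_eq_iff vec_eq_iff forall_2)
thus ?thesis by(simp only:)(intro borel_measurable_continuous_onI continuous_intros)
qed

lemma distr_prod_vec2: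
"distr lborel borel(%p. vector[fst p,snd p]) = (lborel :: (real ^ 2)measure)"
proof(rule lborel_eqI[symmetric])
fix l u ::"real ^ 2"
assume lu:"!!b. b\<in>Basis==>l\<bullet>b\<le>u\<bullet>b"
have le:"l $ i\<le>u $ i"for i
using lu[of "axis i 1"]by(auto simp: inner_axis Basis_vec_def)
note m = vec2_measurable
have B:"(\<Prod>b\<in>Basis. (u - l)\<bullet>b) = (u $ 1 - l $ 1) * (u $ 2 - l $ 2)"
proof -
have Beq:"(Basis :: (real ^ 2)set) = {axis 1 1,axis 2 1}"
 by(auto simp: Basis_vec_def UNIV_2)
have ne:"axis 1 1\<noteq>(axis 2 1 :: real ^ 2)"by(simp add: axis_eq_axis)
show ?thesis unfolding Beq using ne by(simp add: inner_axis)
qed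
have "emeasure(distr lborel borel(%p. vector[fst p,snd p]))(box l u) =
 emeasure lborel({l $ 1 <..< u $ 1}\<times>{l $ 2 <..< u $ 2})"
using m by(subst emeasure_distr)(auto simp: mem_box_cart forall_2 intro!: arg_cong[where f = "emeasure lborel"])
also have "... = (\<Prod>b\<in>Basis. (u - l)\<bullet>b)"
unfolding B using le by(subst lborel_prod[symmetric],subst lborel.emeasure_pair_measure_Times)
 (auto simp: ennreal_mult)
finally show "emeasure(distr lborel borel(%p. vector[fst p,snd p]))(box l u) = ennreal(\<Prod>b\<in>Basis. (u - l)\<bullet>b)" .
qed simp

text \<open>As an identity of measures it applies to all nonnegative integrals without integrability
  conditions; it is enough to compare the measures of boxes.\<close>

lemma lborel_linear_image:
fixes L ::"real ^ 2=>real ^ 2"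
assumes L:"linear L""inj L"
shows "lborel = density(distr lborel borel L)(%_. ennreal\<bar>det(matrix L)\<bar>)"
proof(rule lborel_eqI)
fix l u ::"real ^ 2"
assume lu:"!!b. b\<in>Basis==>l\<bullet>b\<le>u\<bullet>b"
have m[measurable]:"L\<in>borel_measurable borel"
using L by(intro borel_measurable_continuous_onI linear_continuous_on)(simp add: linear_conv_bounded_linear)
obtain g where g:"linear g""g\<circ>L = id"using linear_injective_left_inverse[OF L]by blast
have "L\<circ>g = id"using linear_inverse_left[OF L(1)g(1)]g(2)by(simp add: linear_inverse_left)
hence Lg:"L(g y) = y"for y by(metis comp_apply id_apply)
have gL:"g(L y) = y"for y using g(2)by(metis comp_apply id_apply)
have pre:"L -` box l u = g ` box l u"
proof(intro set_eqI iffI)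
fix y assume "y\<in>L -` box l u"
thus "y\<in>g ` box l u"using gL[of y]by(intro image_eqI[of _ _ "L y"])auto
qed(auto simp: Lg)
hence bd:"bounded(L -` box l u)"
using bounded_linear_image[of "box l u"g]g(1)by(simp add: linear_conv_bounded_linear)
have op:"open(L -` box l u)"
using L by(intro open_vimage)(auto intro: linear_continuous_on simp: linear_conv_bounded_linear)
have lm:"L -` box l u\<in>lmeasurable"using bd op by(rule lmeasurable_open)
have "L ` (L -` box l u) = box l u"using \<open>L\<circ>g = id\<close> by(intro surj_image_vimage_eq)(metis surj_def Lg)
hence "measure lebesgue(box l u) = \<bar>det(matrix L)\<bar> * measure lebesgue(L -` box l u)"
using measure_linear_image[OF L(1)lm]by simp
moreover have "measure lebesgue(box l u) = (\<Prod>b\<in>Basis. (u - l)\<bullet>b)"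
using lu by(simp add: measure_lborel_box_eq)
ultimately have *:"\<bar>det(matrix L)\<bar> * measure lebesgue(L -` box l u) = (\<Prod>b\<in>Basis. (u - l)\<bullet>b)"by simp
have "emeasure lborel(L -` box l u) = ennreal(measure lebesgue(L -` box l u))"
using emeasure_eq_measure2[OF lm]op by(subst(asm)emeasure_completion)(auto simp: borel_open)
thus "emeasure(density(distr lborel borel L)(%_. ennreal\<bar>det(matrix L)\<bar>))(box l u) = ennreal(\<Prod>b\<in>Basis. (u - l)\<bullet>b)"
by(simp add: emeasure_density_const emeasure_distr *[symmetric]ennreal_mult)
qed simp

lemma nn_integral_translate:
assumes "f\<in>borel_measurable borel"
shows "(\<integral>\<^sup>+x. f(a + x)\<partial>lborel) = (\<integral>\<^sup>+x. f x\<partial>(lborel :: 'a::euclidean_space measure))"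
proof -
have "(\<integral>\<^sup>+x. f x\<partial>lborel) = (\<integral>\<^sup>+x. f x\<partial>distr lborel borel((+)a))"by(simp add: lborel_distr_plus)
also have "... = (\<integral>\<^sup>+x. f(a + x)\<partial>lborel)"using assms by(subst nn_integral_distr)auto
finally show ?thesis ..
qed

text \<open>Iterated integrals along two independent directions become an area integral, with the
  reciprocal of the determinant as constant. Bounds along segments turn into bounds over the
  triangle in this way.\<close>

lemma nn_integral_parallelogram:
fixes a b x0 ::"real ^ 2"
assumes ind:"!!s t. s *\<^sub>R a + t *\<^sub>R b = 0==>s = 0&t = 0"
obtains c where "0\<le>c""!!f x0. f\<in>borel_measurable borel==>
(\<integral>\<^sup>+s. \<integral>\<^sup>+t. f(x0 + s *\<^sub>R a + t *\<^sub>R b)\<partial>lborel\<partial>lborel) = ennreal c * (\<integral>\<^sup>+x. f x\<partial>lborel)"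
proof -
define L where "L y = (y $ 1) *\<^sub>R a + (y $ 2) *\<^sub>R b"for y ::"real ^ 2"
have lin:"linear L"by(rule linearI)(auto simp: L_def algebra_simps)
have inj:"inj L"unfolding linear_injective_0[OF lin]
using ind[of "_ $ 1""_ $ 2"]unfolding L_def vec_eq_iff forall_2 by simp blast
define d where "d = \<bar>det(matrix L)\<bar>"
have d:"0 < d"using det_nz_iff_inj[OF lin]inj by(simp add: d_def)
have m[measurable]:"L\<in>borel_measurable borel"
using lin by(intro borel_measurable_continuous_onI linear_continuous_on)(simp add: linear_conv_bounded_linear)
have "(\<integral>\<^sup>+s. \<integral>\<^sup>+t. f(x0 + s *\<^sub>R a + t *\<^sub>R b)\<partial>lborel\<partial>lborel) = ennreal(1 / d) * (\<integral>\<^sup>+x. f x\<partial>lborel)"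
if f[measurable]:"f\<in>borel_measurable borel"for f x0
proof -
note v = vec2_measurable
have "(\<integral>\<^sup>+s. \<integral>\<^sup>+t. f(x0 + s *\<^sub>R a + t *\<^sub>R b)\<partial>lborel\<partial>lborel) = (\<integral>\<^sup>+p. f(x0 + fst p *\<^sub>R a + snd p *\<^sub>R b)\<partial>(lborel\<Otimes>\<^sub>M lborel))"
 by(subst lborel.nn_integral_fst[symmetric])auto
also have "... = (\<integral>\<^sup>+p. f(x0 + L(vector[fst p,snd p]))\<partial>lborel)"
 by(simp add: lborel_prod L_def add.assoc)
also have "... = (\<integral>\<^sup>+y. f(x0 + L y)\<partial>distr lborel borel(%p. vector[fst p,snd p]))"
 using v by(subst nn_integral_distr)auto
also have "... = (\<integral>\<^sup>+y. f(x0 + L y)\<partial>lborel)"by(simp add: distr_prod_vec2)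
finally have 1:"(\<integral>\<^sup>+s. \<integral>\<^sup>+t. f(x0 + s *\<^sub>R a + t *\<^sub>R b)\<partial>lborel\<partial>lborel) = (\<integral>\<^sup>+y. f(x0 + L y)\<partial>lborel)" .
have "(\<integral>\<^sup>+x. f x\<partial>lborel) = (\<integral>\<^sup>+x. f(x0 + x)\<partial>lborel)"by(rule nn_integral_translate[OF f,symmetric])
also have "... = (\<integral>\<^sup>+x. f(x0 + x)\<partial>density(distr lborel borel L)(%_. ennreal d))"
 using lborel_linear_image[OF lin inj]by(simp add: d_def)
also have "... = ennreal d * (\<integral>\<^sup>+y. f(x0 + L y)\<partial>lborel)"
 by(subst nn_integral_density)(auto simp: nn_integral_cmult nn_integral_distr)
finally have 2:"(\<integral>\<^sup>+x. f x\<partial>lborel) = ennreal d * (\<integral>\<^sup>+y. f(x0 + L y)\<partial>lborel)" .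
have "ennreal(1 / d) * ennreal d = 1"using d by(subst ennreal_mult[symmetric])auto
thus ?thesis unfolding 1 2 mult.assoc[symmetric]by simp
qed
thus thesis using that[of "1 / d"]d by simp
qed

text \<open>Integrate the derivative of \<open>(1 - t) f(t)\<close> over the unit interval.\<close>
lemma square_le_integral_unit:
assumes D:"!!t. (f has_real_derivative f' t)(at t)"and c:"continuous_on UNIV f'"
shows "ennreal((f 0)\<^sup>2)\<le>(\<integral>\<^sup>+t. ennreal(2 * (f t)\<^sup>2 + 2 * (f' t)\<^sup>2) * indicator{0..1}t\<partial>lborel)"
proof -
let ?M = "lebesgue_on{0..1::real}"
have fin:"finite_measure ?M"by(rule finite_measure_lebesgue_on)simp
have fc:"continuous_on UNIV f"using D by(auto intro: DERIV_isCont continuous_at_imp_continuous_on)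
define g where "g t = (1 - t) * f' t - f t"for t
have gc:"continuous_on UNIV g"unfolding g_def by(intro continuous_intros fc c)
have gm[measurable]:"g\<in>borel_measurable borel"by(rule borel_measurable_continuous_onI[OF gc])
have "bounded(g ` {0..1})"by(intro compact_imp_bounded compact_continuous_image continuous_on_subset[OF gc])auto
then obtain B where "\<forall>t\<in>{0..1}. \<bar>g t\<bar>\<le>B"by(auto simp: bounded_iff)
hence gL2:"g\<in>L2 ?M"by(intro L2_bounded[OF fin borel_measurable_lebesgue_on[OF gm],of B]AE_I2)simp
have "has_bochner_integral lborel(%x. g x * indicator{0..1}x)((1 - 1) * f 1 - (1 - 0) * f 0)"
by(rule has_bochner_integral_FTC_Icc_real[where F = "%t. (1 - t) * f t"])
 (use D gc in "auto simp: g_def continuous_on_eq_continuous_at intro!: derivative_eq_intros")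
hence "(\<integral>x. g x * indicator{0..1}x\<partial>lborel) = - f 0"by(simp add: has_bochner_integral_integral_eq)
moreover have "(\<integral>x. g x\<partial>?M) = (\<integral>x. g x * indicator{0..1}x\<partial>lborel)"
by(subst integral_restrict_space)(auto simp: mult.commute integral_completion)
ultimately have i:"(\<integral>x. g x\<partial>?M) = - f 0"by simp
have "\<bar>f 0\<bar>\<le>(\<integral>x. \<bar>g x\<bar>\<partial>?M)"using integral_abs_bound[of ?M g]i by simp
also have "...\<le>norm2 ?M g"using abs_integral_le_norm2[OF fin gL2]by(simp add: measure_restrict_space)
finally have "\<bar>f 0\<bar>\<^sup>2\<le>(norm2 ?M g)\<^sup>2"by(rule power_mono)simp
hence "ennreal((f 0)\<^sup>2)\<le>ennreal((norm2 ?M g)\<^sup>2)"by(intro ennreal_leI)simp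
also have "... = (\<integral>\<^sup>+t. ennreal((g t)\<^sup>2)\<partial>?M)"by(rule nn_integral_norm2[OF gL2,symmetric])
also have "... = (\<integral>\<^sup>+t. ennreal((g t)\<^sup>2) * indicator{0..1}t\<partial>lborel)"
by(subst nn_integral_restrict_space)(auto simp: nn_integral_completion)
also have "...\<le>(\<integral>\<^sup>+t. ennreal(2 * (f t)\<^sup>2 + 2 * (f' t)\<^sup>2) * indicator{0..1}t\<partial>lborel)"
proof(intro nn_integral_mono)
fix t :: real
have "(g t)\<^sup>2\<le>2 * (f t)\<^sup>2 + 2 * (f' t)\<^sup>2"if "t\<in>{0..1}"
proof -
 have "(1 - t)\<^sup>2 * (f' t)\<^sup>2\<le>1 * (f' t)\<^sup>2"using that by(intro mult_right_mono power_le_one)auto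
 moreover have "(g t)\<^sup>2 + ((1 - t) * f' t + f t)\<^sup>2 = 2 * ((1 - t)\<^sup>2 * (f' t)\<^sup>2) + 2 * (f t)\<^sup>2"
 by(simp add: g_def power2_eq_square algebra_simps)
 ultimately show ?thesis using zero_le_power2[of "(1 - t) * f' t + f t"]by linarith
qed
thus "ennreal((g t)\<^sup>2) * indicator{0..1}t\<le>ennreal(2 * (f t)\<^sup>2 + 2 * (f' t)\<^sup>2) * indicator{0..1}t"
 by(cases "t\<in>{0..1}")(simp_all only: indicator_simps mult_1_right mult_zero_right ennreal_leI order_refl if_True if_False simp_thms)
qed
finally show ?thesis .
qed

section \<open>Point values and traces on a triangle\<close>

definition dd ::"pt=>fld=>fld"where
"dd v f x = (\<Sum>c\<in>Basis. (v\<bullet>c) * pd c f x)"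

text \<open>The density whose integral over a triangle is the squared \<open>Hnorm\<close> of order
  \<open>m\<close> of a smooth function.\<close>

definition dens ::"nat=>fld=>fld"where
"dens m f x = (\<Sum>j\<le>m. \<Sum>bs\<in>dirs j. (pds bs f x)\<^sup>2)"

lemma sum_dirs_Suc:"(\<Sum>bs\<in>dirs(Suc m). F bs) = (\<Sum>b\<in>Basis. \<Sum>bs\<in>dirs m. F(b # bs))"
proof -
have "dirs(Suc m) = (%(b,bs). b # bs) ` (Basis\<times>dirs m)"
by(auto simp: dirs_def length_Suc_conv image_iff)
moreover have "inj_on(%(b,bs). b # bs)(Basis\<times>dirs m)"by(auto simp: inj_on_def)
ultimately have "(\<Sum>bs\<in>dirs(Suc m). F bs) = (\<Sum>(b,bs)\<in>Basis\<times>dirs m. F(b # bs))"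
by(simp add: sum.reindex case_prod_unfold)
thus ?thesis by(simp add: sum.cartesian_product)
qed

lemma dens_1:"dens 1 f x = (f x)\<^sup>2 + (\<Sum>c\<in>Basis. (pd c f x)\<^sup>2)"
and dens_2:"dens 2 f x = (f x)\<^sup>2 + (\<Sum>c\<in>Basis. (pd c f x)\<^sup>2) + (\<Sum>d\<in>Basis. \<Sum>c\<in>Basis. (pd d(pd c f)x)\<^sup>2)"
by(simp_all add: dens_def sum_dirs_Suc numeral_2_eq_2)

lemma dd_smooth:"smooth f==>smooth(dd v f)"
unfolding dd_def[abs_def]by(intro smooth_sum smooth_cmult smooth_pd)

lemma dd_line:"smooth f==>((%t. f(x + t *\<^sub>R v))has_real_derivative dd v f(x + t *\<^sub>R v))(at t)"
using smooth_line_derivative by(simp add: dd_def)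

lemma inner_sum_square_le:"(\<Sum>c\<in>Basis. (v\<bullet>c) * F c)\<^sup>2\<le>(norm v)\<^sup>2 * (\<Sum>c\<in>Basis. (F c)\<^sup>2)"
for v ::"'a::euclidean_space"
proof -
have "(norm v)\<^sup>2 = (\<Sum>c\<in>Basis. (v\<bullet>c)\<^sup>2)"
unfolding power2_norm_eq_inner by(subst euclidean_inner)(simp add: power2_eq_square)
thus ?thesis using Cauchy_Schwarz_ineq_sum[of "%c. v\<bullet>c"F Basis]by simp
qed

lemma dd_square_le:"(dd v f x)\<^sup>2\<le>(norm v)\<^sup>2 * (\<Sum>c\<in>Basis. (pd c f x)\<^sup>2)"
unfolding dd_def by(rule inner_sum_square_le)

lemma dens_nonneg:"0\<le>dens m f x"
by(simp add: dens_def sum_nonneg)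

lemma dens_mono:"m\<le>n==>dens m f x\<le>dens n f x"
unfolding dens_def by(rule sum_mono2)(auto intro: sum_nonneg)

lemma dens_measurable:"smooth f==>dens m f\<in>borel_measurable borel"
unfolding dens_def[abs_def]
by(intro borel_measurable_sum borel_measurable_power smooth_measurable smooth_pds)(auto dest: dirsD)

text \<open>A value is controlled by the first order density along a segment. A second application
  in an independent direction, to \<open>f\<close> and to its first derivatives, gives control by
  the second order density over a parallelogram; this is how \<open>H^2\<close> embeds into the
  continuous functions in the plane.\<close>

lemma segment_bound:
assumes f:"smooth f"
shows "ennreal((f x)\<^sup>2)\<le>(\<integral>\<^sup>+t. ennreal(2 * (1 + (norm v)\<^sup>2) * dens 1 f(x + t *\<^sub>R v)) * indicator{0..1}t\<partial>lborel)"
proof -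
have "continuous_on UNIV(%t. dd v f(x + t *\<^sub>R v))"
by(intro continuous_on_compose2[OF smooth_continuous_on[OF dd_smooth[OF f],of UNIV v]]continuous_intros)auto
from square_le_integral_unit[OF dd_line[OF f,of x v]this]
have "ennreal((f x)\<^sup>2)\<le>(\<integral>\<^sup>+t. ennreal(2 * (f(x + t *\<^sub>R v))\<^sup>2 + 2 * (dd v f(x + t *\<^sub>R v))\<^sup>2) * indicator{0..1}t\<partial>lborel)"
by simp
also have "...\<le>(\<integral>\<^sup>+t. ennreal(2 * (1 + (norm v)\<^sup>2) * dens 1 f(x + t *\<^sub>R v)) * indicator{0..1}t\<partial>lborel)"
proof(intro nn_integral_mono mult_right_mono ennreal_leI)
fix t
let ?y = "x + t *\<^sub>R v"
have "0\<le>(\<Sum>c\<in>Basis. (pd c f ?y)\<^sup>2)"by(intro sum_nonneg)simp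
moreover have "0\<le>(norm v)\<^sup>2 * (f ?y)\<^sup>2"by simp
ultimately show "2 * (f ?y)\<^sup>2 + 2 * (dd v f ?y)\<^sup>2\<le>2 * (1 + (norm v)\<^sup>2) * dens 1 f ?y"
 using dd_square_le[of v f ?y]unfolding dens_1 by(simp only: distrib_left distrib_right mult_1 mult.assoc)
qed simp
finally show ?thesis .
qed

lemma dens_step:
assumes f:"smooth f"
shows "ennreal(dens 1 f x)\<le>(\<integral>\<^sup>+t. ennreal(6 * (1 + (norm v)\<^sup>2) * dens 2 f(x + t *\<^sub>R v)) * indicator{0..1}t\<partial>lborel)"
proof -
let ?k = "2 * (1 + (norm v)\<^sup>2)"
let ?I = "%g. \<integral>\<^sup>+t. ennreal(?k * dens 1 g(x + t *\<^sub>R v)) * indicator{0..1}t\<partial>lborel"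
have pd:"smooth(pd c f)"if "c\<in>Basis"for c using f that by(rule smooth_pd)
have m:"(%t. ennreal(?k * dens 1 g(x + t *\<^sub>R v)) * indicator{0..1}t)\<in>borel_measurable lborel"if "smooth g"for g
proof -
note[measurable] = dens_measurable[OF that,of 1]
show ?thesis by measurable
qed
have "ennreal(dens 1 f x) = ennreal((f x)\<^sup>2) + (\<Sum>c\<in>Basis. ennreal((pd c f x)\<^sup>2))"
unfolding dens_1 by(subst ennreal_plus)(auto intro!: sum_nonneg)
also have "...\<le>?I f + (\<Sum>c\<in>Basis. ?I(pd c f))"
by(intro add_mono sum_mono segment_bound f pd)
also have "(\<Sum>c\<in>Basis. ?I(pd c f)) = (\<integral>\<^sup>+t. (\<Sum>c\<in>Basis. ennreal(?k * dens 1(pd c f)(x + t *\<^sub>R v)) * indicator{0..1}t)\<partial>lborel)"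
by(rule nn_integral_sum[symmetric])(intro m pd)
also have "?I f + ... = (\<integral>\<^sup>+t. ennreal(?k * dens 1 f(x + t *\<^sub>R v)) * indicator{0..1}t
 + (\<Sum>c\<in>Basis. ennreal(?k * dens 1(pd c f)(x + t *\<^sub>R v)) * indicator{0..1}t)\<partial>lborel)"
by(rule nn_integral_add[symmetric])(intro m f,intro borel_measurable_sum m pd)
also have "...\<le>(\<integral>\<^sup>+t. ennreal(6 * (1 + (norm v)\<^sup>2) * dens 2 f(x + t *\<^sub>R v)) * indicator{0..1}t\<partial>lborel)"
proof(intro nn_integral_mono)
fix t
let ?y = "x + t *\<^sub>R v"
have c:"dens 1(pd c f) ?y\<le>dens 2 f ?y"if "c\<in>Basis"for c
proof -
 have "(pd c f ?y)\<^sup>2\<le>(\<Sum>c\<in>Basis. (pd c f ?y)\<^sup>2)"using that by(intro member_le_sum)auto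
 moreover have "(\<Sum>d\<in>Basis. (pd d(pd c f) ?y)\<^sup>2)\<le>(\<Sum>d\<in>Basis. \<Sum>c\<in>Basis. (pd d(pd c f) ?y)\<^sup>2)"
 using that by(intro sum_mono member_le_sum[of c Basis "%c. (pd _(pd c f) ?y)\<^sup>2"])auto
 ultimately show ?thesis unfolding dens_1 dens_2 using zero_le_power2[of "f ?y"]by linarith
qed
\<comment> \<open>One term for \<open>f\<close> and one for each of the two first derivatives: this
  factor 3 turns the constant 2 of \<open>segment_bound\<close> into 6.\<close>
have "dens 1 f ?y + (\<Sum>c\<in>Basis. dens 1(pd c f) ?y)\<le>dens 2 f ?y + (\<Sum>c\<in>(Basis::pt set). dens 2 f ?y)"
 by(intro add_mono sum_mono c dens_mono)auto
hence "?k * (dens 1 f ?y + (\<Sum>c\<in>Basis. dens 1(pd c f) ?y))\<le>?k * (3 * dens 2 f ?y)"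
 by(intro mult_left_mono)auto
hence le:"?k * dens 1 f ?y + (\<Sum>c\<in>Basis. ?k * dens 1(pd c f) ?y)\<le>6 * (1 + (norm v)\<^sup>2) * dens 2 f ?y"
 by(simp only: distrib_left sum_distrib_left)(simp add: algebra_simps)
have "ennreal(?k * dens 1 f ?y) + (\<Sum>c\<in>Basis. ennreal(?k * dens 1(pd c f) ?y))
 = ennreal(?k * dens 1 f ?y + (\<Sum>c\<in>Basis. ?k * dens 1(pd c f) ?y))"
 by(subst ennreal_plus)(auto intro!: sum_nonneg mult_nonneg_nonneg simp: dens_nonneg)
also have "...\<le>ennreal(6 * (1 + (norm v)\<^sup>2) * dens 2 f ?y)"by(rule ennreal_leI[OF le])
finally show "ennreal(?k * dens 1 f ?y) * indicator{0..1}t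
 + (\<Sum>c\<in>Basis. ennreal(?k * dens 1(pd c f) ?y) * indicator{0..1}t)
 \<le>ennreal(6 * (1 + (norm v)\<^sup>2) * dens 2 f ?y) * indicator{0..1}t"
 by(cases "t\<in>{0..1}")auto
qed
finally show ?thesis .
qed

section \<open>A single triangle: the embedding into continuous functions\<close>

locale triangle =
fixes t ::"pt set"
assumes card_t:"card t = 3"and aff_t:"~affine_dependent t"
begin

sublocale bounded_plane "itri t"
proof
have "finite t"using card_t by(simp add: card_eq_0_iff[symmetric]card_ge_0_finite)
thus "bounded(itri t)"by(meson bounded_convex_hull bounded_subset finite_imp_bounded interior_subset)
qed simp

lemma finite_t:"finite t"using card_t by(simp add: card_ge_0_finite)

lemma compact_hull:"compact(convex hull t)"
using finite_t by(rule finite_imp_compact_convex_hull)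

lemma K_nonempty:"itri t\<noteq>{}"
using interior_convex_hull_eq_empty[of t]card_t aff_t by simp

lemma K_convex:"convex(itri t)"
by(simp add: convex_interior)

lemma closure_K:"closure(itri t) = convex hull t"
using convex_closure_interior[OF convex_convex_hull K_nonempty]compact_hull by(simp add: compact_imp_closed closure_closed)

lemma vertices:
assumes "p\<in>t""q\<in>t""p\<noteq>q"
obtains z where "t = {p,q,z}""z\<noteq>p""z\<noteq>q"
proof -
have "card(t - {p,q}) = 1"using assms card_t finite_t by(simp add: card_Diff_subset)
then obtain z where "t - {p,q} = {z}"by(auto simp: card_1_singleton_iff)
thus thesis using that[of z]assms by blast
qed

lemma independent_edges:
assumes t:"t = {p,q,z}"and d:"p\<noteq>q""z\<noteq>p""z\<noteq>q"and 0:"s *\<^sub>R(q - p) + r *\<^sub>R(z - p) = 0"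
shows "s = 0&r = 0"
proof -
have "independent((%x. - p + x) ` {q,z})"
using aff_t affine_dependent_iff_dependent[of p "{q,z}"]d unfolding t by auto
hence ind:"independent{q - p,z - p}"by simp
have ne:"q - p\<noteq>z - p"using d by simp
have "\<forall>u. (\<Sum>v\<in>{q - p,z - p}. u v *\<^sub>R v) = 0-->(\<forall>v\<in>{q - p,z - p}. u v = 0)"
using ind by(subst(asm)independent_explicit)simp
hence "\<forall>v\<in>{q - p,z - p}. (if v = q - p then s else r) = 0"
by(rule spec[where x = "%v. if v = q - p then s else r",THEN mp])(use ne 0 in auto)
thus ?thesis using ne by(metis insertCI)
qed

text \<open>The constant depends only on the shape of the parallelogram and not on its corner
  \<open>x0\<close>, which makes the later pointwise bounds uniform.\<close>

lemma parallelogram_bound: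
assumes t:"t = {p,q,z}"and d:"p\<noteq>q""z\<noteq>p""z\<noteq>q"and k:"k\<noteq>0"
obtains c where "0\<le>c""!!F x0. F\<in>borel_measurable borel==>
 (!!s r. s\<in>{0..1}==>r\<in>{0..1}==>x0 + s *\<^sub>R(k *\<^sub>R(q - p)) + r *\<^sub>R(k *\<^sub>R(z - p))\<in>convex hull t)==>
 (\<integral>\<^sup>+s. (\<integral>\<^sup>+r. F(x0 + s *\<^sub>R(k *\<^sub>R(q - p)) + r *\<^sub>R(k *\<^sub>R(z - p))) * indicator{0..1}r\<partial>lborel) * indicator{0..1}s\<partial>lborel)
 \<le>ennreal c * (\<integral>\<^sup>+x. F x\<partial>lebesgue_on(itri t))"
proof -
let ?a = "k *\<^sub>R(q - p)"and ?b = "k *\<^sub>R(z - p)"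
have ind:"s = 0&r = 0"if "s *\<^sub>R ?a + r *\<^sub>R ?b = 0"for s r
using independent_edges[OF t d,of "s * k""r * k"]that k by simp
obtain c where c:"0\<le>c""!!f x0. f\<in>borel_measurable borel==>
(\<integral>\<^sup>+s. \<integral>\<^sup>+r. f(x0 + s *\<^sub>R ?a + r *\<^sub>R ?b)\<partial>lborel\<partial>lborel) = ennreal c * (\<integral>\<^sup>+x. f x\<partial>lborel)"
using nn_integral_parallelogram[of ?a ?b]ind by metis
have closed:"closed(convex hull t)"using compact_hull by(rule compact_imp_closed)
have neg:"negligible(convex hull t - itri t)"
using negligible_convex_frontier[of "convex hull t"]closed by(simp add: frontier_def closure_closed)
show thesis
proof(rule that[OF c(1)])
fix F ::"pt=>ennreal"and x0
assume F[measurable]:"F\<in>borel_measurable borel"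
 and mem:"!!s r. s\<in>{0..1}==>r\<in>{0..1}==>x0 + s *\<^sub>R ?a + r *\<^sub>R ?b\<in>convex hull t"
\<comment> \<open>Cutting \<open>F\<close> off outside the closed triangle allows both parameters to
  run over the whole line, where the change of variables applies. The boundary of the triangle is
  then discarded as a null set.\<close>
define G where "G x = F x * indicator(convex hull t)x"for x
have[measurable]:"convex hull t\<in>sets borel"using closed by simp
have G:"G\<in>borel_measurable borel"unfolding G_def by measurable
have "(\<integral>\<^sup>+s. (\<integral>\<^sup>+r. F(x0 + s *\<^sub>R ?a + r *\<^sub>R ?b) * indicator{0..1}r\<partial>lborel) * indicator{0..1}s\<partial>lborel)
 \<le>(\<integral>\<^sup>+s. \<integral>\<^sup>+r. G(x0 + s *\<^sub>R ?a + r *\<^sub>R ?b)\<partial>lborel\<partial>lborel)"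
proof(rule nn_integral_mono)
 fix s :: real
 show "(\<integral>\<^sup>+r. F(x0 + s *\<^sub>R ?a + r *\<^sub>R ?b) * indicator{0..1}r\<partial>lborel) * indicator{0..1}s
  \<le>(\<integral>\<^sup>+r. G(x0 + s *\<^sub>R ?a + r *\<^sub>R ?b)\<partial>lborel)"
 proof(cases "s\<in>{0..1}")
 case True
 have "(\<integral>\<^sup>+r. F(x0 + s *\<^sub>R ?a + r *\<^sub>R ?b) * indicator{0..1}r\<partial>lborel)\<le>(\<integral>\<^sup>+r. G(x0 + s *\<^sub>R ?a + r *\<^sub>R ?b)\<partial>lborel)"
 proof(rule nn_integral_mono)
  fix r :: real
  show "F(x0 + s *\<^sub>R ?a + r *\<^sub>R ?b) * indicator{0..1}r\<le>G(x0 + s *\<^sub>R ?a + r *\<^sub>R ?b)"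
  using mem[OF True,of r]by(cases "r\<in>{0..1}")(simp_all add: G_def del: scaleR_scaleR)
 qed
 thus ?thesis using True by simp
 qed simp
qed
also have "... = ennreal c * (\<integral>\<^sup>+x. G x\<partial>lborel)"by(rule c(2)[OF G])
also have "(\<integral>\<^sup>+x. G x\<partial>lborel) = (\<integral>\<^sup>+x. G x\<partial>lebesgue)"by(simp add: nn_integral_completion)
also have "... = (\<integral>\<^sup>+x. F x * indicator(itri t)x\<partial>lebesgue)"
proof(rule nn_integral_cong_AE)
 have "AE x in lebesgue. x\<notin>convex hull t - itri t"
 using neg by(intro AE_not_in)(simp add: negligible_iff_null_sets)
 thus "AE x in lebesgue. G x = F x * indicator(itri t)x"
 proof eventually_elim
 case(elim x)
 thus ?case using interior_subset[of "convex hull t"]by(auto simp: G_def indicator_def)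
 qed
qed
also have "... = (\<integral>\<^sup>+x. F x\<partial>lebesgue_on(itri t))"
 using S_sets by(simp add: nn_integral_restrict_space)
finally show "(\<integral>\<^sup>+s. (\<integral>\<^sup>+r. F(x0 + s *\<^sub>R ?a + r *\<^sub>R ?b) * indicator{0..1}r\<partial>lborel) * indicator{0..1}s\<partial>lborel)
 \<le>ennreal c * (\<integral>\<^sup>+x. F x\<partial>lebesgue_on(itri t))" .
qed
qed

lemma nn_integral_dens:
assumes f:"smooth f"
shows "(\<integral>\<^sup>+x. ennreal(dens m f x)\<partial>lebesgue_on(itri t)) = ennreal((Hnorm(itri t)(real m)f)\<^sup>2)"
proof -
have L2:"pds bs f\<in>L2S(itri t)"if "bs\<in>dirs j"for bs j by(rule smooth_Hs(3)[OF f dirsD(1)[OF that]])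
have "(\<integral>\<^sup>+x. ennreal(dens m f x)\<partial>lebesgue_on(itri t)) = (\<integral>\<^sup>+x. (\<Sum>j\<le>m. \<Sum>bs\<in>dirs j. ennreal((pds bs f x)\<^sup>2))\<partial>lebesgue_on(itri t))"
by(simp add: dens_def sum_nonneg)
also have "... = (\<Sum>j\<le>m. \<Sum>bs\<in>dirs j. \<integral>\<^sup>+x. ennreal((pds bs f x)\<^sup>2)\<partial>lebesgue_on(itri t))"
proof -
have m:"(%x. ennreal((pds bs f x)\<^sup>2))\<in>borel_measurable(lebesgue_on(itri t))"if "bs\<in>dirs j"for bs j
 using L2_measurable[OF L2[OF that]]by measurable
have "(\<integral>\<^sup>+x. (\<Sum>j\<le>m. \<Sum>bs\<in>dirs j. ennreal((pds bs f x)\<^sup>2))\<partial>lebesgue_on(itri t))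
 = (\<Sum>j\<le>m. \<integral>\<^sup>+x. (\<Sum>bs\<in>dirs j. ennreal((pds bs f x)\<^sup>2))\<partial>lebesgue_on(itri t))"
 by(intro nn_integral_sum borel_measurable_sum m)
also have "... = (\<Sum>j\<le>m. \<Sum>bs\<in>dirs j. \<integral>\<^sup>+x. ennreal((pds bs f x)\<^sup>2)\<partial>lebesgue_on(itri t))"
 by(intro sum.cong refl nn_integral_sum m)
finally show ?thesis .
qed
also have "... = (\<Sum>j\<le>m. \<Sum>bs\<in>dirs j. ennreal((L2norm(itri t)(wderiv(itri t)bs f))\<^sup>2))"
proof(intro sum.cong refl)
fix j bs assume bs:"bs\<in>dirs j"
have "L2norm(itri t)(wderiv(itri t)bs f) = L2norm(itri t)(pds bs f)"
 using wderiv_smooth[OF f L2[OF bs]dirsD(1)[OF bs]]by(intro L2norm_cong wderiv L2[OF bs])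
thus "(\<integral>\<^sup>+x. ennreal((pds bs f x)\<^sup>2)\<partial>lebesgue_on(itri t)) = ennreal((L2norm(itri t)(wderiv(itri t)bs f))\<^sup>2)"
 using nn_integral_norm2[OF L2[OF bs]]by(simp add: L2norm_eq_norm2)
qed
also have "... = ennreal(Hinner m(itri t)f f)"
by(simp add: Hinner_def L2norm_square[symmetric]sum_nonneg)
also have "Hinner m(itri t)f f = (Hnorm(itri t)(real m)f)\<^sup>2"
by(simp add: Hnorm_nat Hinner_def L2norm_square[symmetric]sum_nonneg)
finally show ?thesis .
qed

lemma hull_3:
assumes "t = {p,q,z}"shows "convex hull t = {u *\<^sub>R p + v *\<^sub>R q + w *\<^sub>R z |u v w. 0\<le>u&0\<le>v&0\<le>w&u + v + w = 1}"
unfolding assms by(rule convex_hull_3)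

text \<open>Near the vertex \<open>p\<close> a parallelogram of fixed shape fits into the triangle.\<close>
lemma sup_bound_vertex:
assumes t:"t = {p,q,z}"and d:"p\<noteq>q""z\<noteq>p""z\<noteq>q"
obtains C where "0\<le>C""!!f u v w. smooth f==>1/3\<le>u==>0\<le>v==>0\<le>w==>u + v + w = 1==>
 \<bar>f(u *\<^sub>R p + v *\<^sub>R q + w *\<^sub>R z)\<bar>\<le>C * Hnorm(itri t)2 f"
proof -
\<comment> \<open>The barycentric coordinate at \<open>p\<close> is at least \<open>1/3\<close> and
  loses at most \<open>1/6\<close> in each direction, so it stays nonnegative on the
  parallelogram.\<close>
let ?a = "(1/6) *\<^sub>R(q - p)"and ?b = "(1/6) *\<^sub>R(z - p)"
obtain c where c:"0\<le>c""!!F x0. F\<in>borel_measurable borel==>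
 (!!s r. s\<in>{0..1}==>r\<in>{0..1}==>x0 + s *\<^sub>R ?a + r *\<^sub>R ?b\<in>convex hull t)==>
 (\<integral>\<^sup>+s. (\<integral>\<^sup>+r. F(x0 + s *\<^sub>R ?a + r *\<^sub>R ?b) * indicator{0..1}r\<partial>lborel) * indicator{0..1}s\<partial>lborel)
 \<le>ennreal c * (\<integral>\<^sup>+x. F x\<partial>lebesgue_on(itri t))"
by(rule parallelogram_bound[OF t d,of "1/6"])auto
define k1 k2 where "k1 = 2 * (1 + (norm ?a)\<^sup>2)"and "k2 = 6 * (1 + (norm ?b)\<^sup>2)"
have k:"0\<le>k1""0\<le>k2"by(auto simp: k1_def k2_def)
show thesis
proof(rule that[of "sqrt(c * (k1 * k2))"])
fix f :: fld and u v w :: real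
assume f:"smooth f"and uvw:"1/3\<le>u""0\<le>v""0\<le>w""u + v + w = 1"
define x0 where "x0 = u *\<^sub>R p + v *\<^sub>R q + w *\<^sub>R z"
have[measurable]:"dens m f\<in>borel_measurable borel"for m by(rule dens_measurable[OF f])
have mem:"x0 + s *\<^sub>R ?a + r *\<^sub>R ?b\<in>convex hull t"if "s\<in>{0..1}""r\<in>{0..1}"for s r
proof -
 have "x0 + s *\<^sub>R ?a + r *\<^sub>R ?b = (u - s/6 - r/6) *\<^sub>R p + (v + s/6) *\<^sub>R q + (w + r/6) *\<^sub>R z"
 by(simp add: x0_def algebra_simps)
 thus ?thesis unfolding hull_3[OF t]using uvw that
 by(intro CollectI exI[of _ "u - s/6 - r/6"]exI[of _ "v + s/6"]exI[of _ "w + r/6"])auto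
qed
have "ennreal((f x0)\<^sup>2)\<le>(\<integral>\<^sup>+s. ennreal(k1 * dens 1 f(x0 + s *\<^sub>R ?a)) * indicator{0..1}s\<partial>lborel)"
 unfolding k1_def by(rule segment_bound[OF f])
also have "...\<le>(\<integral>\<^sup>+s. (\<integral>\<^sup>+r. ennreal(k1 * (k2 * dens 2 f(x0 + s *\<^sub>R ?a + r *\<^sub>R ?b))) * indicator{0..1}r\<partial>lborel) * indicator{0..1}s\<partial>lborel)"
proof(intro nn_integral_mono mult_right_mono)
 fix s
 let ?y = "x0 + s *\<^sub>R ?a"
 have "ennreal(k1 * dens 1 f ?y)\<le>ennreal k1 * (\<integral>\<^sup>+r. ennreal(k2 * dens 2 f(?y + r *\<^sub>R ?b)) * indicator{0..1}r\<partial>lborel)"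
 unfolding ennreal_mult[OF k(1)dens_nonneg]k2_def by(intro mult_left_mono dens_step f)auto
 also have "... = (\<integral>\<^sup>+r. ennreal k1 * (ennreal(k2 * dens 2 f(?y + r *\<^sub>R ?b)) * indicator{0..1}r)\<partial>lborel)"
 by(rule nn_integral_cmult[symmetric])measurable
 also have "... = (\<integral>\<^sup>+r. ennreal(k1 * (k2 * dens 2 f(?y + r *\<^sub>R ?b))) * indicator{0..1}r\<partial>lborel)"
 using k by(simp add: ennreal_mult[of k1]dens_nonneg mult.assoc)
 finally show "ennreal(k1 * dens 1 f ?y)\<le>..." .
qed simp
also have "...\<le>ennreal c * (\<integral>\<^sup>+x. ennreal(k1 * (k2 * dens 2 f x))\<partial>lebesgue_on(itri t))"
 by(rule c(2)[OF _ mem])measurable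
also have "(\<integral>\<^sup>+x. ennreal(k1 * (k2 * dens 2 f x))\<partial>lebesgue_on(itri t)) = ennreal(k1 * k2) * (\<integral>\<^sup>+x. ennreal(dens 2 f x)\<partial>lebesgue_on(itri t))"
 using k by(subst nn_integral_cmult[symmetric])
 (auto intro!: borel_measurable_lebesgue_on nn_integral_cong simp: ennreal_mult[symmetric]dens_nonneg mult.assoc)
also have "... = ennreal(k1 * k2) * ennreal((Hnorm(itri t)2 f)\<^sup>2)"
 using nn_integral_dens[OF f,of 2]by simp
also have "ennreal c * ... = ennreal(c * (k1 * k2) * (Hnorm(itri t)2 f)\<^sup>2)"
 using c(1)k by(simp add: ennreal_mult mult.assoc)
finally have "(f x0)\<^sup>2\<le>c * (k1 * k2) * (Hnorm(itri t)2 f)\<^sup>2"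
 using c(1)k by(subst(asm)ennreal_le_iff)auto
hence "sqrt((f x0)\<^sup>2)\<le>sqrt(c * (k1 * k2) * (Hnorm(itri t)2 f)\<^sup>2)"by(rule real_sqrt_le_mono)
thus "\<bar>f(u *\<^sub>R p + v *\<^sub>R q + w *\<^sub>R z)\<bar>\<le>sqrt(c * (k1 * k2)) * Hnorm(itri t)2 f"
 by(simp add: real_sqrt_mult x0_def)
qed(use c(1)k in auto)
qed

text \<open>One of the three barycentric coordinates is at least \<open>1/3\<close>, so every point
  is covered from one of the vertices.\<close>

lemma sup_bound:
obtains C where "0\<le>C""!!f x. smooth f==>x\<in>convex hull t==>\<bar>f x\<bar>\<le>C * Hnorm(itri t)2 f"
proof -
obtain p q z where t:"t = {p,q,z}"and d:"p\<noteq>q""z\<noteq>p""z\<noteq>q"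
using card_t by(auto simp: card_3_iff)
have t2:"t = {q,z,p}"and t3:"t = {z,p,q}"using t by auto
obtain C1 where C1:"0\<le>C1""!!f u v w. smooth f==>1/3\<le>u==>0\<le>v==>0\<le>w==>u + v + w = 1==>
 \<bar>f(u *\<^sub>R p + v *\<^sub>R q + w *\<^sub>R z)\<bar>\<le>C1 * Hnorm(itri t)2 f"
using sup_bound_vertex[OF t]d by metis
obtain C2 where C2:"0\<le>C2""!!f u v w. smooth f==>1/3\<le>u==>0\<le>v==>0\<le>w==>u + v + w = 1==>
 \<bar>f(u *\<^sub>R q + v *\<^sub>R z + w *\<^sub>R p)\<bar>\<le>C2 * Hnorm(itri t)2 f"
using sup_bound_vertex[OF t2]d by metis
obtain C3 where C3:"0\<le>C3""!!f u v w. smooth f==>1/3\<le>u==>0\<le>v==>0\<le>w==>u + v + w = 1==>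
 \<bar>f(u *\<^sub>R z + v *\<^sub>R p + w *\<^sub>R q)\<bar>\<le>C3 * Hnorm(itri t)2 f"
using sup_bound_vertex[OF t3]d by metis
show thesis
proof(rule that[of "C1 + C2 + C3"])
fix f :: fld and x assume f:"smooth f"and x:"x\<in>convex hull t"
then obtain u v w where uvw:"0\<le>u""0\<le>v""0\<le>w""u + v + w = 1"and x:"x = u *\<^sub>R p + v *\<^sub>R q + w *\<^sub>R z"
 unfolding hull_3[OF t]by auto
let ?H = "Hnorm(itri t)2 f"
have nn:"0\<le>C1 * ?H""0\<le>C2 * ?H""0\<le>C3 * ?H"using C1 C2 C3 by auto
consider "1/3\<le>u" | "1/3\<le>v" | "1/3\<le>w"using uvw by linarith
hence "\<bar>f x\<bar>\<le>C1 * ?H + C2 * ?H + C3 * ?H"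
proof cases
 case 1 thus ?thesis using C1(2)[OF f 1 uvw(2,3)]uvw nn x by simp
next
 case 2
 thus ?thesis using C2(2)[OF f 2 uvw(3,1)]uvw nn x by(simp add: ac_simps)
next
 case 3
 thus ?thesis using C3(2)[OF f 3 uvw(1,2)]uvw nn x by(simp add: ac_simps)
qed
thus "\<bar>f x\<bar>\<le>(C1 + C2 + C3) * ?H"by(simp add: distrib_right)
qed(use C1 C2 C3 in auto)
qed

text \<open>Starting on the half of the edge next to \<open>p\<close>, a segment of half the length
  of the other side stays in the triangle, since \<open>1 - s/2 - r/2\<close> is nonnegative. The
  other half of the edge is reached from the opposite endpoint.\<close>

lemma corner_bound:
assumes t:"t = {p,q,z}"and d:"p\<noteq>q""z\<noteq>p""z\<noteq>q"
obtains C where "0\<le>C""!!f. smooth f==>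
 (\<integral>\<^sup>+s. ennreal((f(p + (s / 2) *\<^sub>R(q - p)))\<^sup>2) * indicator{0..1}s\<partial>lborel)\<le>ennreal(C * (Hnorm(itri t)1 f)\<^sup>2)"
proof -
let ?a = "(1/2) *\<^sub>R(q - p)"and ?b = "(1/2) *\<^sub>R(z - p)"
obtain c where c:"0\<le>c""!!F x0. F\<in>borel_measurable borel==>
 (!!s r. s\<in>{0..1}==>r\<in>{0..1}==>x0 + s *\<^sub>R ?a + r *\<^sub>R ?b\<in>convex hull t)==>
 (\<integral>\<^sup>+s. (\<integral>\<^sup>+r. F(x0 + s *\<^sub>R ?a + r *\<^sub>R ?b) * indicator{0..1}r\<partial>lborel) * indicator{0..1}s\<partial>lborel)
 \<le>ennreal c * (\<integral>\<^sup>+x. F x\<partial>lebesgue_on(itri t))"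
by(rule parallelogram_bound[OF t d,of "1/2"])auto
define k where "k = 2 * (1 + (norm ?b)\<^sup>2)"
have k:"0\<le>k"by(auto simp: k_def)
show thesis
proof(rule that[of "c * k"])
fix f :: fld assume f:"smooth f"
have[measurable]:"dens m f\<in>borel_measurable borel"for m by(rule dens_measurable[OF f])
have mem:"p + s *\<^sub>R ?a + r *\<^sub>R ?b\<in>convex hull t"if "s\<in>{0..1}""r\<in>{0..1}"for s r
proof -
 have "p + s *\<^sub>R ?a + r *\<^sub>R ?b = (1 - s/2 - r/2) *\<^sub>R p + (s/2) *\<^sub>R q + (r/2) *\<^sub>R z"
 by(simp add: algebra_simps)
 thus ?thesis unfolding hull_3[OF t]using that
 by(intro CollectI exI[of _ "1 - s/2 - r/2"]exI[of _ "s/2"]exI[of _ "r/2"])auto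
qed
have "(\<integral>\<^sup>+s. ennreal((f(p + (s / 2) *\<^sub>R(q - p)))\<^sup>2) * indicator{0..1}s\<partial>lborel)
 \<le>(\<integral>\<^sup>+s. (\<integral>\<^sup>+r. ennreal(k * dens 1 f(p + s *\<^sub>R ?a + r *\<^sub>R ?b)) * indicator{0..1}r\<partial>lborel) * indicator{0..1}s\<partial>lborel)"
proof(intro nn_integral_mono mult_right_mono)
 fix s :: real
 show "ennreal((f(p + (s / 2) *\<^sub>R(q - p)))\<^sup>2)\<le>(\<integral>\<^sup>+r. ennreal(k * dens 1 f(p + s *\<^sub>R ?a + r *\<^sub>R ?b)) * indicator{0..1}r\<partial>lborel)"
 using segment_bound[OF f,of "p + s *\<^sub>R ?a" ?b]by(simp add: k_def)
qed simp
also have "...\<le>ennreal c * (\<integral>\<^sup>+x. ennreal(k * dens 1 f x)\<partial>lebesgue_on(itri t))"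
 by(rule c(2)[OF _ mem])measurable
also have "(\<integral>\<^sup>+x. ennreal(k * dens 1 f x)\<partial>lebesgue_on(itri t)) = ennreal k * (\<integral>\<^sup>+x. ennreal(dens 1 f x)\<partial>lebesgue_on(itri t))"
 using k by(subst nn_integral_cmult[symmetric])
 (auto intro!: borel_measurable_lebesgue_on nn_integral_cong simp: ennreal_mult[symmetric]dens_nonneg)
also have "... = ennreal k * ennreal((Hnorm(itri t)1 f)\<^sup>2)"
 using nn_integral_dens[OF f,of 1]by simp
also have "ennreal c * ... = ennreal(c * k * (Hnorm(itri t)1 f)\<^sup>2)"
 using c(1)k by(simp add: ennreal_mult mult.assoc)
finally show "(\<integral>\<^sup>+s. ennreal((f(p + (s / 2) *\<^sub>R(q - p)))\<^sup>2) * indicator{0..1}s\<partial>lborel)\<le>ennreal(c * k * (Hnorm(itri t)1 f)\<^sup>2)" .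
qed(use c(1)k in auto)
qed

end

text \<open>Each substitution contributes a factor \<open>1/2\<close>, which is simply estimated by
  1.\<close>

lemma nn_integral_unit_halves:
assumes[measurable]:"h\<in>borel_measurable borel"
shows "(\<integral>\<^sup>+s. h s * indicator{0..1::real}s\<partial>lborel)\<le>
(\<integral>\<^sup>+s. h(s / 2) * indicator{0..1}s\<partial>lborel) + (\<integral>\<^sup>+s. h(1 - s / 2) * indicator{0..1}s\<partial>lborel)"
proof -
have half:"ennreal(1/2) * x\<le>x"for x
proof -
have "ennreal(1/2)\<le>1"using ennreal_leI[of "1/2"1]by(simp only: ennreal_1)
from mult_right_mono[OF this,of x]show ?thesis by simp
qed
have "(\<integral>\<^sup>+s. h s * indicator{0..1::real}s\<partial>lborel)\<le>(\<integral>\<^sup>+s. h s * indicator{0..1/2}s + h s * indicator{1/2..1}s\<partial>lborel)"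
by(intro nn_integral_mono)(auto simp: indicator_def)
also have "... = (\<integral>\<^sup>+s. h s * indicator{0..1/2}s\<partial>lborel) + (\<integral>\<^sup>+s. h s * indicator{1/2..1}s\<partial>lborel)"
by(intro nn_integral_add)measurable
also have "(\<integral>\<^sup>+s. h s * indicator{0..1/2}s\<partial>lborel) = ennreal(1/2) * (\<integral>\<^sup>+s. h(0 + (1/2) * s) * indicator{0..1/2}(0 + (1/2) * s)\<partial>lborel)"
using nn_integral_real_affine[of "%s. h s * indicator{0..1/2}s""1/2"0]by simp
also have "...\<le>(\<integral>\<^sup>+s. h(s / 2) * indicator{0..1}s\<partial>lborel)"
by(rule half[THEN order_trans],rule nn_integral_mono)(auto simp: indicator_def)
also have "(\<integral>\<^sup>+s. h s * indicator{1/2..1}s\<partial>lborel) = ennreal(1/2) * (\<integral>\<^sup>+s. h(1 + (-1/2) * s) * indicator{1/2..1}(1 + (-1/2) * s)\<partial>lborel)"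
using nn_integral_real_affine[of "%s. h s * indicator{1/2..1}s""-1/2"1]by simp
also have "...\<le>(\<integral>\<^sup>+s. h(1 - s / 2) * indicator{0..1}s\<partial>lborel)"
by(rule half[THEN order_trans],rule nn_integral_mono)(auto simp: indicator_def)
finally show ?thesis by(simp add: add_mono)
qed

section \<open>Traces on edges\<close>

abbreviation "M01\<equiv>lebesgue_on{0..1::real}"

lemma finite_M01:"finite_measure M01"
by(rule finite_measure_lebesgue_on)simp

lemma edge_param:
assumes "card e = 2"
obtains p q where "e = {p,q}""p\<noteq>q""edge_param e = (%s. p + s *\<^sub>R(q - p))"
proof -
obtain p q where "e = {p,q}""p\<noteq>q"using assms by(auto simp: card_2_iff)
hence "\<exists>ga. \<exists>p q. e = {p,q}&ga = (%s. (1 - s) *\<^sub>R p + s *\<^sub>R q)"by blast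
from someI_ex[OF this]obtain p q where pq:"e = {p,q}""edge_param e = (%s. (1 - s) *\<^sub>R p + s *\<^sub>R q)"
unfolding edge_param_def[symmetric]by blast
moreover have "p\<noteq>q"using assms pq(1)by auto
ultimately show thesis using that[of p q]by(auto simp: algebra_simps)
qed

lemma edge_len_pos: assumes "card e = 2"shows "0 < edge_len e"
proof -
obtain p q where pq:"e = {p,q}""p\<noteq>q"using assms by(auto simp: card_2_iff)
have "dist p q\<le>diameter e"using pq by(intro diameter_bounded_bound)auto
thus ?thesis using pq by(simp add: edge_len_def)(meson dist_pos_lt less_le_trans)
qed

lemma edge_int_square:"edge_int e(%x. (f x)\<^sup>2) = edge_len e * (norm2 M01(%s. f(edge_param e s)))\<^sup>2"
by(simp add: edge_int_def norm2_square)

text \<open>The predicate from which \<open>edge_trace\<close> selects, isolated so that existence,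
  linearity and uniqueness can be stated for it.\<close>

definition is_trace ::"pt set=>pt set=>fld=>fld=>bool"where
"is_trace t e g ta\<longleftrightarrow>(%s. ta(edge_param e s))\<in>L2 M01&
 (\<exists>ph :: nat=>fld. (\<forall>j. smooth(ph j))&
 (%j. Hnorm(itri t)1(%x. ph j x - g x))---->0&
 (%j. edge_int e(%x. (ph j x - ta x)\<^sup>2))---->0)"

lemma edge_trace_eq:"edge_trace t e g = (SOME ta. is_trace t e g ta)"
by(simp add: edge_trace_def is_trace_def)

lemma smooth_edge_L2: assumes "card e = 2""smooth ph"shows "(%s. ph(edge_param e s))\<in>L2 M01"
proof -
obtain p q where pq:"e = {p,q}""edge_param e = (%s. p + s *\<^sub>R(q - p))"using assms(1)by(rule edge_param)
have c:"continuous_on UNIV(%s. ph(p + s *\<^sub>R(q - p)))"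
by(intro continuous_on_compose2[OF smooth_continuous_on[OF assms(2),of UNIV]]continuous_intros)auto
have "bounded((%s. ph(p + s *\<^sub>R(q - p))) ` {0..1})"
by(intro compact_imp_bounded compact_continuous_image continuous_on_subset[OF c])auto
then obtain B where "\<forall>s\<in>{0..1}. \<bar>ph(p + s *\<^sub>R(q - p))\<bar>\<le>B"by(auto simp: bounded_iff)
thus ?thesis unfolding pq(2)
by(intro L2_bounded[OF finite_M01 borel_measurable_lebesgue_on[OF borel_measurable_continuous_onI[OF c]],of B]AE_I2)simp
qed

lemma is_trace_iff:
assumes "card e = 2"
shows "is_trace t e g ta\<longleftrightarrow>(%s. ta(edge_param e s))\<in>L2 M01&
 (\<exists>ph :: nat=>fld. (\<forall>j. smooth(ph j))&
 (%j. Hnorm(itri t)1(%x. ph j x - g x))---->0&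
 (%j. norm2 M01(%s. ph j(edge_param e s) - ta(edge_param e s)))---->0)"
proof -
have l:"edge_len e\<noteq>0"using edge_len_pos[OF assms]by simp
have "(%j. edge_int e(%x. (ph j x - ta x)\<^sup>2))---->0\<longleftrightarrow>
 (%j. norm2 M01(%s. ph j(edge_param e s) - ta(edge_param e s)))---->0"for ph ::"nat=>fld"
proof
assume "(%j. edge_int e(%x. (ph j x - ta x)\<^sup>2))---->0"
hence "(%j. (1 / edge_len e) * edge_int e(%x. (ph j x - ta x)\<^sup>2))---->(1 / edge_len e) * 0"by(intro tendsto_intros)
hence "(%j. (norm2 M01(%s. ph j(edge_param e s) - ta(edge_param e s)))\<^sup>2)---->0"
 using l by(simp add: edge_int_square)
from tendsto_real_sqrt[OF this]show "(%j. norm2 M01(%s. ph j(edge_param e s) - ta(edge_param e s)))---->0"by simp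
next
assume "(%j. norm2 M01(%s. ph j(edge_param e s) - ta(edge_param e s)))---->0"
hence "(%j. edge_len e * (norm2 M01(%s. ph j(edge_param e s) - ta(edge_param e s)))\<^sup>2)---->edge_len e * 0\<^sup>2"
 by(intro tendsto_intros)
thus "(%j. edge_int e(%x. (ph j x - ta x)\<^sup>2))---->0"by(simp add: edge_int_square)
qed
thus ?thesis unfolding is_trace_def by simp
qed

context triangle
begin

lemma edge_bound:
assumes e:"card e = 2""e\<subseteq>t"
obtains C where "0\<le>C""!!f. smooth f==>norm2 M01(%s. f(edge_param e s))\<le>C * Hnorm(itri t)1 f"
proof -
obtain p q where pq:"e = {p,q}""p\<noteq>q""edge_param e = (%s. p + s *\<^sub>R(q - p))"using e(1)by(rule edge_param)
obtain z where z:"t = {p,q,z}""z\<noteq>p""z\<noteq>q"using vertices[of p q]e(2)pq by auto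
have t2:"t = {q,p,z}"using z by auto
obtain C1 where C1:"0\<le>C1""!!f. smooth f==>
 (\<integral>\<^sup>+s. ennreal((f(p + (s / 2) *\<^sub>R(q - p)))\<^sup>2) * indicator{0..1}s\<partial>lborel)\<le>ennreal(C1 * (Hnorm(itri t)1 f)\<^sup>2)"
using corner_bound[OF z(1)pq(2)z(2,3)]by blast
obtain C2 where C2:"0\<le>C2""!!f. smooth f==>
 (\<integral>\<^sup>+s. ennreal((f(q + (s / 2) *\<^sub>R(p - q)))\<^sup>2) * indicator{0..1}s\<partial>lborel)\<le>ennreal(C2 * (Hnorm(itri t)1 f)\<^sup>2)"
using corner_bound[OF t2 pq(2)[symmetric]z(3,2)]by blast
show thesis
proof(rule that[of "sqrt(C1 + C2)"])
fix f :: fld assume f:"smooth f"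
let ?H = "Hnorm(itri t)1 f"
have[measurable]:"f\<in>borel_measurable borel"by(rule smooth_measurable[OF f])
have "ennreal((norm2 M01(%s. f(edge_param e s)))\<^sup>2) = (\<integral>\<^sup>+s. ennreal((f(edge_param e s))\<^sup>2)\<partial>M01)"
 by(rule nn_integral_norm2[OF smooth_edge_L2[OF e(1)f],symmetric])
also have "... = (\<integral>\<^sup>+s. ennreal((f(p + s *\<^sub>R(q - p)))\<^sup>2) * indicator{0..1}s\<partial>lborel)"
 unfolding pq(3)by(subst nn_integral_restrict_space)(auto simp: nn_integral_completion)
also have "...\<le>(\<integral>\<^sup>+s. ennreal((f(p + (s / 2) *\<^sub>R(q - p)))\<^sup>2) * indicator{0..1}s\<partial>lborel)
 + (\<integral>\<^sup>+s. ennreal((f(p + (1 - s / 2) *\<^sub>R(q - p)))\<^sup>2) * indicator{0..1}s\<partial>lborel)"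
 by(rule nn_integral_unit_halves)measurable
also have "(\<integral>\<^sup>+s. ennreal((f(p + (s / 2) *\<^sub>R(q - p)))\<^sup>2) * indicator{0..1}s\<partial>lborel)
 + (\<integral>\<^sup>+s. ennreal((f(p + (1 - s / 2) *\<^sub>R(q - p)))\<^sup>2) * indicator{0..1}s\<partial>lborel)\<le>
 ennreal(C1 * ?H\<^sup>2) + ennreal(C2 * ?H\<^sup>2)"
proof -
 have "(%s::real. p + (1 - s / 2) *\<^sub>R(q - p)) = (%s. q + (s / 2) *\<^sub>R(p - q))"
 by(auto simp: algebra_simps)
 hence "p + (1 - s / 2) *\<^sub>R(q - p) = q + (s / 2) *\<^sub>R(p - q)"for s by meson
 thus ?thesis using C1(2)[OF f]C2(2)[OF f]by(simp only: add_mono)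
qed
also have "... = ennreal((sqrt(C1 + C2) * ?H)\<^sup>2)"
 using C1(1)C2(1)by(subst ennreal_plus[symmetric])(auto simp: power_mult_distrib distrib_right)
finally have "ennreal((norm2 M01(%s. f(edge_param e s)))\<^sup>2)\<le>ennreal((sqrt(C1 + C2) * ?H)\<^sup>2)" .
hence "(norm2 M01(%s. f(edge_param e s)))\<^sup>2\<le>(sqrt(C1 + C2) * ?H)\<^sup>2"
 using zero_le_power2 ennreal_le_iff by blast
thus "norm2 M01(%s. f(edge_param e s))\<le>sqrt(C1 + C2) * ?H"
 by(rule power2_le_imp_le)(use C1(1)C2(1)in simp)
qed(use C1 C2 in auto)
qed

text \<open>Smooth functions that approximate \<open>g\<close> in \<open>H^1\<close> have
  restrictions to the edge that form a Cauchy sequence, by \<open>edge_bound\<close>.\<close>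

lemma trace_exists:
assumes e:"card e = 2""e\<subseteq>t"and g:"g\<in>Hs(itri t)1"
shows "\<exists>ta. is_trace t e g ta"
proof -
obtain C where C:"0\<le>C""!!f. smooth f==>norm2 M01(%s. f(edge_param e s))\<le>C * Hnorm(itri t)1 f"
using edge_bound[OF e]by blast
obtain p q where pq:"e = {p,q}""p\<noteq>q""edge_param e = (%s. p + s *\<^sub>R(q - p))"using e(1)by(rule edge_param)
have "g\<in>Hs(itri t)(real 1)"using g by simp
then obtain ph where ph':"\<forall>n. smooth(ph n)""(%n. Hnorm(itri t)(real 1)(%x. ph n x - g x))---->0"
by(rule Hs_smooth_dense[OF K_convex K_nonempty])
note ph = ph'(1)[rule_format]ph'(2)
have phlim:"(%n. Hnorm(itri t)1(%x. ph n x - g x))---->0"using ph(2)by simp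
have phH:"ph n\<in>Hs(itri t)1"for n using smooth_Hs(1)[OF ph(1),of n 1]by simp
let ?f = "%n s. ph n(edge_param e s)"
have fL2:"?f n\<in>L2 M01"for n by(rule smooth_edge_L2[OF e(1)ph(1)])
have cauchy:"\<exists>N. \<forall>m\<ge>N. \<forall>n\<ge>N. norm2 M01(%s. ?f m s - ?f n s) < ep"if "0 < ep"for ep
proof -
have "0 < ep / (2 * (C + 1))"using that C(1)by simp
then obtain N where N:"!!n. n\<ge>N==>Hnorm(itri t)1(%x. ph n x - g x) < ep / (2 * (C + 1))"
 using order_tendstoD(2)[OF phlim]by(force simp: eventually_sequentially)
have "norm2 M01(%s. ?f m s - ?f n s) < ep"if "m\<ge>N""n\<ge>N"for m n
proof -
 have "norm2 M01(%s. ?f m s - ?f n s)\<le>C * Hnorm(itri t)1(%x. ph m x - ph n x)"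
 using C(2)[OF smooth_diff[OF ph(1)ph(1)]] .
 also have "Hnorm(itri t)1(%x. ph m x - ph n x)\<le>Hnorm(itri t)1(%x. ph m x - g x) + Hnorm(itri t)1(%x. g x - ph n x)"
 by(rule H1.nrm_triangle[OF phH phH g])
 also have "Hnorm(itri t)1(%x. g x - ph n x) = Hnorm(itri t)1(%x. ph n x - g x)"
 by(rule H1.nrm_commute[OF g phH])
 also have "C * (Hnorm(itri t)1(%x. ph m x - g x) + Hnorm(itri t)1(%x. ph n x - g x))\<le>C * (ep / (2 * (C + 1)) + ep / (2 * (C + 1)))"
 using N[OF that(1)]N[OF that(2)]C(1)by(intro mult_left_mono)auto
 also have "ep / (2 * (C + 1)) + ep / (2 * (C + 1)) = (2 * ep) / (2 * (C + 1))"
 unfolding add_divide_distrib[symmetric]by simp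
 also have "C * ((2 * ep) / (2 * (C + 1))) = C / (C + 1) * ep"
 by(subst mult_divide_mult_cancel_left)auto
 also have "... < 1 * ep"using C(1) \<open>0 < ep\<close> by(intro mult_strict_right_mono)(auto simp: field_simps)
 finally show ?thesis using C(1)by(simp add: mult_left_mono)
qed
thus ?thesis by blast
qed
obtain F where F:"F\<in>L2 M01""(%n. norm2 M01(%s. ?f n s - F s))---->0"
by(rule L2_complete[of ?f M01,OF fL2 cauchy])
\<comment> \<open>The limit is a function of the edge parameter; since the parametrization is
  injective, it can be carried over to points of the plane.\<close>
define ta where "ta x = F(inv(edge_param e)x)"for x
have "inj(edge_param e)"unfolding pq(3)using pq(2)by(auto intro!: injI)
hence ta:"ta(edge_param e s) = F s"for s by(simp add: ta_def)
have "is_trace t e g ta"unfolding is_trace_iff[OF e(1)]ta using F ph(1)phlim by blast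
thus ?thesis by blast
qed

lemma is_trace_lin:
assumes e:"card e = 2"and g:"g\<in>Hs(itri t)1""g' \<in>Hs(itri t)1"
and ta:"is_trace t e g ta""is_trace t e g' ta'"
shows "is_trace t e(%x. c * g x + g' x)(%x. c * ta x + ta' x)"
proof -
let ?p = "edge_param e"
obtain ph where ph:"(%s. ta(?p s))\<in>L2 M01""!!j. smooth(ph j)""(%j. Hnorm(itri t)1(%x. ph j x - g x))---->0"
"(%j. norm2 M01(%s. ph j(?p s) - ta(?p s)))---->0"using ta(1)unfolding is_trace_iff[OF e]by blast
obtain psz where psz:"(%s. ta' (?p s))\<in>L2 M01""!!j. smooth(psz j)""(%j. Hnorm(itri t)1(%x. psz j x - g' x))---->0"
"(%j. norm2 M01(%s. psz j(?p s) - ta' (?p s)))---->0"using ta(2)unfolding is_trace_iff[OF e]by blast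
have H:"smooth f==>f\<in>Hs(itri t)1"for f using smooth_Hs(1)[of f 1]by simp
have "(%j. Hnorm(itri t)1(%x. (c * ph j x + psz j x) - (c * g x + g' x)))---->0"
proof(rule Lim_null_comparison[where g = "%j. \<bar>c\<bar> * Hnorm(itri t)1(%x. ph j x - g x) + Hnorm(itri t)1(%x. psz j x - g' x)"])
show "(%j. \<bar>c\<bar> * Hnorm(itri t)1(%x. ph j x - g x) + Hnorm(itri t)1(%x. psz j x - g' x))---->0"
 using tendsto_add[OF tendsto_mult_right_zero[OF ph(3),of "\<bar>c\<bar>"]psz(3)]by simp
have d1:"(%x. ph j x - g x)\<in>Hs(itri t)1"for j by(intro H1.diff_mem H ph g)
have d2:"(%x. psz j x - g' x)\<in>Hs(itri t)1"for j by(intro H1.diff_mem H psz g)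
have "Hnorm(itri t)1(%x. (c * ph j x + psz j x) - (c * g x + g' x))\<le>\<bar>c\<bar> * Hnorm(itri t)1(%x. ph j x - g x) + Hnorm(itri t)1(%x. psz j x - g' x)"for j
 using H1.nrm_add[OF H1.cmult_mem[OF d1]d2,of c j j]H1.nrm_cmult[OF d1,of c j]by(simp add: algebra_simps)
thus "\<forall>\<^sub>F j in sequentially. norm(Hnorm(itri t)1(%x. (c * ph j x + psz j x) - (c * g x + g' x)))\<le>\<bar>c\<bar> * Hnorm(itri t)1(%x. ph j x - g x) + Hnorm(itri t)1(%x. psz j x - g' x)"
 by simp
qed
moreover have "(%j. norm2 M01(%s. (c * ph j(?p s) + psz j(?p s)) - (c * ta(?p s) + ta' (?p s))))---->0"
proof(rule Lim_null_comparison[where g = "%j. \<bar>c\<bar> * norm2 M01(%s. ph j(?p s) - ta(?p s)) + norm2 M01(%s. psz j(?p s) - ta' (?p s))"])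
show "(%j. \<bar>c\<bar> * norm2 M01(%s. ph j(?p s) - ta(?p s)) + norm2 M01(%s. psz j(?p s) - ta' (?p s)))---->0"
 using tendsto_add[OF tendsto_mult_right_zero[OF ph(4),of "\<bar>c\<bar>"]psz(4)]by simp
have d1:"(%s. ph j(?p s) - ta(?p s))\<in>L2 M01"for j by(intro Submission.L2.diff_mem smooth_edge_L2 e ph)
have d2:"(%s. psz j(?p s) - ta' (?p s))\<in>L2 M01"for j by(intro Submission.L2.diff_mem smooth_edge_L2 e psz)
have "norm2 M01(%s. (c * ph j(?p s) + psz j(?p s)) - (c * ta(?p s) + ta' (?p s)))\<le>\<bar>c\<bar> * norm2 M01(%s. ph j(?p s) - ta(?p s)) + norm2 M01(%s. psz j(?p s) - ta' (?p s))"for j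
 using Submission.L2.nrm_add[OF Submission.L2.cmult_mem[OF d1]d2,of c j j]Submission.L2.nrm_cmult[OF d1,of c j]by(simp add: algebra_simps)
thus "\<forall>\<^sub>F j in sequentially. norm(norm2 M01(%s. (c * ph j(?p s) + psz j(?p s)) - (c * ta(?p s) + ta' (?p s))))\<le>\<bar>c\<bar> * norm2 M01(%s. ph j(?p s) - ta(?p s)) + norm2 M01(%s. psz j(?p s) - ta' (?p s))"
 by simp
qed
moreover have "\<forall>j. smooth(%x. c * ph j x + psz j x)"by(intro allI smooth_add smooth_cmult ph psz)
ultimately have "\<exists>ph. (\<forall>j. smooth(ph j))&(%j. Hnorm(itri t)1(%x. ph j x - (c * g x + g' x)))---->0&
 (%j. norm2 M01(%s. ph j(?p s) - (c * ta(?p s) + ta' (?p s))))---->0"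
by(intro exI[of _ "%j x. c * ph j x + psz j x"]conjI)
thus ?thesis unfolding is_trace_iff[OF e]by(rule conjI[OF Submission.L2.lin_mem[OF ph(1)psz(1)]])
qed

text \<open>Two approximating sequences approach each other in \<open>H^1\<close>, hence also on the
  edge by \<open>edge_bound\<close>.\<close>

lemma is_trace_unique:
assumes e:"card e = 2""e\<subseteq>t"and g:"g\<in>Hs(itri t)1"
and ta:"is_trace t e g ta""is_trace t e g ta'"
shows "AE s in M01. ta(edge_param e s) = ta' (edge_param e s)"
proof -
let ?p = "edge_param e"
obtain C where C:"0\<le>C""!!f. smooth f==>norm2 M01(%s. f(edge_param e s))\<le>C * Hnorm(itri t)1 f"
using edge_bound[OF e]by blast
obtain ph where ph:"(%s. ta(?p s))\<in>L2 M01""!!j. smooth(ph j)""(%j. Hnorm(itri t)1(%x. ph j x - g x))---->0"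
"(%j. norm2 M01(%s. ph j(?p s) - ta(?p s)))---->0"using ta(1)unfolding is_trace_iff[OF e(1)]by blast
obtain psz where psz:"(%s. ta' (?p s))\<in>L2 M01""!!j. smooth(psz j)""(%j. Hnorm(itri t)1(%x. psz j x - g x))---->0"
"(%j. norm2 M01(%s. psz j(?p s) - ta' (?p s)))---->0"using ta(2)unfolding is_trace_iff[OF e(1)]by blast
have H:"smooth f==>f\<in>Hs(itri t)1"for f using smooth_Hs(1)[of f 1]by simp
note E = smooth_edge_L2[OF e(1)]
have "norm2 M01(%s. ta(?p s) - ta' (?p s))\<le>norm2 M01(%s. ph j(?p s) - ta(?p s)) +
 (C * (Hnorm(itri t)1(%x. ph j x - g x) + Hnorm(itri t)1(%x. psz j x - g x)) + norm2 M01(%s. psz j(?p s) - ta' (?p s)))"for j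
proof -
have "norm2 M01(%s. ta(?p s) - ta' (?p s))\<le>norm2 M01(%s. ta(?p s) - ph j(?p s)) + norm2 M01(%s. ph j(?p s) - ta' (?p s))"
 by(rule Submission.L2.nrm_triangle[OF ph(1)psz(1)E[OF ph(2)]])
moreover have "norm2 M01(%s. ph j(?p s) - ta' (?p s))\<le>norm2 M01(%s. ph j(?p s) - psz j(?p s)) + norm2 M01(%s. psz j(?p s) - ta' (?p s))"
 by(rule Submission.L2.nrm_triangle[OF E[OF ph(2)]psz(1)E[OF psz(2)]])
moreover have "norm2 M01(%s. ta(?p s) - ph j(?p s)) = norm2 M01(%s. ph j(?p s) - ta(?p s))"
 by(rule Submission.L2.nrm_commute[OF ph(1)E[OF ph(2)]])
moreover have "norm2 M01(%s. ph j(?p s) - psz j(?p s))\<le>C * Hnorm(itri t)1(%x. ph j x - psz j x)"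
 using C(2)[OF smooth_diff[OF ph(2)psz(2)]] .
moreover have "Hnorm(itri t)1(%x. ph j x - psz j x)\<le>Hnorm(itri t)1(%x. ph j x - g x) + Hnorm(itri t)1(%x. g x - psz j x)"
 by(rule H1.nrm_triangle[OF H[OF ph(2)]H[OF psz(2)]g])
moreover have "Hnorm(itri t)1(%x. g x - psz j x) = Hnorm(itri t)1(%x. psz j x - g x)"
 by(rule H1.nrm_commute[OF g H[OF psz(2)]])
ultimately show ?thesis using mult_left_mono[of "Hnorm(itri t)1(%x. ph j x - psz j x)"_ C]C(1)by fastforce
qed
note b = this
have l:"(%j. norm2 M01(%s. ph j(?p s) - ta(?p s)) +
 (C * (Hnorm(itri t)1(%x. ph j x - g x) + Hnorm(itri t)1(%x. psz j x - g x)) + norm2 M01(%s. psz j(?p s) - ta' (?p s))))---->0 + (C * (0 + 0) + 0)"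
by(intro tendsto_intros ph psz)
have "norm2 M01(%s. ta(?p s) - ta' (?p s))\<le>0 + (C * (0 + 0) + 0)"
by(rule LIMSEQ_le_const[OF l])(use b in blast)
hence "norm2 M01(%s. ta(?p s) - ta' (?p s)) = 0"using norm2_nonneg[of M01]by(simp add: antisym)
hence "AE s in M01. ta(?p s) - ta' (?p s) = 0"
using norm2_eq_0_iff[OF Submission.L2.diff_mem[OF ph(1)psz(1)]]by simp
thus ?thesis by eventually_elim simp
qed

end

section \<open>The discrete norm\<close>

context triangle
begin

text \<open>Inside the triangle the set where the functions differ is open and null, hence empty.
  The closed triangle is the closure of its interior, so vertices and edges follow by
  continuity.\<close>

lemma continuous_ae_unique:
assumes c:"continuous_on(convex hull t)f""continuous_on(convex hull t)g"and ae:"ae_eq(itri t)f g"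
and x:"x\<in>convex hull t"
shows "f x = g x"
proof -
have hc:"continuous_on(convex hull t)(%x. f x - g x)"by(intro continuous_intros c)
have hK:"continuous_on(itri t)(%x. f x - g x)"by(rule continuous_on_subset[OF hc interior_subset])
have "f y - g y = 0"if y:"y\<in>itri t"for y
proof(rule ccontr)
assume ne:"f y - g y\<noteq>0"
let ?U = "{w\<in>itri t. f w - g w\<noteq>0}"
have "?U = (%x. f x - g x) -` (- {0})\<inter>itri t"by auto
moreover have "open((%x. f x - g x) -` (- {0})\<inter>itri t)"
 using continuous_on_open_vimage[THEN iffD1,OF open_S hK]open_Compl[OF closed_singleton]by blast
ultimately have "open ?U"by simp
moreover have "AE w in lebesgue. w\<notin>?U"
 using ae S_sets unfolding ae_eq_def by(subst(asm)AE_restrict_space_iff)(auto elim!: eventually_mono)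
hence "negligible ?U"
 using \<open>open ?U\<close> by(simp add: negligible_iff_null_sets AE_iff_null_sets borel_open)
ultimately show False using open_not_negligible[of ?U]y ne by blast
qed
hence "f x - g x = 0"
using continuous_constant_on_closure[of "itri t""%x. f x - g x"0 x]hc x closure_K by auto
thus ?thesis by simp
qed

lemma continuous_L2: assumes "continuous_on(convex hull t)g"shows "g\<in>L2S(itri t)"
proof -
have "bounded(g ` (convex hull t))"by(intro compact_imp_bounded compact_continuous_image assms compact_hull)
then obtain B where B:"\<forall>x\<in>convex hull t. \<bar>g x\<bar>\<le>B"by(auto simp: bounded_iff)
have "g\<in>borel_measurable(lebesgue_on(itri t))"
using continuous_on_subset[OF assms interior_subset]S_sets by(rule continuous_imp_measurable_on_sets_lebesgue)
thus ?thesis using B interior_subset[of "convex hull t"]lmeasurable_open[OF bounded_S open_S]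
by(intro L2_bounded[OF finite_measure_lebesgue_on,of _ _ B]AE_I2)auto
qed

text \<open>By \<open>sup_bound\<close> smooth approximations in \<open>H^2\<close> are uniformly
  Cauchy on the closed triangle; their uniform limit is the representative. This is what makes the
  choice in \<open>pt_val\<close> meaningful.\<close>

lemma continuous_representative:
assumes v:"v\<in>Hs(itri t)2"
shows "\<exists>g. continuous_on(convex hull t)g&ae_eq(itri t)v g"
proof -
obtain C where C:"0\<le>C""!!f x. smooth f==>x\<in>convex hull t==>\<bar>f x\<bar>\<le>C * Hnorm(itri t)2 f"
using sup_bound by blast
have "v\<in>Hs(itri t)(real 2)"using v by simp
then obtain ph where ph':"\<forall>n. smooth(ph n)""(%n. Hnorm(itri t)(real 2)(%x. ph n x - v x))---->0"
by(rule Hs_smooth_dense[OF K_convex K_nonempty])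
note ph = ph'(1)[rule_format]
have lim:"(%n. Hnorm(itri t)2(%x. ph n x - v x))---->0"using ph'(2)by simp
have phH:"ph n\<in>Hs(itri t)2"for n using smooth_Hs(1)[OF ph,of n 2]by simp
have cauchy:"\<exists>N. \<forall>m n x. N\<le>m&N\<le>n&x\<in>convex hull t-->dist(ph m x)(ph n x) < ep"if "0 < ep"for ep
proof -
have pos:"0 < ep / (2 * (C + 1))"using that C(1)by simp
obtain N where N:"!!n. n\<ge>N==>Hnorm(itri t)2(%x. ph n x - v x) < ep / (2 * (C + 1))"
 using order_tendstoD(2)[OF lim pos]unfolding eventually_sequentially by blast
have "dist(ph m x)(ph n x) < ep"if "m\<ge>N""n\<ge>N""x\<in>convex hull t"for m n x
proof -
 have "\<bar>ph m x - ph n x\<bar>\<le>C * Hnorm(itri t)2(%x. ph m x - ph n x)"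
 by(rule C(2)[OF smooth_diff[OF ph ph]that(3)])
 also have "...\<le>(C + 1) * Hnorm(itri t)2(%x. ph m x - ph n x)"by(intro mult_right_mono)auto
 also have "Hnorm(itri t)2(%x. ph m x - ph n x)\<le>Hnorm(itri t)2(%x. ph m x - v x) + Hnorm(itri t)2(%x. v x - ph n x)"
 by(rule H2.nrm_triangle[OF phH phH v])
 also have "Hnorm(itri t)2(%x. v x - ph n x) = Hnorm(itri t)2(%x. ph n x - v x)"
 by(rule H2.nrm_commute[OF v phH])
 also have "(C + 1) * (Hnorm(itri t)2(%x. ph m x - v x) + Hnorm(itri t)2(%x. ph n x - v x)) < (C + 1) * (ep / (2 * (C + 1)) + ep / (2 * (C + 1)))"
 using N[OF that(1)]N[OF that(2)]C(1)by(intro mult_strict_left_mono add_strict_mono)auto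
 also have "ep / (2 * (C + 1)) + ep / (2 * (C + 1)) = (2 * ep) / (2 * (C + 1))"
 unfolding add_divide_distrib[symmetric]by simp
 also have "(C + 1) * ((2 * ep) / (2 * (C + 1))) = ep"
 using C(1)by(subst mult_divide_mult_cancel_left)auto
 finally show ?thesis using C(1)by(simp add: dist_norm)
qed
thus ?thesis by blast
qed
then obtain g where g:"\<forall>ep>0. \<exists>N. \<forall>n x. N\<le>n&x\<in>convex hull t-->dist(ph n x)(g x) < ep"
using uniformly_convergent_eq_cauchy[of "%x. x\<in>convex hull t"ph]by blast
hence ul:"uniform_limit(convex hull t)ph g sequentially"
unfolding uniform_limit_iff eventually_sequentially by blast
have gc:"continuous_on(convex hull t)g"
by(rule uniform_limit_theorem[OF _ ul])(auto intro!: always_eventually smooth_continuous_on ph)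
have gL2:"g\<in>L2S(itri t)"by(rule continuous_L2[OF gc])
have phL2:"ph n\<in>L2S(itri t)"for n using phH by(rule Hs_L2)
have vL2:"v\<in>L2S(itri t)"using v by(rule Hs_L2)
define muz where "muz = sqrt(measure(lebesgue_on(itri t))(itri t))"
have "L2norm(itri t)(%x. v x - g x)\<le>0 + ep * (1 + muz)"if e0:"0 < ep"for ep
proof -
obtain N where N:"\<forall>n x. N\<le>n&x\<in>convex hull t-->dist(ph n x)(g x) < ep"using g e0 by blast
obtain N' where N':"!!n. n\<ge>N' ==>Hnorm(itri t)2(%x. ph n x - v x) < ep"
 using order_tendstoD(2)[OF lim e0]unfolding eventually_sequentially by blast
let ?n = "max N N'"
have "L2norm(itri t)(%x. v x - g x)\<le>L2norm(itri t)(%x. v x - ph ?n x) + L2norm(itri t)(%x. ph ?n x - g x)"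
 by(rule L2.nrm_triangle[OF vL2 gL2 phL2])
also have "L2norm(itri t)(%x. v x - ph ?n x) = L2norm(itri t)(%x. ph ?n x - v x)"
 by(rule L2.nrm_commute[OF vL2 phL2])
also have "...\<le>Hnorm(itri t)2(%x. ph ?n x - v x)"
 by(intro L2norm_le_Hnorm L2.diff_mem phL2 vL2)
also have "...\<le>ep"using N'[of ?n]by simp
also have "L2norm(itri t)(%x. ph ?n x - g x)\<le>ep * muz"
 unfolding L2norm_eq_norm2 muz_def
proof(rule order_trans[OF norm2_bounded[of _ _ ep]])
 show "finite_measure(lebesgue_on(itri t))"
 by(intro finite_measure_lebesgue_on lmeasurable_open bounded_S open_S)
 show "(%x. ph ?n x - g x)\<in>borel_measurable(lebesgue_on(itri t))"
 using L2_measurable[OF phL2]L2_measurable[OF gL2]by measurable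
 show "AE x in lebesgue_on(itri t). \<bar>ph ?n x - g x\<bar>\<le>ep"
 proof(rule AE_I2)
 fix x assume "x\<in>space(lebesgue_on(itri t))"
 hence "x\<in>convex hull t"using interior_subset by auto
 hence "dist(ph ?n x)(g x) < ep"using N by simp
 thus "\<bar>ph ?n x - g x\<bar>\<le>ep"by(simp add: dist_norm)
 qed
qed(use that in auto)
finally show ?thesis by(simp add: algebra_simps)
qed
note bnd = this
have "L2norm(itri t)(%x. v x - g x)\<le>0 + ep"if "0 < ep"for ep
proof -
have muz:"0\<le>muz"by(simp add: muz_def)
have "L2norm(itri t)(%x. v x - g x)\<le>0 + ep / (1 + muz) * (1 + muz)"
 using bnd[of "ep / (1 + muz)"]that muz by simp
thus ?thesis using muz by simp
qed
hence "L2norm(itri t)(%x. v x - g x)\<le>0"by(rule field_le_epsilon)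
hence "ae_eq(itri t)v g"unfolding ae_eq_L2[OF vL2 gL2]using L2norm_nonneg by(simp add: antisym)
thus ?thesis using gc by blast
qed

lemma pt_val:
assumes "v\<in>Hs(itri t)2"
shows "continuous_on(convex hull t)(pt_val t v)""ae_eq(itri t)v(pt_val t v)"
using someI_ex[OF continuous_representative[OF assms]]unfolding pt_val_def by auto

lemma pt_val_lin:
assumes v:"v\<in>Hs(itri t)2"and w:"w\<in>Hs(itri t)2"and z:"z\<in>convex hull t"
shows "pt_val t(%x. c * v x + w x)z = c * pt_val t v z + pt_val t w z"
proof(rule continuous_ae_unique[OF _ _ _ z])
show "continuous_on(convex hull t)(pt_val t(%x. c * v x + w x))"
by(intro pt_val H2.lin_mem v w)
show "continuous_on(convex hull t)(%z. c * pt_val t v z + pt_val t w z)"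
by(intro continuous_intros pt_val v w)
have "ae_eq(itri t)(pt_val t(%x. c * v x + w x))(%x. c * v x + w x)"
by(intro ae_eq_sym[OF pt_val(2)]H2.lin_mem v w)
moreover have "ae_eq(itri t)(%x. c * v x + w x)(%z. c * pt_val t v z + pt_val t w z)"
by(intro ae_eq_lin pt_val v w)
ultimately show "ae_eq(itri t)(pt_val t(%x. c * v x + w x))(%z. c * pt_val t v z + pt_val t w z)"
by(rule ae_eq_trans)
qed

lemma wderiv_H1:
assumes v:"v\<in>Hs(itri t)2"and b:"b\<in>Basis"
shows "wderiv(itri t)[b]v\<in>Hs(itri t)1"
proof -
have 1:"has_wderiv(itri t)[b]v"by(rule Hs_2_wderiv[OF v,of 1])(use b in "auto simp: dirs_def")
have "has_wderiv(itri t)bs(wderiv(itri t)[b]v)"if j:"j\<le>1""bs\<in>dirs j"for j bs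
proof(cases "j = 0")
case True
thus ?thesis using j wderiv_Nil(1)[OF wderiv(1)[OF 1]]by simp
next
case False
then obtain c where c:"bs = [c]""c\<in>Basis"using j by(auto simp: dirs_def length_Suc_conv le_Suc_eq)
have 2:"has_wderiv(itri t)[b,c]v"by(rule Hs_2_wderiv[OF v,of 2])(use b c in "auto simp: dirs_def")
show ?thesis unfolding c(1)has_wderiv_def
 using weak_deriv_step[OF wderiv(2)[OF 1]wderiv(2)[OF 2]c(2)]wderiv(1)[OF 2]by blast
qed
hence "wderiv(itri t)[b]v\<in>Hs(itri t)(real 1)"unfolding Hs_nat using wderiv(1)[OF 1]by blast
thus ?thesis by simp
qed

lemma normal_deriv_H1:"v\<in>Hs(itri t)2==>normal_deriv t e v\<in>Hs(itri t)1"
unfolding normal_deriv_def by(intro H1.sum_mem H1.cmult_mem wderiv_H1)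

lemma normal_deriv_lin:
assumes v:"v\<in>Hs(itri t)2"and w:"w\<in>Hs(itri t)2"
shows "ae_eq(itri t)(normal_deriv t e(%x. c * v x + w x))(%x. c * normal_deriv t e v x + normal_deriv t e w x)"
proof -
have "ae_eq(itri t)(wderiv(itri t)[b] (%x. c * v x + w x))(%x. c * wderiv(itri t)[b]v x + wderiv(itri t)[b]w x)"
if b:"b\<in>Basis"for b
using v w b by(intro wderiv_lin(2)Hs_L2 Hs_2_wderiv[of _ 1])(auto simp: dirs_def)
hence "AE x in lebesgue_on(itri t). \<forall>b\<in>Basis. wderiv(itri t)[b] (%x. c * v x + w x)x = c * wderiv(itri t)[b]v x + wderiv(itri t)[b]w x"
unfolding ae_eq_def by(intro AE_finite_allI)auto
thus ?thesis unfolding ae_eq_def normal_deriv_def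
proof eventually_elim
case(elim x)
have "(\<Sum>b\<in>Basis. (edge_normal e\<bullet>b) * wderiv(itri t)[b] (%x. c * v x + w x)x)
 = (\<Sum>b\<in>Basis. c * ((edge_normal e\<bullet>b) * wderiv(itri t)[b]v x) + (edge_normal e\<bullet>b) * wderiv(itri t)[b]w x)"
 using elim by(intro sum.cong)(auto simp: algebra_simps)
thus ?case by(simp add: sum.distrib sum_distrib_left)
qed
qed

lemma is_trace_cong:
assumes "ae_eq(itri t)g g'""g\<in>Hs(itri t)1""g' \<in>Hs(itri t)1"
shows "is_trace t e g ta\<longleftrightarrow>is_trace t e g' ta"
proof -
have "Hnorm(itri t)1(%x. ph x - g x) = Hnorm(itri t)1(%x. ph x - g' x)"if "smooth ph"for ph :: fld
proof(rule Hs_cong(2))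
have "ph\<in>L2S(itri t)"using smooth_Hs(1)[OF that,of 0]by(rule Hs_L2)
thus "(%x. ph x - g x)\<in>L2S(itri t)""(%x. ph x - g' x)\<in>L2S(itri t)"
 using assms Hs_L2 by(auto intro: L2.diff_mem)
show "ae_eq(itri t)(%x. ph x - g x)(%x. ph x - g' x)"
 using assms(1)unfolding ae_eq_def by eventually_elim simp
qed
hence "(%j. Hnorm(itri t)1(%x. ph j x - g x)) = (%j. Hnorm(itri t)1(%x. ph j x - g' x))"
if "\<forall>j. smooth(ph j)"for ph ::"nat=>fld"using that by simp
thus ?thesis unfolding is_trace_def by(metis(no_types,lifting))
qed

definition tr ::"pt set=>fld=>real=>real"where
"tr e v s = edge_trace t e(normal_deriv t e v)(edge_param e s)"

lemma tr:
assumes e:"card e = 2""e\<subseteq>t"and v:"v\<in>Hs(itri t)2"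
shows "is_trace t e(normal_deriv t e v)(edge_trace t e(normal_deriv t e v))""tr e v\<in>L2 M01"
proof -
show *:"is_trace t e(normal_deriv t e v)(edge_trace t e(normal_deriv t e v))"
unfolding edge_trace_eq by(rule someI_ex[OF trace_exists[OF e normal_deriv_H1[OF v]]])
thus "tr e v\<in>L2 M01"unfolding tr_def[abs_def]is_trace_def by blast
qed

text \<open>The selected trace of the combination and the combination of the selected traces are
  both traces of the same \<open>H^1\<close> function, so uniqueness identifies them.\<close>

lemma tr_lin:
assumes e:"card e = 2""e\<subseteq>t"and v:"v\<in>Hs(itri t)2"and w:"w\<in>Hs(itri t)2"
shows "AE s in M01. tr e(%x. c * v x + w x)s = c * tr e v s + tr e w s"
proof -
let ?n = "normal_deriv t e"
have vw:"(%x. c * v x + w x)\<in>Hs(itri t)2"by(intro H2.lin_mem v w)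
have l:"(%x. c * ?n v x + ?n w x)\<in>Hs(itri t)1"by(intro H1.lin_mem normal_deriv_H1 v w)
have "is_trace t e(%x. c * ?n v x + ?n w x)(%x. c * edge_trace t e(?n v)x + edge_trace t e(?n w)x)"
by(intro is_trace_lin e normal_deriv_H1 v w tr)
moreover have "is_trace t e(%x. c * ?n v x + ?n w x)(edge_trace t e(?n(%x. c * v x + w x)))"
using tr(1)[OF e vw]is_trace_cong[OF normal_deriv_lin[OF v w]normal_deriv_H1[OF vw]l]by blast
ultimately show ?thesis unfolding tr_def using is_trace_unique[OF e l]by blast
qed

end

text \<open>Weighted squares of linear functionals may be added to a semidefinite form; the vertex
  jumps and the mean normal jumps of the discrete norm are both of this kind.\<close>

lemma semidef_functional_sum:
assumes "semidef_form V B"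
and "!!i v w c. i\<in>I==>v\<in>V==>w\<in>V==>l i(%x. c * v x + w x) = c * l i v + l i w"
and "!!i. i\<in>I==>(0::real)\<le>k i"
shows "semidef_form V(%v w. B v w + (\<Sum>i\<in>I. k i * (l i v * l i w)))"
proof -
interpret semidef_form V B by fact
show ?thesis
proof
fix v w z c assume v:"v\<in>V""w\<in>V""z\<in>V"
have "(\<Sum>i\<in>I. k i * (l i(%x. c * v x + w x) * l i z)) = (\<Sum>i\<in>I. c * (k i * (l i v * l i z)) + k i * (l i w * l i z))"
 using v assms(2)by(intro sum.cong)(auto simp: algebra_simps)
thus "B(%x. c * v x + w x)z + (\<Sum>i\<in>I. k i * (l i(%x. c * v x + w x) * l i z)) =
 c * (B v z + (\<Sum>i\<in>I. k i * (l i v * l i z))) + (B w z + (\<Sum>i\<in>I. k i * (l i w * l i z)))"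
 using lin_left[OF v]by(simp add: sum.distrib sum_distrib_left algebra_simps)
next
fix v assume "v\<in>V"
thus "0\<le>B v v + (\<Sum>i\<in>I. k i * (l i v * l i v))"
 by(intro add_nonneg_nonneg nonneg sum_nonneg mult_nonneg_nonneg[OF assms(3)zero_le_square])
qed(auto simp: zero_mem lin_mem sym mult.commute)
qed

section \<open>Triangulated polygons: gluing the triangles and the jump functionals\<close>

locale mesh =
fixes Om ::"pt set"and Tr ::"pt set set"
assumes mesh:"mesh_triangulation Om Tr"and polygon:"polygonal_lipschitz_domain Om"
begin

lemma finite_T:"finite Tr"using mesh by(simp add: mesh_triangulation_def)

lemma triangle:"t\<in>Tr==>triangle t"
using mesh by(simp add: mesh_triangulation_def triangle_def)

sublocale bounded_plane Om
using polygon by unfold_locales(auto simp: polygonal_lipschitz_domain_def)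

text \<open>The triangles cover the closure of the domain, so their interiors might contain boundary
  points. A Lipschitz domain excludes this, because it lies locally on one side of its boundary:
  below the graph there is an open set that misses the domain.\<close>

lemma interior_closure_Om:"interior(closure Om)\<subseteq>Om"
proof
fix p assume p:"p\<in>interior(closure Om)"
show "p\<in>Om"
proof(rule ccontr)
assume np:"p\<notin>Om"
hence "p\<in>frontier Om"using p interior_subset open_S by(auto simp: frontier_def interior_open)
then obtain a b r L g where a:"norm a = 1""norm b = 1""a\<bullet>b = 0""0 < r""L-lipschitz_on UNIV g"
 and iff:"\<forall>x. \<bar>a\<bullet>(x - p)\<bar> < r&\<bar>b\<bullet>(x - p)\<bar> < r-->(x\<in>Om\<longleftrightarrow>b\<bullet>(x - p) > g(a\<bullet>(x - p)))"
 using polygon unfolding polygonal_lipschitz_domain_def lipschitz_boundary_def by metis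
have g0:"g 0\<ge>0"using iff[rule_format,of p]np a(4)by simp
define U where "U = {x. b\<bullet>(x - p) < g(a\<bullet>(x - p))}\<inter>{x. \<bar>a\<bullet>(x - p)\<bar> < r}\<inter>{x. \<bar>b\<bullet>(x - p)\<bar> < r}"
have gc:"continuous_on UNIV g"using a(5)by(rule lipschitz_on_continuous_on)
have "continuous_on UNIV(%x. g(a\<bullet>(x - p)))"
 by(intro continuous_on_compose2[OF gc]continuous_intros)auto
hence "open U"unfolding U_def
 by(intro open_Int open_Collect_less continuous_intros)
moreover have "U\<inter>Om = {}"using iff unfolding U_def by auto
ultimately have Ucl:"U\<inter>closure Om = {}"using open_Int_closure_eq_empty by blast
obtain d where d:"0 < d""ball p d\<subseteq>closure Om"using p by(meson mem_interior)
define ep where "ep = min d r / 2"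
have ep:"0 < ep""ep < d""ep < r"using d a(4)by(auto simp: ep_def)
\<comment> \<open>As \<open>p\<close> is outside the domain, \<open>g 0\<close> is nonnegative, so
  moving from \<open>p\<close> against the direction \<open>b\<close> leads strictly below the
  graph.\<close>
define x where "x = p - ep *\<^sub>R b"
have "b\<bullet>b = 1"using a(2)by(simp add: norm_eq_1)
hence "x\<in>U"using ep a(3)g0 a(4)by(simp add: U_def x_def)
moreover have "x\<in>ball p d"using ep a(2)by(simp add: x_def dist_norm)
ultimately show False using Ucl d(2)by blast
qed
qed

lemma itri_subset: assumes "t\<in>Tr"shows "itri t\<subseteq>Om"
proof -
have "convex hull t\<subseteq>closure Om"using mesh assms unfolding mesh_triangulation_def by blast
thus ?thesis using interior_mono interior_closure_Om by blast
qed

lemma negligible_skeleton:"negligible(Om - (\<Union>t\<in>Tr. itri t))"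
proof(rule negligible_subset)
show "negligible(\<Union>t\<in>Tr. frontier(convex hull t))"
 proof(intro negligible_Union)
fix T assume "T\<in>(%t. frontier(convex hull t)) ` Tr"
then obtain t where "T = frontier(convex hull t)"by blast
thus "negligible T"by(simp only: negligible_convex_frontier[OF convex_convex_hull])
qed(rule finite_imageI[OF finite_T])
have "(\<Union>t\<in>Tr. convex hull t) = closure Om"using mesh by(simp add: mesh_triangulation_def)
hence "Om\<subseteq>(\<Union>t\<in>Tr. convex hull t)"using closure_subset[of Om]by simp
moreover have "convex hull t - itri t\<subseteq>frontier(convex hull t)"for t ::"pt set"
using closure_subset by(auto simp: frontier_def)
ultimately show "Om - (\<Union>t\<in>Tr. itri t)\<subseteq>(\<Union>t\<in>Tr. frontier(convex hull t))"by blast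
qed

text \<open>A piecewise function is controlled only on the open triangles, so measurability on the
  domain is assembled from the pieces and the null skeleton.\<close>

lemma piecewise_L2:
assumes w:"!!t. t\<in>Tr==>w\<in>L2S(itri t)"
shows "w\<in>L2S Om""(L2norm Om w)\<^sup>2\<le>(\<Sum>t\<in>Tr. (L2norm(itri t)w)\<^sup>2)"
proof -
let ?N = "Om - (\<Union>t\<in>Tr. itri t)"
have Ks:"itri t\<in>sets lebesgue"for t ::"pt set"by(simp add: open_sets_lebesgue)
have wm:"w\<in>borel_measurable(lebesgue_on Om)"
proof(rule borel_measurableI_greater)
fix y
have "{x\<in>space(lebesgue_on Om). y < w x} = (\<Union>t\<in>Tr. {x\<in>itri t. y < w x})\<union>{x\<in>?N. y < w x}"
 using itri_subset by auto
moreover have "{x\<in>itri t. y < w x}\<in>sets lebesgue"if "t\<in>Tr"for t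
proof -
 have "{x\<in>space(lebesgue_on(itri t)). y < w x}\<in>sets(lebesgue_on(itri t))"
 using L2_measurable[OF w[OF that]]by measurable
 thus ?thesis using Ks[of t]by(auto simp: sets_restrict_space_iff)
qed
moreover have "{x\<in>?N. y < w x}\<in>sets lebesgue"
 by(intro negligible_imp_sets negligible_subset[OF negligible_skeleton])auto
ultimately have "{x\<in>space(lebesgue_on Om). y < w x}\<in>sets lebesgue"
 using finite_T by(simp only:)(intro sets.Un sets.finite_UN)
thus "{x\<in>space(lebesgue_on Om). y < w x}\<in>sets(lebesgue_on Om)"
 using S_sets by(subst sets_restrict_space_iff)auto
qed
have "(\<integral>\<^sup>+x. ennreal((w x)\<^sup>2)\<partial>lebesgue_on Om) = (\<integral>\<^sup>+x. ennreal((w x)\<^sup>2) * indicator Om x\<partial>lebesgue)"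
using S_sets by(simp add: nn_integral_restrict_space)
also have "...\<le>(\<integral>\<^sup>+x. (\<Sum>t\<in>Tr. ennreal((w x)\<^sup>2) * indicator(itri t)x)\<partial>lebesgue)"
proof(rule nn_integral_mono_AE)
have "AE x in lebesgue. x\<notin>?N"
 using negligible_skeleton by(intro AE_not_in)(simp add: negligible_iff_null_sets)
thus "AE x in lebesgue. ennreal((w x)\<^sup>2) * indicator Om x\<le>(\<Sum>t\<in>Tr. ennreal((w x)\<^sup>2) * indicator(itri t)x)"
proof eventually_elim
 case(elim x)
 show ?case
 proof(cases "x\<in>Om")
 case True
 then obtain t where t:"t\<in>Tr""x\<in>itri t"using elim by blast
 have "ennreal((w x)\<^sup>2) * indicator(itri t)x\<le>(\<Sum>t\<in>Tr. ennreal((w x)\<^sup>2) * indicator(itri t)x)"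
  using t finite_T by(intro member_le_sum)auto
 thus ?thesis using t True by simp
 qed simp
qed
qed
also have "... = (\<Sum>t\<in>Tr. \<integral>\<^sup>+x. ennreal((w x)\<^sup>2) * indicator(itri t)x\<partial>lebesgue)"
proof(rule nn_integral_sum)
fix t assume t:"t\<in>Tr"
have "(%x. ennreal((w x)\<^sup>2))\<in>borel_measurable(lebesgue_on(itri t))"
 using L2_measurable[OF w[OF t]]by measurable
thus "(%x. ennreal((w x)\<^sup>2) * indicator(itri t)x)\<in>borel_measurable lebesgue"
 using Ks[of t]by(subst(asm)borel_measurable_restrict_space_iff_ennreal)auto
qed
also have "... = (\<Sum>t\<in>Tr. ennreal((L2norm(itri t)w)\<^sup>2))"
proof(rule sum.cong[OF refl])
fix t assume t:"t\<in>Tr"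
show "(\<integral>\<^sup>+x. ennreal((w x)\<^sup>2) * indicator(itri t)x\<partial>lebesgue) = ennreal((L2norm(itri t)w)\<^sup>2)"
 unfolding L2norm_eq_norm2 nn_integral_norm2[OF w[OF t],symmetric]using Ks[of t]by(simp add: nn_integral_restrict_space)
qed
also have "... = ennreal((sqrt(\<Sum>t\<in>Tr. (L2norm(itri t)w)\<^sup>2))\<^sup>2)"by(simp add: sum_nonneg)
finally have *:"(\<integral>\<^sup>+x. ennreal((w x)\<^sup>2)\<partial>lebesgue_on Om)\<le>ennreal((sqrt(\<Sum>t\<in>Tr. (L2norm(itri t)w)\<^sup>2))\<^sup>2)" .
note R = L2I_nn_integral[OF wm *]
show "w\<in>L2S Om"using R(1)by(simp add: sum_nonneg)
have "L2norm Om w\<le>sqrt(\<Sum>t\<in>Tr. (L2norm(itri t)w)\<^sup>2)"using R(2)by(simp add: sum_nonneg L2norm_eq_norm2)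
hence "(L2norm Om w)\<^sup>2\<le>(sqrt(\<Sum>t\<in>Tr. (L2norm(itri t)w)\<^sup>2))\<^sup>2"by(rule power_mono)simp
thus "(L2norm Om w)\<^sup>2\<le>(\<Sum>t\<in>Tr. (L2norm(itri t)w)\<^sup>2)"by(simp add: sum_nonneg)
qed

lemma Hpw_L2:"v\<in>Hpw Tr s==>v\<in>L2S Om"
by(intro piecewise_L2)(auto simp: Hpw_def Hs_L2)

lemma Hs_Hpw: assumes "v\<in>Hs Om 2"shows "v\<in>Hpw Tr 2"
proof -
have "v\<in>Hs(itri t)(real 2)"if "t\<in>Tr"for t
by(rule Hs_restrict(1))(use assms itri_subset[OF that]in auto)
thus ?thesis by(simp add: Hpw_def)
qed

definition jp ::"pt set=>pt=>fld=>real"where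
"jp e z v = jump Tr e(%t. pt_val t v z)"

definition jn ::"pt set=>fld=>real"where
"jn e v = (1 / edge_len e) * edge_int e(%x. jump Tr e(%t. edge_trace t e(normal_deriv t e v)x))"

lemma edgeD:
assumes "e\<in>edges Tr"
shows "card e = 2""tri_plus Tr e\<in>Tr""e\<subseteq>tri_plus Tr e"
proof -
show "card e = 2"using assms by(simp add: edges_def)
have "\<exists>t. t\<in>Tr&e\<subseteq>t"using assms by(auto simp: edges_def)
from someI_ex[OF this]show "tri_plus Tr e\<in>Tr""e\<subseteq>tri_plus Tr e"by(auto simp: tri_plus_def)
qed

lemma interior_edgeD:
assumes "e\<in>interior_edges Tr"
shows "tri_minus Tr e\<in>Tr""e\<subseteq>tri_minus Tr e"
proof -
obtain s t where "s\<in>Tr""t\<in>Tr""s\<noteq>t""e\<subseteq>s""e\<subseteq>t"using assms by(auto simp: interior_edges_def)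
hence "\<exists>t. t\<in>Tr&e\<subseteq>t&t\<noteq>tri_plus Tr e"by(cases "s = tri_plus Tr e")blast+
from someI_ex[OF this]show "tri_minus Tr e\<in>Tr""e\<subseteq>tri_minus Tr e"by(auto simp: tri_minus_def)
qed

lemma jump_lin:
assumes "e\<in>edges Tr""!!t. t\<in>Tr==>e\<subseteq>t==>q t = c * q1 t + q2 t"
shows "jump Tr e q = c * jump Tr e q1 + jump Tr e q2"
using assms(2)[OF edgeD(2,3)[OF assms(1)]]assms(2)[OF interior_edgeD]by(auto simp: jump_def algebra_simps)

lemma jp_lin:
assumes e:"e\<in>edges Tr""z\<in>e"and v:"v\<in>Hpw Tr 2""w\<in>Hpw Tr 2"
shows "jp e z(%x. c * v x + w x) = c * jp e z v + jp e z w"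
unfolding jp_def
proof(rule jump_lin[OF e(1)])
fix t assume t:"t\<in>Tr""e\<subseteq>t"
interpret K: triangle t by(rule triangle[OF t(1)])
show "pt_val t(%x. c * v x + w x)z = c * pt_val t v z + pt_val t w z"
using v t e(2)by(intro K.pt_val_lin)(auto simp: Hpw_def hull_inc)
qed

lemma jn_eq:
assumes e:"e\<in>edges Tr"
shows "jn e v = (\<integral>s. jump Tr e(%t. triangle.tr t e v s)\<partial>M01)"
proof -
have "triangle.tr t e v s = edge_trace t e(normal_deriv t e v)(edge_param e s)"if "t\<in>Tr"for t s
using triangle.tr_def[OF triangle[OF that]] .
hence "jump Tr e(%t. triangle.tr t e v s) = jump Tr e(%t. edge_trace t e(normal_deriv t e v)(edge_param e s))"for s
using edgeD[OF e]interior_edgeD by(auto simp: jump_def)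
thus ?thesis using edge_len_pos[OF edgeD(1)[OF e]]by(simp add: jn_def edge_int_def)
qed

text \<open>Traces are linear only for almost every parameter, so linearity holds for the integrated
  jump and not pointwise on the edge.\<close>

lemma jn_lin:
assumes e:"e\<in>edges Tr"and v:"v\<in>Hpw Tr 2"and w:"w\<in>Hpw Tr 2"
shows "jn e(%x. c * v x + w x) = c * jn e v + jn e w"
proof -
have tri:"triangle.tr t e u\<in>L2 M01"if "t\<in>Tr""e\<subseteq>t""u\<in>Hpw Tr 2"for t u
using triangle.tr(2)[OF triangle[OF that(1)]edgeD(1)[OF e]that(2)]that by(simp add: Hpw_def)
have int:"(%s. jump Tr e(%t. triangle.tr t e u s))\<in>L2 M01"if "u\<in>Hpw Tr 2"for u
using tri[OF edgeD(2,3)[OF e]that]tri[OF interior_edgeD that]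
by(cases "e\<in>interior_edges Tr")(auto simp: jump_def intro: Submission.L2.diff_mem)
have i:"integrable M01(%s. jump Tr e(%t. triangle.tr t e u s))"if "u\<in>Hpw Tr 2"for u
by(rule L2_integrable[OF finite_M01 int[OF that]])
have vw:"(%x. c * v x + w x)\<in>Hpw Tr 2"
using v w unfolding Hpw_def by(auto intro!: semidef_form.lin_mem[OF open_plane.semidef_a_form]simp: open_plane_def)
have lin:"AE s in M01. triangle.tr t e(%x. c * v x + w x)s = c * triangle.tr t e v s + triangle.tr t e w s"
if "t\<in>Tr""e\<subseteq>t"for t
using triangle.tr_lin[OF triangle[OF that(1)]edgeD(1)[OF e]that(2)]v w that by(simp add: Hpw_def)
have "AE s in M01. \<forall>t\<in>{t\<in>Tr. e\<subseteq>t}. triangle.tr t e(%x. c * v x + w x)s = c * triangle.tr t e v s + triangle.tr t e w s"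
using lin finite_T by(intro AE_finite_allI)auto
hence "AE s in M01. jump Tr e(%t. triangle.tr t e(%x. c * v x + w x)s) =
 c * jump Tr e(%t. triangle.tr t e v s) + jump Tr e(%t. triangle.tr t e w s)"
by eventually_elim(rule jump_lin[OF e],simp)
hence "jn e(%x. c * v x + w x) = (\<integral>s. c * jump Tr e(%t. triangle.tr t e v s) + jump Tr e(%t. triangle.tr t e w s)\<partial>M01)"
unfolding jn_eq[OF e]by(intro integral_cong_AE)(use i[OF vw]i[OF v]i[OF w]in auto)
thus ?thesis using i[OF v]i[OF w]by(simp add: jn_eq[OF e])
qed

text \<open>Polarization of the squared discrete norm. The pairs of edge and endpoint form one index
  set, so that each jump part has the shape required by
  \<open>semidef_functional_sum\<close>.\<close>

definition Hh ::"fld=>fld=>real"where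
"Hh v w = ((\<Sum>t\<in>Tr. a_form(itri t)v w) + (\<Sum>(e,z)\<in>(SIGMA e:edges Tr. e). 1 / (edge_len e)\<^sup>2 * (jp e z v * jp e z w)))
 + (\<Sum>e\<in>edges Tr. 1 * (jn e v * jn e w))"

lemma finite_edges:"finite(edges Tr)"
proof(rule finite_subset)
have "finite t"if "t\<in>Tr"for t using triangle.finite_t[OF triangle[OF that]] .
thus "finite(\<Union>t\<in>Tr. Pow t)"using finite_T by blast
show "edges Tr\<subseteq>(\<Union>t\<in>Tr. Pow t)"by(auto simp: edges_def)
qed

lemma finite_edge:"e\<in>edges Tr==>finite e"
using edgeD(1)by(metis card.infinite zero_neq_numeral)

lemma h_norm_eq:"h_norm Tr v = sqrt(Hh v v)"
proof -
have "(\<Sum>t\<in>Tr. (H2semi(itri t)v)\<^sup>2) = (\<Sum>t\<in>Tr. a_form(itri t)v v)"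
by(simp add: H2semi_eq a_form_def ip_def sum_nonneg)
moreover have "(\<Sum>e\<in>edges Tr. \<Sum>z\<in>e. \<bar>jump Tr e(%t. pt_val t v z)\<bar>\<^sup>2 / (edge_len e)\<^sup>2) =
 (\<Sum>(e,z)\<in>(SIGMA e:edges Tr. e). 1 / (edge_len e)\<^sup>2 * (jp e z v * jp e z v))"
using finite_edges finite_edge by(subst sum.Sigma)(auto simp: jp_def power2_eq_square)
ultimately show ?thesis by(simp add: h_norm_def Hh_def jn_def power2_eq_square)
qed

lemma semidef_Hh:"semidef_form(Hpw Tr 2)Hh"
proof -
have pl:"semidef_form(Hs(itri t)2)(a_form(itri t))"if "t\<in>Tr"for t
by(rule open_plane.semidef_a_form)(simp add: open_plane_def)
have 1:"semidef_form(Hpw Tr 2)(%v w. \<Sum>t\<in>Tr. a_form(itri t)v w)"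
proof
show "(%x. 0)\<in>Hpw Tr 2"unfolding Hpw_def using semidef_form.zero_mem[OF pl]by blast
fix v w z c assume v:"v\<in>Hpw Tr 2""w\<in>Hpw Tr 2"
show "(%x. c * v x + w x)\<in>Hpw Tr 2"using v semidef_form.lin_mem[OF pl]by(auto simp: Hpw_def)
show "(\<Sum>t\<in>Tr. a_form(itri t)v w) = (\<Sum>t\<in>Tr. a_form(itri t)w v)"
 using v semidef_form.sym[OF pl]by(intro sum.cong)(auto simp: Hpw_def)
show "0\<le>(\<Sum>t\<in>Tr. a_form(itri t)v v)"
 using v semidef_form.nonneg[OF pl]by(intro sum_nonneg)(auto simp: Hpw_def)
assume z:"z\<in>Hpw Tr 2"
show "(\<Sum>t\<in>Tr. a_form(itri t)(%x. c * v x + w x)z) = c * (\<Sum>t\<in>Tr. a_form(itri t)v z) + (\<Sum>t\<in>Tr. a_form(itri t)w z)"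
 unfolding sum_distrib_left sum.distrib[symmetric]
 using v z semidef_form.lin_left[OF pl]by(intro sum.cong)(auto simp: Hpw_def)
qed
have 2:"semidef_form(Hpw Tr 2)(%v w. (\<Sum>t\<in>Tr. a_form(itri t)v w) +
 (\<Sum>p\<in>(SIGMA e:edges Tr. e). 1 / (edge_len(fst p))\<^sup>2 * (jp(fst p)(snd p)v * jp(fst p)(snd p)w)))"
by(rule semidef_functional_sum[OF 1])(auto simp: jp_lin)
from semidef_functional_sum[OF 2,of "edges Tr"jn "%_. 1"]jn_lin
show ?thesis unfolding Hh_def[abs_def]case_prod_unfold by simp
qed

sublocale h: semidef_form "Hpw Tr 2"Hh rewrites "semidef_form.nrm Hh = h_norm Tr"
proof -
show *:"semidef_form(Hpw Tr 2)Hh"by(rule semidef_Hh)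
show "semidef_form.nrm Hh = h_norm Tr"by(simp add: fun_eq_iff semidef_form.nrm_def[OF *]h_norm_eq)
qed

lemma h_norm_nonneg[simp]:"0\<le>h_norm Tr v"
by(simp add: h_norm_def sum_nonneg)

lemma h_norm_cong:
assumes ae:"ae_eq Om v w"and v:"v\<in>Hpw Tr 2"and w:"w\<in>Hpw Tr 2"
shows "h_norm Tr v = h_norm Tr w"
proof -
have ae':"ae_eq(itri t)v w"if "t\<in>Tr"for t
using ae S_sets itri_subset[OF that]unfolding ae_eq_def
by(auto simp: AE_restrict_space_iff open_sets_lebesgue elim!: eventually_mono)
have 1:"H2semi(itri t)v = H2semi(itri t)w"if "t\<in>Tr"for t
using open_plane.Hs_cong(3)[OF _ ae'[OF that]]Hs_L2[of v "itri t"2]Hs_L2[of w "itri t"2]v w that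
by(auto simp: open_plane_def Hpw_def)
have "ae_eq(itri t)v g\<longleftrightarrow>ae_eq(itri t)w g"if "t\<in>Tr"for t g
using ae'[OF that]open_plane.ae_eq_trans[of "itri t"]open_plane.ae_eq_sym[of "itri t"]by(metis open_plane_def open_interior)
hence 2:"pt_val t v = pt_val t w"if "t\<in>Tr"for t using that by(simp add: pt_val_def)
have 3:"normal_deriv t e v = normal_deriv t e w"if "t\<in>Tr"for t e
proof -
have "wderiv(itri t)[b]v = wderiv(itri t)[b]w"if "b\<in>Basis"for b
 using open_plane.wderiv_cong(1)[OF _ ae'[OF \<open>t\<in>Tr\<close>],of "[b]"]v w that \<open>t\<in>Tr\<close>
 L2_measurable[OF Hs_L2,of v "itri t"2]L2_measurable[OF Hs_L2,of w "itri t"2]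
 by(auto simp: open_plane_def Hpw_def)
thus ?thesis by(auto simp: normal_deriv_def fun_eq_iff)
qed
have 4:"jump Tr e q = jump Tr e q'"if "e\<in>edges Tr""!!t. t\<in>Tr==>q t = q' t"for e q q'
using edgeD[OF that(1)]interior_edgeD[of e]that(2)by(auto simp: jump_def)
have 5:"jp e z v = jp e z w""jn e v = jn e w"if "e\<in>edges Tr"for e z
proof -
show "jp e z v = jp e z w"unfolding jp_def by(rule 4[OF that])(simp add: 2)
have "jump Tr e(%t. edge_trace t e(normal_deriv t e v)x) = jump Tr e(%t. edge_trace t e(normal_deriv t e w)x)"for x
 by(rule 4[OF that])(simp add: 3)
thus "jn e v = jn e w"unfolding jn_def by simp
qed
show ?thesis unfolding h_norm_eq Hh_def
using 1 5 by(auto simp: H2semi_eq intro!: sum.cong)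
qed

end

section \<open>The space \<open>H\<^sup>2\<^sub>0\<close> and the clamped biharmonic operator\<close>

lemma choose_null_sequence:
fixes d ::"nat=> 'b=>real"
assumes "!!n e. 0 < e==>\<exists>x. P x&d n x < e""!!n x. 0\<le>d n x"
obtains x where "\<forall>n. P(x n)""(%n. d n(x n))---->0"
proof -
have "\<forall>n. \<exists>x. P x&d n x < 1 / real(Suc n)"using assms(1)by simp
then obtain x where x:"\<forall>n. P(x n)&d n(x n) < 1 / real(Suc n)"by metis
have "(%n. d n(x n))---->0"
by(rule Lim_null_comparison[OF _ LIMSEQ_Suc[OF lim_1_over_n]])(use x assms(2)in "auto intro!: always_eventually simp: less_imp_le")
thus thesis using that x by blast
qed

context open_plane
begin

text \<open>Each weak derivative converges separately in \<open>L^2\<close>, and the limits are the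
  derivatives of the limit because weak derivatives are closed under such convergence.\<close>

theorem Hs_2_complete:
assumes v:"!!n. v n\<in>Hs S 2"
and cauchy:"!!e. 0 < e==>\<exists>N. \<forall>m\<ge>N. \<forall>n\<ge>N. Hnorm S 2(%x. v m x - v n x) < e"
obtains u where "u\<in>Hs S 2""(%n. Hnorm S 2(%x. v n x - u x))---->0"
proof -
have wd:"has_wderiv S bs(v n)"if "j\<le>2""bs\<in>dirs j"for j bs n
by(rule Hs_2_wderiv[OF v that])
have ex:"\<exists>g. g\<in>L2S S&(%n. L2norm S(%x. wderiv S bs(v n)x - g x))---->0"if j:"j\<le>2""bs\<in>dirs j"for j bs
proof -
have "\<exists>N. \<forall>m\<ge>N. \<forall>n\<ge>N. norm2(lebesgue_on S)(%x. wderiv S bs(v m)x - wderiv S bs(v n)x) < e"if e0:"0 < e"for e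
proof -
 obtain N where N:"\<forall>m\<ge>N. \<forall>n\<ge>N. Hnorm S 2(%x. v m x - v n x) < e"using cauchy[OF e0]by blast
 have "L2norm S(%x. wderiv S bs(v m)x - wderiv S bs(v n)x)\<le>Hnorm S 2(%x. v m x - v n x)"for m n
 proof -
 have "ae_eq S(wderiv S bs(%x. v m x - v n x))(%x. wderiv S bs(v m)x - wderiv S bs(v n)x)"
  by(intro wderiv_diff Hs_L2[OF v]wd[OF j]dirsD(1)[OF j(2)])
 from L2norm_cong[OF this]have "L2norm S(%x. wderiv S bs(v m)x - wderiv S bs(v n)x) = L2norm S(wderiv S bs(%x. v m x - v n x))"
  using wderiv(1)[OF Hs_2_wderiv[OF H2.diff_mem[OF v v]j]]L2.diff_mem[OF wderiv(1)[OF wd[OF j]]wderiv(1)[OF wd[OF j]]]by simp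
 also have "...\<le>Hnorm S 2(%x. v m x - v n x)"using j by(intro L2norm_wderiv_le_Hnorm)auto
 finally show ?thesis .
 qed
 thus ?thesis using N unfolding L2norm_eq_norm2 by(meson le_less_trans)
qed
note c = this
obtain g where "g\<in>L2S S""(%n. norm2(lebesgue_on S)(%x. wderiv S bs(v n)x - g x))---->0"
 by(rule L2_complete[of "%n. wderiv S bs(v n)""lebesgue_on S",OF wderiv(1)[OF wd[OF j]]c])
thus ?thesis unfolding L2norm_eq_norm2 by blast
qed
define g where "g bs = (SOME g. g\<in>L2S S&(%n. L2norm S(%x. wderiv S bs(v n)x - g x))---->0)"for bs
have g:"g bs\<in>L2S S""(%n. L2norm S(%x. wderiv S bs(v n)x - g bs x))---->0"if "j\<le>2""bs\<in>dirs j"for j bs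
using someI_ex[OF ex[OF that]]unfolding g_def by blast+
define u where "u = g[]"
have u:"u\<in>L2S S"using g(1)[of 0 "[]"]by(simp add: u_def)
have vu:"(%n. L2norm S(%x. v n x - u x))---->0"
proof -
have "L2norm S(%x. wderiv S[] (v n)x - g[]x) = L2norm S(%x. v n x - u x)"for n
proof(rule L2norm_cong)
 show "ae_eq S(%x. wderiv S[] (v n)x - g[]x)(%x. v n x - u x)"
 using wderiv_Nil(2)[OF Hs_L2[OF v,of n]]unfolding ae_eq_def u_def by eventually_elim simp
 show "(%x. wderiv S[] (v n)x - g[]x)\<in>L2S S"
 by(intro L2.diff_mem wderiv(1)wd[of 0]g(1)[of 0])auto
 show "(%x. v n x - u x)\<in>L2S S"by(intro L2.diff_mem Hs_L2[OF v]u)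
qed
thus ?thesis using g(2)[of 0 "[]"]by simp
qed
have wdu:"weak_deriv S bs u(g bs)"if j:"j\<le>2""bs\<in>dirs j"for j bs
by(rule weak_deriv_closed[OF Hs_L2[OF v]wderiv(1)[OF wd[OF j]]u g(1)[OF j]dirsD(1)[OF j(2)]vu g(2)[OF j]wderiv(2)[OF wd[OF j]]])
have uH:"u\<in>Hs S(real 2)"unfolding Hs_nat has_wderiv_def using u g(1)wdu by blast
have "(%n. Hnorm S(real 2)(%x. v n x - u x))---->0"
proof(subst Hnorm_tendsto_iff[OF uH])
show "v n\<in>Hs S(real 2)"for n using v by simp
show "\<forall>j\<le>2. \<forall>bs\<in>dirs j. (%n. L2norm S(%x. wderiv S bs(v n)x - wderiv S bs u x))---->0"
proof(intro allI impI ballI)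
 fix j bs assume j:"j\<le>2""bs\<in>dirs j"
 have e:"ae_eq S(wderiv S bs u)(g bs)"by(rule wderiv_eq(2)[OF g(1)[OF j]wdu[OF j]])
 have "L2norm S(%x. wderiv S bs(v n)x - wderiv S bs u x) = L2norm S(%x. wderiv S bs(v n)x - g bs x)"for n
 proof(rule L2norm_cong)
 show "ae_eq S(%x. wderiv S bs(v n)x - wderiv S bs u x)(%x. wderiv S bs(v n)x - g bs x)"
  using e unfolding ae_eq_def by eventually_elim simp
 show "(%x. wderiv S bs(v n)x - wderiv S bs u x)\<in>L2S S"
  using uH j by(intro L2.diff_mem wderiv(1)wd[OF j]Hs_mem_wderiv[OF uH])
 show "(%x. wderiv S bs(v n)x - g bs x)\<in>L2S S"
  by(intro L2.diff_mem wderiv(1)wd[OF j]g(1)[OF j])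
 qed
 thus "(%n. L2norm S(%x. wderiv S bs(v n)x - wderiv S bs u x))---->0"using g(2)[OF j]by simp
qed
qed
thus thesis using that[of u]uH by simp
qed

section \<open>Closure properties of the clamped functions and the biharmonic form\<close>

lemma H20_D:"v\<in>H20 S==>v\<in>Hs S 2"
by(simp add: H20_def)

lemma H20E:
assumes "v\<in>H20 S"
obtains ph where "\<forall>j. test_fun S(ph j)""(%j. Hnorm S 2(%x. ph j x - v x))---->0"
using assms unfolding H20_def by blast

lemma test_Hs: assumes t:"test_fun S ph"shows "ph\<in>Hs S 2""set bs\<subseteq>Basis==>ae_eq S(wderiv S bs ph)(pds bs ph)"
proof -
note sm = test_fun_smooth[OF t]
have "ph\<in>Hs S(real 2)"unfolding Hs_nat
using wderiv_smooth(1)[OF sm test_pds_L2[OF t dirsD(1)]dirsD(1)]test_L2[OF t]by blast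
thus "ph\<in>Hs S 2"by simp
show "set bs\<subseteq>Basis==>ae_eq S(wderiv S bs ph)(pds bs ph)"
by(rule wderiv_smooth(2)[OF sm test_pds_L2[OF t]])
qed

lemma test_H20:"test_fun S ph==>ph\<in>H20 S"
unfolding H20_def using test_Hs(1)H2.zero_mem by(auto intro!: exI[of _ "%_. ph"]simp: H2.zero_left Hnorm_nat[of S 2,simplified])

lemma zero_H20:"(%x. 0)\<in>H20 S"
by(rule test_H20)simp

lemma H20_lin: assumes v:"v\<in>H20 S"and w:"w\<in>H20 S"shows "(%x. c * v x + w x)\<in>H20 S"
proof -
obtain ph where ph:"\<forall>j. test_fun S(ph j)""(%j. Hnorm S 2(%x. ph j x - v x))---->0"using v by(rule H20E)
obtain psz where psz:"\<forall>j. test_fun S(psz j)""(%j. Hnorm S 2(%x. psz j x - w x))---->0"using w by(rule H20E)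
have d1:"(%x. ph j x - v x)\<in>Hs S 2"for j using ph(1)v by(intro H2.diff_mem test_Hs H20_D)auto
have d2:"(%x. psz j x - w x)\<in>Hs S 2"for j using psz(1)w by(intro H2.diff_mem test_Hs H20_D)auto
have "(%j. Hnorm S 2(%x. (c * ph j x + psz j x) - (c * v x + w x)))---->0"
proof(rule Lim_null_comparison)
show "(%j. \<bar>c\<bar> * Hnorm S 2(%x. ph j x - v x) + Hnorm S 2(%x. psz j x - w x))---->0"
 using tendsto_add[OF tendsto_mult_right_zero[OF ph(2),of "\<bar>c\<bar>"]psz(2)]by simp
have "Hnorm S 2(%x. (c * ph j x + psz j x) - (c * v x + w x))\<le>\<bar>c\<bar> * Hnorm S 2(%x. ph j x - v x) + Hnorm S 2(%x. psz j x - w x)"for j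
 using H2.nrm_add[OF H2.cmult_mem[OF d1]d2,of c j j]H2.nrm_cmult[OF d1,of c j]by(simp add: algebra_simps)
thus "\<forall>\<^sub>F j in sequentially. norm(Hnorm S 2(%x. (c * ph j x + psz j x) - (c * v x + w x)))\<le>\<bar>c\<bar> * Hnorm S 2(%x. ph j x - v x) + Hnorm S 2(%x. psz j x - w x)"
 by simp
qed
moreover have "\<forall>j. test_fun S(%x. c * ph j x + psz j x)"using ph(1)psz(1)by(intro allI test_fun_add test_fun_cmult)blast+
ultimately have "\<exists>ph. (\<forall>j. test_fun S(ph j))&(%j. Hnorm S 2(%x. ph j x - (c * v x + w x)))---->0"
by(intro exI[of _ "%j x. c * ph j x + psz j x"]conjI)
thus ?thesis unfolding H20_def using H2.lin_mem[OF H20_D[OF v]H20_D[OF w],of c]by blast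
qed

lemma H20_cmult:"v\<in>H20 S==>(%x. c * v x)\<in>H20 S"
using H20_lin[OF _ zero_H20,of v c]by simp

lemma H20_diff:"v\<in>H20 S==>w\<in>H20 S==>(%x. v x - w x)\<in>H20 S"
using H20_lin[of w v "-1"]by simp

lemma H20_add:"v\<in>H20 S==>w\<in>H20 S==>(%x. v x + w x)\<in>H20 S"
using H20_lin[of v w 1]by simp

lemma H20_sum:"(!!i. i\<in>I==>v i\<in>H20 S)==>(%x. \<Sum>i\<in>I. v i x)\<in>H20 S"
by(induction I rule: infinite_finite_induct)(auto simp: zero_H20 H20_add)

lemma H20_closed:
assumes v:"!!n. v n\<in>H20 S"and u:"u\<in>Hs S 2"and lim:"(%n. Hnorm S 2(%x. v n x - u x))---->0"
shows "u\<in>H20 S"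
proof -
have ex:"\<exists>ph. test_fun S ph&Hnorm S 2(%x. ph x - v n x) < e"if "0 < e"for n e
proof -
obtain ph where ph:"\<forall>j. test_fun S(ph j)""(%j. Hnorm S 2(%x. ph j x - v n x))---->0"using v by(rule H20E)
obtain N where "\<forall>j\<ge>N. Hnorm S 2(%x. ph j x - v n x) < e"
 using order_tendstoD(2)[OF ph(2) \<open>0 < e\<close>]unfolding eventually_sequentially by blast
thus ?thesis using ph(1)by blast
qed
obtain ph where ph:"\<forall>n. test_fun S(ph n)""(%n. Hnorm S 2(%x. ph n x - v n x))---->0"
by(rule choose_null_sequence[of "test_fun S""%n ph. Hnorm S 2(%x. ph x - v n x)",OF ex Hnorm_nonneg])
have "(%n. Hnorm S 2(%x. ph n x - u x))---->0"
proof(rule Lim_null_comparison)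
show "(%n. Hnorm S 2(%x. ph n x - v n x) + Hnorm S 2(%x. v n x - u x))---->0"
 using tendsto_add[OF ph(2)lim]by simp
have "Hnorm S 2(%x. ph n x - u x)\<le>Hnorm S 2(%x. ph n x - v n x) + Hnorm S 2(%x. v n x - u x)"for n
 using ph(1)by(intro H2.nrm_triangle test_Hs u H20_D[OF v])auto
thus "\<forall>\<^sub>F n in sequentially. norm(Hnorm S 2(%x. ph n x - u x))\<le>Hnorm S 2(%x. ph n x - v n x) + Hnorm S 2(%x. v n x - u x)"by simp
qed
thus ?thesis unfolding H20_def using u ph(1)by blast
qed

lemma H20_cong:
assumes ae:"ae_eq S v w"and v:"v\<in>H20 S"and w:"w\<in>L2S S"
shows "w\<in>H20 S"
proof -
note vL = Hs_L2[OF H20_D[OF v]]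
obtain ph where ph:"\<forall>j. test_fun S(ph j)""(%j. Hnorm S 2(%x. ph j x - v x))---->0"using v by(rule H20E)
have "Hnorm S 2(%x. ph j x - v x) = Hnorm S 2(%x. ph j x - w x)"for j
proof(rule Hs_cong(2))
show "ae_eq S(%x. ph j x - v x)(%x. ph j x - w x)"using ae unfolding ae_eq_def by eventually_elim simp
show "(%x. ph j x - v x)\<in>L2S S""(%x. ph j x - w x)\<in>L2S S"using ph(1)vL w by(auto intro: L2.diff_mem test_L2)
qed
hence "(%j. Hnorm S 2(%x. ph j x - w x))---->0"using ph(2)by simp
thus ?thesis unfolding H20_def using Hs_cong(1)[OF ae vL w]H20_D[OF v]ph(1)by blast
qed

text \<open>Both derivatives are moved to the test function. The sum over ordered pairs of
  directions then contains each fourth derivative with the multiplicity it has in the squared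
  Laplacian, after reordering by symmetry.\<close>

lemma a_form_test:
assumes z:"z\<in>Hs S 2"and t:"test_fun S ph"
shows "a_form S z ph = ip S z(bilaplacian ph)"
proof -
note sm = test_fun_smooth[OF t]
have 1:"ip S(wderiv S bs z)(wderiv S bs ph) = ip S z(pds bs(pds bs ph))"if bs:"bs\<in>dirs 2"for bs
proof -
note b = dirsD[OF bs]
have wz:"has_wderiv S bs z"by(rule Hs_2_wderiv[OF z _ bs])simp
have wph:"has_wderiv S bs ph"by(rule Hs_2_wderiv[OF test_Hs(1)[OF t]_ bs])simp
have "ip S(wderiv S bs z)(wderiv S bs ph) = ip S(wderiv S bs z)(pds bs ph)"
 by(intro ip_cong test_Hs(2)[OF t b(1)]wderiv(1)wz wph test_pds_L2[OF t b(1)])auto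
also have "... = ip S z(pds bs(pds bs ph))"
 using wderiv(2)[OF wz]test_fun_pds[OF t b(1)]b(2)by(simp add: weak_deriv_def)
finally show ?thesis .
qed
have "a_form S z ph = (\<Sum>bs\<in>dirs 2. ip S z(pds bs(pds bs ph)))"
unfolding a_form_def by(rule sum.cong[OF refl 1])
also have "... = ip S z(%x. \<Sum>bs\<in>dirs 2. pds bs(pds bs ph)x)"
by(rule L2.sum_right[symmetric])(auto intro!: test_pds_L2 test_fun_pds t Hs_L2[OF z]dest: dirsD)
also have "(%x. \<Sum>bs\<in>dirs 2. pds bs(pds bs ph)x) = bilaplacian ph"
proof
fix x
have "pds[b,c] (pds[b,c]ph) = pds[b,b,c,c]ph"if "b\<in>Basis""c\<in>Basis"for b c
proof -
 have "pd c(pd b(pd c ph)) = pd b(pd c(pd c ph))"using pd_commute[OF smooth_pd[OF sm that(2)]that(2,1)] .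
 thus ?thesis by simp
qed
thus "(\<Sum>bs\<in>dirs 2. pds bs(pds bs ph)x) = bilaplacian ph x"
 by(simp add: numeral_2_eq_2 sum_dirs_Suc bilaplacian_def del: pds_Cons cong: sum.cong)
qed
finally show ?thesis .
qed

lemma A_tendsto:
assumes "!!n. v n\<in>Hs S 2""w\<in>Hs S 2""z\<in>Hs S 2""(%n. Hnorm S 2(%x. v n x - w x))---->0"
shows "(%n. a_form S z(v n))---->a_form S z w"
proof -
have "(%n. H2semi S(%x. v n x - w x))---->0"
proof(rule Lim_null_comparison[OF _ assms(4)])
have "0\<le>H2semi S(%x. v n x - w x)"for n by(simp add: H2semi_def sum_nonneg)
thus "\<forall>\<^sub>F n in sequentially. norm(H2semi S(%x. v n x - w x))\<le>Hnorm S 2(%x. v n x - w x)"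
 by(simp add: H2semi_le_Hnorm)
qed
from A.tendsto_form[OF assms(1-3)this]show ?thesis using A.sym assms by simp
qed

lemma L2_tendsto_of_Hnorm:
assumes "!!n. v n\<in>Hs S 2""w\<in>Hs S 2""(%n. Hnorm S 2(%x. v n x - w x))---->0"
shows "(%n. L2norm S(%x. v n x - w x))---->0"
proof(rule Lim_null_comparison[OF _ assms(3)])
have "L2norm S(%x. v n x - w x)\<le>Hnorm S 2(%x. v n x - w x)"for n
using assms by(intro L2norm_le_Hnorm L2.diff_mem Hs_L2)
thus "\<forall>\<^sub>F n in sequentially. norm(L2norm S(%x. v n x - w x))\<le>Hnorm S 2(%x. v n x - w x)"by simp
qed

text \<open>The distributional identity is stated for test functions; both sides are continuous in
  \<open>H^2\<close>, and test functions are dense in \<open>H20 S\<close>.\<close>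

lemma a_form_bilaplacian:
assumes z:"z\<in>Hs S 2"and g:"has_bilaplacian S z g"and v:"v\<in>H20 S"
shows "a_form S z v = ip S g v"
proof -
obtain ph where ph:"\<forall>j. test_fun S(ph j)""(%j. Hnorm S 2(%x. ph j x - v x))---->0"using v by(rule H20E)
have gL:"g\<in>L2S S"using g by(simp add: has_bilaplacian_def)
have phH:"ph j\<in>Hs S 2"for j using ph(1)test_Hs by blast
have "a_form S z(ph j) = ip S g(ph j)"for j
using a_form_test[OF z,of "ph j"]g ph(1)by(simp add: has_bilaplacian_def)
moreover have "(%j. a_form S z(ph j))---->a_form S z v"by(rule A_tendsto[OF phH H20_D[OF v]z ph(2)])
moreover have "(%j. ip S(ph j)g)---->ip S v g"
by(rule L2.tendsto_form[OF Hs_L2[OF phH]Hs_L2[OF H20_D[OF v]]gL L2_tendsto_of_Hnorm[OF phH H20_D[OF v]ph(2)]])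
ultimately show ?thesis using LIMSEQ_unique by(metis(no_types,lifting)LIMSEQ_unique L2.sym Hs_L2[OF phH]gL Hs_L2[OF H20_D[OF v]]ext)
qed

lemma DA_I:
assumes z:"z\<in>H20 S"and g:"g\<in>L2S S"and eq:"!!v. v\<in>H20 S==>a_form S z v = ip S g v"
shows "z\<in>DA S""has_bilaplacian S z g"
proof -
show "has_bilaplacian S z g"unfolding has_bilaplacian_def
using g eq test_H20 a_form_test[OF H20_D[OF z]]by auto
thus "z\<in>DA S"using z by(auto simp: DA_def)
qed

end

context bounded_plane
begin

text \<open>Integrating the derivative in direction \<open>b\<close> of
  \<open>(x \<bullet> b) * ph^2\<close> gives zero. This expresses the squared norm of
  \<open>ph\<close> by a mixed term, and \<open>x \<bullet> b\<close> is at most \<open>R\<close> on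
  the domain.\<close>

lemma friedrichs_test:
assumes R:"!!x. x\<in>S==>norm x\<le>R""0\<le>R"and t:"test_fun S ph"and b:"b\<in>Basis"
shows "L2norm S ph\<le>2 * R * L2norm S(pd b ph)"
proof -
note sm = test_fun_smooth[OF t]
let ?f = "%x. (x\<bullet>b) * (ph x * ph x)"and ?g = "%x. (x\<bullet>b) * ph x"
have tb:"test_fun S(pd b ph)"by(rule test_fun_pd[OF t b])
have tf:"test_fun S ?f"by(intro test_fun_mult smooth_inner sm t)
have tg:"test_fun S ?g"by(intro test_fun_mult smooth_inner t)
have pb:"pd b(%x. x\<bullet>b) = (%x. 1)"
using b by(auto simp: fun_eq_iff inner_same_Basis intro!: pd_eq[THEN trans]derivative_eq_intros)
have p:"pd b ?f = (%x. 2 * (?g x * pd b ph x) + ph x * ph x)"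
using pd_mult_smooth[OF smooth_inner smooth_mult[OF sm sm]]pd_mult_smooth[OF sm sm]pb by(auto simp: fun_eq_iff algebra_simps)
have "(\<integral>x. pd b ?f x\<partial>lebesgue_on S) = (\<integral>x. pd b ?f x\<partial>lborel)"
by(rule integral_lebesgue_on_eq_lborel(1)[OF S_sets smooth_measurable[OF test_fun_smooth[OF test_fun_pd[OF tf b]]]
 test_fun_outside[OF test_fun_pd[OF tf b]]])
hence "(\<integral>x. 2 * (?g x * pd b ph x) + ph x * ph x\<partial>lebesgue_on S) = 0"
using integral_pd_test_fun[OF tf b]p by simp
hence "2 * ip S ?g(pd b ph) + ip S ph ph = 0"
using L2_mult_integrable[OF test_L2[OF tg]test_L2[OF tb]]L2_mult_integrable[OF test_L2[OF t]test_L2[OF t]]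
by(simp add: ip_def)
hence "(L2norm S ph)\<^sup>2 = - 2 * ip S ?g(pd b ph)"by(simp add: L2norm_square)
also have "...\<le>2 * (L2norm S ?g * L2norm S(pd b ph))"
using L2.cauchy_schwarz[OF test_L2[OF tg]test_L2[OF tb]]by linarith
also have "...\<le>2 * ((R * L2norm S ph) * L2norm S(pd b ph))"
proof(intro mult_left_mono mult_right_mono)
have "(L2norm S ?g)\<^sup>2\<le>(R * L2norm S ph)\<^sup>2"
proof -
 have "(\<integral>x. (?g x)\<^sup>2\<partial>lebesgue_on S)\<le>(\<integral>x. R\<^sup>2 * (ph x)\<^sup>2\<partial>lebesgue_on S)"
 proof(rule integral_mono)
 fix x assume x:"x\<in>space(lebesgue_on S)"
 have "\<bar>x\<bullet>b\<bar>\<le>R"using Basis_le_norm[OF b,of x]R(1)[of x]x by simp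
 hence "\<bar>x\<bullet>b\<bar>\<^sup>2\<le>R\<^sup>2"by(rule power_mono)simp
 thus "(?g x)\<^sup>2\<le>R\<^sup>2 * (ph x)\<^sup>2"unfolding power_mult_distrib by(intro mult_right_mono)auto
 qed(use L2_square_integrable[OF test_L2[OF tg]]L2_square_integrable[OF test_L2[OF t]]in auto)
 thus ?thesis unfolding power_mult_distrib[of R "L2norm S ph"]L2norm_square ip_def by(simp add: power2_eq_square)
qed
thus "L2norm S ?g\<le>R * L2norm S ph"by(rule power2_le_imp_le)(simp add: R)
qed auto
finally have *:"L2norm S ph * L2norm S ph\<le>(2 * R * L2norm S(pd b ph)) * L2norm S ph"
by(simp add: power2_eq_square ac_simps)
show ?thesis
proof(cases "L2norm S ph = 0")
case True thus ?thesis using R by simp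
next
case False
hence "0 < L2norm S ph"using L2norm_nonneg[of S ph]by linarith
thus ?thesis using * by simp
qed
qed

lemma friedrichs:
obtains C where "0\<le>C""!!v. v\<in>H20 S==>Hnorm S 2 v\<le>C * H2semi S v"
proof -
obtain R0 where "\<forall>x\<in>S. norm x\<le>R0"using bounded_S by(auto simp: bounded_iff)
hence R:"!!x. x\<in>S==>norm x\<le>max R0 0""0\<le>max R0 0"by force+
define R where "R = 2 * max R0 0"
have R0:"0\<le>R"by(simp add: R_def)
\<comment> \<open>The three summands bound the function itself, its two first derivatives, and its
  second derivatives.\<close>
define C where "C = sqrt((R * R)\<^sup>2 + 2 * R\<^sup>2 + 1)"
have test:"Hnorm S 2 ph\<le>C * H2semi S ph"if t:"test_fun S ph"for ph
proof -
let ?h = "H2semi S ph"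
have F:"L2norm S psz\<le>R * L2norm S(pd b psz)"if "test_fun S psz""b\<in>Basis"for psz b
 using friedrichs_test[OF R that]by(simp add: R_def)
have wd:"L2norm S(wderiv S bs ph) = L2norm S(pds bs ph)"if "j\<le>2""bs\<in>dirs j"for bs j
 by(intro L2norm_cong test_Hs(2)[OF t]wderiv(1)Hs_2_wderiv[OF test_Hs(1)[OF t]that]test_pds_L2[OF t]dirsD(1)[OF that(2)])
have s2:"L2norm S(pds bs ph)\<le>?h"if bs:"bs\<in>dirs 2"for bs
proof -
 have "(L2norm S(wderiv S bs ph))\<^sup>2\<le>(\<Sum>bs\<in>dirs 2. (L2norm S(wderiv S bs ph))\<^sup>2)"
 using bs by(intro member_le_sum)auto
 hence "sqrt((L2norm S(wderiv S bs ph))\<^sup>2)\<le>?h"unfolding H2semi_def by(rule real_sqrt_le_mono)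
 thus ?thesis using wd[OF _ bs]by simp
qed
have s1:"L2norm S(pd c ph)\<le>R * ?h"if c:"c\<in>Basis"for c
proof -
 have "[c,c]\<in>dirs 2"using c by(simp add: dirs_def)
 from s2[OF this]have "R * L2norm S(pd c(pd c ph))\<le>R * ?h"using R0 by(intro mult_left_mono)auto
 thus ?thesis using F[OF test_fun_pd[OF t c]c]by linarith
qed
obtain b where b:"b\<in>(Basis :: pt set)"using nonempty_Basis by blast
have "R * L2norm S(pd b ph)\<le>R * (R * ?h)"using s1[OF b]R0 by(intro mult_left_mono)
hence s0:"L2norm S ph\<le>(R * R) * ?h"using F[OF t b]by(simp add: mult.assoc)
have "(Hnorm S 2 ph)\<^sup>2 = (\<Sum>j\<le>2. \<Sum>bs\<in>dirs j. (L2norm S(wderiv S bs ph))\<^sup>2)"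
 using Hnorm_nat[of S 2 ph]by(simp add: Hinner_def L2norm_square[symmetric]sum_nonneg)
also have "... = (L2norm S ph)\<^sup>2 + (\<Sum>c\<in>Basis. (L2norm S(pd c ph))\<^sup>2) + (\<Sum>bs\<in>dirs 2. (L2norm S(wderiv S bs ph))\<^sup>2)"
proof -
 have "(\<Sum>bs\<in>dirs 1. (L2norm S(wderiv S bs ph))\<^sup>2) = (\<Sum>c\<in>Basis. (L2norm S(pd c ph))\<^sup>2)"
 proof -
 have "L2norm S(wderiv S[c]ph) = L2norm S(pd c ph)"if "c\<in>Basis"for c
  using wd[of 1 "[c]"]that by(simp add: dirs_def)
 thus ?thesis using sum_dirs_Suc[of "%bs. (L2norm S(wderiv S bs ph))\<^sup>2"0]by simp
 qed
 moreover have "L2norm S(wderiv S[]ph) = L2norm S ph"using wd[of 0 "[]"]by simp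
 ultimately show ?thesis by(simp add: numeral_2_eq_2)
qed
also have "...\<le>((R * R) * ?h)\<^sup>2 + (\<Sum>c\<in>(Basis::pt set). (R * ?h)\<^sup>2) + ?h\<^sup>2"
proof(intro add_mono sum_mono power_mono s0 s1)
 show "(\<Sum>bs\<in>dirs 2. (L2norm S(wderiv S bs ph))\<^sup>2)\<le>?h\<^sup>2"by(simp add: H2semi_def sum_nonneg)
qed auto
also have "... = (C * ?h)\<^sup>2"by(simp add: C_def power_mult_distrib algebra_simps)
finally show ?thesis by(rule power2_le_imp_le)(simp add: C_def H2semi_def sum_nonneg)
qed
show thesis
proof(rule that[of C])
fix v assume v:"v\<in>H20 S"
obtain ph where ph:"\<forall>j. test_fun S(ph j)""(%j. Hnorm S 2(%x. ph j x - v x))---->0"using v by(rule H20E)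
have phH:"ph j\<in>Hs S 2"for j using ph(1)test_Hs by blast
have 1:"(%j. Hnorm S 2(ph j))---->Hnorm S 2 v"by(rule H2.tendsto_nrm[OF phH H20_D[OF v]ph(2)])
have "(%n. H2semi S(%x. ph n x - v x))---->0"
proof(rule Lim_null_comparison[OF _ ph(2)])
 have "0\<le>H2semi S(%x. ph n x - v x)"for n by(simp add: H2semi_def sum_nonneg)
 thus "\<forall>\<^sub>F n in sequentially. norm(H2semi S(%x. ph n x - v x))\<le>Hnorm S 2(%x. ph n x - v x)"
 by(simp add: H2semi_le_Hnorm)
qed
hence 2:"(%j. C * H2semi S(ph j))---->C * H2semi S v"
 by(intro tendsto_intros A.tendsto_nrm[OF phH H20_D[OF v]])
show "Hnorm S 2 v\<le>C * H2semi S v"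
 by(rule LIMSEQ_le[OF 1 2])(use test ph(1)in blast)
qed(simp add: C_def)
qed

end

section \<open>Eigenfunction expansions\<close>

locale eigen = bounded_plane +
fixes lam ::"nat=>real"and psi ::"nat=>fld"
assumes es:"eigensystem S lam psi"
begin

lemma psi_H20:"psi n\<in>H20 S"and psi_bilaplacian:"has_bilaplacian S(psi n)(%x. lam n * psi n x)"
and psi_orth:"ip S(psi m)(psi n) = (if m = n then 1 else 0)"
and psi_expansion:"w\<in>L2S S==>(%N. L2norm S(%x. w x - (\<Sum>n<N. ip S w(psi n) * psi n x)))---->0"
using es unfolding eigensystem_def DA_def by blast+

lemma psi_L2:"psi n\<in>L2S S"by(rule Hs_L2[OF H20_D[OF psi_H20]])

lemma a_form_psi: assumes v:"v\<in>H20 S"shows "a_form S v(psi n) = lam n * ip S v(psi n)"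
proof -
have "a_form S(psi n)v = ip S(%x. lam n * psi n x)v"
by(rule a_form_bilaplacian[OF H20_D[OF psi_H20]psi_bilaplacian v])
also have "... = lam n * ip S(psi n)v"by(rule L2.cmult_left[OF psi_L2 Hs_L2[OF H20_D[OF v]]])
finally show ?thesis using A.sym[OF H20_D[OF v]H20_D[OF psi_H20]]L2.sym[OF Hs_L2[OF H20_D[OF v]]psi_L2]by simp
qed

lemma coeffs_determine:
assumes w:"w\<in>L2S S"and v:"v\<in>L2S S"and eq:"!!n. ip S w(psi n) = ip S v(psi n)"
shows "ae_eq S w v"
proof -
have d:"(%x. w x - v x)\<in>L2S S"by(rule L2.diff_mem[OF w v])
have "ip S(%x. w x - v x)(psi n) = 0"for n using L2.diff_left[OF w v psi_L2]eq by simp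
hence "(%N. L2norm S(%x. w x - v x))---->0"using psi_expansion[OF d]by simp
thus ?thesis by(simp add: ae_eq_L2[OF w v]LIMSEQ_const_iff)
qed

lemma bessel: assumes w:"w\<in>L2S S"shows "(\<Sum>n<N. (ip S w(psi n))\<^sup>2)\<le>(L2norm S w)\<^sup>2""summable(%n. (ip S w(psi n))\<^sup>2)"
proof -
have le:"(\<Sum>n<N. (ip S w(psi n))\<^sup>2)\<le>(L2norm S w)\<^sup>2"for N
proof -
define P where "P = (%x. \<Sum>n<N. ip S w(psi n) * psi n x)"
have P:"P\<in>L2S S"unfolding P_def by(intro L2.sum_mem L2.cmult_mem psi_L2)
have wP:"ip S w P = (\<Sum>n<N. (ip S w(psi n))\<^sup>2)"unfolding P_def
 using w by(subst L2.sum_right)(auto simp: L2.cmult_mem L2.cmult_right psi_L2 power2_eq_square)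
have "ip S P(psi m) = (if m < N then ip S w(psi m)else 0)"for m unfolding P_def
 by(subst L2.sum_left)(auto simp: L2.cmult_mem L2.cmult_left psi_L2 psi_orth if_distrib cong: if_cong)
hence PP:"ip S P P = (\<Sum>n<N. (ip S w(psi n))\<^sup>2)"
 by(subst(2)P_def,subst L2.sum_right)(auto simp: P L2.cmult_mem L2.cmult_right psi_L2 power2_eq_square)
have "0\<le>ip S(%x. w x - P x)(%x. w x - P x)"by(intro L2.nonneg L2.diff_mem w P)
also have "... = ip S w w - 2 * ip S w P + ip S P P"
 using w P by(simp add: L2.diff_left L2.diff_right L2.diff_mem L2.sym[of P w])
finally show ?thesis using wP PP by(simp add: L2norm_square)
qed
thus "(\<Sum>n<N. (ip S w(psi n))\<^sup>2)\<le>(L2norm S w)\<^sup>2" .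
show "summable(%n. (ip S w(psi n))\<^sup>2)"
by(rule summableI_nonneg_bounded[OF _ le])simp
qed

text \<open>The expansion of \<open>w\<close> converges in \<open>H\<^sup>2\<close>.\<close>
theorem spectral_H20:
assumes w:"w\<in>L2S S"and s:"summable(%n. (lam n * ip S w(psi n))\<^sup>2)"
shows "w\<in>H20 S"
proof -
define c where "c n = ip S w(psi n)"for n
define P where "P N = (%x. \<Sum>n<N. c n * psi n x)"for N
have PH:"P N\<in>H20 S"for N unfolding P_def by(intro H20_sum H20_cmult psi_H20)
obtain C where C:"0\<le>C""!!v. v\<in>H20 S==>Hnorm S 2 v\<le>C * H2semi S v"using friedrichs by blast
\<comment> \<open>These weighted squares are the energies of the modes. They are summable because
  the mixed product is at most the sum of the two squares, both summable: by hypothesis and by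
  Bessel's inequality.\<close>
have sum:"summable(%n. lam n * (c n)\<^sup>2)"
proof(rule summable_comparison_test)
show "summable(%n. (lam n * c n)\<^sup>2 + (c n)\<^sup>2)"
 using summable_add[OF s bessel(2)[OF w]]by(simp add: c_def)
have "\<bar>lam n * (c n)\<^sup>2\<bar>\<le>(lam n * c n)\<^sup>2 + (c n)\<^sup>2"for n
proof -
 have "2 * (\<bar>lam n * c n\<bar> * \<bar>c n\<bar>)\<le>(lam n * c n)\<^sup>2 + (c n)\<^sup>2"
 using sum_squares_bound[of "\<bar>lam n * c n\<bar>""\<bar>c n\<bar>"]by(simp add: mult.assoc)
 moreover have "\<bar>lam n * (c n)\<^sup>2\<bar> = \<bar>lam n * c n\<bar> * \<bar>c n\<bar>"by(simp add: power2_eq_square abs_mult)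
 ultimately show ?thesis using mult_nonneg_nonneg[of "\<bar>lam n * c n\<bar>""\<bar>c n\<bar>"]by linarith
qed
thus "\<exists>N. \<forall>n\<ge>N. norm(lam n * (c n)\<^sup>2)\<le>(lam n * c n)\<^sup>2 + (c n)\<^sup>2"by simp
qed
\<comment> \<open>Eigenfunctions are orthogonal for the energy form as well, so the energy of a
  block of the expansion is a block of the series; with Friedrichs' inequality the partial sums are
  Cauchy in \<open>H^2\<close>.\<close>
have dist:"H2semi S(%x. P n x - P m x) = sqrt(\<Sum>i\<in>{m..<n}. lam i * (c i)\<^sup>2)"if "m\<le>n"for m n
proof -
let ?D = "%x. \<Sum>i\<in>{m..<n}. c i * psi i x"
have D:"?D\<in>H20 S"by(intro H20_sum H20_cmult psi_H20)
have e:"(%x. P n x - P m x) = ?D"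
 using that by(auto simp: P_def sum_diff_nat_ivl lessThan_atLeast0)
have i:"ip S ?D(psi k) = (if k\<in>{m..<n}then c k else 0)"for k
 by(subst L2.sum_left)(auto simp: L2.cmult_mem L2.cmult_left psi_L2 psi_orth if_distrib cong: if_cong)
have "a_form S ?D ?D = (\<Sum>k\<in>{m..<n}. c k * a_form S ?D(psi k))"
 using H20_D[OF D]H20_D[OF psi_H20]by(subst A.sum_right)(auto intro: A.cmult_mem simp: A.cmult_right)
also have "... = (\<Sum>k\<in>{m..<n}. lam k * (c k)\<^sup>2)"
 by(intro sum.cong)(auto simp: a_form_psi[OF D]i power2_eq_square)
finally show ?thesis by(simp add: e H2semi_eq)
qed
have "\<exists>N. \<forall>m\<ge>N. \<forall>n\<ge>N. Hnorm S 2(%x. P m x - P n x) < e"if e:"0 < e"for e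
proof -
have pos:"0 < (e / (C + 1))\<^sup>2"using C(1)e by simp
obtain N where N:"\<forall>m\<ge>N. \<forall>n. norm(\<Sum>i\<in>{m..<n}. lam i * (c i)\<^sup>2) < (e / (C + 1))\<^sup>2"
 using sum pos unfolding summable_Cauchy by blast
have *:"Hnorm S 2(%x. P n x - P m x) < e"if "N\<le>m""m\<le>n"for m n
proof -
 have "(\<Sum>i\<in>{m..<n}. lam i * (c i)\<^sup>2) < (e / (C + 1))\<^sup>2"using N that(1)by(auto simp: abs_less_iff)
 hence "sqrt(\<Sum>i\<in>{m..<n}. lam i * (c i)\<^sup>2) < sqrt((e / (C + 1))\<^sup>2)"by(rule real_sqrt_less_mono)
 hence h:"H2semi S(%x. P n x - P m x) < e / (C + 1)"using C(1)e by(simp add: dist[OF that(2)])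
 have "Hnorm S 2(%x. P n x - P m x)\<le>C * H2semi S(%x. P n x - P m x)"by(intro C(2)H20_diff PH)
 also have "...\<le>(C + 1) * H2semi S(%x. P n x - P m x)"
 by(intro mult_right_mono)(auto simp: H2semi_def sum_nonneg)
 also have "... < (C + 1) * (e / (C + 1))"using h C(1)by(intro mult_strict_left_mono)auto
 also have "... = e"using C(1)by simp
 finally show ?thesis .
qed
have "Hnorm S 2(%x. P m x - P n x) < e"if "N\<le>m""N\<le>n"for m n
 using *[of m n] *[of n m]that H2.nrm_commute[OF H20_D[OF PH]H20_D[OF PH],of m n]by(cases "m\<le>n")auto
thus ?thesis by blast
qed
note cauchy = this
obtain u where u:"u\<in>Hs S 2""(%n. Hnorm S 2(%x. P n x - u x))---->0"
by(rule Hs_2_complete[OF H20_D[OF PH]cauchy])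
have uH:"u\<in>H20 S"by(rule H20_closed[OF PH u])
have uL:"u\<in>L2S S"by(rule Hs_L2[OF u(1)])
have PL:"P n\<in>L2S S"for n by(rule Hs_L2[OF H20_D[OF PH]])
have "(%n. L2norm S(%x. w x - P n x) + L2norm S(%x. P n x - u x))---->0 + 0"
using psi_expansion[OF w]by(intro tendsto_add L2_tendsto_of_Hnorm[OF H20_D[OF PH]u])(simp add: P_def c_def)
moreover have "L2norm S(%x. w x - u x)\<le>L2norm S(%x. w x - P n x) + L2norm S(%x. P n x - u x)"for n
by(rule L2.nrm_triangle[OF w uL PL])
ultimately have "L2norm S(%x. w x - u x)\<le>0 + 0"by(intro LIMSEQ_le_const)auto
hence "ae_eq S w u"using ae_eq_L2[OF w uL]L2norm_nonneg[of S "%x. w x - u x"]by simp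
thus ?thesis by(rule H20_cong[OF ae_eq_sym uH w])
qed

end

section \<open>Sobolev norms of fractional order as Hilbert norms\<close>

text \<open>The Slobodeckij seminorm of \<open>g\<close> is the \<open>L\<^sup>2\<close> norm of this difference quotient on \<open>S \<times> S\<close>.\<close>
definition slob_quot ::"real=>fld=>pt\<times>pt=>real"where
"slob_quot si g p = (g(fst p) - g(snd p)) / norm(fst p - snd p)powr(1 + si)"

definition slob_inner ::"pt set=>real=>fld=>fld=>real"where
"slob_inner S si v w = (if si = 0 then 0 else
 inner2(lebesgue_on S\<Otimes>\<^sub>M lebesgue_on S)(slob_quot si v)(slob_quot si w))"

lemma slob_quot_square:"(slob_quot si g(x,y))\<^sup>2 = (g x - g y)\<^sup>2 / norm(x - y)powr(2 + 2 * si)"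
proof -
have "(norm(x - y)powr(1 + si))\<^sup>2 = norm(x - y)powr(2 + 2 * si)"
unfolding power2_eq_square powr_add[symmetric]by(simp add: algebra_simps)
thus ?thesis by(simp add: slob_quot_def power_divide)
qed

context bounded_plane
begin

abbreviation MM where "MM\<equiv>lebesgue_on S\<Otimes>\<^sub>M lebesgue_on S"

lemma finite_M:"finite_measure(lebesgue_on S)"
by(intro finite_measure_lebesgue_on lmeasurable_open bounded_S open_S)

lemma sigma_finite_M:"sigma_finite_measure(lebesgue_on S)"
using finite_M by(simp add: finite_measure_def)

lemma slob_quot_measurable:
assumes[measurable]:"g\<in>borel_measurable(lebesgue_on S)"
shows "slob_quot si g\<in>borel_measurable MM"
proof -
note[measurable] = measurable_ident_lebesgue_on
have[measurable]:"fst\<in>borel_measurable MM""snd\<in>borel_measurable MM"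
using measurable_compose[OF measurable_fst measurable_ident_lebesgue_on,of S "lebesgue_on S"]
 measurable_compose[OF measurable_snd measurable_ident_lebesgue_on,of "lebesgue_on S"S]by simp_all
have[measurable]:"(%p. g(fst p))\<in>borel_measurable MM""(%p. g(snd p))\<in>borel_measurable MM"
using measurable_compose[OF measurable_fst assms]measurable_compose[OF measurable_snd assms] .
show ?thesis unfolding slob_quot_def[abs_def]
by(intro borel_measurable_divide borel_measurable_diff powr_real_measurable borel_measurable_norm)measurable
qed

lemma slob_eq:
assumes "g\<in>borel_measurable(lebesgue_on S)""si\<noteq>0"
shows "slob S si g = (\<integral>\<^sup>+p. ennreal((slob_quot si g p)\<^sup>2)\<partial>MM)"
proof -
interpret sigma_finite_measure "lebesgue_on S"by(rule sigma_finite_M)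
have[measurable]:"slob_quot si g\<in>borel_measurable MM"by(rule slob_quot_measurable[OF assms(1)])
show ?thesis using assms(2)by(subst nn_integral_fst[symmetric])(auto simp: slob_def slob_quot_square)
qed

lemma slob_finite_iff:
assumes "g\<in>borel_measurable(lebesgue_on S)""si\<noteq>0"
shows "slob S si g < \<infinity>\<longleftrightarrow>slob_quot si g\<in>L2 MM"
proof
assume "slob S si g < \<infinity>"
thus "slob_quot si g\<in>L2 MM"using slob_quot_measurable[OF assms(1),of si]
unfolding slob_eq[OF assms]by(auto simp: L2_def intro!: integrableI_nonneg)
next
assume "slob_quot si g\<in>L2 MM"
from nn_integral_norm2[OF this]show "slob S si g < \<infinity>"unfolding slob_eq[OF assms]by simp
qed

lemma slob_inner_eq:
assumes "g\<in>borel_measurable(lebesgue_on S)""slob S si g < \<infinity>"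
shows "slob_inner S si g g = enn2real(slob S si g)"
proof(cases "si = 0")
case False
have "slob_quot si g\<in>L2 MM"using slob_finite_iff[OF assms(1)False]assms(2)by simp
from nn_integral_norm2[OF this]show ?thesis unfolding slob_eq[OF assms(1)False]using False
by(simp add: slob_inner_def norm2_def inner2_def)
qed(simp add: slob_inner_def slob_def)

text \<open>Linearity of weak derivatives holds almost everywhere on \<open>S\<close> and is
  transferred here to the product, where the Slobodeckij quotients live.\<close>

lemma AE_pair:
assumes "AE x in lebesgue_on S. P x"shows "AE p in MM. P(fst p)&P(snd p)"
proof -
interpret sigma_finite_measure "lebesgue_on S"by(rule sigma_finite_M)
obtain N where N:"N\<in>null_sets(lebesgue_on S)""{x\<in>space(lebesgue_on S). ~P x}\<subseteq>N"
using assms by(auto elim!: AE_E simp: null_sets_def)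
let ?A = "N\<times>space(lebesgue_on S)"and ?B = "space(lebesgue_on S)\<times>N"
have "?A\<in>null_sets MM""?B\<in>null_sets MM"
using N(1)by(auto simp: null_sets_def emeasure_pair_measure_Times)
hence AB:"?A\<union>?B\<in>null_sets MM"by(rule null_sets.Un)
have "{p\<in>space MM. ~(P(fst p)&P(snd p))}\<subseteq>?A\<union>?B"
using N(2)by(auto simp: space_pair_measure)
thus ?thesis by(rule AE_I'[OF AB])
qed

lemma slob_quot_lin:
assumes "ae_eq S g(%x. c * g1 x + g2 x)"
shows "AE p in MM. slob_quot si g p = c * slob_quot si g1 p + slob_quot si g2 p"
using AE_pair[OF assms[unfolded ae_eq_def]]
by eventually_elim(simp add: slob_quot_def add_divide_distrib[symmetric]diff_divide_distrib[symmetric]algebra_simps)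

lemma Hs_iff:
"v\<in>Hs S s\<longleftrightarrow>v\<in>Hs S(real(nat\<lfloor>s\<rfloor>))&
 (frac s\<noteq>0-->(\<forall>bs\<in>dirs(nat\<lfloor>s\<rfloor>). slob_quot(frac s)(wderiv S bs v)\<in>L2 MM))"
proof -
have "(\<forall>bs\<in>dirs(nat\<lfloor>s\<rfloor>). slob S(frac s)(wderiv S bs v) < \<infinity>)\<longleftrightarrow>
 (frac s\<noteq>0-->(\<forall>bs\<in>dirs(nat\<lfloor>s\<rfloor>). slob_quot(frac s)(wderiv S bs v)\<in>L2 MM))"
if v:"v\<in>Hs S(real(nat\<lfloor>s\<rfloor>))"
proof(cases "frac s = 0")
case True thus ?thesis by(simp add: slob_def)
next
case False
have "wderiv S bs v\<in>borel_measurable(lebesgue_on S)"if "bs\<in>dirs(nat\<lfloor>s\<rfloor>)"for bs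
 using wderiv(1)[OF Hs_mem_wderiv[OF v order_refl that]]by(rule L2_measurable)
thus ?thesis using slob_finite_iff False by simp
qed
moreover have "v\<in>Hs S(real(nat\<lfloor>s\<rfloor>))\<longleftrightarrow>v\<in>L2S S&(\<forall>j\<le>nat\<lfloor>s\<rfloor>. \<forall>bs\<in>dirs j. \<exists>g\<in>L2S S. weak_deriv S bs v g)"
unfolding Hs_nat by(simp add: has_wderiv_def)
ultimately show ?thesis unfolding Hs_def by blast
qed

text \<open>The purpose is the reverse triangle inequality for the fractional norm. It makes the
  norm a Lipschitz functional, so that the norm of a Bochner measurable function is measurable in
  time.\<close>

lemma semidef_Hs:
"semidef_form(Hs S s)(%v w. Hinner(nat\<lfloor>s\<rfloor>)S v w +
 (\<Sum>bs\<in>dirs(nat\<lfloor>s\<rfloor>). slob_inner S(frac s)(wderiv S bs v)(wderiv S bs w)))"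
proof -
let ?m = "nat\<lfloor>s\<rfloor>"and ?si = "frac s"
interpret H: semidef_form "Hs S(real ?m)""Hinner ?m S"by(rule semidef_Hinner)
have L:"slob_quot ?si(wderiv S bs v)\<in>L2 MM"if "v\<in>Hs S s""bs\<in>dirs ?m""?si\<noteq>0"for v bs
using that Hs_iff by blast
have Hm:"v\<in>Hs S(real ?m)"if "v\<in>Hs S s"for v using that Hs_iff by blast
have lin:"AE p in MM. slob_quot ?si(wderiv S bs(%x. c * v x + w x))p
 = c * slob_quot ?si(wderiv S bs v)p + slob_quot ?si(wderiv S bs w)p"
if "v\<in>Hs S s""w\<in>Hs S s""bs\<in>dirs ?m"for v w bs c
using that by(intro slob_quot_lin wderiv_lin Hs_L2[OF Hm]Hs_mem_wderiv[OF Hm order_refl]dirsD(1))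
have meas:"slob_quot ?si(wderiv S bs v)\<in>borel_measurable MM"if "v\<in>Hs S(real ?m)""bs\<in>dirs ?m"for v bs
by(rule slob_quot_measurable[OF L2_measurable[OF wderiv(1)[OF Hs_mem_wderiv[OF that(1)order_refl that(2)]]]])
have mem:"(%x. c * v x + w x)\<in>Hs S s"if v:"v\<in>Hs S s""w\<in>Hs S s"for v w c
proof -
have vw:"(%x. c * v x + w x)\<in>Hs S(real ?m)"by(intro H.lin_mem Hm v)
have "slob_quot ?si(wderiv S bs(%x. c * v x + w x))\<in>L2 MM"if bs:"bs\<in>dirs ?m""?si\<noteq>0"for bs
proof(rule L2_cong_AE)
 show "(%p. c * slob_quot ?si(wderiv S bs v)p + slob_quot ?si(wderiv S bs w)p)\<in>L2 MM"
 using v bs by(intro Submission.L2.lin_mem L)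
 show "slob_quot ?si(wderiv S bs(%x. c * v x + w x))\<in>borel_measurable MM"by(rule meas[OF vw bs(1)])
 show "AE p in MM. c * slob_quot ?si(wderiv S bs v)p + slob_quot ?si(wderiv S bs w)p
  = slob_quot ?si(wderiv S bs(%x. c * v x + w x))p"
 using lin[OF v bs(1),of c]by eventually_elim simp
qed
thus ?thesis using Hs_iff vw by blast
qed
have sl:"slob_inner S ?si(wderiv S bs(%x. c * v x + w x))(wderiv S bs z)
 = c * slob_inner S ?si(wderiv S bs v)(wderiv S bs z) + slob_inner S ?si(wderiv S bs w)(wderiv S bs z)"
if v:"v\<in>Hs S s""w\<in>Hs S s""z\<in>Hs S s"and bs:"bs\<in>dirs ?m"for v w z bs c
proof(cases "?si = 0")
case False
have "inner2 MM(slob_quot ?si(wderiv S bs(%x. c * v x + w x)))(slob_quot ?si(wderiv S bs z))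
 = inner2 MM(%p. c * slob_quot ?si(wderiv S bs v)p + slob_quot ?si(wderiv S bs w)p)(slob_quot ?si(wderiv S bs z))"
 using lin[OF v(1,2)bs,of c]L[OF v(1)bs False]L[OF v(2)bs False]L[OF v(3)bs False]L[OF mem[OF v(1,2)]bs False]
 by(intro inner2_cong_AE)(auto dest!: L2_measurable)
thus ?thesis using False Submission.L2.lin_left[OF L[OF v(1)bs False]L[OF v(2)bs False]L[OF v(3)bs False]]
 by(simp add: slob_inner_def)
qed(simp add: slob_inner_def)
show ?thesis
proof
show "(%x. 0)\<in>Hs S s"
proof -
 have "ae_eq S(wderiv S bs(%x. 0))(%x. 0 * 0 + 0)"if "bs\<in>dirs ?m"for bs
 using wderiv_eq(2)[OF L2.zero_mem,of bs "%x. 0"]by(simp add: weak_deriv_def ip_def)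
 note a = slob_quot_lin[OF this,of _ ?si]
 have "slob_quot ?si(wderiv S bs(%x. 0))\<in>L2 MM"if "bs\<in>dirs ?m"for bs
 by(rule L2_cong_AE[OF Submission.L2.zero_mem meas[OF H.zero_mem that]])
  (use a[OF that]in \<open>auto simp: slob_quot_def[of _ "%x. 0"]elim!: eventually_mono\<close>)
 thus ?thesis using Hs_iff[of "%x. 0"s]H.zero_mem by blast
qed
next
fix v w z c assume v:"v\<in>Hs S s""w\<in>Hs S s"
show "(%x. c * v x + w x)\<in>Hs S s"by(rule mem[OF v])
show "Hinner ?m S v w + (\<Sum>bs\<in>dirs ?m. slob_inner S ?si(wderiv S bs v)(wderiv S bs w)) =
 Hinner ?m S w v + (\<Sum>bs\<in>dirs ?m. slob_inner S ?si(wderiv S bs w)(wderiv S bs v))"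
 using H.sym[OF Hm[OF v(1)]Hm[OF v(2)]]by(auto simp: slob_inner_def inner2_def mult.commute intro!: sum.cong)
assume z:"z\<in>Hs S s"
have "(\<Sum>bs\<in>dirs ?m. slob_inner S ?si(wderiv S bs(%x. c * v x + w x))(wderiv S bs z)) =
 (\<Sum>bs\<in>dirs ?m. c * slob_inner S ?si(wderiv S bs v)(wderiv S bs z) + slob_inner S ?si(wderiv S bs w)(wderiv S bs z))"
 by(intro sum.cong refl sl v z)
thus "Hinner ?m S(%x. c * v x + w x)z + (\<Sum>bs\<in>dirs ?m. slob_inner S ?si(wderiv S bs(%x. c * v x + w x))(wderiv S bs z)) =
 c * (Hinner ?m S v z + (\<Sum>bs\<in>dirs ?m. slob_inner S ?si(wderiv S bs v)(wderiv S bs z))) +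
 (Hinner ?m S w z + (\<Sum>bs\<in>dirs ?m. slob_inner S ?si(wderiv S bs w)(wderiv S bs z)))"
 using H.lin_left[OF Hm[OF v(1)]Hm[OF v(2)]Hm[OF z],of c]by(simp add: sum.distrib sum_distrib_left algebra_simps)
next
fix v assume "v\<in>Hs S s"
thus "0\<le>Hinner ?m S v v + (\<Sum>bs\<in>dirs ?m. slob_inner S ?si(wderiv S bs v)(wderiv S bs v))"
 by(intro add_nonneg_nonneg H.nonneg Hm sum_nonneg)(auto simp: slob_inner_def inner2_def)
qed
qed

lemma Hnorm_eq_form:
assumes v:"v\<in>Hs S s"
shows "Hnorm S s v = sqrt(Hinner(nat\<lfloor>s\<rfloor>)S v v + (\<Sum>bs\<in>dirs(nat\<lfloor>s\<rfloor>). slob_inner S(frac s)(wderiv S bs v)(wderiv S bs v)))"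
proof -
have "slob_inner S(frac s)(wderiv S bs v)(wderiv S bs v) = enn2real(slob S(frac s)(wderiv S bs v))"
if bs:"bs\<in>dirs(nat\<lfloor>s\<rfloor>)"for bs
using v bs by(intro slob_inner_eq L2_measurable[OF wderiv(1)[OF HsD[OF v order_refl bs]]])(auto simp: Hs_def)
thus ?thesis by(simp add: Hnorm_def Hinner_def L2norm_square)
qed

lemma Hnorm_triangle_rev:
assumes v:"v\<in>Hs S s"and w:"w\<in>Hs S s"
shows "\<bar>Hnorm S s v - Hnorm S s w\<bar>\<le>Hnorm S s(%x. v x - w x)"
proof -
interpret H: semidef_form "Hs S s""%v w. Hinner(nat\<lfloor>s\<rfloor>)S v w +
 (\<Sum>bs\<in>dirs(nat\<lfloor>s\<rfloor>). slob_inner S(frac s)(wderiv S bs v)(wderiv S bs w))"by(rule semidef_Hs)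
show ?thesis using H.nrm_triangle_rev[OF v w]H.diff_mem[OF v w]v w by(simp add: Hnorm_eq_form H.nrm_def)
qed

end

section \<open>Primitives and weak derivatives on an interval\<close>

lemma smooth_real_derivative:
assumes "smooth(etz :: real=>real)"
shows "(etz has_real_derivative deriv etz x)(at x)""pd 1 etz = deriv etz"
proof -
have d:"(etz has_real_derivative pd 1 etz x)(at x)"for x
proof -
have "(%v. \<Sum>b\<in>Basis. (v\<bullet>b) * pd b etz x) = (*)(pd 1 etz x)"by(simp add: fun_eq_iff)
thus ?thesis
 using has_derivative_pd[OF smooth_differentiable[OF assms],of x]by(simp add: has_field_derivative_def)
qed
show "pd 1 etz = deriv etz"using DERIV_imp_deriv[OF d]by(auto simp: fun_eq_iff)
thus "(etz has_real_derivative deriv etz x)(at x)"using d by simp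
qed

lemma test_fun_deriv:"test_fun S(etz :: real=>real)==>test_fun S(deriv etz)"
using test_fun_pd[of S etz 1]smooth_real_derivative(2)[OF test_fun_smooth]by fastforce

lemma smooth_antiderivative:
assumes "!!x. (F has_real_derivative f x)(at x)""smooth f"
shows "smooth F"
proof(rule smooth_coinduct[where X = "%g. g = F\<or>smooth g"])
have p:"pd 1 F = f"
using pd_eq[OF assms(1)[unfolded has_field_derivative_def],of 1]by(auto simp: fun_eq_iff)
show "g = F\<or>smooth g==>b\<in>Basis==>pd b g = F\<or>smooth(pd b g)"for g and b :: real
using p assms(2)by(auto simp: smooth_pd)
show "g = F\<or>smooth g==>g differentiable at x"for g x
using differentiableI[OF assms(1)[of x,unfolded has_field_derivative_def]]smooth_differentiable by blast
qed simp

lemma test_fun_interval: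
assumes "test_fun{0<..<T}(psz :: real=>real)""0 < T"
obtains a b where "0 < a""a < b""b < T""\<forall>x. x\<notin>{a..b}-->psz x = 0"
proof -
obtain K where K:"compact K""K\<subseteq>{0<..<T}""\<forall>x. x\<notin>K-->psz x = 0"
using assms(1)by(rule test_funE)
\<comment> \<open>The two extra points keep the compact set nonempty and force
  \<open>a < b\<close>.\<close>
let ?K = "insert(T/3)(insert(T/2)K)"
have c:"compact ?K""?K\<noteq>{}"using K(1)by auto
obtain a where a:"a\<in>?K""\<forall>x\<in>?K. a\<le>x"using compact_attains_inf[OF c]by blast
obtain b where b:"b\<in>?K""\<forall>x\<in>?K. x\<le>b"using compact_attains_sup[OF c]by blast
have "?K\<subseteq>{0<..<T}"using K(2)assms(2)by auto
hence "0 < a""b < T"using a(1)b(1)by(meson greaterThanLessThan_iff subsetD)+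
moreover have "a\<le>T/3""T/2\<le>b"using a(2)b(2)by simp_all
moreover have "\<forall>x. x\<notin>{a..b}-->psz x = 0"using a(2)b(2)K(3)by(metis atLeastAtMost_iff insertCI)
ultimately show thesis using assms(2)by(intro that[of a b])simp_all
qed

lemma test_fun_antiderivative:
assumes t:"test_fun{0<..<T}(psz :: real=>real)"and T:"0 < T"and z:"(\<integral>x. psz x\<partial>lborel) = 0"
obtains etz where "test_fun{0<..<T}etz""deriv etz = psz"
proof -
obtain a b where ab:"0 < a""a < b""b < T""\<forall>x. x\<notin>{a..b}-->psz x = 0"using t T by(rule test_fun_interval)
have sm:"smooth psz"by(rule test_fun_smooth[OF t])
define etz where "etz x = integral{0..x}psz"for x
have out:"etz x = 0"if "x\<notin>{a..b}"for x
proof(cases "x < a")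
case True
have "integral{0..x}psz = integral{0..x}(%x. 0)"using ab True by(intro integral_cong)auto
thus ?thesis by(simp add: etz_def)
next
case False
hence x:"b < x"using that by auto
have "integrable lborel psz"by(rule test_fun_integrable_lborel[OF t])
hence "(psz has_integral 0)UNIV"using has_integral_integral_lborel[of psz]z by simp
moreover have "(%y. if y\<in>{0..x}then psz y else 0) = psz"using ab x by(auto simp: fun_eq_iff)
ultimately have "(psz has_integral 0){0..x}"using has_integral_restrict_UNIV[of "{0..x}"psz]by simp
thus ?thesis by(simp add: etz_def integral_unique)
qed
have d:"(etz has_real_derivative psz x)(at x)"for x
proof(cases "x < a")
case True
have "((%x. 0)has_real_derivative psz x)(at x)"using ab True by simp
thus ?thesis
 by(rule has_field_derivative_transform_within_open[of _ _ _ "{..<a}"])(use True out in auto)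
next
case False
have "((%u. integral{0..u}psz)has_vector_derivative psz x)(at x within{0..x+1})"
 using False ab by(intro integral_has_vector_derivative smooth_continuous_on sm)auto
moreover have "at x within{0..x+1} = at x"using False ab by(intro at_within_interior)auto
ultimately show ?thesis by(simp add: etz_def[abs_def]has_real_derivative_iff_has_vector_derivative)
qed
show thesis
proof(rule that)
show "test_fun{0<..<T}etz"
 by(rule test_funI[OF smooth_antiderivative[OF d sm],of "{a..b}"])(use ab out in auto)
show "deriv etz = psz"using DERIV_imp_deriv[OF d]by auto
qed
qed

section \<open>Weak derivatives on the time interval and primitives\<close>

lemma finite_tm:"finite_measure(tm T)"
by(intro finite_measure_lebesgue_on lmeasurable_interval)

lemma tm_sets:"{0<..<T::real}\<in>sets lebesgue"by(rule fmeasurableD[OF lmeasurable_interval(2)])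

lemma measure_tm:"0 < T==>measure(tm T)(space(tm T)) = T"
by(simp add: measure_restrict_space)

text \<open>Subtracting from a test function the multiple of a fixed bump \<open>om\<close> with the
  same integral leaves a function whose primitive is again a test function. Hence \<open>g\<close>
  sees only the integral of a test function, and \<open>c\<close> is its pairing with the
  bump.\<close>

lemma weak_derivative_zero:
assumes T:"0 < T"and g:"g\<in>L2(tm T)"
and 0:"!!etz. test_fun{0<..<T}etz==>(\<integral>t. g t * deriv etz t\<partial>tm T) = 0"
obtains c where "AE t in tm T. g t = c"
proof -
obtain etz0 ::"real=>real"where e:"smooth etz0""!!x. 1/2\<le>norm x==>etz0 x = 0""(\<integral>x. etz0 x\<partial>lborel) = 1"
using mollifier_exists by metis
\<comment> \<open>The mollifier is moved to the centre \<open>T/2\<close> and scaled so that its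
  support lies in the middle half of the interval.\<close>
define om where "om x = (2/T) * etz0(-1 + (2/T) * x)"for x
have "smooth om"unfolding om_def[abs_def]
using smooth_cmult[OF smooth_affine(1)[OF e(1),of "2/T""-1"],of "2/T"]by(simp add: algebra_simps)
moreover have "om x = 0"if "x\<notin>{T/4..3*T/4}"for x
proof -
have "1/2\<le>\<bar>-1 + (2/T) * x\<bar>"using that T by(auto simp: field_simps abs_if)
thus ?thesis using e(2)[of "-1 + (2/T) * x"]by(simp add: om_def)
qed
ultimately have t:"test_fun{0<..<T}om"using T by(intro test_funI[of _ "{T/4..3*T/4}"])auto
have i:"(\<integral>x. om x\<partial>lborel) = 1"
using lborel_integral_real_affine[of "2/T"etz0 "-1"]e(3)T by(simp add: om_def[abs_def])
have sm:"integral\<^sup>L(tm T)ph = integral\<^sup>L lborel ph"if "test_fun{0<..<T}ph"for ph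
by(rule integral_lebesgue_on_eq_lborel(1)[OF tm_sets smooth_measurable[OF test_fun_smooth[OF that]]test_fun_outside[OF that]])
note L = test_fun_L2[OF tm_sets]
define c where "c = (\<integral>t. g t * om t\<partial>tm T)"
have "AE t in tm T. g t - c = 0"
proof(rule test_fun_separating)
show gc:"(%t. g t - c)\<in>L2(tm T)"by(intro L2.diff_mem g L2_const finite_tm)
fix ph assume ph:"test_fun{0<..<T}ph"
define d where "d = (\<integral>t. ph t\<partial>lborel)"
have ps:"test_fun{0<..<T}(%x. ph x - d * om x)"by(intro test_fun_diff test_fun_cmult ph t)
have "(\<integral>x. ph x - d * om x\<partial>lborel) = 0"
 using test_fun_integrable_lborel[OF ph]test_fun_integrable_lborel[OF t]i by(simp add: d_def)
then obtain etz where "test_fun{0<..<T}etz""deriv etz = (%x. ph x - d * om x)"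
 using test_fun_antiderivative[OF ps T]by blast
from 0[OF this(1)]this(2)have "inner2(tm T)g(%x. ph x - d * om x) = 0"by(simp add: inner2_def)
hence "inner2(tm T)g ph = d * c"
 using L2.diff_right[OF L[OF ph]L2.cmult_mem[OF L[OF t]]g]L2.cmult_right[OF L[OF t]g,of d]by(simp add: c_def inner2_def)
moreover have "inner2(tm T)(%t. c)ph = c * d"using sm[OF ph]by(simp add: inner2_def d_def)
ultimately show "inner2(tm T)(%t. g t - c)ph = 0"
 using L2.diff_left[OF g L2_const[OF finite_tm]L[OF ph],of c]by simp
qed simp
thus thesis by(intro that[of c])(auto elim!: eventually_mono)
qed

text \<open>The primitive that vanishes at 0. The indicator form keeps all integrals over the one
  measure \<open>tm T\<close>, so that exchange of integrals and dominated convergence apply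
  directly.\<close>

definition prim ::"real=>(real=>real)=>real=>real"where
"prim T b t = (\<integral>r. indicator{..t}r * b r\<partial>tm T)"

lemma prim_integrable:
assumes "integrable(tm T)b"shows "integrable(tm T)(%r. indicator{..t}r * b r :: real)"
proof(rule Bochner_Integration.integrable_bound[OF assms])
show "(%r. indicator{..t}r * b r)\<in>borel_measurable(tm T)"
by(intro borel_measurable_times borel_measurable_lebesgue_on borel_measurable_integrable[OF assms])simp
qed(auto simp: indicator_def)

lemma prim_cong:"integrable(tm T)b==>integrable(tm T)b' ==>AE r in tm T. b r = b' r==>prim T b t = prim T b' t"
unfolding prim_def by(intro integral_cong_AE borel_measurable_integrable prim_integrable)(auto elim!: eventually_mono)

lemma prim_lin:"integrable(tm T)a==>integrable(tm T)b==>prim T(%r. c * a r + b r)t = c * prim T a t + prim T b t"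
using prim_integrable[of T a t]prim_integrable[of T b t]by(simp add: prim_def algebra_simps)

lemma prim_0:"prim T b 0 = 0"
unfolding prim_def by(subst Bochner_Integration.integral_cong[OF refl,of _ _ "%_. 0"])(auto simp: indicator_def)

lemma prim_T:"prim T b T = integral\<^sup>L(tm T)b"
unfolding prim_def by(rule Bochner_Integration.integral_cong)(auto simp: indicator_def)

lemma prim_bound:
assumes "integrable(tm T)b""integrable(tm T)bez""AE r in tm T. \<bar>b r\<bar>\<le>bez r""s\<le>t"
shows "\<bar>prim T b t - prim T b s\<bar>\<le>prim T bez t - prim T bez s"
proof -
have e:"prim T f t - prim T f s = (\<integral>r. (indicator{..t}r - indicator{..s}r) * f r\<partial>tm T)" 
"integrable(tm T)(%r. (indicator{..t}r - indicator{..s}r) * f r)"if "integrable(tm T)f"for f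
using prim_integrable[OF that,of t]prim_integrable[OF that,of s]by(simp_all add: prim_def left_diff_distrib)
have "\<bar>prim T b t - prim T b s\<bar>\<le>(\<integral>r. \<bar>(indicator{..t}r - indicator{..s}r) * b r\<bar>\<partial>tm T)"
unfolding e(1)[OF assms(1)]by(rule integral_abs_bound)
also have "...\<le>(\<integral>r. (indicator{..t}r - indicator{..s}r) * bez r\<partial>tm T)"
using assms(3,4)by(intro integral_mono_AE integrable_abs e assms(1,2))(auto simp: indicator_def elim!: eventually_mono)
finally show ?thesis using e(1)[OF assms(2)]by simp
qed

lemma prim_mono:"integrable(tm T)bez==>(!!r. 0\<le>bez r)==>s\<le>t==>prim T bez s\<le>prim T bez t"
using prim_bound[of T bez bez s t]by auto

lemma prim_continuous: assumes b:"integrable(tm T)b"shows "continuous_on A(prim T b)"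
proof -
have "(prim T b\<longlongrightarrow>prim T b t)(at t within A)"for t
proof(rule tendsto_at_iff_sequentially[THEN iffD2],intro allI impI)
fix X assume X:"\<forall>i. X i\<in>A - {t}""X---->t"
have "(%i. indicator{..X i}r * b r)---->indicator{..t}r * b r"if r:"r\<noteq>t"for r
proof -
 have "eventually(%i. indicator{..X i}r = (indicator{..t}r :: real))sequentially"
 proof(cases "r < t")
 case True show ?thesis using order_tendstoD(1)[OF X(2)True]by(rule eventually_mono)(use True in auto)
 next
 case False hence "t < r"using r by auto
 show ?thesis using order_tendstoD(2)[OF X(2) \<open>t < r\<close>]by(rule eventually_mono)(use \<open>t < r\<close> in auto)
 qed
 thus ?thesis by(intro tendsto_mult tendsto_const tendsto_eventually)
qed
hence *:"r\<noteq>t==>(%i. indicator{..X i}r * b r)---->indicator{..t}r * b r"for r .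
have "AE r in tm T. r\<noteq>t"using AE_lebesgue_on_negligible[OF tm_sets negligible_sing,of t T]by simp
hence "AE r in tm T. (%i. indicator{..X i}r * b r)---->indicator{..t}r * b r"by(rule eventually_mono)(rule *)
thus "(prim T b\<circ>X)---->prim T b t"unfolding prim_def comp_def
 by(rule integral_dominated_convergence[where w = "%r. \<bar>b r\<bar>",rotated 3])
 (use b prim_integrable[OF b]in "auto simp: indicator_def")
qed
thus ?thesis by(simp add: continuous_on)
qed

text \<open>Exchange of integrals over the region \<open>r \<le> t\<close>; the inner integral of
  the derivative from \<open>r\<close> to \<open>T\<close> is minus the value at \<open>r\<close>,
  as the test function vanishes at \<open>T\<close>.\<close>

lemma prim_weak:
assumes T:"0 < T"and b:"integrable(tm T)b"and t:"test_fun{0<..<T}etz"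
shows "(\<integral>t. prim T b t * deriv etz t\<partial>tm T) = - (\<integral>t. b t * etz t\<partial>tm T)"
proof -
interpret F: finite_measure "tm T"by(rule finite_tm)
interpret pair_sigma_finite "tm T""tm T" ..
note td = test_fun_deriv[OF t]
obtain B where B:"0\<le>B""\<forall>x. \<bar>deriv etz x\<bar>\<le>B"using test_fun_bounded[OF td]by blast
have[measurable]:"deriv etz\<in>borel_measurable(tm T)"by(rule smooth_measurable_on[OF test_fun_smooth[OF td]])
have[measurable]:"b\<in>borel_measurable(tm T)"using b by simp
note[measurable] = measurable_compose[OF measurable_fst measurable_ident_lebesgue_on,of "{0<..<T}""tm T"]
 measurable_compose[OF measurable_snd measurable_ident_lebesgue_on,of "tm T""{0<..<T}"]
let ?f = "%r t. (if r\<le>t then 1 else 0) * b r * deriv etz t"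
have m:"case_prod ?f\<in>borel_measurable(tm T\<Otimes>\<^sub>M tm T)"unfolding case_prod_beta by measurable
have bB:"integrable(tm T)(%t. \<bar>?f r t\<bar>)""(\<integral>t. \<bar>?f r t\<bar>\<partial>tm T)\<le>\<bar>b r\<bar> * B * T"for r
proof -
have le:"\<bar>?f r t\<bar>\<le>\<bar>b r\<bar> * B"for t using B by(auto simp: abs_mult intro!: mult_left_mono)
show i:"integrable(tm T)(%t. \<bar>?f r t\<bar>)"
 using le measurable_ident_lebesgue_on[measurable]by(intro F.integrable_const_bound[of _ "\<bar>b r\<bar> * B"])auto
have "(\<integral>t. \<bar>?f r t\<bar>\<partial>tm T)\<le>(\<integral>t. \<bar>b r\<bar> * B\<partial>tm T)"by(intro integral_mono i le)simp
thus "(\<integral>t. \<bar>?f r t\<bar>\<partial>tm T)\<le>\<bar>b r\<bar> * B * T"using measure_tm[OF T]by(simp add: ac_simps)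
qed
have i:"integrable(tm T\<Otimes>\<^sub>M tm T)(case_prod ?f)"
proof(rule Fubini_integrable[OF m])
have mm:"(%r. \<integral>t. norm(case_prod ?f(r,t))\<partial>tm T)\<in>borel_measurable(tm T)"
 by(rule F.borel_measurable_lebesgue_integral)(use m in measurable)
show "integrable(tm T)(%r. \<integral>t. norm(case_prod ?f(r,t))\<partial>tm T)"
 by(rule Bochner_Integration.integrable_bound[OF _ mm,of "%r. \<bar>b r\<bar> * B * T"])
 (use b bB(2)T B in "auto intro!: AE_I2")
show "AE r in tm T. integrable(tm T)(%t. case_prod ?f(r,t))"
proof(rule AE_I2)
 fix r
 show "integrable(tm T)(%t. case_prod ?f(r,t))"
 by(rule integrable_abs_cancel)(use bB(1)measurable_ident_lebesgue_on[measurable]in "simp_all")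
qed
qed
have inner:"(\<integral>t. ?f r t\<partial>tm T) = - (b r * etz r)"if r:"r\<in>{0<..<T}"for r
proof -
have o:"etz T = 0""!!t. t\<notin>{0<..<T}==>deriv etz t = 0"using test_fun_outside[OF t]test_fun_outside[OF td]by auto
have "(\<integral>t. ?f r t\<partial>tm T) = (\<integral>t. ?f r t\<partial>lborel)"
 using o(2)smooth_measurable[OF test_fun_smooth[OF td]]by(intro integral_lebesgue_on_eq_lborel(1))auto
also have "... = b r * (\<integral>t. indicator{r..T}t *\<^sub>R deriv etz t\<partial>lborel)"
 unfolding integral_mult_right_zero[symmetric]using o(2)
 by(intro Bochner_Integration.integral_cong)(auto simp: indicator_def)
also have "(\<integral>t. indicator{r..T}t *\<^sub>R deriv etz t\<partial>lborel) = etz T - etz r"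
 using r smooth_real_derivative(1)[OF test_fun_smooth[OF t]]
 by(intro integral_FTC_Icc smooth_continuous_on[OF test_fun_smooth[OF td]])
 (auto simp: has_real_derivative_iff_has_vector_derivative[symmetric]intro: DERIV_subset)
finally show ?thesis using o(1)by simp
qed
have "(\<integral>t. prim T b t * deriv etz t\<partial>tm T) = (\<integral>t. (\<integral>r. ?f r t\<partial>tm T)\<partial>tm T)"
unfolding prim_def integral_mult_left_zero[symmetric]
by(intro Bochner_Integration.integral_cong refl)(auto simp: indicator_def)
also have "... = (\<integral>r. (\<integral>t. ?f r t\<partial>tm T)\<partial>tm T)"by(rule Fubini_integral[OF i])
also have "... = (\<integral>r. - (b r * etz r)\<partial>tm T)"by(intro Bochner_Integration.integral_cong inner)auto
finally show ?thesis by simp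
qed

lemma weak_derivative_prim:
assumes T:"0 < T"and a:"a\<in>L2(tm T)"and b:"b\<in>L2(tm T)"
and w:"!!etz. test_fun{0<..<T}etz==>(\<integral>t. a t * deriv etz t\<partial>tm T) = - (\<integral>t. b t * etz t\<partial>tm T)"
obtains c where "AE t in tm T. a t = c + prim T b t"
proof -
have bi:"integrable(tm T)b"by(rule L2_integrable[OF finite_tm b])
have P:"prim T b\<in>L2(tm T)"
proof(rule L2_bounded[OF finite_tm])
show "prim T b\<in>borel_measurable(tm T)"
 by(intro borel_measurable_lebesgue_on borel_measurable_continuous_onI prim_continuous bi)
have "\<bar>prim T b t\<bar>\<le>(\<integral>r. \<bar>b r\<bar>\<partial>tm T)"for t
proof -
 have "\<bar>prim T b t\<bar>\<le>(\<integral>r. \<bar>indicator{..t}r * b r\<bar>\<partial>tm T)"unfolding prim_def by(rule integral_abs_bound)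
 also have "...\<le>(\<integral>r. \<bar>b r\<bar>\<partial>tm T)"
 by(intro integral_mono integrable_abs prim_integrable bi)(auto simp: indicator_def)
 finally show ?thesis .
qed
thus "AE t in tm T. \<bar>prim T b t\<bar>\<le>(\<integral>r. \<bar>b r\<bar>\<partial>tm T)"by simp
qed
have "(\<integral>t. (a t - prim T b t) * deriv etz t\<partial>tm T) = 0"if t:"test_fun{0<..<T}etz"for etz
using L2.diff_left[OF a P test_fun_L2[OF tm_sets test_fun_deriv[OF t]]]w[OF t]prim_weak[OF T bi t]by(simp add: inner2_def)
then obtain c where "AE t in tm T. a t - prim T b t = c"using weak_derivative_zero[OF T L2.diff_mem[OF a P]]by blast
thus thesis by(intro that[of c])(auto elim!: eventually_mono)
qed

text \<open>The device that carries almost everywhere bounds to every time, the endpoints included.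
  A violation would persist on a nonempty open part of the interval.\<close>

lemma AE_interval_le:
assumes T:"0 < T"and f:"continuous_on{0..T}f""continuous_on{0..T}g"
and ae:"AE t in tm T. f t\<le>g t"and t:"t\<in>{0..T}"
shows "f t\<le>(g t :: real)"
proof(rule ccontr)
assume "~f t\<le>g t"
hence pos:"0 < f t - g t"by simp
have "continuous_on{0..T}(%t. f t - g t)"by(intro continuous_on_diff f)
then obtain d where d:"0 < d""!!s. s\<in>{0..T}==>dist s t < d==>dist(f s - g s)(f t - g t) < f t - g t"
using t pos unfolding continuous_on_iff by metis
let ?U = "{0<..<T}\<inter>ball t d"
have "?U\<noteq>{}"
proof -
have "t\<in>closure{0<..<T}"using t T by simp
then obtain s where "s\<in>{0<..<T}""dist s t < d"using d(1)unfolding closure_approachable by blast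
thus ?thesis by(auto simp: dist_commute)
qed
hence "~negligible ?U"by(intro open_not_negligible)auto
moreover have "negligible ?U"
proof -
have "negligible{t\<in>{0<..<T}. ~f t\<le>g t}"
proof -
 obtain N where N:"N\<in>null_sets(tm T)""{x\<in>space(tm T). ~f x\<le>g x}\<subseteq>N"
 using ae by(auto elim!: AE_E simp: null_sets_def)
 hence "negligible N"by(simp add: negligible_iff_null_sets null_sets_restrict_space)
 thus ?thesis by(rule negligible_subset)(use N(2)in auto)
qed
thus ?thesis
proof(rule negligible_subset,safe)
 fix s assume s:"s\<in>{0<..<T}""s\<in>ball t d""f s\<le>g s"
 have "dist(f s - g s)(f t - g t) < f t - g t"using d(2)[of s]s by(auto simp: dist_commute)
 thus False using s(3)pos by(auto simp: dist_real_def abs_if split: if_splits)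
qed
qed
ultimately show False by blast
qed

lemma AE_interval_eq:
assumes T:"0 < T"and f:"continuous_on{0..T}f""continuous_on{0..T}g"
and ae:"AE t in tm T. f t = (g t :: real)"and t:"t\<in>{0..T}"
shows "f t = g t"
proof(rule antisym)
show "f t\<le>g t"by(rule AE_interval_le[OF T f _ t])(use ae in eventually_elim,simp)
show "g t\<le>f t"by(rule AE_interval_le[OF T f(2,1)_ t])(use ae in eventually_elim,simp)
qed

lemma weak_derivative_continuous:
assumes T:"0 < T"and a:"continuous_on{0..T}a"and b:"b\<in>L2(tm T)"
and w:"!!etz. test_fun{0<..<T}etz==>(\<integral>t. a t * deriv etz t\<partial>tm T) = - (\<integral>t. b t * etz t\<partial>tm T)"
and st:"s\<in>{0..T}""t\<in>{0..T}"
shows "a t - a s = prim T b t - prim T b s"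
proof -
have aL:"a\<in>L2(tm T)"
proof -
obtain B where "\<forall>x\<in>{0..T}. norm(a x)\<le>B"
 using compact_imp_bounded[OF compact_continuous_image[OF a compact_Icc]]by(auto simp: bounded_iff)
moreover have "a\<in>borel_measurable(tm T)"
 by(rule continuous_imp_measurable_on_sets_lebesgue[OF continuous_on_subset[OF a]])auto
ultimately show ?thesis by(intro L2_bounded[OF finite_tm,of _ _ B])(auto intro!: AE_I2)
qed
obtain c where c:"AE t in tm T. a t = c + prim T b t"by(rule weak_derivative_prim[OF T aL b w])
have "a t = c + prim T b t"if "t\<in>{0..T}"for t
by(rule AE_interval_eq[OF T a _ c that])(intro continuous_intros prim_continuous L2_integrable[OF finite_tm b])
thus ?thesis using st by simp
qed

section \<open>Functions of time with values in a function space\<close>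

lemma borel_measurable_lebesgue_on_AE:
fixes f g ::"'a::euclidean_space=>real"
assumes f:"f\<in>borel_measurable(lebesgue_on S)"and S:"S\<in>sets lebesgue"and e:"AE x in lebesgue_on S. f x = g x"
shows "g\<in>borel_measurable(lebesgue_on S)"
proof -
have "(%x. if x\<in>S then f x else 0)\<in>borel_measurable lebesgue"using f S by(simp add: borel_measurable_if)
moreover have "AE x in lebesgue. (if x\<in>S then f x else 0) = (if x\<in>S then g x else 0)"
using e S by(subst(asm)AE_restrict_space_iff)(auto elim!: eventually_mono)
ultimately have "(%x. if x\<in>S then g x else 0)\<in>borel_measurable lebesgue"by(rule borel_measurable_AE)
thus ?thesis using S by(simp add: borel_measurable_if)
qed

text \<open>A Lipschitz functional applied to the approximating simple functions gives measurable
  functions that converge almost everywhere. Norms and pairings with a fixed element are the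
  functionals of interest.\<close>

lemma bochner_borel_measurable:
assumes g:"bochner_measurable T X nuz g"and F:"!!x y. x\<in>X==>y\<in>X==>\<bar>F x - F y\<bar>\<le>K * nuz(%z. x z - y z)"
shows "(%t. F(g t))\<in>borel_measurable(tm T)"
proof -
obtain s ::"nat=>real=>fld"where s:"!!j. simple_function(tm T)(s j)""!!j t. s j t\<in>X"
"AE t in tm T. (%j. nuz(%x. s j t x - g t x))---->0"and gX:"AE t in tm T. g t\<in>X"
using g unfolding bochner_measurable_def by blast
have m:"(%t. F(s j t))\<in>borel_measurable(tm T)"for j
by(rule borel_measurable_simple_function[OF simple_function_compose1[OF s(1)]])
have "AE t in tm T. lim(%j. F(s j t)) = F(g t)"using s(3)gX
proof eventually_elim
fix t assume t:"(%j. nuz(%x. s j t x - g t x))---->0""g t\<in>X"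
have "(%j. K * nuz(%x. s j t x - g t x))---->0"using tendsto_mult_right_zero[OF t(1)] .
hence "(%j. F(s j t) - F(g t))---->0"
 by(rule Lim_null_comparison[rotated])(use F[OF s(2)t(2)]in auto)
thus "lim(%j. F(s j t)) = F(g t)"by(intro limI)(simp add: LIM_zero_iff)
qed
thus ?thesis by(rule borel_measurable_lebesgue_on_AE[OF borel_measurable_lim_metric[OF m]tm_sets])
qed

lemma time_continuous_compose:
assumes g:"time_continuous T X nuz g"and F:"!!x y. x\<in>X==>y\<in>X==>\<bar>F x - F y\<bar>\<le>K * nuz(%z. x z - y z)"
shows "continuous_on{0..T}(%t. F(g t))"
unfolding continuous_on
proof
fix t assume t:"t\<in>{0..T}"
have "((%s. nuz(%x. g s x - g t x))\<longlongrightarrow>0)(at t within{0..T})"and gX:"!!s. s\<in>{0..T}==>g s\<in>X"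
using g t unfolding time_continuous_def by blast+
hence "((%s. K * nuz(%x. g s x - g t x))\<longlongrightarrow>0)(at t within{0..T})"using tendsto_mult_right_zero by blast
hence "((%s. F(g s) - F(g t))\<longlongrightarrow>0)(at t within{0..T})"
by(rule Lim_null_comparison[rotated])
 (use F gX t in "auto simp: eventually_at_filter intro!: always_eventually")
thus "((%s. F(g s))\<longlongrightarrow>F(g t))(at t within{0..T})"by(simp add: LIM_zero_iff)
qed

lemma ip_lipschitz:"v\<in>L2S S==>x\<in>L2S S==>y\<in>L2S S==>\<bar>ip S x v - ip S y v\<bar>\<le>L2norm S v * L2norm S(%z. x z - y z)"
unfolding ip_eq_inner2 L2norm_eq_norm2
using L2.cauchy_schwarz[OF L2.diff_mem[of x _ y],of "lebesgue_on S"v]L2.diff_left[of x "lebesgue_on S"y v]by(simp add: mult.commute)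

lemma L2norm_lipschitz:"x\<in>L2S S==>y\<in>L2S S==>\<bar>L2norm S x - L2norm S y\<bar>\<le>1 * L2norm S(%z. x z - y z)"
unfolding L2norm_eq_norm2 using L2.nrm_triangle_rev[of x _ y]by simp

text \<open>The scalar content of square integrability in time with values in \<open>L^2\<close>:
  norms and pairings. It is available both for essentially bounded and for continuous functions of
  time.\<close>

definition pairable ::"real=>pt set=>(real=>fld)=>bool"where
"pairable T S g\<longleftrightarrow>(AE t in tm T. g t\<in>L2S S)&(%t. L2norm S(g t))\<in>L2(tm T)&
 (\<forall>v\<in>L2S S. (%t. ip S(g t)v)\<in>L2(tm T))"

lemma pairableD:
assumes "pairable T S g"
shows "AE t in tm T. g t\<in>L2S S""(%t. L2norm S(g t))\<in>L2(tm T)""integrable(tm T)(%t. L2norm S(g t))"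
"v\<in>L2S S==>(%t. ip S(g t)v)\<in>L2(tm T)""v\<in>L2S S==>integrable(tm T)(%t. ip S(g t)v)"
"v\<in>L2S S==>AE t in tm T. \<bar>ip S(g t)v\<bar>\<le>L2norm S(g t) * L2norm S v"
proof -
show *:"AE t in tm T. g t\<in>L2S S""(%t. L2norm S(g t))\<in>L2(tm T)""v\<in>L2S S==>(%t. ip S(g t)v)\<in>L2(tm T)"
using assms by(auto simp: pairable_def)
thus "integrable(tm T)(%t. L2norm S(g t))""v\<in>L2S S==>integrable(tm T)(%t. ip S(g t)v)"
using L2_integrable[OF finite_tm]by blast+
assume v:"v\<in>L2S S"
show "AE t in tm T. \<bar>ip S(g t)v\<bar>\<le>L2norm S(g t) * L2norm S v"
using *(1)by(rule eventually_mono)(use L2.cauchy_schwarz[OF _ v]in "simp add: ip_eq_inner2 L2norm_eq_norm2")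
qed

lemma pairableI:
assumes b:"bochner_measurable T(L2S S)(L2norm S)g"and n:"(%t. L2norm S(g t))\<in>L2(tm T)"
shows "pairable T S g"
unfolding pairable_def
proof(intro conjI ballI n)
show ae:"AE t in tm T. g t\<in>L2S S"using b by(simp add: bochner_measurable_def)
fix v assume v:"v\<in>L2S S"
have m:"(%t. ip S(g t)v)\<in>borel_measurable(tm T)"by(rule bochner_borel_measurable[OF b ip_lipschitz[OF v]])
have "integrable(tm T)(%t. (L2norm S v)\<^sup>2 * (L2norm S(g t))\<^sup>2)"using L2_square_integrable[OF n]by simp
hence "integrable(tm T)(%t. (ip S(g t)v)\<^sup>2)"
proof(rule Bochner_Integration.integrable_bound)
show "AE t in tm T. norm((ip S(g t)v)\<^sup>2)\<le>norm((L2norm S v)\<^sup>2 * (L2norm S(g t))\<^sup>2)"using ae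
proof eventually_elim
 fix t assume "g t\<in>L2S S"
 hence "\<bar>ip S(g t)v\<bar>\<le>L2norm S v * L2norm S(g t)"
 using L2.cauchy_schwarz[OF _ v,of "g t"]by(simp add: ip_eq_inner2 L2norm_eq_norm2 mult.commute)
 hence "\<bar>ip S(g t)v\<bar>\<^sup>2\<le>(L2norm S v * L2norm S(g t))\<^sup>2"by(rule power_mono)simp
 thus "norm((ip S(g t)v)\<^sup>2)\<le>norm((L2norm S v)\<^sup>2 * (L2norm S(g t))\<^sup>2)"by(simp add: power_mult_distrib)
qed
qed(use m in simp)
thus "(%t. ip S(g t)v)\<in>L2(tm T)"using m by(simp add: L2_def)
qed

lemma LTinf_L2:
assumes "g\<in>LTinf T X nuz""!!x y. x\<in>X==>y\<in>X==>\<bar>nuz x - nuz y\<bar>\<le>1 * nuz(%z. x z - y z)""!!x. 0\<le>nuz x"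
shows "(%t. nuz(g t))\<in>L2(tm T)"
proof -
obtain c where b:"bochner_measurable T X nuz g"and c:"AE t in tm T. nuz(g t)\<le>c"using assms by(auto simp: LTinf_def)
show ?thesis
by(rule L2_bounded[OF finite_tm bochner_borel_measurable[OF b assms(2)],of c])(use c assms(3)in auto)
qed

lemma LTinf_pairable: assumes g:"g\<in>LTinf T(L2S S)(L2norm S)"shows "pairable T S g"
by(rule pairableI[OF _ LTinf_L2[OF g L2norm_lipschitz L2norm_nonneg]])(use g in "simp add: LTinf_def")

lemma time_continuous_pairable:
assumes g:"time_continuous T(L2S S)(L2norm S)g"shows "pairable T S g"
unfolding pairable_def
proof(intro conjI ballI)
have c:"f\<in>L2(tm T)"if f:"continuous_on{0..T}f"for f ::"real=>real"
proof -
obtain B where "\<forall>x\<in>{0..T}. norm(f x)\<le>B"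
 using compact_imp_bounded[OF compact_continuous_image[OF f compact_Icc]]by(auto simp: bounded_iff)
moreover have "f\<in>borel_measurable(tm T)"
 by(rule continuous_imp_measurable_on_sets_lebesgue[OF continuous_on_subset[OF f]tm_sets])auto
ultimately show ?thesis by(intro L2_bounded[OF finite_tm,of _ _ B])(auto intro!: AE_I2)
qed
show "(%t. L2norm S(g t))\<in>L2(tm T)"by(rule c[OF time_continuous_compose[OF g L2norm_lipschitz]])
show "(%t. ip S(g t)v)\<in>L2(tm T)"if "v\<in>L2S S"for v
by(rule c[OF time_continuous_compose[OF g ip_lipschitz[OF that]]])
show "AE t in tm T. g t\<in>L2S S"using g by(auto simp: time_continuous_def intro!: AE_I2)
qed

text \<open>The infimum in \<open>LTinfnorm\<close> is attained, because countably many exceptional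
  sets have a null union.\<close>

lemma LTinfnorm_bound:
assumes "AE t in tm T. nuz(g t)\<le>c"
shows "AE t in tm T. nuz(g t)\<le>LTinfnorm T nuz g""0\<le>LTinfnorm T nuz g"
proof -
let ?C = "{c. 0\<le>c&(AE t in tm T. nuz(g t)\<le>c)}"
have ne:"max 0 c\<in>?C"using assms by(auto elim!: eventually_mono)
show "0\<le>LTinfnorm T nuz g"unfolding LTinfnorm_def by(rule cInf_greatest)(use ne in blast)+
have "AE t in tm T. nuz(g t)\<le>LTinfnorm T nuz g + 1 / real(Suc n)"for n
proof -
have "Inf ?C < LTinfnorm T nuz g + 1 / real(Suc n)"by(simp add: LTinfnorm_def)
then obtain d where "d\<in>?C""d < LTinfnorm T nuz g + 1 / real(Suc n)"using cInf_lessD[of ?C]ne by blast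
thus ?thesis by(auto elim!: eventually_mono)
qed
hence "AE t in tm T. \<forall>n. nuz(g t)\<le>LTinfnorm T nuz g + 1 / real(Suc n)"by(simp add: AE_all_countable)
thus "AE t in tm T. nuz(g t)\<le>LTinfnorm T nuz g"
proof(rule eventually_mono)
fix t assume *:"\<forall>n. nuz(g t)\<le>LTinfnorm T nuz g + 1 / real(Suc n)"
have "(%n. LTinfnorm T nuz g + 1 / real(Suc n))---->LTinfnorm T nuz g + 0"
 by(intro tendsto_add tendsto_const LIMSEQ_Suc lim_1_over_n)
thus "nuz(g t)\<le>LTinfnorm T nuz g"using * by(intro LIMSEQ_le_const)auto
qed
qed

text \<open>Cauchy-Schwarz in time; this is the origin of the factors \<open>sqrt T\<close> in the
  final constant.\<close>

lemma prim_LT2norm: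
assumes "0 < T""(%t. nuz(g t))\<in>L2(tm T)""!!x. 0\<le>nuz x"
shows "prim T(%t. nuz(g t))T\<le>sqrt T * LT2norm T nuz g"
using abs_integral_le_norm2[OF finite_tm assms(2)]assms(1,3)measure_tm[OF assms(1)]
by(simp add: prim_T LT2norm_def norm2_def inner2_def power2_eq_square mult.commute)

section \<open>From scalar increments to derivatives and norms\<close>

lemma prim_derivative:
assumes b:"continuous_on{0..T}b"and bi:"integrable(tm T)b"and t:"t\<in>{0..T}"
shows "(prim T b has_real_derivative b t)(at t within{0..T})"
proof -
have "prim T b s = integral{0..s}b"if s:"s\<in>{0..T}"for s
proof -
have "prim T b s = integral{0<..<T}(%r. indicator{..s}r * b r)"
 unfolding prim_def by(rule lebesgue_integral_eq_integral[OF prim_integrable[OF bi]tm_sets])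
also have "(%r. indicator{..s}r * b r) = (%r. if r\<in>{..s}then b r else 0)"by(auto simp: fun_eq_iff)
also have "integral{0<..<T}... = integral({..s}\<inter>{0<..<T})b"by(rule integral_restrict_Int)
also have "... = integral{0..s}b"
 by(rule integral_spike_set)(rule negligible_subset[of "{0,T}"],use s in auto)+
finally show ?thesis .
qed
moreover have "((%u. integral{0..u}b)has_real_derivative b t)(at t within{0..T})"
unfolding has_real_derivative_iff_has_vector_derivative by(rule integral_has_vector_derivative[OF b t])
ultimately show ?thesis
using t by(intro has_field_derivative_transform_within[of _ _ t "{0..T}"1 "prim T b"])auto
qed

lemma derivative_of_increments:
assumes inc:"!!s t. s\<in>{0..T}==>t\<in>{0..T}==>a t - a s = prim T b t - prim T b s"
and b:"continuous_on{0..T}b"and bi:"integrable(tm T)b"and t:"t\<in>{0..T}"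
shows "(a has_real_derivative b t)(at t within{0..T})"
proof -
have "((%r. prim T b r + (a t - prim T b t))has_real_derivative b t + 0)(at t within{0..T})"
by(intro DERIV_add prim_derivative b bi t DERIV_const)
thus ?thesis
by(intro has_field_derivative_transform_within[of "%r. prim T b r + (a t - prim T b t)"_ t "{0..T}"1 a])
 (use inc[OF t]t in "auto simp: algebra_simps")
qed

text \<open>How scalar estimates become norm estimates: a bound that is linear in the norm of the
  test element is applied to the element itself.\<close>

lemma norm_le_of_pairing:
assumes "z\<in>L2S S""0\<le>b""\<bar>ip S z z\<bar>\<le>b * L2norm S z"
shows "L2norm S z\<le>b"
proof(cases "L2norm S z = 0")
case False
hence "0 < L2norm S z"using L2norm_nonneg[of S z]by linarith
moreover have "L2norm S z * L2norm S z\<le>b * L2norm S z"using assms(3)L2norm_square[of S z]by(simp add: power2_eq_square)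
ultimately show ?thesis by simp
qed(use assms in simp)

context eigen
begin

text \<open>The identity of coefficients is the equation tested with eigenfunctions; expanding
  \<open>w\<close> and \<open>g\<close> in the pairing with a test function turns it into the
  distributional equation. Membership in \<open>H20 S\<close> follows from the square summable
  coefficients of \<open>g\<close>.\<close>

lemma spectral_bilaplacian:
assumes w:"w\<in>L2S S"and g:"g\<in>L2S S"and eq:"!!n. lam n * ip S w(psi n) = ip S g(psi n)"
shows "w\<in>H20 S""has_bilaplacian S w g"
proof -
show "w\<in>H20 S"by(rule spectral_H20[OF w])(use bessel(2)[OF g]eq in simp)
have P:"(%x. \<Sum>n<N. ip S h(psi n) * psi n x)\<in>L2S S"for h N
by(intro L2.sum_mem L2.cmult_mem psi_L2)
have lim:"(%N. \<Sum>n<N. ip S h(psi n) * ip S(psi n)z)---->ip S h z"if h:"h\<in>L2S S"and z:"z\<in>L2S S"for h z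
proof -
have "(%N. L2norm S(%x. (\<Sum>n<N. ip S h(psi n) * psi n x) - h x))---->0"
 using psi_expansion[OF h]L2.nrm_commute[OF h P]by simp
from L2.tendsto_form[OF P h z this]
show ?thesis using z by(simp add: L2.sum_left L2.cmult_mem L2.cmult_left psi_L2)
qed
show "has_bilaplacian S w g"unfolding has_bilaplacian_def
proof(intro conjI allI impI g)
fix ph assume ph:"test_fun S ph"
have b:"bilaplacian ph\<in>L2S S"unfolding bilaplacian_def[abs_def]
 by(intro L2.sum_mem test_pds_L2[OF ph])auto
have "ip S w(psi n) * ip S(psi n)(bilaplacian ph) = ip S g(psi n) * ip S(psi n)ph"for n
 using psi_bilaplacian[of n]ph L2.cmult_left[OF psi_L2 Hs_L2[OF test_Hs(1)[OF ph]],of "lam n"n]eq[of n,symmetric]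
 by(simp add: has_bilaplacian_def)
thus "ip S w(bilaplacian ph) = ip S g ph"
 using lim[OF w b]lim[OF g Hs_L2[OF test_Hs(1)[OF ph]]]LIMSEQ_unique by simp
qed
qed

text \<open>A function with a bounded weak derivative has a weakly continuous representative, obtained from
  the continuous representatives of its coefficients.\<close>
lemma weak_time_deriv_representative:
assumes T:"0 < T"and g:"pairable T S g"and g':"pairable T S g'"and w:"weak_time_deriv S T g g'"
and c:"AE t in tm T. L2norm S(g t)\<le>c"
obtains G where "\<forall>t\<in>{0..T}. G t\<in>L2S S&L2norm S(G t)\<le>c""AE t in tm T. ae_eq S(G t)(g t)"
"\<forall>s\<in>{0..T}. \<forall>t\<in>{0..T}. \<forall>v\<in>L2S S. ip S(G t)v - ip S(G s)v = prim T(%r. ip S(g' r)v)t - prim T(%r. ip S(g' r)v)s"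
proof -
let ?P = "%v. prim T(%r. ip S(g' r)v)"
have "\<exists>d. AE t in tm T. ip S(g t)(psi n) = d + ?P(psi n)t"for n
proof -
have "(\<integral>t. ip S(g t)(psi n) * deriv etz t\<partial>tm T) = - (\<integral>t. ip S(g' t)(psi n) * etz t\<partial>tm T)"if "test_fun{0<..<T}etz"for etz
 using w psi_L2[of n]that unfolding weak_time_deriv_def by blast
thus ?thesis
 using weak_derivative_prim[OF T pairableD(4)[OF g psi_L2]pairableD(4)[OF g' psi_L2],of n n]by blast
qed
hence "\<exists>d. \<forall>n. AE t in tm T. ip S(g t)(psi n) = d n + ?P(psi n)t"by(intro choice)blast
then obtain d where d:"!!n. AE t in tm T. ip S(g t)(psi n) = d n + ?P(psi n)t"by blast
\<comment> \<open>The continuous version of the \<open>n\<close>-th coefficient, with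
  \<open>d n\<close> as its constant of integration.\<close>
define ga where "ga n t = d n + ?P(psi n)t"for n t
have gac:"continuous_on{0..T}(ga n)"for n unfolding ga_def
by(intro continuous_intros prim_continuous pairableD(5)[OF g' psi_L2])
have c0:"AE t in tm T. 0\<le>c"using c by(rule eventually_mono)(use L2norm_nonneg order_trans in blast)
have ae:"AE t in tm T. \<forall>n. ip S(g t)(psi n) = ga n t"using d by(simp add: AE_all_countable ga_def)
\<comment> \<open>Bessel's inequality holds for almost every \<open>t\<close> and extends to every
  \<open>t\<close>, because a finite sum of the coefficients is continuous. It gives the square
  summability from which \<open>G t\<close> is built.\<close>
have bnd:"(\<Sum>n<N. (ga n t)\<^sup>2)\<le>c\<^sup>2"if t:"t\<in>{0..T}"for N t
proof(rule AE_interval_le[OF T _ continuous_on_const _ t])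
show "continuous_on{0..T}(%t. \<Sum>n<N. (ga n t)\<^sup>2)"by(intro continuous_intros gac)
show "AE t in tm T. (\<Sum>n<N. (ga n t)\<^sup>2)\<le>c\<^sup>2"using ae c pairableD(1)[OF g]
proof eventually_elim
 fix t assume t:"\<forall>n. ip S(g t)(psi n) = ga n t""L2norm S(g t)\<le>c""g t\<in>L2S S"
 have "(\<Sum>n<N. (ga n t)\<^sup>2)\<le>(L2norm S(g t))\<^sup>2"using bessel(1)[OF t(3),of N]t(1)by simp
 also have "...\<le>c\<^sup>2"by(rule power_mono[OF t(2)])simp
 finally show "(\<Sum>n<N. (ga n t)\<^sup>2)\<le>c\<^sup>2" .
qed
qed
have cpos:"0\<le>c"
proof -
have "0\<in>{0..T}"using T by simp
from AE_interval_le[OF T continuous_on_const continuous_on_const c0 this]show ?thesis .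
qed
have "\<exists>G. G\<in>L2S S&(%N. norm2(lebesgue_on S)(%x. (\<Sum>n<N. ga n t * psi n x) - G x))---->0&(\<forall>n. ip S G(psi n) = ga n t)"
if t:"t\<in>{0..T}"for t
proof -
have "summable(%n. (ga n t)\<^sup>2)"by(rule summableI_nonneg_bounded[OF _ bnd[OF t]])simp
from orthonormal_series[OF psi_L2 psi_orth[unfolded ip_eq_inner2]this]obtain G where "G\<in>L2S S"
 "(%N. norm2(lebesgue_on S)(%x. (\<Sum>n<N. ga n t * psi n x) - G x))---->0"
 "!!n. inner2(lebesgue_on S)G(psi n) = ga n t"by blast
thus ?thesis unfolding ip_eq_inner2 by blast
qed
hence "\<exists>G. \<forall>t\<in>{0..T}. G t\<in>L2S S&(%N. norm2(lebesgue_on S)(%x. (\<Sum>n<N. ga n t * psi n x) - G t x))---->0&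
 (\<forall>n. ip S(G t)(psi n) = ga n t)"by(intro bchoice)blast
then obtain G where GL:"!!t. t\<in>{0..T}==>G t\<in>L2S S"
and GN:"!!t. t\<in>{0..T}==>(%N. norm2(lebesgue_on S)(%x. (\<Sum>n<N. ga n t * psi n x) - G t x))---->0"
and GC:"!!t n. t\<in>{0..T}==>ip S(G t)(psi n) = ga n t"by blast
show thesis
proof(rule that;(intro ballI conjI)?)
fix t assume t:"t\<in>{0..T}"
show "G t\<in>L2S S"by(rule GL[OF t])
have P:"(%x. \<Sum>n<N. ga n t * psi n x)\<in>L2S S"for N by(intro L2.sum_mem L2.cmult_mem psi_L2)
have "(%N. ip S(%x. \<Sum>n<N. ga n t * psi n x)(G t))---->ip S(G t)(G t)"
 by(rule L2.tendsto_form[OF P GL[OF t]GL[OF t]])(use GN[OF t]in "simp add: L2norm_eq_norm2")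
moreover have "ip S(%x. \<Sum>n<N. ga n t * psi n x)(G t) = (\<Sum>n<N. (ga n t)\<^sup>2)"for N
 using GC[OF t]L2.sym[OF psi_L2 GL[OF t]]GL[OF t]
 by(simp add: L2.sum_left L2.cmult_mem L2.cmult_left psi_L2 power2_eq_square)
ultimately have "ip S(G t)(G t)\<le>c\<^sup>2"using bnd[OF t]by(intro LIMSEQ_le_const2)auto
hence "(L2norm S(G t))\<^sup>2\<le>c\<^sup>2"by(simp add: L2norm_square)
thus "L2norm S(G t)\<le>c"by(rule power2_le_imp_le[OF _ cpos])
next
show "AE t in tm T. ae_eq S(G t)(g t)"
 using ae pairableD(1)[OF g]AE_space
proof eventually_elim
 fix t assume t:"\<forall>n. ip S(g t)(psi n) = ga n t""g t\<in>L2S S""t\<in>space(tm T)"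
 hence "t\<in>{0..T}"by simp
 thus "ae_eq S(G t)(g t)"using t by(intro coeffs_determine GL)(auto simp: GC)
qed
next
fix s t v assume st:"s\<in>{0..T}""t\<in>{0..T}"and v:"v\<in>L2S S"
\<comment> \<open>For eigenfunctions the increment formula holds by construction. A general
  \<open>v\<close> is approximated by its expansion, and the primitives converge since
  \<open>g'\<close> has an integrable norm.\<close>
define c where "c n = ip S v(psi n)"for n
let ?v = "%N x. \<Sum>n<N. c n * psi n x"
have vN:"?v N\<in>L2S S"for N by(intro L2.sum_mem L2.cmult_mem psi_L2)
have nv:"(%N. L2norm S(%x. ?v N x - v x))---->0"
 using psi_expansion[OF v]L2.nrm_commute[OF v vN]by(simp add: c_def)
have pN:"ip S w(?v N) = (\<Sum>n<N. c n * ip S w(psi n))"if "w\<in>L2S S"for w N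
 using that by(simp add: L2.sum_right L2.cmult_mem L2.cmult_right psi_L2)
have li:"(%N. ip S w(?v N))---->ip S w v"if w:"w\<in>L2S S"for w
 using L2.tendsto_form[OF vN v w nv]L2.sym[OF w vN]L2.sym[OF w v]by simp
have e:"ip S(G t)(?v N) - ip S(G s)(?v N) = ?P(?v N)t - ?P(?v N)s"for N
proof -
 have pr:"?P(?v N)r = (\<Sum>n<N. c n * ?P(psi n)r)"for r
 proof -
 have "?P(?v N)r = prim T(%r. \<Sum>n<N. c n * ip S(g' r)(psi n))r"
 proof(rule prim_cong[OF pairableD(5)[OF g' vN]])
  show "integrable(tm T)(%r. \<Sum>n<N. c n * ip S(g' r)(psi n))"
  by(intro Bochner_Integration.integrable_sum integrable_mult_right pairableD(5)[OF g' psi_L2])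
  show "AE r in tm T. ip S(g' r)(?v N) = (\<Sum>n<N. c n * ip S(g' r)(psi n))"
  using pairableD(1)[OF g']by(rule eventually_mono)(rule pN)
 qed
 also have "... = (\<Sum>n<N. c n * ?P(psi n)r)"
  using prim_integrable[OF pairableD(5)[OF g' psi_L2],where t = r]
  by(simp add: prim_def sum_distrib_left mult.left_commute[of "indicator _ _"])
 finally show ?thesis .
 qed
 show ?thesis unfolding pr pN[OF GL[OF st(1)]]pN[OF GL[OF st(2)]]
 by(simp add: GC[OF st(1)]GC[OF st(2)]ga_def sum_subtractf[symmetric]algebra_simps)
qed
have lP:"(%N. ?P(?v N)r)---->?P v r"for r
proof -
 have "\<bar>?P(?v N)r - ?P v r\<bar>\<le>L2norm S(%x. ?v N x - v x) * (\<integral>t. L2norm S(g' t)\<partial>tm T)"for N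
 proof -
 let ?I = "%v t. indicator{..r}t * ip S(g' t)v :: real"
 note i = prim_integrable[OF pairableD(5)[OF g' vN[of N]],of r]prim_integrable[OF pairableD(5)[OF g' v],of r]
 have "\<bar>?P(?v N)r - ?P v r\<bar>\<le>(\<integral>t. \<bar>?I(?v N)t - ?I v t\<bar>\<partial>tm T)"
  unfolding prim_def using integral_abs_bound[of "tm T""%t. ?I(?v N)t - ?I v t"]i by simp
 also have "...\<le>(\<integral>t. L2norm S(%x. ?v N x - v x) * L2norm S(g' t)\<partial>tm T)"
 proof(rule integral_mono_AE)
  show "AE t in tm T. \<bar>?I(?v N)t - ?I v t\<bar>\<le>L2norm S(%x. ?v N x - v x) * L2norm S(g' t)"
  using pairableD(1)[OF g']
  proof eventually_elim
  fix t assume t:"g' t\<in>L2S S"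
  have "\<bar>?I(?v N)t - ?I v t\<bar>\<le>\<bar>ip S(g' t)(%x. ?v N x - v x)\<bar>"
  using L2.diff_right[OF vN v t]by(auto simp: indicator_def)
  also have "...\<le>L2norm S(%x. ?v N x - v x) * L2norm S(g' t)"
  using L2.cauchy_schwarz[OF t L2.diff_mem[OF vN v]]by(simp add: mult.commute)
  finally show "\<bar>?I(?v N)t - ?I v t\<bar>\<le>L2norm S(%x. ?v N x - v x) * L2norm S(g' t)" .
  qed
 qed(use i pairableD(3)[OF g']in auto)
 finally show ?thesis by simp
 qed
 hence "(%N. ?P(?v N)r - ?P v r)---->0"
 by(intro Lim_null_comparison[OF _ tendsto_mult_left_zero[OF nv,of "\<integral>t. L2norm S(g' t)\<partial>tm T"]]always_eventually)simp
 thus ?thesis by(simp add: LIM_zero_iff)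
qed
have "(%N. ip S(G t)(?v N) - ip S(G s)(?v N))---->ip S(G t)v - ip S(G s)v"
 by(intro tendsto_diff li GL st)
moreover have "(%N. ?P(?v N)t - ?P(?v N)s)---->?P v t - ?P v s"by(intro tendsto_diff lP)
ultimately show "ip S(G t)v - ip S(G s)v = ?P v t - ?P v s"unfolding e by(rule LIMSEQ_unique)
qed
qed

end

section \<open>Regularity of the weak solution at grid points\<close>

lemma abs_le_of_derivative:
assumes d:"!!r. r\<in>{a..b}==>(E has_real_derivative e r)(at r within{a..b})"
and e:"!!r. r\<in>{a..b}==>\<bar>e r\<bar>\<le>c"and rt:"r\<in>{a..b}""t\<in>{a..b}"and k:"\<bar>r - t\<bar>\<le>k"and c:"0\<le>c"
shows "\<bar>E r - E t\<bar>\<le>c * k"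
proof -
have "norm(E r - E t)\<le>c * norm(r - t)"
by(rule field_differentiable_bound[OF convex_real_interval(5)d _ rt])(use e in auto)
also have "...\<le>c * k"using k c by(intro mult_left_mono)auto
finally show ?thesis by simp
qed

text \<open>A linear function does not change the second difference, so the slope \<open>e t\<close>
  may be subtracted from the derivative.\<close>

lemma second_difference_bound:
assumes d:"!!r. r\<in>{t - k..t + k}==>(E has_real_derivative e r)(at r within{t - k..t + k})"
and e:"!!r. r\<in>{t - k..t + k}==>\<bar>e r - e t\<bar>\<le>c"and k:"0\<le>k"
shows "\<bar>E(t + k) - 2 * E t + E(t - k)\<bar>\<le>2 * c * k"
proof -
have c:"0\<le>c"using e[of t]k by simp
have D:"((%r. E r - e t * r)has_real_derivative e r - e t)(at r within{t - k..t + k})"if "r\<in>{t - k..t + k}"for r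
using d[OF that]by(auto intro!: derivative_eq_intros)
have "\<bar>(E(t + k) - e t * (t + k)) - (E t - e t * t)\<bar>\<le>c * k"
by(rule abs_le_of_derivative[OF D e])(use k c in auto)
moreover have "\<bar>(E(t - k) - e t * (t - k)) - (E t - e t * t)\<bar>\<le>c * k"
by(rule abs_le_of_derivative[OF D e])(use k c in auto)
ultimately show ?thesis by(simp add: algebra_simps abs_if split: if_splits)
qed

text \<open>The bound on \<open>q - q0\<close> is integrated three times, each time at the cost of a
  factor \<open>k\<close>; the factorials are given away. The free value \<open>q0\<close> serves
  both the centred and the one-sided estimate.\<close>

lemma taylor_remainders:
assumes d:"!!r. r\<in>{a..b}==>(ph has_real_derivative phd r)(at r within{a..b})"
"!!r. r\<in>{a..b}==>(phd has_real_derivative p r)(at r within{a..b})"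
"!!r. r\<in>{a..b}==>(p has_real_derivative q r)(at r within{a..b})"
and w:"!!r. r\<in>{a..b}==>\<bar>q r - q0\<bar>\<le>w"and t:"t\<in>{a..b}"and k:"!!r. r\<in>{a..b}==>\<bar>r - t\<bar>\<le>k"
and r:"r\<in>{a..b}"
shows "\<bar>p r - p t - (r - t) * q0\<bar>\<le>w * k"
and "\<bar>ph r - ph t - (r - t) * phd t - (r - t)\<^sup>2 / 2 * p t - (r - t) ^ 3 / 6 * q0\<bar>\<le>w * k * k * k"
proof -
have w0:"0\<le>w"using w[OF t]by linarith
have k0:"0\<le>k"using k[OF t]by simp
have 1:"\<bar>p r - p t - (r - t) * q0\<bar>\<le>w * k"if r:"r\<in>{a..b}"for r
proof -
have "\<bar>(p r - (r - t) * q0) - (p t - (t - t) * q0)\<bar>\<le>w * k"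
 by(rule abs_le_of_derivative[where e = "%r. q r - q0",OF _ w r t k[OF r]w0])
 (auto intro!: derivative_eq_intros d(3))
thus ?thesis by(simp add: algebra_simps)
qed
thus "\<bar>p r - p t - (r - t) * q0\<bar>\<le>w * k"using r .
have 2:"\<bar>phd r - phd t - (r - t) * p t - (r - t)\<^sup>2 / 2 * q0\<bar>\<le>w * k * k"if r:"r\<in>{a..b}"for r
proof -
have "\<bar>(phd r - (r - t) * p t - (r - t)\<^sup>2 / 2 * q0) - (phd t - (t - t) * p t - (t - t)\<^sup>2 / 2 * q0)\<bar>\<le>w * k * k"
 by(rule abs_le_of_derivative[where e = "%r. p r - p t - (r - t) * q0",OF _ 1 r t k[OF r]])
 (auto intro!: derivative_eq_intros d(2)simp: w0 k0)
thus ?thesis by(simp add: algebra_simps)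
qed
have "\<bar>(ph r - (r - t) * phd t - (r - t)\<^sup>2 / 2 * p t - (r - t) ^ 3 / 6 * q0)
 - (ph t - (t - t) * phd t - (t - t)\<^sup>2 / 2 * p t - (t - t) ^ 3 / 6 * q0)\<bar>\<le>w * k * k * k"
by(rule abs_le_of_derivative[where e = "%r. phd r - phd t - (r - t) * p t - (r - t)\<^sup>2 / 2 * q0",OF _ 2 r t k[OF r]])
 (auto intro!: derivative_eq_intros d(1)simp: w0 k0 field_simps)
thus "\<bar>ph r - ph t - (r - t) * phd t - (r - t)\<^sup>2 / 2 * p t - (r - t) ^ 3 / 6 * q0\<bar>\<le>w * k * k * k"
by(simp add: algebra_simps)
qed

text \<open>With \<open>q0 = q t\<close> the odd terms cancel by symmetry. The weighted average
  differs from \<open>p t\<close> by at most half of \<open>w * k\<close> and the difference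
  quotient by twice that product, together less than the stated factor 3.\<close>

lemma trapezoidal_second_difference:
assumes "!!r. r\<in>{t - k..t + k}==>(ph has_real_derivative phd r)(at r within{t - k..t + k})"
"!!r. r\<in>{t - k..t + k}==>(phd has_real_derivative p r)(at r within{t - k..t + k})"
"!!r. r\<in>{t - k..t + k}==>(p has_real_derivative q r)(at r within{t - k..t + k})"
and w:"!!r. r\<in>{t - k..t + k}==>\<bar>q r - q t\<bar>\<le>w"and k:"0 < k"
shows "\<bar>(p(t + k) + 2 * p t + p(t - k)) / 4 - (ph(t + k) - 2 * ph t + ph(t - k)) / k\<^sup>2\<bar>\<le>3 * w * k"
proof -
have t:"t\<in>{t - k..t + k}""t + k\<in>{t - k..t + k}""t - k\<in>{t - k..t + k}"using k by auto
have K:"!!r. r\<in>{t - k..t + k}==>\<bar>r - t\<bar>\<le>k"by auto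
have R:"\<bar>p r - p t - (r - t) * q t\<bar>\<le>w * k"
"\<bar>ph r - ph t - (r - t) * phd t - (r - t)\<^sup>2 / 2 * p t - (r - t) ^ 3 / 6 * q t\<bar>\<le>w * k * k * k"
if "r\<in>{t - k..t + k}"for r
by(rule taylor_remainders[OF assms(1-3)w t(1)K that];assumption)+
note A = R(1)[OF t(2)]R(1)[OF t(3)]R(2)[OF t(2)]R(2)[OF t(3)]
have w0:"0\<le>w"using w[of t]k by simp
have 1:"\<bar>p(t + k) + p(t - k) - 2 * p t\<bar>\<le>2 * (w * k)"using A(1,2)by(simp add: abs_if split: if_splits)
have 2:"\<bar>ph(t + k) - 2 * ph t + ph(t - k) - k\<^sup>2 * p t\<bar>\<le>2 * (w * k * k * k)"
using A(3,4)unfolding abs_le_iff by(simp add: power3_eq_cube)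
have "\<bar>(ph(t + k) - 2 * ph t + ph(t - k)) / k\<^sup>2 - p t\<bar> = \<bar>ph(t + k) - 2 * ph t + ph(t - k) - k\<^sup>2 * p t\<bar> / k\<^sup>2"
proof -
have "(ph(t + k) - 2 * ph t + ph(t - k)) / k\<^sup>2 - p t = (ph(t + k) - 2 * ph t + ph(t - k) - k\<^sup>2 * p t) / k\<^sup>2"
 using k by(simp add: diff_divide_distrib)
thus ?thesis by(simp add: abs_divide)
qed
also have "...\<le>2 * (w * k * k * k) / k\<^sup>2"by(rule divide_right_mono[OF 2])simp
also have "... = 2 * (w * k)"using k by(simp add: power2_eq_square field_simps)
finally have 3:"\<bar>(ph(t + k) - 2 * ph t + ph(t - k)) / k\<^sup>2 - p t\<bar>\<le>2 * (w * k)" .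
have "\<bar>(a + 2 * b + c) / 4 - y\<bar>\<le>3 * d"if "\<bar>a + c - 2 * b\<bar>\<le>2 * d""\<bar>y - b\<bar>\<le>2 * d""0\<le>d"for a b c d y :: real
using that by(simp add: abs_le_iff)(auto simp: field_simps)
thus ?thesis using 1 3 mult_nonneg_nonneg[OF w0 less_imp_le[OF k]]by(simp only: mult.assoc[of 3])
qed

text \<open>The first step is one-sided, so no third order term cancels: \<open>q0 = 0\<close> is
  taken and \<open>q\<close> itself must be bounded. This is where the supremum of
  \<open>uttt\<close> enters \<open>M_u\<close>.\<close>

lemma trapezoidal_first_step:
assumes "!!r. r\<in>{0..k}==>(ph has_real_derivative phd r)(at r within{0..k})"
"!!r. r\<in>{0..k}==>(phd has_real_derivative p r)(at r within{0..k})"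
"!!r. r\<in>{0..k}==>(p has_real_derivative q r)(at r within{0..k})"
and w:"!!r. r\<in>{0..k}==>\<bar>q r\<bar>\<le>w"and k:"0 < k"
shows "\<bar>(p 0 + p k) / 2 - 2 / k * ((ph k - ph 0) / k - phd 0)\<bar>\<le>3 * w * k"
proof -
have w':"!!r. r\<in>{0..k}==>\<bar>q r - 0\<bar>\<le>w"using w by simp
have 0:"0\<in>{0..k}""k\<in>{0..k}"and K:"!!r. r\<in>{0..k}==>\<bar>r - 0\<bar>\<le>k"using k by auto
have A:"\<bar>p k - p 0 - (k - 0) * 0\<bar>\<le>w * k"
"\<bar>ph k - ph 0 - (k - 0) * phd 0 - (k - 0)\<^sup>2 / 2 * p 0 - (k - 0) ^ 3 / 6 * 0\<bar>\<le>w * k * k * k"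
by(rule taylor_remainders[OF assms(1-3)w' 0(1)K 0(2)];assumption)+
have w0:"0\<le>w"using w[of 0]k by simp
have e:"2 / k * ((ph k - ph 0) / k - phd 0) - p 0 = 2 * (ph k - ph 0 - k * phd 0 - k\<^sup>2 / 2 * p 0) / k\<^sup>2"
using k by(simp add: field_simps power2_eq_square)
have "\<bar>2 / k * ((ph k - ph 0) / k - phd 0) - p 0\<bar> = 2 * \<bar>ph k - ph 0 - k * phd 0 - k\<^sup>2 / 2 * p 0\<bar> / k\<^sup>2"
unfolding e abs_divide abs_mult by simp
also have "...\<le>2 * (w * k * k * k) / k\<^sup>2"using A(2)by(intro divide_right_mono mult_left_mono)auto
also have "... = 2 * (w * k)"using k by(simp add: power2_eq_square field_simps)
finally have 3:"\<bar>2 / k * ((ph k - ph 0) / k - phd 0) - p 0\<bar>\<le>2 * (w * k)" .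
have "\<bar>p k - p 0\<bar>\<le>w * k"using A(1)by simp
moreover have "\<bar>(a + b) / 2 - y\<bar>\<le>3 * c"if "\<bar>b - a\<bar>\<le>c""\<bar>y - a\<bar>\<le>2 * c"for a b c y :: real
using that by(simp add: abs_le_iff)(auto simp: field_simps)
ultimately show ?thesis using 3 by(simp only: mult.assoc[of 3])
qed

section \<open>The weak solution and its time derivatives at every time\<close>

locale wave = eigen S lam psi for S lam psi +
fixes T ga :: real and u0 v0 :: fld and f ft ftt fttt u ut utt uttt utttt ::"real=>fld"
assumes T:"0 < T"and data:"smooth_data S T lam psi u0 v0 f ft ftt fttt"
and sol:"weak_solution S T u0 v0 f u ut"and reg:"regular_solution S T ga u ut utt uttt utttt"
begin

lemma f_cont:"time_continuous T(L2S S)(L2norm S)f"and ft_cont:"time_continuous T(L2S S)(L2norm S)ft"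
and ftt_cont:"time_continuous T(L2S S)(L2norm S)ftt"
and f_weak:"weak_time_deriv S T f ft"and ft_weak:"weak_time_deriv S T ft ftt"
using data by(auto simp: smooth_data_def)

lemma u_cont:"time_continuous T(H20 S)(Hnorm S 2)u"and ut_cont:"time_continuous T(L2S S)(L2norm S)ut"
and u_deriv:"time_deriv T(L2norm S)u ut"
and weak_eq:"v\<in>H20 S==>test_fun{0<..<T}etz==>
 - (\<integral>t. ip S(ut t)v * deriv etz t\<partial>tm T) + (\<integral>t. a_form S(u t)v * etz t\<partial>tm T) = (\<integral>t. ip S(f t)v * etz t\<partial>tm T)"
and u_0:"ae_eq S(u 0)u0"and ut_0:"ae_eq S(ut 0)v0"
using sol unfolding weak_solution_def by blast+

lemma ut_weak:"weak_time_deriv S T ut utt"and utt_weak:"weak_time_deriv S T utt uttt"and uttt_weak:"weak_time_deriv S T uttt utttt"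
and LT:"u\<in>LTinf T(Hs S(2 + ga))(Hnorm S(2 + ga))""ut\<in>LTinf T(Hs S(2 + ga))(Hnorm S(2 + ga))"
"utt\<in>LTinf T(Hs S(2 + ga))(Hnorm S(2 + ga))"
"utt\<in>LTinf T(L2S S)(L2norm S)""uttt\<in>LTinf T(L2S S)(L2norm S)""utttt\<in>LTinf T(L2S S)(L2norm S)"
using reg unfolding regular_solution_def by blast+

lemmas pf = time_continuous_pairable[OF f_cont]and pft = time_continuous_pairable[OF ft_cont]
and pftt = time_continuous_pairable[OF ftt_cont]and put = time_continuous_pairable[OF ut_cont]
and putt = LTinf_pairable[OF LT(4)]and puttt = LTinf_pairable[OF LT(5)]and putttt = LTinf_pairable[OF LT(6)]

lemma LTinf_bound:
assumes "g\<in>LTinf T X nuz"shows "AE t in tm T. nuz(g t)\<le>LTinfnorm T nuz g""0\<le>LTinfnorm T nuz g"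
using assms LTinfnorm_bound[of nuz g _ T]unfolding LTinf_def by blast+

lemma mem:"t\<in>{0..T}==>f t\<in>L2S S""t\<in>{0..T}==>ft t\<in>L2S S""t\<in>{0..T}==>u t\<in>H20 S""t\<in>{0..T}==>ut t\<in>L2S S"
using f_cont ft_cont u_cont ut_cont by(auto simp: time_continuous_def)

lemma u_L2:"t\<in>{0..T}==>u t\<in>L2S S"by(rule Hs_L2[OF H20_D[OF mem(3)]])

lemma f_ip_cont:"v\<in>L2S S==>continuous_on{0..T}(%t. ip S(f t)v)"
and ft_ip_cont:"v\<in>L2S S==>continuous_on{0..T}(%t. ip S(ft t)v)"
and ut_ip_cont:"v\<in>L2S S==>continuous_on{0..T}(%t. ip S(ut t)v)"
using time_continuous_compose[OF f_cont ip_lipschitz]time_continuous_compose[OF ft_cont ip_lipschitz]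
time_continuous_compose[OF ut_cont ip_lipschitz]by blast+

lemma u_a_form_cont: assumes v:"v\<in>H20 S"shows "continuous_on{0..T}(%t. a_form S(u t)v)"
proof(rule time_continuous_compose[OF u_cont])
fix x y assume xy:"x\<in>H20 S""y\<in>H20 S"
note D = H20_D[OF xy(1)]H20_D[OF xy(2)]H20_D[OF v]
have "\<bar>a_form S x v - a_form S y v\<bar>\<le>H2semi S(%z. x z - y z) * H2semi S v"
using A.cauchy_schwarz[OF A.diff_mem[OF D(1,2)]D(3)]A.diff_left[OF D]by simp
also have "...\<le>Hnorm S 2(%z. x z - y z) * H2semi S v"by(intro mult_right_mono H2semi_le_Hnorm)(simp add: H2semi_def sum_nonneg)
finally show "\<bar>a_form S x v - a_form S y v\<bar>\<le>H2semi S v * Hnorm S 2(%z. x z - y z)"by(simp add: mult.commute)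
qed

text \<open>A version of \<open>g\<close> that has values at every time, obeys the essential bound
  everywhere, and whose pairings are the primitives of those of \<open>g'\<close>.\<close>

definition representative ::"(real=>fld)=>(real=>fld)=>(real=>fld)=>bool"where
"representative G g g' \<longleftrightarrow>(\<forall>t\<in>{0..T}. G t\<in>L2S S&L2norm S(G t)\<le>LTinfnorm T(L2norm S)g)&(AE t in tm T. ae_eq S(G t)(g t))&
(\<forall>s\<in>{0..T}. \<forall>t\<in>{0..T}. \<forall>v\<in>L2S S. ip S(G t)v - ip S(G s)v = prim T(%r. ip S(g' r)v)t - prim T(%r. ip S(g' r)v)s)"

lemma representativeD:
assumes "representative G g g'"
shows "t\<in>{0..T}==>G t\<in>L2S S""t\<in>{0..T}==>L2norm S(G t)\<le>LTinfnorm T(L2norm S)g""AE t in tm T. ae_eq S(G t)(g t)"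
"s\<in>{0..T}==>t\<in>{0..T}==>v\<in>L2S S==>ip S(G t)v - ip S(G s)v = prim T(%r. ip S(g' r)v)t - prim T(%r. ip S(g' r)v)s"
using assms unfolding representative_def by blast+

text \<open>\<open>W\<close> and \<open>Z\<close> stand for the second and third time derivative of
  \<open>u\<close> at individual times, where \<open>utt\<close> and \<open>uttt\<close> themselves
  may have arbitrary values.\<close>

definition W where "W = (SOME G. representative G utt uttt)"

definition Z where "Z = (SOME G. representative G uttt utttt)"

lemma W_rep:"representative W utt uttt"and Z_rep:"representative Z uttt utttt"
proof -
have "\<exists>G. representative G utt uttt"unfolding representative_def
by(rule weak_time_deriv_representative[OF T putt puttt utt_weak LTinf_bound(1)[OF LT(4)]])(rule exI,intro conjI)
thus "representative W utt uttt"unfolding W_def by(rule someI_ex)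
have "\<exists>G. representative G uttt utttt"unfolding representative_def
by(rule weak_time_deriv_representative[OF T puttt putttt uttt_weak LTinf_bound(1)[OF LT(5)]])(rule exI,intro conjI)
thus "representative Z uttt utttt"unfolding Z_def by(rule someI_ex)
qed

lemmas W = representativeD[OF W_rep]and Z = representativeD[OF Z_rep]

lemma ip_ae:"ae_eq S a b==>a\<in>L2S S==>b\<in>L2S S==>v\<in>L2S S==>ip S a v = ip S b v"
by(rule ip_cong)auto

lemma
assumes v:"v\<in>L2S S"
shows AE_W:"AE t in tm T. ip S(utt t)v = ip S(W t)v"(is ?A)
and AE_Z:"AE t in tm T. ip S(uttt t)v = ip S(Z t)v"(is ?B)
proof -
show ?A using W(3)pairableD(1)[OF putt]AE_space
by eventually_elim(auto intro!: ip_ae[symmetric]W(1)v)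
show ?B using Z(3)pairableD(1)[OF puttt]AE_space
by eventually_elim(auto intro!: ip_ae[symmetric]Z(1)v)
qed

lemma
assumes v:"v\<in>L2S S"
shows W_ip_cont:"continuous_on{0..T}(%t. ip S(W t)v)"and Z_ip_cont:"continuous_on{0..T}(%t. ip S(Z t)v)"
and W_int:"integrable(tm T)(%t. ip S(W t)v)"and Z_int:"integrable(tm T)(%t. ip S(Z t)v)"
proof -
have 0:"0\<in>{0..T}"using T by simp
show c:"continuous_on{0..T}(%t. ip S(W t)v)"
proof(rule continuous_on_eq)
show "continuous_on{0..T}(%t. ip S(W 0)v + prim T(%r. ip S(uttt r)v)t)"
 by(intro continuous_intros prim_continuous pairableD(5)[OF puttt v])
show "ip S(W 0)v + prim T(%r. ip S(uttt r)v)t = ip S(W t)v"if "t\<in>{0..T}"for t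
 using W(4)[OF 0 that v]prim_0 by simp
qed
show d:"continuous_on{0..T}(%t. ip S(Z t)v)"
proof(rule continuous_on_eq)
show "continuous_on{0..T}(%t. ip S(Z 0)v + prim T(%r. ip S(utttt r)v)t)"
 by(intro continuous_intros prim_continuous pairableD(5)[OF putttt v])
show "ip S(Z 0)v + prim T(%r. ip S(utttt r)v)t = ip S(Z t)v"if "t\<in>{0..T}"for t
 using Z(4)[OF 0 that v]prim_0 by simp
qed
have sub:"{0<..<T}\<subseteq>{0..T}"by auto
note m = continuous_imp_measurable_on_sets_lebesgue[OF continuous_on_subset[OF _ sub]tm_sets]
show "integrable(tm T)(%t. ip S(W t)v)"by(rule integrable_cong_AE_imp[OF pairableD(5)[OF putt v]m[OF c]AE_W[OF v]])
show "integrable(tm T)(%t. ip S(Z t)v)"by(rule integrable_cong_AE_imp[OF pairableD(5)[OF puttt v]m[OF d]AE_Z[OF v]])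
qed

lemma u_ip_deriv: assumes v:"v\<in>L2S S"and t:"t\<in>{0..T}"
shows "((%t. ip S(u t)v)has_real_derivative ip S(ut t)v)(at t within{0..T})"
unfolding has_field_derivative_iff
proof -
let ?q = "%s x. (u s x - u t x) / (s - t)"
have q:"?q s\<in>L2S S""ip S(?q s)v = (ip S(u s)v - ip S(u t)v) / (s - t)"if s:"s\<in>{0..T}"for s
proof -
have e:"?q s = (%x. (1 / (s - t)) * (u s x - u t x))"by(simp add: fun_eq_iff)
note d = L2.diff_mem[OF u_L2[OF s]u_L2[OF t]]
show "?q s\<in>L2S S"unfolding e by(rule L2.cmult_mem[OF d])
show "ip S(?q s)v = (ip S(u s)v - ip S(u t)v) / (s - t)"
 unfolding e L2.cmult_left[OF d v]L2.diff_left[OF u_L2[OF s]u_L2[OF t]v]by simp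
qed
have "((%s. L2norm S(%x. ?q s x - ut t x))\<longlongrightarrow>0)(at t within{0..T})"using u_deriv t by(simp add: time_deriv_def)
hence "((%s. L2norm S v * L2norm S(%x. ?q s x - ut t x))\<longlongrightarrow>0)(at t within{0..T})"using tendsto_mult_right_zero by blast
hence "((%s. (ip S(u s)v - ip S(u t)v) / (s - t) - ip S(ut t)v)\<longlongrightarrow>0)(at t within{0..T})"
by(rule Lim_null_comparison[rotated])
 (use ip_lipschitz[OF v q(1)mem(4)[OF t]]q(2)in "auto simp: eventually_at_filter intro!: always_eventually")
thus "((%s. (ip S(u s)v - ip S(u t)v) / (s - t))\<longlongrightarrow>ip S(ut t)v)(at t within{0..T})"
by(simp add: LIM_zero_iff)
qed

lemma ut_ip_deriv: assumes v:"v\<in>L2S S"and t:"t\<in>{0..T}"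
shows "((%t. ip S(ut t)v)has_real_derivative ip S(W t)v)(at t within{0..T})"
proof(rule derivative_of_increments[OF _ W_ip_cont[OF v]W_int[OF v]t])
fix s t assume st:"s\<in>{0..T}""t\<in>{0..T}"
have "prim T(%r. ip S(utt r)v)r = prim T(%r. ip S(W r)v)r"for r
by(rule prim_cong[OF pairableD(5)[OF putt v]W_int[OF v]AE_W[OF v]])
thus "ip S(ut t)v - ip S(ut s)v = prim T(%r. ip S(W r)v)t - prim T(%r. ip S(W r)v)s"
using weak_derivative_continuous[OF T ut_ip_cont[OF v]pairableD(4)[OF putt v]_ st]ut_weak v
by(simp add: weak_time_deriv_def)
qed

lemma W_ip_deriv: assumes v:"v\<in>L2S S"and t:"t\<in>{0..T}"
shows "((%t. ip S(W t)v)has_real_derivative ip S(Z t)v)(at t within{0..T})"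
proof(rule derivative_of_increments[OF _ Z_ip_cont[OF v]Z_int[OF v]t])
fix s t assume st:"s\<in>{0..T}""t\<in>{0..T}"
have "prim T(%r. ip S(uttt r)v)r = prim T(%r. ip S(Z r)v)r"for r
by(rule prim_cong[OF pairableD(5)[OF puttt v]Z_int[OF v]AE_Z[OF v]])
thus "ip S(W t)v - ip S(W s)v = prim T(%r. ip S(Z r)v)t - prim T(%r. ip S(Z r)v)s"
using W(4)[OF st v]by simp
qed

lemma f_inc:"v\<in>L2S S==>s\<in>{0..T}==>t\<in>{0..T}==>ip S(f t)v - ip S(f s)v = prim T(%r. ip S(ft r)v)t - prim T(%r. ip S(ft r)v)s"
and ft_inc:"v\<in>L2S S==>s\<in>{0..T}==>t\<in>{0..T}==>ip S(ft t)v - ip S(ft s)v = prim T(%r. ip S(ftt r)v)t - prim T(%r. ip S(ftt r)v)s"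
using weak_derivative_continuous[OF T f_ip_cont pairableD(4)[OF pft],of v v]f_weak
weak_derivative_continuous[OF T ft_ip_cont pairableD(4)[OF pftt],of v v]ft_weak
by(simp_all add: weak_time_deriv_def)

lemma f_ip_deriv:"v\<in>L2S S==>t\<in>{0..T}==>
((%t. ip S(f t)v)has_real_derivative ip S(ft t)v)(at t within{0..T})"
by(rule derivative_of_increments[OF f_inc ft_ip_cont pairableD(5)[OF pft]])

text \<open>The equation is given as a distribution in time. Replacing the weak derivative of
  \<open>ut\<close> by \<open>utt\<close> gives it for almost every \<open>t\<close>, and with the
  version \<open>W\<close> both sides are continuous, so it holds at every \<open>t\<close>.\<close>

lemma equation:
assumes v:"v\<in>H20 S"and t:"t\<in>{0..T}"
shows "a_form S(u t)v = ip S(f t)v - ip S(W t)v"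
proof -
have vL:"v\<in>L2S S"by(rule Hs_L2[OF H20_D[OF v]])
let ?g = "%t. ip S(utt t)v + (a_form S(u t)v - ip S(f t)v)"
have aL:"(%t. a_form S(u t)v)\<in>L2(tm T)"
proof -
obtain B where "\<forall>x\<in>{0..T}. norm(a_form S(u x)v)\<le>B"
 using compact_imp_bounded[OF compact_continuous_image[OF u_a_form_cont[OF v]compact_Icc]]by(auto simp: bounded_iff)
thus ?thesis
 by(intro L2_bounded[OF finite_tm,of _ _ B]continuous_imp_measurable_on_sets_lebesgue[OF continuous_on_subset[OF u_a_form_cont[OF v]]tm_sets])
 (auto intro!: AE_I2)
qed
note L = pairableD(4)[OF putt vL]aL pairableD(4)[OF pf vL]
have "AE t in tm T. ?g t = 0"
proof(rule test_fun_separating)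
show "?g\<in>L2(tm T)"by(intro Submission.L2.add_mem Submission.L2.diff_mem L)
fix etz ::"real=>real"assume etz:"test_fun{0<..<T}etz"
note e = test_fun_L2[OF tm_sets etz]
have "inner2(tm T) ?g etz = inner2(tm T)(%t. ip S(utt t)v)etz + (inner2(tm T)(%t. a_form S(u t)v)etz - inner2(tm T)(%t. ip S(f t)v)etz)"
 using Submission.L2.add_left[OF L(1)Submission.L2.diff_mem[OF L(2,3)]e]Submission.L2.diff_left[OF L(2,3)e]by simp
also have "... = 0"using weak_eq[OF v etz]ut_weak vL etz by(simp add: weak_time_deriv_def inner2_def)
finally show "inner2(tm T) ?g etz = 0" .
qed simp
hence "AE t in tm T. a_form S(u t)v = ip S(f t)v - ip S(W t)v"
using AE_W[OF vL]by eventually_elim auto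
from AE_interval_eq[OF T u_a_form_cont[OF v]_ this t]show ?thesis
using f_ip_cont[OF vL]W_ip_cont[OF vL]by(simp add: continuous_intros)
qed

text \<open>This opens elliptic regularity at each single time, grid points included.\<close>

lemma u_bilaplacian: assumes t:"t\<in>{0..T}"
shows "u t\<in>DA S""has_bilaplacian S(u t)(%x. f t x - W t x)"
proof -
have *:"!!v. v\<in>H20 S==>a_form S(u t)v = ip S(%x. f t x - W t x)v"
using equation[OF _ t]L2.diff_left[OF mem(1)[OF t]W(1)[OF t]Hs_L2[OF H20_D]]by simp
note I = DA_I[OF mem(3)[OF t]L2.diff_mem[OF mem(1)[OF t]W(1)[OF t]]]
show "u t\<in>DA S"by(rule I(1)[OF *])
show "has_bilaplacian S(u t)(%x. f t x - W t x)"by(rule I(2)[OF *])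
qed

text \<open>Tested with an eigenfunction the equation is scalar and can be differentiated in time.
  With a general test function the derivative would involve the energy form of \<open>ut\<close>,
  which is not yet known to lie in \<open>H^2\<close>.\<close>

lemma ut_coeff: assumes t:"t\<in>{0..T}"
shows "lam n * ip S(ut t)(psi n) = ip S(ft t)(psi n) - ip S(Z t)(psi n)"
proof -
have e:"lam n * ip S(u s)(psi n) = ip S(f s)(psi n) - ip S(W s)(psi n)"if "s\<in>{0..T}"for s
using equation[OF psi_H20 that]a_form_psi[OF mem(3)[OF that]]by simp
have "((%s. ip S(f s)(psi n) - ip S(W s)(psi n))has_real_derivative ip S(ft t)(psi n) - ip S(Z t)(psi n))(at t within{0..T})"
by(intro DERIV_diff f_ip_deriv W_ip_deriv psi_L2 t)
hence 1:"((%s. lam n * ip S(u s)(psi n))has_real_derivative ip S(ft t)(psi n) - ip S(Z t)(psi n))(at t within{0..T})"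
by(rule has_field_derivative_transform_within[OF _ zero_less_one t])(simp add: e)
have 2:"((%s. lam n * ip S(u s)(psi n))has_real_derivative lam n * ip S(ut t)(psi n))(at t within{0..T})"
by(intro DERIV_cmult u_ip_deriv psi_L2 t)
note v = 2[unfolded has_real_derivative_iff_has_vector_derivative,folded box_real(2)]
1[unfolded has_real_derivative_iff_has_vector_derivative,folded box_real(2)]
show ?thesis by(rule vector_derivative_unique_within_closed_interval[OF T _ v])(use t in simp)
qed

lemma ut_bilaplacian: assumes t:"t\<in>{0..T}"
shows "ut t\<in>H20 S""has_bilaplacian S(ut t)(%x. ft t x - Z t x)"
proof -
have "lam n * ip S(ut t)(psi n) = ip S(%x. ft t x - Z t x)(psi n)"for n
using ut_coeff[OF t]L2.diff_left[OF mem(2)[OF t]Z(1)[OF t]psi_L2]by simp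
from spectral_bilaplacian[OF mem(4)[OF t]L2.diff_mem[OF mem(2)[OF t]Z(1)[OF t]]this]
show "ut t\<in>H20 S""has_bilaplacian S(ut t)(%x. ft t x - Z t x)" .
qed

text \<open>A further time derivative exists only weakly, as \<open>utttt\<close> has no continuous
  version; hence the identity for almost every \<open>t\<close>.\<close>

lemma utt_coeff:"AE t in tm T. lam n * ip S(utt t)(psi n) = ip S(ftt t)(psi n) - ip S(utttt t)(psi n)"
proof -
let ?p = "%g t. ip S(g t)(psi n)"
note L = pairableD(4)[OF putt psi_L2,of n]pairableD(4)[OF pftt psi_L2,of n]pairableD(4)[OF putttt psi_L2,of n]
pairableD(4)[OF put psi_L2,of n]pairableD(4)[OF pft psi_L2,of n]pairableD(4)[OF puttt psi_L2,of n]
let ?g = "%t. lam n * ?p utt t + (?p utttt t - ?p ftt t)"and ?h = "%t. lam n * ?p ut t + (?p uttt t - ?p ft t)"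
have lin:"inner2(tm T)(%t. lam n * a t + (b t - c t))e = lam n * inner2(tm T)a e + (inner2(tm T)b e - inner2(tm T)c e)"
if "a\<in>L2(tm T)""b\<in>L2(tm T)""c\<in>L2(tm T)""e\<in>L2(tm T)"for a b c e
using Submission.L2.lin_left[OF that(1)Submission.L2.diff_mem[OF that(2,3)]that(4)]Submission.L2.diff_left[OF that(2-4)]by simp
have "AE t in tm T. ?g t = 0"
proof(rule test_fun_separating)
show "?g\<in>L2(tm T)"by(intro Submission.L2.lin_mem Submission.L2.diff_mem L)
fix etz ::"real=>real"assume etz:"test_fun{0<..<T}etz"
note e = test_fun_L2[OF tm_sets etz]and e' = test_fun_L2[OF tm_sets test_fun_deriv[OF etz]]
have "AE t in tm T. ?h t * deriv etz t = 0"using AE_Z[OF psi_L2[of n]]AE_space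
proof eventually_elim
 fix t assume *:"ip S(uttt t)(psi n) = ip S(Z t)(psi n)""t\<in>space(tm T)"
 hence "t\<in>{0..T}"by simp
 from ut_coeff[OF this,of n]show "?h t * deriv etz t = 0"using *(1)by simp
qed
hence "inner2(tm T) ?h(deriv etz) = 0"unfolding inner2_def by(rule integral_eq_zero_AE)
hence "inner2(tm T) ?g etz = 0"
 unfolding lin[OF L(4,6,5)e']lin[OF L(1,3,2)e]
 using ut_weak ft_weak uttt_weak psi_L2[of n]etz by(simp add: weak_time_deriv_def inner2_def)
thus "inner2(tm T) ?g etz = 0" .
qed simp
thus ?thesis by(rule eventually_mono)simp
qed

lemma utt_bilaplacian:"AE t in tm T. utt t\<in>H20 S&has_bilaplacian S(utt t)(%x. ftt t x - utttt t x)"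
proof -
have "AE t in tm T. \<forall>n. lam n * ip S(utt t)(psi n) = ip S(ftt t)(psi n) - ip S(utttt t)(psi n)"
using utt_coeff by(simp add: AE_all_countable)
thus ?thesis using pairableD(1)[OF putt]pairableD(1)[OF pftt]pairableD(1)[OF putttt]
proof eventually_elim
fix t assume a:"\<forall>n. lam n * ip S(utt t)(psi n) = ip S(ftt t)(psi n) - ip S(utttt t)(psi n)"
 and m:"utt t\<in>L2S S""ftt t\<in>L2S S""utttt t\<in>L2S S"
have "lam n * ip S(utt t)(psi n) = ip S(%x. ftt t x - utttt t x)(psi n)"for n
 using a L2.diff_left[OF m(2,3)psi_L2]by simp
from spectral_bilaplacian[OF m(1)L2.diff_mem[OF m(2,3)]this]
show "utt t\<in>H20 S&has_bilaplacian S(utt t)(%x. ftt t x - utttt t x)"by blast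
qed
qed

end

section \<open>Estimates between neighbouring times\<close>

lemma increment_bound:
assumes inc:"!!s t. s\<in>{0..T}==>t\<in>{0..T}==>a t - a s = prim T b t - prim T b s"
and b:"integrable(tm T)b""integrable(tm T)bez""AE r in tm T. \<bar>b r\<bar>\<le>c * bez r""!!r. 0\<le>bez r"and c:"0\<le>c"
and l:"0\<le>l""h\<le>T"and rt:"r\<in>{l..h}""t\<in>{l..h}"
shows "\<bar>a r - a t\<bar>\<le>c * (prim T bez h - prim T bez l)"
proof -
have *:"\<bar>a r - a t\<bar>\<le>c * (prim T bez h - prim T bez l)"if "r\<in>{l..h}""t\<in>{l..h}""t\<le>r"for r t
proof -
have z:"integrable(tm T)(%r. 0 :: real)"by simp
have e:"prim T(%r. c * bez r)x = c * prim T bez x"for x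
 using prim_lin[OF b(2)z,of c x]by(simp add: prim_def)
have "\<bar>a r - a t\<bar> = \<bar>prim T b r - prim T b t\<bar>"using inc[of t r]that l by simp
also have "...\<le>prim T(%r. c * bez r)r - prim T(%r. c * bez r)t"
 by(rule prim_bound[OF b(1)_ b(3)that(3)])(use b(2)in simp)
also have "... = c * (prim T bez r - prim T bez t)"unfolding e by(simp add: algebra_simps)
also have "...\<le>c * (prim T bez h - prim T bez l)"
 using that by(intro mult_left_mono diff_mono prim_mono b(2,4)c)auto
finally show ?thesis .
qed
show ?thesis
proof(cases "t\<le>r")
case False thus ?thesis using *[OF rt(2,1)]by(simp add: abs_minus_commute)
qed(use *[OF rt]in simp)
qed

\<comment> \<open>Averages, difference quotients and second differences are all combinations of
  three terms.\<close>
lemma(in semidef_form)comb3: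
assumes "a\<in>V""b\<in>V""c\<in>V"
shows "(%x. p * a x + q * b x + r * c x)\<in>V"
and "z\<in>V==>B(%x. p * a x + q * b x + r * c x)z = p * B a z + q * B b z + r * B c z"
proof -
have m:"(%x. p * a x + q * b x)\<in>V"by(intro lin_mem cmult_mem assms)
show "(%x. p * a x + q * b x + r * c x)\<in>V"by(intro add_mem m cmult_mem assms)
assume z:"z\<in>V"
show "B(%x. p * a x + q * b x + r * c x)z = p * B a z + q * B b z + r * B c z"
using add_left[OF m cmult_mem[OF assms(3)]z]lin_left[OF assms(1)cmult_mem[OF assms(2)]z]cmult_left[OF assms(2)z]cmult_left[OF assms(3)z]
by simp
qed

context wave
begin

lemma f_bound:"t\<in>{0..T}==>L2norm S(f t)\<le>LTinfnorm T(L2norm S)f"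

and f_bound_nonneg:"0\<le>LTinfnorm T(L2norm S)f"
proof -
have c:"continuous_on{0..T}(%t. L2norm S(f t))"by(rule time_continuous_compose[OF f_cont L2norm_lipschitz])
obtain B where "\<forall>x\<in>{0..T}. norm(L2norm S(f x))\<le>B"
using compact_imp_bounded[OF compact_continuous_image[OF c compact_Icc]]by(auto simp: bounded_iff)
hence ae:"AE t in tm T. L2norm S(f t)\<le>B"by(auto intro!: AE_I2)
show "L2norm S(f t)\<le>LTinfnorm T(L2norm S)f"if t:"t\<in>{0..T}"
by(rule AE_interval_le[OF T c continuous_on_const LTinfnorm_bound(1)[where nuz = "L2norm S",OF ae]t])
show "0\<le>LTinfnorm T(L2norm S)f"by(rule LTinfnorm_bound(2)[where nuz = "L2norm S",OF ae])
qed

lemma residual_L2:"t\<in>{0..T}==>(%x. f t x - W t x)\<in>L2S S"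
by(intro L2.diff_mem mem W(1))

lemma residual_bound: assumes t:"t\<in>{0..T}"
shows "L2norm S(%x. f t x - W t x)\<le>LTinfnorm T(L2norm S)f + LTinfnorm T(L2norm S)utt"
using L2.nrm_diff[OF mem(1)[OF t]W(1)[OF t]]f_bound[OF t]W(2)[OF t]by linarith

text \<open>\<open>f - W\<close> is the bilaplacian of \<open>u\<close>. Its increment is paired
  with itself, where the scalar increments are integrals of pairings with \<open>ft\<close> and
  \<open>uttt\<close>. Bounding by increments of a primitive makes the sum over time steps
  telescope.\<close>

lemma residual_increment:
assumes st:"0\<le>s""s\<le>t""t\<le>T"
shows "L2norm S(%x. (f t x - W t x) - (f s x - W s x))\<le>
prim T(%r. L2norm S(ft r) + L2norm S(uttt r))t - prim T(%r. L2norm S(ft r) + L2norm S(uttt r))s"(is "L2norm S ?z\<le>?P t - ?P s")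
proof -
have t:"s\<in>{0..T}""t\<in>{0..T}"using st by auto
note g = residual_L2[OF t(1)]residual_L2[OF t(2)]
have z:"?z\<in>L2S S"by(rule L2.diff_mem[OF g(2,1)])
have bi:"integrable(tm T)(%r. L2norm S(ft r) + L2norm S(uttt r))"
by(intro Bochner_Integration.integrable_add pairableD(3)pft puttt)
have "\<bar>(ip S(f t) ?z - ip S(W t) ?z) - (ip S(f s) ?z - ip S(W s) ?z)\<bar>\<le>L2norm S ?z * (?P t - ?P s)"
proof(rule increment_bound[where a = "%t. ip S(f t) ?z - ip S(W t) ?z"and b = "%r. ip S(ft r) ?z - ip S(uttt r) ?z"])
show i:"integrable(tm T)(%r. ip S(ft r) ?z - ip S(uttt r) ?z)"
 by(intro Bochner_Integration.integrable_diff pairableD(5)pft puttt z)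
show "(ip S(f t) ?z - ip S(W t) ?z) - (ip S(f s) ?z - ip S(W s) ?z) =
 prim T(%r. ip S(ft r) ?z - ip S(uttt r) ?z)t - prim T(%r. ip S(ft r) ?z - ip S(uttt r) ?z)s"
 if "s\<in>{0..T}""t\<in>{0..T}"for s t
 using f_inc[OF z that]W(4)[OF that z]prim_lin[OF pairableD(5)[OF puttt z]pairableD(5)[OF pft z],of "-1"]by simp
show "AE r in tm T. \<bar>ip S(ft r) ?z - ip S(uttt r) ?z\<bar>\<le>L2norm S ?z * (L2norm S(ft r) + L2norm S(uttt r))"
 using pairableD(6)[OF pft z]pairableD(6)[OF puttt z]by eventually_elim(simp add: algebra_simps)
qed(use bi st in auto)
moreover have "ip S ?z ?z = (ip S(f t) ?z - ip S(W t) ?z) - (ip S(f s) ?z - ip S(W s) ?z)"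
using L2.diff_left[OF g(2,1)z]L2.diff_left[OF mem(1)[OF t(1)]W(1)[OF t(1)]z]L2.diff_left[OF mem(1)[OF t(2)]W(1)[OF t(2)]z]by simp
ultimately have "\<bar>ip S ?z ?z\<bar>\<le>(?P t - ?P s) * L2norm S ?z"by(simp add: mult.commute)
moreover have "0\<le>?P t - ?P s"using prim_mono[OF bi _ st(2)]by simp
ultimately show ?thesis by(intro norm_le_of_pairing[OF z])
qed

lemma u_bound: assumes t:"t\<in>{0..T}"shows "L2norm S(u t)\<le>LTinfnorm T(Hnorm S(2 + ga))u"
proof(rule AE_interval_le[OF T _ continuous_on_const _ t])
show "continuous_on{0..T}(%t. L2norm S(u t))"
proof(rule time_continuous_compose[OF u_cont])
fix x y assume "x\<in>H20 S""y\<in>H20 S"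
hence xy:"x\<in>L2S S""y\<in>L2S S"by(auto intro: Hs_L2 H20_D)
show "\<bar>L2norm S x - L2norm S y\<bar>\<le>1 * Hnorm S 2(%z. x z - y z)"
 using L2norm_lipschitz[OF xy]L2norm_le_Hnorm[OF L2.diff_mem[OF xy],of 2]by simp
qed
show "AE t in tm T. L2norm S(u t)\<le>LTinfnorm T(Hnorm S(2 + ga))u"
using LTinf_bound(1)[OF LT(1)]AE_space
proof eventually_elim
fix t assume "Hnorm S(2 + ga)(u t)\<le>LTinfnorm T(Hnorm S(2 + ga))u""t\<in>space(tm T)"
thus "L2norm S(u t)\<le>LTinfnorm T(Hnorm S(2 + ga))u"
 using L2norm_le_Hnorm[OF u_L2[of t],of "2 + ga"]by simp
qed
qed

text \<open>The essential supremum says nothing about a single time. Elliptic regularity at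
  \<open>t\<close> replaces it, and the terms on the right all occur in \<open>L_fu\<close>.\<close>

lemma u_regular:
assumes c:"!!psz g. psz\<in>DA S==>psz\<in>Hs S(2 + ga)&(has_bilaplacian S psz g-->Hnorm S(2 + ga)psz\<le>c * (L2norm S psz + L2norm S g))"
and t:"t\<in>{0..T}"and c0:"0\<le>c"
shows "u t\<in>H20 S\<inter>Hs S(2 + ga)"
"Hnorm S(2 + ga)(u t)\<le>c * (LTinfnorm T(Hnorm S(2 + ga))u + (LTinfnorm T(L2norm S)f + LTinfnorm T(L2norm S)utt))"
proof -
note b = u_bilaplacian[OF t]
show "u t\<in>H20 S\<inter>Hs S(2 + ga)"using c[OF b(1)]mem(3)[OF t]by blast
have "Hnorm S(2 + ga)(u t)\<le>c * (L2norm S(u t) + L2norm S(%x. f t x - W t x))"using c[OF b(1)]b(2)by blast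
also have "...\<le>c * (LTinfnorm T(Hnorm S(2 + ga))u + (LTinfnorm T(L2norm S)f + LTinfnorm T(L2norm S)utt))"
by(intro mult_left_mono add_mono u_bound residual_bound t c0)
finally show "Hnorm S(2 + ga)(u t)\<le>c * (LTinfnorm T(Hnorm S(2 + ga))u + (LTinfnorm T(L2norm S)f + LTinfnorm T(L2norm S)utt))" .
qed

lemma within_subset:"(E has_real_derivative e)(at r within{0..T})==>0\<le>a==>b\<le>T==>(E has_real_derivative e)(at r within{a..b})"
by(erule DERIV_subset)auto

text \<open>The defect is paired with itself and the scalar estimate applied to \<open>u\<close>,
  \<open>ut\<close>, \<open>W\<close>, \<open>Z\<close>; the oscillation of \<open>Z\<close> is
  measured by a primitive of the norm of \<open>utttt\<close>.\<close>

lemma trapezoidal_defect: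
assumes t:"0\<le>t - k""t + k\<le>T"and k:"0 < k"
shows "L2norm S(%x. (1/4) * (W(t + k)x + 2 * W t x + W(t - k)x) - (u(t + k)x - 2 * u t x + u(t - k)x) / k\<^sup>2)
\<le>3 * k * (prim T(%r. L2norm S(utttt r))(t + k) - prim T(%r. L2norm S(utttt r))(t - k))"(is "L2norm S ?z\<le>3 * k * ?q")
proof -
have m:"t - k\<in>{0..T}""t\<in>{0..T}""t + k\<in>{0..T}"using t k by auto
let ?a = "%x. 1/4 * W(t + k)x + 1/2 * W t x + 1/4 * W(t - k)x"
let ?b = "%x. (1/k\<^sup>2) * u(t + k)x + (-2/k\<^sup>2) * u t x + (1/k\<^sup>2) * u(t - k)x"
note Wm = W(1)[OF m(3)]W(1)[OF m(2)]W(1)[OF m(1)]and um = u_L2[OF m(3)]u_L2[OF m(2)]u_L2[OF m(1)]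
have e:"?z = (%x. ?a x - ?b x)"by(auto simp: fun_eq_iff add_divide_distrib diff_divide_distrib)
note am = L2.comb3(1)[OF Wm]and bm = L2.comb3(1)[OF um]
have z:"?z\<in>L2S S"unfolding e by(rule L2.diff_mem[OF am bm])
have "ip S ?z ?z = ip S ?a ?z - ip S ?b ?z"by(subst(1)e)(rule L2.diff_left[OF am bm z])
also have "... = (ip S(W(t + k)) ?z + 2 * ip S(W t) ?z + ip S(W(t - k)) ?z) / 4
 - (ip S(u(t + k)) ?z - 2 * ip S(u t) ?z + ip S(u(t - k)) ?z) / k\<^sup>2"
unfolding L2.comb3(2)[OF Wm z]L2.comb3(2)[OF um z]by(simp add: add_divide_distrib diff_divide_distrib)
finally have ipz:"ip S ?z ?z = ..." .
have bi:"integrable(tm T)(%r. L2norm S(utttt r))"by(rule pairableD(3)[OF putttt])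
have "\<bar>ip S ?z ?z\<bar>\<le>3 * (L2norm S ?z * ?q) * k"unfolding ipz
proof(rule trapezoidal_second_difference[where ph = "%r. ip S(u r) ?z"and phd = "%r. ip S(ut r) ?z"and p = "%r. ip S(W r) ?z"and q = "%r. ip S(Z r) ?z",OF _ _ _ _ k])
fix r assume r:"r\<in>{t - k..t + k}"
hence r':"r\<in>{0..T}"using t by auto
show "((%r. ip S(u r) ?z)has_real_derivative ip S(ut r) ?z)(at r within{t - k..t + k})"
 "((%r. ip S(ut r) ?z)has_real_derivative ip S(W r) ?z)(at r within{t - k..t + k})"
 "((%r. ip S(W r) ?z)has_real_derivative ip S(Z r) ?z)(at r within{t - k..t + k})"
 by(rule within_subset[OF _ t]u_ip_deriv ut_ip_deriv W_ip_deriv z r')+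
show "\<bar>ip S(Z r) ?z - ip S(Z t) ?z\<bar>\<le>L2norm S ?z * ?q"
proof(rule increment_bound[where b = "%r. ip S(utttt r) ?z"and a = "%t. ip S(Z t) ?z"])
 show "AE r in tm T. \<bar>ip S(utttt r) ?z\<bar>\<le>L2norm S ?z * L2norm S(utttt r)"
 using pairableD(6)[OF putttt z]by(simp add: mult.commute)
 show "ip S(Z t) ?z - ip S(Z s) ?z = prim T(%r. ip S(utttt r) ?z)t - prim T(%r. ip S(utttt r) ?z)s"
 if "s\<in>{0..T}""t\<in>{0..T}"for s t by(rule Z(4)[OF that z])
qed(use bi pairableD(5)[OF putttt z]t k r in auto)
qed
hence "\<bar>ip S ?z ?z\<bar>\<le>(3 * k * ?q) * L2norm S ?z"by(simp only: ac_simps)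
moreover have "0\<le>3 * k * ?q"using prim_mono[OF bi L2norm_nonneg,of "t - k""t + k"]k by simp
ultimately show ?thesis by(intro norm_le_of_pairing[OF z])
qed

text \<open>The same argument for the first step, where the one-sided formula requires the size of
  \<open>Z\<close> instead of its oscillation.\<close>

lemma first_step_defect:
assumes k:"0 < k""k\<le>T"
shows "L2norm S(%x. (1/2) * (W k x + W 0 x) - 2 / k * ((u k x - u 0 x) / k - ut 0 x))\<le>3 * k * LTinfnorm T(L2norm S)uttt"(is "L2norm S ?z\<le>_")
proof -
have m:"0\<in>{0..T}""k\<in>{0..T}"using k by auto
let ?a = "%x. 1/2 * W k x + 1/2 * W 0 x + 0 * W 0 x"and ?b = "%x. (2/k\<^sup>2) * u k x + (-2/k\<^sup>2) * u 0 x + (-2/k) * ut 0 x"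
have e:"?z = (%x. ?a x - ?b x)"
by(auto simp: fun_eq_iff add_divide_distrib diff_divide_distrib power2_eq_square algebra_simps)
note am = L2.comb3(1)[OF W(1)[OF m(2)]W(1)[OF m(1)]W(1)[OF m(1)]]and bm = L2.comb3(1)[OF u_L2[OF m(2)]u_L2[OF m(1)]mem(4)[OF m(1)]]
have z:"?z\<in>L2S S"unfolding e by(rule L2.diff_mem[OF am bm])
have "ip S ?z ?z = ip S ?a ?z - ip S ?b ?z"by(subst(1)e)(rule L2.diff_left[OF am bm z])
also have "... = (ip S(W 0) ?z + ip S(W k) ?z) / 2 - 2 / k * ((ip S(u k) ?z - ip S(u 0) ?z) / k - ip S(ut 0) ?z)"
unfolding L2.comb3(2)[OF W(1)[OF m(2)]W(1)[OF m(1)]W(1)[OF m(1)]z]L2.comb3(2)[OF u_L2[OF m(2)]u_L2[OF m(1)]mem(4)[OF m(1)]z]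
by(simp add: add_divide_distrib diff_divide_distrib power2_eq_square algebra_simps)
finally have ipz:"ip S ?z ?z = ..." .
have "\<bar>ip S ?z ?z\<bar>\<le>3 * (LTinfnorm T(L2norm S)uttt * L2norm S ?z) * k"unfolding ipz
proof(rule trapezoidal_first_step[where ph = "%r. ip S(u r) ?z"and phd = "%r. ip S(ut r) ?z"and p = "%r. ip S(W r) ?z"and q = "%r. ip S(Z r) ?z",OF _ _ _ _ k(1)])
fix r assume r:"r\<in>{0..k}"
hence r':"r\<in>{0..T}"using k by auto
show "((%r. ip S(u r) ?z)has_real_derivative ip S(ut r) ?z)(at r within{0..k})"
 "((%r. ip S(ut r) ?z)has_real_derivative ip S(W r) ?z)(at r within{0..k})"
 "((%r. ip S(W r) ?z)has_real_derivative ip S(Z r) ?z)(at r within{0..k})"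
 by(rule within_subset[OF _ order_refl k(2)]u_ip_deriv ut_ip_deriv W_ip_deriv z r')+
have "\<bar>ip S(Z r) ?z\<bar>\<le>L2norm S(Z r) * L2norm S ?z"by(rule L2.cauchy_schwarz[OF Z(1)[OF r']z])
also have "...\<le>LTinfnorm T(L2norm S)uttt * L2norm S ?z"by(intro mult_right_mono Z(2)[OF r'])simp
finally show "\<bar>ip S(Z r) ?z\<bar>\<le>LTinfnorm T(L2norm S)uttt * L2norm S ?z" .
qed
hence "\<bar>ip S ?z ?z\<bar>\<le>(3 * k * LTinfnorm T(L2norm S)uttt) * L2norm S ?z"by(simp add: ac_simps)
thus ?thesis using LTinf_bound(2)[OF LT(5)]k by(intro norm_le_of_pairing[OF z])auto
qed

text \<open>Testing the Ritz projection error with \<open>w\<close> turns it into \<open>(z, w) - a(z, xiz)\<close>, and for \<open>z = u(t)\<close> the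
  equation removes the second derivatives from the second term. The result is differentiable in time
  although \<open>u\<close> is only known to be continuous with values in \<open>H\<^sup>2\<close>.\<close>
lemma
fixes R ::"fld=>fld"
assumes R:"!!z. z\<in>H20 S==>R z\<in>L2S S""!!w. w\<in>L2S S==>\<exists>xiz\<in>H20 S. \<forall>z\<in>H20 S. ip S(R z)w = a_form S z xiz"
and err:"!!z. z\<in>H20 S==>z\<in>Hs S(2 + ga)==>L2norm S(%x. z x - R z x)\<le>ka * Hnorm S(2 + ga)z"and ka:"0\<le>ka"
defines "rh\<equiv>%t x. u t x - R(u t)x"
shows projection_error_L2:"t\<in>{0..T}==>rh t\<in>L2S S"
and projection_error_difference:"s\<in>{0..T}==>t\<in>{0..T}==>
 L2norm S(%x. rh t x - rh s x)\<le>ka * LTinfnorm T(Hnorm S(2 + ga))ut * \<bar>t - s\<bar>"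
and projection_error_second_difference:"0\<le>t - k==>t + k\<le>T==>0 < k==>
 L2norm S(%x. rh(t + k)x - 2 * rh t x + rh(t - k)x)\<le>
 2 * ka * k * (prim T(%r. Hnorm S(2 + ga)(utt r))(t + k) - prim T(%r. Hnorm S(2 + ga)(utt r))(t - k))"
proof -
have H0:"0\<le>Hnorm S(2 + ga)v"for v by(simp add: Hnorm_def sum_nonneg)
show rhL:"rh t\<in>L2S S"if "t\<in>{0..T}"for t
unfolding rh_def by(intro L2.diff_mem u_L2 R(1)mem(3)that)
let ?bez = "%r. Hnorm S(2 + ga)(utt r)"
have bez:"integrable(tm T) ?bez"
by(intro L2_integrable[OF finite_tm]LTinf_L2[OF LT(3)])(use Hnorm_triangle_rev H0 in auto)
have main:"\<exists>Ph Ph'. (\<forall>t\<in>{0..T}. ip S(rh t)w = Ph t)&(\<forall>t\<in>{0..T}. (Ph has_real_derivative Ph' t)(at t within{0..T}))&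
 (\<forall>t\<in>{0..T}. \<bar>Ph' t\<bar>\<le>ka * LTinfnorm T(Hnorm S(2 + ga))ut * L2norm S w)&
 (\<forall>l h r t. 0\<le>l-->h\<le>T-->r\<in>{l..h}-->t\<in>{l..h}-->\<bar>Ph' r - Ph' t\<bar>\<le>(ka * L2norm S w) * (prim T ?bez h - prim T ?bez l))"
if w:"w\<in>L2S S"for w
proof -
obtain xiz where xiz:"xiz\<in>H20 S""\<forall>z\<in>H20 S. ip S(R z)w = a_form S z xiz"using R(2)[OF w]by blast
have xizL:"xiz\<in>L2S S"by(rule Hs_L2[OF H20_D[OF xiz(1)]])
have F:"ip S(%x. z x - R z x)w = ip S z w - a_form S z xiz"if "z\<in>H20 S"for z
 using L2.diff_left[OF Hs_L2[OF H20_D[OF that]]R(1)[OF that]w]xiz(2)that by simp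
have Fb:"\<bar>ip S z w - ip S g xiz\<bar>\<le>(ka * L2norm S w) * Hnorm S(2 + ga)z"
 if z:"z\<in>H20 S""z\<in>Hs S(2 + ga)"and g:"has_bilaplacian S z g"for z g
proof -
 have "\<bar>ip S z w - ip S g xiz\<bar> = \<bar>ip S(%x. z x - R z x)w\<bar>"
 using F[OF z(1)]a_form_bilaplacian[OF H20_D[OF z(1)]g xiz(1)]by simp
 also have "...\<le>L2norm S(%x. z x - R z x) * L2norm S w"
 by(rule L2.cauchy_schwarz[OF L2.diff_mem[OF Hs_L2[OF z(2)]R(1)[OF z(1)]]w])
 also have "...\<le>(ka * Hnorm S(2 + ga)z) * L2norm S w"by(intro mult_right_mono err z)simp
 finally show ?thesis by(simp add: ac_simps)
qed
let ?Ph = "%t. ip S(u t)w - (ip S(f t)xiz - ip S(W t)xiz)"and ?Ph' = "%t. ip S(ut t)w - (ip S(ft t)xiz - ip S(Z t)xiz)"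
have D:"(?Ph has_real_derivative ?Ph' t)(at t within{0..T})"if t:"t\<in>{0..T}"for t
 by(intro DERIV_diff u_ip_deriv f_ip_deriv W_ip_deriv w xizL t)
have c:"continuous_on{0..T} ?Ph'"by(intro continuous_on_diff ut_ip_cont ft_ip_cont Z_ip_cont w xizL)
\<comment> \<open>At almost every \<open>t\<close> the value \<open>?Ph' t\<close> is the projection
  error of \<open>ut t\<close> paired with \<open>w\<close>, since \<open>ut t\<close> is clamped
  with bilaplacian \<open>ft t - Z t\<close>. Continuity of \<open>?Ph'\<close> will carry the bound
  to every \<open>t\<close>.\<close>
have ae:"AE t in tm T. \<bar>?Ph' t\<bar>\<le>ka * LTinfnorm T(Hnorm S(2 + ga))ut * L2norm S w"
proof -
 have "AE t in tm T. ut t\<in>Hs S(2 + ga)"using LT(2)by(simp add: LTinf_def bochner_measurable_def)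
 thus ?thesis using LTinf_bound(1)[OF LT(2)]AE_space
 proof eventually_elim
 fix t assume h:"ut t\<in>Hs S(2 + ga)"and le:"Hnorm S(2 + ga)(ut t)\<le>LTinfnorm T(Hnorm S(2 + ga))ut"and "t\<in>space(tm T)"
 hence t:"t\<in>{0..T}"by simp
 have "\<bar>?Ph' t\<bar>\<le>(ka * L2norm S w) * Hnorm S(2 + ga)(ut t)"
  using Fb[OF ut_bilaplacian(1)[OF t]h ut_bilaplacian(2)[OF t]]L2.diff_left[OF mem(2)[OF t]Z(1)[OF t]xizL]by simp
 also have "...\<le>(ka * L2norm S w) * LTinfnorm T(Hnorm S(2 + ga))ut"by(intro mult_left_mono le)(use ka in simp)
 finally show "\<bar>?Ph' t\<bar>\<le>ka * LTinfnorm T(Hnorm S(2 + ga))ut * L2norm S w"by(simp add: ac_simps)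
 qed
qed
\<comment> \<open>The weak derivative of \<open>?Ph'\<close>, almost everywhere the projection error
  of \<open>utt\<close> paired with \<open>w\<close>. Its integral bounds the increments of
  \<open>?Ph'\<close> that the second difference needs.\<close>
let ?b = "%r. ip S(utt r)w - (ip S(ftt r)xiz - ip S(utttt r)xiz)"
note ii = pairableD(5)[OF putt w]pairableD(5)[OF pftt xizL]pairableD(5)[OF putttt xizL]
have bi:"integrable(tm T) ?b"by(intro Bochner_Integration.integrable_diff ii)
have pb:"prim T ?b t = prim T(%r. ip S(utt r)w)t - (prim T(%r. ip S(ftt r)xiz)t - prim T(%r. ip S(utttt r)xiz)t)"for t
 using prim_integrable[OF ii(1),of t]prim_integrable[OF ii(2),of t]prim_integrable[OF ii(3),of t]
 by(simp add: prim_def right_diff_distrib)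
have inc:"?Ph' t - ?Ph' s = prim T ?b t - prim T ?b s"if st:"s\<in>{0..T}""t\<in>{0..T}"for s t
proof -
 have "ip S(ut t)w - ip S(ut s)w = prim T(%r. ip S(utt r)w)t - prim T(%r. ip S(utt r)w)s"
 by(rule weak_derivative_continuous[OF T ut_ip_cont[OF w]pairableD(4)[OF putt w]_ st])
  (use ut_weak w in "simp add: weak_time_deriv_def")
 thus ?thesis unfolding pb using ft_inc[OF xizL st]Z(4)[OF st xizL]by simp
qed
have aeb:"AE r in tm T. \<bar>?b r\<bar>\<le>(ka * L2norm S w) * ?bez r"
proof -
 have "AE t in tm T. utt t\<in>Hs S(2 + ga)"using LT(3)by(simp add: LTinf_def bochner_measurable_def)
 thus ?thesis using utt_bilaplacian pairableD(1)[OF pftt]pairableD(1)[OF putttt]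
 proof eventually_elim
 fix r assume h:"utt r\<in>Hs S(2 + ga)"and b:"utt r\<in>H20 S&has_bilaplacian S(utt r)(%x. ftt r x - utttt r x)"
  and L:"ftt r\<in>L2S S""utttt r\<in>L2S S"
 show "\<bar>?b r\<bar>\<le>(ka * L2norm S w) * ?bez r"
  using Fb[OF conjunct1[OF b]h conjunct2[OF b]]L2.diff_left[OF L xizL]by simp
 qed
qed
show ?thesis
proof(rule exI[of _ ?Ph],rule exI[of _ ?Ph'],intro conjI ballI allI impI)
 fix t assume t:"t\<in>{0..T}"
 show "ip S(rh t)w = ?Ph t"unfolding rh_def F[OF mem(3)[OF t]]equation[OF xiz(1)t] ..
 show "(?Ph has_real_derivative ?Ph' t)(at t within{0..T})"by(rule D[OF t])
 show "\<bar>?Ph' t\<bar>\<le>ka * LTinfnorm T(Hnorm S(2 + ga))ut * L2norm S w"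
 by(rule AE_interval_le[OF T continuous_on_rabs[OF c]continuous_on_const ae t])
next
 fix l h r t assume lh:"0\<le>l""h\<le>T""r\<in>{l..h}""t\<in>{l..h}"
 show "\<bar>?Ph' r - ?Ph' t\<bar>\<le>(ka * L2norm S w) * (prim T ?bez h - prim T ?bez l)"
 by(rule increment_bound[where a = ?Ph',OF inc bi bez aeb H0 _ lh])(use ka in simp_all)
qed
qed
show "L2norm S(%x. rh t x - rh s x)\<le>ka * LTinfnorm T(Hnorm S(2 + ga))ut * \<bar>t - s\<bar>"(is "L2norm S ?z\<le>?M * _")
if st:"s\<in>{0..T}""t\<in>{0..T}"for s t
proof -
have z:"?z\<in>L2S S"by(intro L2.diff_mem rhL st)
obtain Ph Ph' where P:"\<forall>t\<in>{0..T}. ip S(rh t) ?z = Ph t""\<forall>t\<in>{0..T}. (Ph has_real_derivative Ph' t)(at t within{0..T})"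
 "\<forall>t\<in>{0..T}. \<bar>Ph' t\<bar>\<le>?M * L2norm S ?z"using main[OF z]by blast
have M0:"0\<le>?M"using ka LTinf_bound(2)[OF LT(2)]by simp
have "\<bar>Ph t - Ph s\<bar>\<le>(?M * L2norm S ?z) * \<bar>t - s\<bar>"
 by(rule abs_le_of_derivative[OF bspec[OF P(2)]bspec[OF P(3)]st(2,1)])(use M0 in auto)
moreover have "ip S ?z ?z = Ph t - Ph s"using L2.diff_left[OF rhL[OF st(2)]rhL[OF st(1)]z]P(1)st by simp
moreover have "0\<le>?M * \<bar>t - s\<bar>"using M0 by simp
ultimately show ?thesis by(intro norm_le_of_pairing[OF z])(simp_all only: ac_simps)
qed
show "L2norm S(%x. rh(t + k)x - 2 * rh t x + rh(t - k)x)\<le>2 * ka * k * (prim T ?bez(t + k) - prim T ?bez(t - k))"(is "L2norm S ?z\<le>_ * ?D")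
if t:"0\<le>t - k""t + k\<le>T"and k:"0 < k"for t k
proof -
have m:"t - k\<in>{0..T}""t\<in>{0..T}""t + k\<in>{0..T}"using t k by auto
note rm = rhL[OF m(3)]rhL[OF m(2)]rhL[OF m(1)]
have e:"?z = (%x. 1 * rh(t + k)x + (-2) * rh t x + 1 * rh(t - k)x)"by(simp add: fun_eq_iff)
have z:"?z\<in>L2S S"unfolding e by(rule L2.comb3(1)[OF rm])
obtain Ph Ph' where P:"\<forall>t\<in>{0..T}. ip S(rh t) ?z = Ph t""\<forall>t\<in>{0..T}. (Ph has_real_derivative Ph' t)(at t within{0..T})"
 "\<forall>l h r t. 0\<le>l-->h\<le>T-->r\<in>{l..h}-->t\<in>{l..h}-->\<bar>Ph' r - Ph' t\<bar>\<le>(ka * L2norm S ?z) * (prim T ?bez h - prim T ?bez l)"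
 using main[OF z]by blast
have "ip S ?z ?z = Ph(t + k) - 2 * Ph t + Ph(t - k)"
 by(subst(1)e)(use L2.comb3(2)[OF rm z,of 1 "-2"1]P(1)m in simp)
moreover have "\<bar>Ph(t + k) - 2 * Ph t + Ph(t - k)\<bar>\<le>2 * (ka * L2norm S ?z * ?D) * k"
proof(rule second_difference_bound[where e = Ph'])
 fix r assume r:"r\<in>{t - k..t + k}"
 hence "r\<in>{0..T}"using t by auto
 thus "(Ph has_real_derivative Ph' r)(at r within{t - k..t + k})"using P(2)within_subset[OF _ t]by blast
 show "\<bar>Ph' r - Ph' t\<bar>\<le>ka * L2norm S ?z * ?D"using P(3)t r k by auto
qed(use k in simp)
moreover have "0\<le>2 * ka * k * ?D"using ka k prim_mono[OF bez H0,of "t - k""t + k"]by simp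
ultimately show ?thesis by(intro norm_le_of_pairing[OF z])(simp_all only: ac_simps)
qed
qed

end

section \<open>The fully discrete scheme\<close>

text \<open>The maximum of \<open>sqrt E\<close> absorbs the linear terms, so no Gronwall argument is needed. The functionals
  \<open>F i\<close> are moved by summation by parts from the increments of the discrete solution to their own increments.\<close>
lemma discrete_energy:
fixes E ::"nat=>real"and F ::"nat=>nat=>real"
assumes E:"!!n. 0\<le>E n"
and step:"!!i. i < M==>E(Suc i) = E i + 2 * (F i(Suc i) - F i i) + R i"
and l:"!!i j. i < M==>j\<le>M==>\<bar>F i j\<bar>\<le>g * sqrt(E j)"
and d:"!!i. Suc i < M==>\<bar>F(Suc i)(Suc i) - F i(Suc i)\<bar>\<le>d i * sqrt(E(Suc i))"
and R:"!!i. i < M==>\<bar>R i\<bar>\<le>r i * (sqrt(E(Suc i)) + sqrt(E i))"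
and nonneg:"!!i. i < M==>0\<le>d i""!!i. i < M==>0\<le>r i""0\<le>g"
and D:"!!m. Suc m\<le>M==>(\<Sum>i<m. d i)\<le>D""0\<le>D"and Rs:"!!m. m\<le>M==>(\<Sum>i<m. r i)\<le>Rs"
and m:"m\<le>M"
shows "sqrt(E m)\<le>sqrt(E 0) + (4 * g + 2 * D + 2 * Rs)"
proof -
\<comment> \<open>Summation by parts in closed form; its two boundary terms, each with factor 2,
  account for \<open>4 * g\<close>.\<close>
have id:"E(Suc m) = E 0 + 2 * F m(Suc m) - 2 * F 0 0 - 2 * (\<Sum>i<m. F(Suc i)(Suc i) - F i(Suc i)) + (\<Sum>i<Suc m. R i)"
if "Suc m\<le>M"for m
using that by(induction m)(simp_all add: step algebra_simps)
define X where "X = Max((%j. sqrt(E j)) ` {..M})"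
have X:"sqrt(E j)\<le>X"if "j\<le>M"for j unfolding X_def using that by(intro Max_ge)auto
have "X\<in>(%j. sqrt(E j)) ` {..M}"unfolding X_def by(intro Max_in)auto
then obtain n where n:"n\<le>M""X = sqrt(E n)"by auto
have X0:"0\<le>X"using n E[of n]by simp
have Rs0:"0\<le>Rs"using Rs[of 0]by simp
have lX:"\<bar>F i j\<bar>\<le>g * X"if "i < M""j\<le>M"for i j
using l[OF that]mult_left_mono[OF X[OF that(2)]nonneg(3)]by linarith
have "X * X\<le>X * (sqrt(E 0) + (4 * g + 2 * D + 2 * Rs))"
proof(cases n)
case 0
hence "X * X\<le>X * sqrt(E 0)"using n by simp
also have "...\<le>X * (sqrt(E 0) + (4 * g + 2 * D + 2 * Rs))"
 using nonneg(3)D(2)Rs0 X0 by(intro mult_left_mono)auto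
finally show ?thesis .
next
case(Suc m)
hence m:"Suc m\<le>M"using n by simp
have s1:"\<bar>\<Sum>i<m. F(Suc i)(Suc i) - F i(Suc i)\<bar>\<le>D * X"
proof -
 have "\<bar>\<Sum>i<m. F(Suc i)(Suc i) - F i(Suc i)\<bar>\<le>(\<Sum>i<m. \<bar>F(Suc i)(Suc i) - F i(Suc i)\<bar>)"by(rule sum_abs)
 also have "...\<le>(\<Sum>i<m. d i * X)"
 proof(rule sum_mono)
 fix i assume "i\<in>{..<m}"
 hence i:"Suc i < M"using m by auto
 show "\<bar>F(Suc i)(Suc i) - F i(Suc i)\<bar>\<le>d i * X"
  using d[OF i]mult_left_mono[OF X[of "Suc i"]nonneg(1)[of i]]i by linarith
 qed
 also have "... = (\<Sum>i<m. d i) * X"by(simp add: sum_distrib_right)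
 also have "...\<le>D * X"by(intro mult_right_mono D(1)m X0)
 finally show ?thesis .
qed
have s2:"\<bar>\<Sum>i<Suc m. R i\<bar>\<le>2 * Rs * X"
proof -
 have "\<bar>\<Sum>i<Suc m. R i\<bar>\<le>(\<Sum>i<Suc m. \<bar>R i\<bar>)"by(rule sum_abs)
 also have "...\<le>(\<Sum>i<Suc m. r i * (2 * X))"
 proof(rule sum_mono)
 fix i assume "i\<in>{..<Suc m}"
 hence i:"i < M"using m by auto
 have "sqrt(E(Suc i)) + sqrt(E i)\<le>2 * X"using X[of i]X[of "Suc i"]i by simp
 thus "\<bar>R i\<bar>\<le>r i * (2 * X)"using R[OF i]mult_left_mono[OF _ nonneg(2)[OF i]]order_trans by blast
 qed
 also have "... = (\<Sum>i<Suc m. r i) * (2 * X)"by(simp only: sum_distrib_right)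
 also have "...\<le>Rs * (2 * X)"by(intro mult_right_mono Rs m)(use X0 in simp)
 finally show ?thesis by(simp add: ac_simps)
qed
\<comment> \<open>Writing the bound of \<open>E 0\<close> as \<open>X * sqrt (E 0)\<close> puts the
  factor \<open>X\<close> into every term; after division \<open>sqrt (E 0)\<close> keeps the
  coefficient 1.\<close>
have EX:"X * X = E(Suc m)""E 0\<le>X * sqrt(E 0)"
 using n E[of n]Suc mult_right_mono[OF X[of 0],of "sqrt(E 0)"]E[of 0]by simp_all
have l2:"\<bar>F m(Suc m)\<bar>\<le>g * X""\<bar>F 0 0\<bar>\<le>g * X"using m by(auto intro!: lX)
have "X * X\<le>X * sqrt(E 0) + (4 * (g * X) + 2 * (D * X) + 2 * Rs * X)"
 using id[OF m]s1 s2 EX l2 unfolding abs_le_iff by linarith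
thus ?thesis by(simp add: algebra_simps)
qed
hence "X\<le>sqrt(E 0) + (4 * g + 2 * D + 2 * Rs)"
using X0 E[of 0]nonneg(3)D(2)Rs0 by(cases "X = 0")(auto simp: mult_le_cancel_left)
thus ?thesis using X[OF m]by linarith
qed

text \<open>The windows overlap, so each step of the grid is counted at most twice here and three
  times in the next lemma.\<close>

lemma telescope_two:
fixes q ::"nat=>real"
assumes "!!i j. i\<le>j==>j\<le>N==>q i\<le>q j""0\<le>q 0""m + 1\<le>N"
shows "(\<Sum>i<m. q(i + 2) - q i)\<le>2 * q N"
proof -
have "(\<Sum>i<m. q(i + 2) - q i) = q(m + 1) + q m - q 1 - q 0"by(induction m)(simp_all add: numeral_2_eq_2)
thus ?thesis using assms(1)[of "m + 1"N]assms(1)[of m N]assms(1)[of 0 1]assms(2,3)by simp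
qed

lemma telescope_three:
fixes q ::"nat=>real"
assumes "!!i j. i\<le>j==>j\<le>N==>q i\<le>q j""0\<le>q 0""m + 2\<le>N"
shows "(\<Sum>i<m. q(i + 3) - q i)\<le>3 * q N"
proof -
have "(\<Sum>i<m. q(i + 3) - q i) = q(m + 2) + q(m + 1) + q m - q 2 - q 1 - q 0"
by(induction m)(simp_all add: eval_nat_numeral)
thus ?thesis using assms(1)[of "m + 2"N]assms(1)[of "m + 1"N]assms(1)[of m N]assms(1)[of 0 1]assms(1)[of 0 2]assms(2,3)by simp
qed

section \<open>Averages and differences on the time grid\<close>

lemma half_form:
assumes "semidef_form V B""ph(Suc n)\<in>V""ph n\<in>V"
shows "half ph n\<in>V""dt_half k ph n\<in>V"
and "z\<in>V==>B(half ph n)z = (B(ph(Suc n))z + B(ph n)z) / 2"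
and "z\<in>V==>B(dt_half k ph n)z = (B(ph(Suc n))z - B(ph n)z) / k"
proof -
interpret semidef_form V B by fact
have e:"half ph n = (%x. 1/2 * ph(Suc n)x + 1/2 * ph n x + 0 * ph n x)"
"dt_half k ph n = (%x. (1/k) * ph(Suc n)x + (-1/k) * ph n x + 0 * ph n x)"
by(simp_all add: half_def dt_half_def fun_eq_iff diff_divide_distrib add_divide_distrib)
show "half ph n\<in>V""dt_half k ph n\<in>V"unfolding e by(rule comb3(1)[OF assms(2,3,3)])+
assume z:"z\<in>V"
show "B(half ph n)z = (B(ph(Suc n))z + B(ph n)z) / 2""B(dt_half k ph n)z = (B(ph(Suc n))z - B(ph n)z) / k"
unfolding e comb3(2)[OF assms(2,3,3)z]by(simp_all add: diff_divide_distrib add_divide_distrib)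
qed

lemma quarter_form:
assumes "semidef_form V B""ph(Suc n)\<in>V""ph n\<in>V""ph(n - 1)\<in>V""z\<in>V"
shows "B(quarter ph n)z = (B(ph(Suc n))z + 2 * B(ph n)z + B(ph(n - 1))z) / 4"
and "B(dt2 k ph n)z = (B(ph(Suc n))z - 2 * B(ph n)z + B(ph(n - 1))z) / k\<^sup>2"
proof -
interpret semidef_form V B by fact
have e:"quarter ph n = (%x. 1/4 * ph(Suc n)x + 1/2 * ph n x + 1/4 * ph(n - 1)x)"
"dt2 k ph n = (%x. (1/k\<^sup>2) * ph(Suc n)x + (-2/k\<^sup>2) * ph n x + (1/k\<^sup>2) * ph(n - 1)x)"
by(simp_all add: quarter_def dt2_def fun_eq_iff diff_divide_distrib add_divide_distrib)
show "B(quarter ph n)z = (B(ph(Suc n))z + 2 * B(ph n)z + B(ph(n - 1))z) / 4"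
"B(dt2 k ph n)z = (B(ph(Suc n))z - 2 * B(ph n)z + B(ph(n - 1))z) / k\<^sup>2"
unfolding e comb3(2)[OF assms(2-5)]by(simp_all add: diff_divide_distrib add_divide_distrib)
qed

context mesh
begin

text \<open>The algebraic properties of \<open>ah\<close> are assumed on the sum of the discrete
  space and the Morley space; an element of the former lies in that sum as itself plus zero.\<close>

lemma zero_morley:"(%x. 0)\<in>morley Om Tr"
proof -
have pv:"pt_val t w z = 0"if t:"t\<in>Tr"and w:"ae_eq(itri t)w(%x. 0)"and z:"z\<in>convex hull t"for t w z
proof -
interpret t: triangle t by(rule triangle[OF t])
have "\<exists>g. continuous_on(convex hull t)g&ae_eq(itri t)w g"using w by(intro exI[of _ "%x. 0"])simp
from someI_ex[OF this]have "continuous_on(convex hull t)(pt_val t w)""ae_eq(itri t)w(pt_val t w)"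
 unfolding pt_val_def by blast+
thus ?thesis using t.continuous_ae_unique[OF _ continuous_on_const _ z,of "pt_val t w"0]t.ae_eq_trans[OF t.ae_eq_sym w]by blast
qed
have nd:"ae_eq(itri t)(normal_deriv t e(%x. 0))(%x. 0)"if t:"t\<in>Tr"for t e
proof -
interpret t: triangle t by(rule triangle[OF t])
have "!!w. w\<in>Hs(itri t)2==>ae_eq(itri t)(normal_deriv t e(%x. 0))(%x. 0)"
proof -
 have "ae_eq(itri t)(normal_deriv t e(%x. (-1) * 0 + 0))(%x. (-1) * normal_deriv t e(%x. 0)x + normal_deriv t e(%x. 0)x)"
 by(rule t.normal_deriv_lin[OF t.H2.zero_mem t.H2.zero_mem])
 thus "ae_eq(itri t)(normal_deriv t e(%x. 0))(%x. 0)"by simp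
qed
thus ?thesis using t.H2.zero_mem by blast
qed
have v:"z\<in>t==>z\<in>convex hull t"for z :: pt and t by(rule hull_inc)
have pv0:"pt_val t(%x. 0)z = 0"if "t\<in>Tr""z\<in>convex hull t"for t z
by(rule pv[OF that(1)_ that(2)])(simp add: ae_eq_def)
have mid:"edge_mid e\<in>convex hull t"if et:"e\<subseteq>t"and c2:"card e = 2"for e t ::"pt set"
proof -
obtain p q where pq:"e = {p,q}""p\<noteq>q"using c2 by(auto simp: card_2_iff)
have "(1/2) *\<^sub>R p + (1/2) *\<^sub>R q\<in>convex hull t"
 using et pq by(intro convexD[OF convex_convex_hull])(auto intro: hull_inc)
thus ?thesis using pq by(simp add: edge_mid_def scaleR_right_distrib)
qed
have "(%x. 0)\<in>pw_poly 2 Tr"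
unfolding pw_poly_def poly2_def by(auto simp: ae_eq_def intro!: exI[of _ "%x. 0"]exI[of _ "%i j. 0"])
moreover have "card e = 2"if "e\<in>edges Tr"for e using that by(simp add: edges_def)
ultimately show ?thesis
using pv0 pv[OF _ nd]v mid unfolding morley_def interior_edges_def by(auto 0 0)
qed

end

section \<open>The discrete space, the smoother and the Ritz projection\<close>

locale scheme = wave Om lam psi T ga u0 v0 f ft ftt fttt u ut utt uttt utttt + mesh Om Tr
for Om lam psi T ga u0 v0 f ft ftt fttt u ut utt uttt utttt Tr +
fixes V ::"fld set"and ah ::"fld=>fld=>real"and Q Rh ::"fld=>fld"and N :: nat and k al bez C2 :: real
and C1 ::"real=>real"and U ::"nat=>fld"
assumes V:"fin_dim_space V""V\<subseteq>Hpw Tr 2"and form:"discrete_form Om Tr V ah al bez"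
and Q:"!!v. v\<in>V==>Q v\<in>H20 Om"and smoother:"smoother_estimate Om Tr V Q C1"
and ritz:"ritz_projection Om V ah Q Rh"and ritz_est:"ritz_estimate Om Tr ga Rh C2"
and N:"0 < N"and k:"k = T / real N"and implicit:"implicit_scheme Om V ah Rh k N u0 v0 f U"
and pos:"0 < al""0 < C1 0""0 < C2"and ga:"0 < ga""ga\<le>1"
begin

lemma V_span: obtains B where "finite B""B\<subseteq>V""\<forall>v\<in>V. \<exists>c. v = (%x. \<Sum>b\<in>B. c b * b x)"
"\<forall>c. (%x. \<Sum>b\<in>B. c b * b x)\<in>V"
proof -
obtain B where B:"finite B""V = {v. \<exists>c :: fld=>real. v = (%x. \<Sum>b\<in>B. c b * b x)}"
using V(1)by(auto simp: fin_dim_space_def)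
have "b\<in>V"if b:"b\<in>B"for b
proof -
have "b = (%x. \<Sum>b'\<in>B. (if b' = b then 1 else 0) * b' x)"
proof
 fix x
 have "(\<Sum>b'\<in>B. (if b' = b then 1 else 0) * b' x) = (\<Sum>b'\<in>B. if b' = b then b x else 0)"by(rule sum.cong)auto
 also have "... = b x"using B(1)b by simp
 finally show "b x = (\<Sum>b'\<in>B. (if b' = b then 1 else 0) * b' x)"by simp
qed
thus ?thesis unfolding B(2)mem_Collect_eq by(rule exI[of _ "%b'. if b' = b then 1 else 0"])
qed
thus thesis using B by(intro that[of B])auto
qed

lemma V_zero:"(%x. 0)\<in>V"and V_lin:"v\<in>V==>w\<in>V==>(%x. c * v x + w x)\<in>V"
proof -
obtain B where B:"finite B""B\<subseteq>V""\<forall>v\<in>V. \<exists>c. v = (%x. \<Sum>b\<in>B. c b * b x)"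
"\<forall>c. (%x. \<Sum>b\<in>B. c b * b x)\<in>V"by(rule V_span)
show "(%x. 0)\<in>V"using spec[OF B(4),of "%b. 0"]by simp
assume "v\<in>V""w\<in>V"
then obtain d e where "v = (%x. \<Sum>b\<in>B. d b * b x)""w = (%x. \<Sum>b\<in>B. e b * b x)"using B(3)by meson
hence "(%x. c * v x + w x) = (%x. \<Sum>b\<in>B. (c * d b + e b) * b x)"
by(simp add: sum_distrib_left sum.distrib[symmetric]algebra_simps)
thus "(%x. c * v x + w x)\<in>V"using spec[OF B(4),of "%b. c * d b + e b"]by simp
qed

lemma V_sum_space: assumes v:"v\<in>V"shows "v\<in>sum_space V(morley Om Tr)"
proof -
show ?thesis unfolding sum_space_def
by(rule CollectI,intro exI[of _ "%x. 0"]exI[of _ v])(simp add: v zero_morley)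
qed

lemma coercive:"v\<in>V==>al * (h_norm Tr v)\<^sup>2\<le>ah v v"using form by(simp add: discrete_form_def)

sublocale ah: semidef_form V ah
proof
show "(%x. 0)\<in>V"by(rule V_zero)
show "v\<in>V==>w\<in>V==>(%x. c * v x + w x)\<in>V"for v w c by(rule V_lin)
show "ah(%x. c * v x + w x)z = c * ah v z + ah w z"if "v\<in>V""w\<in>V""z\<in>V"for v w z c
using form that V_sum_space unfolding discrete_form_def by blast
show "ah v w = ah w v"if "v\<in>V""w\<in>V"for v w using form that V_sum_space unfolding discrete_form_def by blast
show "0\<le>ah v v"if "v\<in>V"for v using coercive[OF that]pos(1)by(smt(verit)mult_nonneg_nonneg zero_le_power2)
qed

lemma V_H:"v\<in>V==>v\<in>Hpw Tr 2"using V(2)by blast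

lemma V_L2:"v\<in>V==>v\<in>L2S Om"by(rule Hpw_L2[OF V_H])

lemma Rh:"z\<in>H20 Om==>Rh z\<in>V""z\<in>H20 Om==>v\<in>V==>ah(Rh z)v = a_form Om z(Q v)"
using ritz by(auto simp: ritz_projection_def)

lemma h_norm_le: assumes v:"v\<in>V"shows "h_norm Tr v\<le>sqrt(ah v v) / sqrt al"
proof -
have "sqrt al * h_norm Tr v = sqrt(al * (h_norm Tr v)\<^sup>2)"by(simp add: real_sqrt_mult)
also have "...\<le>sqrt(ah v v)"using coercive[OF v]by simp
finally show ?thesis using pos(1)by(simp add: pos_le_divide_eq mult.commute)
qed

abbreviation H where "H\<equiv>mesh_size Tr"

text \<open>The upper bound turns surplus powers of the mesh size into constants of the
  domain.\<close>

lemma mesh_size_pos:"0 < H"and mesh_size_le:"H\<le>diameter(closure Om)"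
proof -
have bc:"bounded(closure Om)"by(rule bounded_closure[OF bounded_S])
have U:"(\<Union>t\<in>Tr. convex hull t) = closure Om"using mesh by(simp add: mesh_triangulation_def)
have "Om\<noteq>{}"using polygon by(simp add: polygonal_lipschitz_domain_def)
hence ne:"Tr\<noteq>{}"using U closure_subset[of Om]by force
have "H\<in>(%t. diameter(convex hull t)) ` Tr"unfolding mesh_size_def using ne finite_T by(intro Max_in)auto
then obtain t where t:"t\<in>Tr""H = diameter(convex hull t)"by blast
have sub:"convex hull t\<subseteq>closure Om"using t(1)U by blast
show "H\<le>diameter(closure Om)"unfolding t(2)by(rule diameter_subset[OF sub bc])
have "card t = 3"using mesh t(1)by(simp add: mesh_triangulation_def)
then obtain p q where pq:"p\<in>t""q\<in>t""p\<noteq>q"by(metis card_3_iff insertCI)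
have "dist p q\<le>diameter(convex hull t)"
by(rule diameter_bounded_bound[OF bounded_subset[OF bc sub]hull_inc[OF pq(1)]hull_inc[OF pq(2)]])
thus "0 < H"using pq(3)unfolding t(2)by(meson less_le_trans zero_less_dist_iff)
qed

text \<open>The smoother estimate is used at order 0, where it gives two powers of the mesh
  size.\<close>

lemma smoother_L2:
assumes v:"v\<in>V"shows "L2norm Om(%x. v x - Q v x)\<le>C1 0 * H\<^sup>2 * h_norm Tr v"
proof -
let ?w = "%x. v x - Q v x"
have QH:"Q v\<in>Hpw Tr 2"by(rule Hs_Hpw[OF H20_D[OF Q[OF v]]])
have w:"?w\<in>L2S(itri t)"if "t\<in>Tr"for t
proof -
have "v\<in>Hs(itri t)2""Q v\<in>Hs(itri t)2"using V_H[OF v]QH that by(auto simp: Hpw_def)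
thus ?thesis by(intro Submission.L2.diff_mem Hs_L2[of _ _ 2])
qed
have "L2norm Om ?w = sqrt((L2norm Om ?w)\<^sup>2)"by simp
also have "...\<le>sqrt(\<Sum>t\<in>Tr. (Hnorm(itri t)0 ?w)\<^sup>2)"
proof(rule real_sqrt_le_mono,rule order_trans[OF piecewise_L2(2)[OF w]],assumption,rule sum_mono,rule power_mono)
fix t assume t:"t\<in>Tr"
interpret t: triangle t by(rule triangle[OF t])
show "L2norm(itri t) ?w\<le>Hnorm(itri t)0 ?w"by(rule t.L2norm_le_Hnorm[OF w[OF t]])
qed simp
also have "... = Hpw_norm Tr 0 ?w"by(simp add: Hpw_norm_def)
also have "...\<le>C1 0 * H powr(2 - 0) * (INF z\<in>H20 Om. h_norm Tr(%x. z x - v x))"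
using smoother v unfolding smoother_estimate_def by(meson atLeastAtMost_iff order_refl zero_le_numeral)
\<comment> \<open>The minimum over clamped functions is estimated by the competitor zero.\<close>
also have "...\<le>C1 0 * H powr(2 - 0) * h_norm Tr(%x. (%x. 0)x - v x)"
proof(intro mult_left_mono)
show "(INF z\<in>H20 Om. h_norm Tr(%x. z x - v x))\<le>h_norm Tr(%x. (%x. 0)x - v x)"
 by(rule cINF_lower[of "%z. h_norm Tr(%x. z x - v x)",OF bdd_belowI[of _ 0]zero_H20])auto
qed(use pos in simp)
also have "h_norm Tr(%x. (%x. 0)x - v x) = h_norm Tr v"
using h.nrm_commute[OF h.zero_mem V_H[OF v]]by simp
finally show ?thesis using mesh_size_pos by simp
qed

text \<open>The Riesz representation needs functionals that vanish on null vectors of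
  \<open>ah\<close>. For such a \<open>v\<close> the discrete norm is zero, so \<open>v\<close> and
  \<open>Q v\<close> agree in \<open>L^2\<close>. Moreover \<open>a_form (Q v) (Q v)\<close> equals
  \<open>ah (Rh (Q v)) v\<close>, which is zero by Cauchy-Schwarz, and Friedrichs' inequality makes
  \<open>Q v\<close> vanish.\<close>

lemma null_L2: assumes v:"v\<in>V"and 0:"ah v v = 0"shows "L2norm Om v = 0"
proof -
have "al * (h_norm Tr v)\<^sup>2\<le>0"using coercive[OF v]0 by simp
hence "h_norm Tr v = 0"using pos(1)by(simp add: mult_le_0_iff)
hence n:"L2norm Om(%x. v x - Q v x) = 0"using smoother_L2[OF v]L2norm_nonneg[of Om "%x. v x - Q v x"]by simp
note q = Q[OF v]and qL = Hs_L2[OF H20_D[OF Q[OF v]]]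
have "\<bar>ah(Rh(Q v))v\<bar>\<le>ah.nrm(Rh(Q v)) * ah.nrm v"by(rule ah.cauchy_schwarz[OF Rh(1)[OF q]v])
hence "a_form Om(Q v)(Q v) = 0"using Rh(2)[OF q v]0 by(simp add: ah.nrm_def)
hence h0:"H2semi Om(Q v) = 0"by(simp add: H2semi_eq)
obtain C where "!!v. v\<in>H20 Om==>Hnorm Om 2 v\<le>C * H2semi Om v"using friedrichs by blast
hence "Hnorm Om 2(Q v)\<le>C * H2semi Om(Q v)"using q .
hence "Hnorm Om 2(Q v)\<le>0"unfolding h0 by simp
hence "L2norm Om(Q v) = 0"using L2norm_le_Hnorm[OF qL,of 2]L2norm_nonneg[of Om "Q v"]by linarith
moreover have "L2norm Om(%x. (v x - Q v x) + Q v x)\<le>L2norm Om(%x. v x - Q v x) + L2norm Om(Q v)"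
by(rule L2.nrm_add[OF L2.diff_mem[OF V_L2[OF v]qL]qL])
ultimately show ?thesis using n L2norm_nonneg[of Om v]by simp
qed

lemma null_ip: assumes "v\<in>L2S Om""w\<in>L2S Om""L2norm Om v = 0"shows "ip Om v w = 0""ip Om w v = 0"
using L2.cauchy_schwarz[OF assms(1,2)]L2.cauchy_schwarz[OF assms(2,1)]assms(3)by simp_all

text \<open>The discrete dual problem: \<open>g\<close> represents the pairing with \<open>w\<close>
  through \<open>ah\<close>, and by the definition of the projection \<open>ah (Rh z) g\<close> is
  the energy form of \<open>z\<close> against \<open>Q g\<close>. The smoothed function
  \<open>Q g\<close> is the witness.\<close>

lemma Rh_dual: assumes w:"w\<in>L2S Om"shows "\<exists>xiz\<in>H20 Om. \<forall>z\<in>H20 Om. ip Om(Rh z)w = a_form Om z xiz"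
proof -
obtain B where B:"finite B""B\<subseteq>V""\<forall>v\<in>V. \<exists>c. v = (%x. \<Sum>b\<in>B. c b * b x)"by(rule V_span)
have "\<exists>g\<in>V. \<forall>c. ah(%x. \<Sum>b\<in>B. c b * b x)g = ip Om(%x. \<Sum>b\<in>B. c b * b x)w"
proof(rule ah.riesz_finite_span[OF B(1,2)])
show "ip Om(%x. c * v x + z x)w = c * ip Om v w + ip Om z w"if "v\<in>V""z\<in>V"for v z c
 by(rule L2.lin_left[OF V_L2[OF that(1)]V_L2[OF that(2)]w])
show "ip Om v w = 0"if "v\<in>V""ah v v = 0"for v by(rule null_ip(1)[OF V_L2[OF that(1)]w null_L2[OF that]])
qed
then obtain g where g:"g\<in>V""\<forall>c. ah(%x. \<Sum>b\<in>B. c b * b x)g = ip Om(%x. \<Sum>b\<in>B. c b * b x)w"by blast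
have "ip Om(Rh z)w = a_form Om z(Q g)"if z:"z\<in>H20 Om"for z
proof -
obtain c where c:"Rh z = (%x. \<Sum>b\<in>B. c b * b x)"using bspec[OF B(3)Rh(1)[OF z]]by blast
have "ah(Rh z)g = ip Om(Rh z)w"unfolding c by(rule spec[OF g(2)])
thus ?thesis using Rh(2)[OF z g(1)]by simp
qed
thus ?thesis using Q[OF g(1)]by blast
qed

abbreviation ka where "ka\<equiv>C2 * H powr(2 * ga)"

lemma Rh_error:
assumes z:"z\<in>H20 Om""z\<in>Hs Om(2 + ga)"
shows "L2norm Om(%x. z x - Rh z x)\<le>ka * Hnorm Om(2 + ga)z"
and "h_norm Tr(%x. z x - Rh z x)\<le>C2 * H powr ga * Hnorm Om(2 + ga)z"
proof -
have e:"L2norm Om(%x. z x - Rh z x) + H powr ga * h_norm Tr(%x. z x - Rh z x)\<le>ka * Hnorm Om(2 + ga)z"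
using ritz_est z unfolding ritz_estimate_def by blast
have p:"0 < H powr ga"using mesh_size_pos by simp
have n:"0\<le>L2norm Om(%x. z x - Rh z x)""0\<le>H powr ga * h_norm Tr(%x. z x - Rh z x)"using p by simp_all
show "L2norm Om(%x. z x - Rh z x)\<le>ka * Hnorm Om(2 + ga)z"using e n(2)by linarith
have "H powr ga * h_norm Tr(%x. z x - Rh z x)\<le>H powr ga * (C2 * H powr ga * Hnorm Om(2 + ga)z)"
proof -
have "H powr(2 * ga) = H powr ga * H powr ga"by(simp add: powr_add[symmetric])
hence "L2norm Om(%x. z x - Rh z x) + H powr ga * h_norm Tr(%x. z x - Rh z x)
 \<le>H powr ga * (C2 * H powr ga * Hnorm Om(2 + ga)z)"using e by(simp add: ac_simps)
thus ?thesis using n(1)by linarith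
qed
thus "h_norm Tr(%x. z x - Rh z x)\<le>C2 * H powr ga * Hnorm Om(2 + ga)z"using p by simp
qed

lemma ka_nonneg:"0\<le>ka"using pos by simp

definition rh where "rh t = (%x. u t x - Rh(u t)x)"

end

section \<open>The error equation and the discrete energy\<close>

context scheme
begin

lemma rh_L2:"t\<in>{0..T}==>rh t\<in>L2S Om"
unfolding rh_def by(intro L2.diff_mem u_L2 V_L2 Rh mem(3))

lemma rh_difference:
assumes "s\<in>{0..T}""t\<in>{0..T}"
shows "L2norm Om(%x. rh t x - rh s x)\<le>ka * LTinfnorm T(Hnorm Om(2 + ga))ut * \<bar>t - s\<bar>"
using projection_error_difference[of Rh ka s t]V_L2[OF Rh(1)]Rh_dual Rh_error(1)ka_nonneg assms unfolding rh_def by blast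

lemma rh_second_difference:
assumes "0\<le>t - d""t + d\<le>T""0 < d"
shows "L2norm Om(%x. rh(t + d)x - 2 * rh t x + rh(t - d)x)\<le>
 2 * ka * d * (prim T(%r. Hnorm Om(2 + ga)(utt r))(t + d) - prim T(%r. Hnorm Om(2 + ga)(utt r))(t - d))"
using projection_error_second_difference[of Rh ka t d]V_L2[OF Rh(1)]Rh_dual Rh_error(1)ka_nonneg assms unfolding rh_def by blast

lemma k_pos:"0 < k"and kN:"real N * k = T"using T N by(simp_all add: k)

definition tt where "tt n = real n * k"

lemma tt_mem:"n\<le>N==>tt n\<in>{0..T}"
proof -
assume "n\<le>N"
hence "real n * k\<le>real N * k"using k_pos by(intro mult_right_mono)auto
thus ?thesis using k_pos unfolding kN by(simp add: tt_def)
qed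

lemma tt_Suc:"tt(Suc n) = tt n + k"and tt_0:"tt 0 = 0"and tt_N:"tt N = T"
by(simp_all only: tt_def kN of_nat_Suc of_nat_0)(simp_all add: algebra_simps)

lemma tt_mono:"i\<le>j==>tt i\<le>tt j"using k_pos by(simp add: tt_def mult_right_mono)

definition P where "P n = Rh(u(tt n))"

definition xiz where "xiz n = (%x. U n x - P n x)"

lemma P_V:"n\<le>N==>P n\<in>V"unfolding P_def by(intro Rh mem(3)tt_mem)

lemma U_V:"n\<le>N==>U n\<in>V"using implicit by(simp add: implicit_scheme_def)

lemma xiz_V:"n\<le>N==>xiz n\<in>V"unfolding xiz_def by(intro ah.diff_mem U_V P_V)

lemma xiz_ah:"n\<le>N==>v\<in>V==>ah(xiz n)v = ah(U n)v - ah(P n)v"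
unfolding xiz_def by(intro ah.diff_left U_V P_V)

lemma xiz_ip:"n\<le>N==>v\<in>L2S Om==>ip Om(xiz n)v = ip Om(U n)v - ip Om(u(tt n))v + ip Om(rh(tt n))v"
proof -
assume n:"n\<le>N"and v:"v\<in>L2S Om"
note m = V_L2[OF U_V[OF n]]V_L2[OF P_V[OF n]]u_L2[OF tt_mem[OF n]]
show ?thesis using L2.diff_left[OF m(1,2)v]L2.diff_left[OF m(3,2)v]by(simp add: xiz_def rh_def P_def)
qed

text \<open>The amount by which the projected solution fails the spatially discrete equation, with
  \<open>W\<close> in place of the second time derivative.\<close>

definition G where "G n v = ip Om(f(tt n))v - ip Om(W(tt n))v - ah(P n)v"

text \<open>The projection replaces \<open>ah (P n) v\<close> by the energy form against
  \<open>Q v\<close>, to which the equation applies. The difference between testing with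
  \<open>v\<close> and with \<open>Q v\<close> remains, and it is small in
  \<open>L^2\<close>.\<close>

lemma G_eq: assumes n:"n\<le>N"and v:"v\<in>V"
shows "G n v = ip Om(%x. f(tt n)x - W(tt n)x)(%x. v x - Q v x)"
proof -
note t = tt_mem[OF n]and qL = Hs_L2[OF H20_D[OF Q[OF v]]]
have "ah(P n)v = ip Om(f(tt n))(Q v) - ip Om(W(tt n))(Q v)"
unfolding P_def Rh(2)[OF mem(3)[OF t]v]by(rule equation[OF Q[OF v]t])
thus ?thesis
using L2.diff_right[OF V_L2[OF v]qL residual_L2[OF t]]L2.diff_left[OF mem(1)[OF t]W(1)[OF t]V_L2[OF v]]
 L2.diff_left[OF mem(1)[OF t]W(1)[OF t]qL]by(simp add: G_def)
qed

text \<open>With coercivity the smoother estimate bounds the \<open>L^2\<close> norm of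
  \<open>v - Q v\<close> by \<open>de * sqrt (ah v v)\<close>. \<open>Mg\<close> bounds the size of
  \<open>f - W\<close>, and \<open>p\<close> accumulates its variation in time.\<close>

abbreviation de where "de\<equiv>C1 0 * H\<^sup>2 / sqrt al"
abbreviation Mg where "Mg\<equiv>LTinfnorm T(L2norm Om)f + LTinfnorm T(L2norm Om)utt"
abbreviation p where "p n\<equiv>prim T(%r. L2norm Om(ft r) + L2norm Om(uttt r))(tt n)"

lemma de_nonneg:"0\<le>de"using pos by simp

lemma smoother_ah: assumes v:"v\<in>V"shows "L2norm Om(%x. v x - Q v x)\<le>de * sqrt(ah v v)"
proof -
have "C1 0 * H\<^sup>2 * h_norm Tr v\<le>C1 0 * H\<^sup>2 * (sqrt(ah v v) / sqrt al)"
by(intro mult_left_mono h_norm_le v)(use pos in simp)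
thus ?thesis using smoother_L2[OF v]by simp
qed

lemma diff_Q_L2:"v\<in>V==>(%x. v x - Q v x)\<in>L2S Om"
by(intro L2.diff_mem V_L2 Hs_L2[OF H20_D]Q)

lemma G_bound: assumes n:"n\<le>N"and v:"v\<in>V"shows "\<bar>G n v\<bar>\<le>Mg * de * sqrt(ah v v)"
proof -
note t = tt_mem[OF n]
have "\<bar>G n v\<bar>\<le>L2norm Om(%x. f(tt n)x - W(tt n)x) * L2norm Om(%x. v x - Q v x)"
unfolding G_eq[OF n v]by(rule L2.cauchy_schwarz[OF residual_L2[OF t]diff_Q_L2[OF v]])
also have "...\<le>Mg * (de * sqrt(ah v v))"
using f_bound_nonneg LTinf_bound(2)[OF LT(4)]by(intro mult_mono residual_bound t smoother_ah v)auto
finally show ?thesis by(simp add: mult.assoc)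
qed

lemma G_increment: assumes n:"Suc n\<le>N"and v:"v\<in>V"
shows "\<bar>G(Suc n)v - G n v\<bar>\<le>(p(Suc n) - p n) * de * sqrt(ah v v)"
proof -
have n':"n\<le>N"using n by simp
note t = tt_mem[OF n]tt_mem[OF n']
let ?d = "%x. (f(tt(Suc n))x - W(tt(Suc n))x) - (f(tt n)x - W(tt n)x)"and ?q = "%x. v x - Q v x"
have e:"G(Suc n)v - G n v = ip Om ?d ?q"
unfolding G_eq[OF n v]G_eq[OF n' v]by(rule L2.diff_left[OF residual_L2[OF t(1)]residual_L2[OF t(2)]diff_Q_L2[OF v],symmetric])
have "\<bar>ip Om ?d ?q\<bar>\<le>L2norm Om ?d * L2norm Om ?q"
by(rule L2.cauchy_schwarz[OF L2.diff_mem[OF residual_L2[OF t(1)]residual_L2[OF t(2)]]diff_Q_L2[OF v]])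
also have "...\<le>(p(Suc n) - p n) * (de * sqrt(ah v v))"
proof(rule mult_mono')
show "L2norm Om ?d\<le>p(Suc n) - p n"by(rule residual_increment)(use t tt_mono[of n "Suc n"]in auto)
qed(use smoother_ah[OF v]in auto)
finally show ?thesis unfolding e by(simp only: mult.assoc)
qed

definition Hn where "Hn n = half xiz n"
definition Dn where "Dn n = dt_half k xiz n"
text \<open>The energy lives on half steps, so \<open>E n\<close> involves level
  \<open>Suc n\<close>. Beyond the last step the value 0 keeps it nonnegative for every index, as
  \<open>discrete_energy\<close> requires.\<close>

definition E where "E n = (if Suc n\<le>N then ip Om(Dn n)(Dn n) + ah(Hn n)(Hn n)else 0)"

lemma HD_V: assumes "Suc n\<le>N"shows "Hn n\<in>V""Dn n\<in>V"
using half_form(1,2)[OF ah.semidef_form_axioms,of xiz n]xiz_V assms by(simp_all add: Hn_def Dn_def)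

lemma E_bounds:
assumes n:"Suc n\<le>N"
shows "sqrt(ah(Hn n)(Hn n))\<le>sqrt(E n)""L2norm Om(Dn n)\<le>sqrt(E n)""h_norm Tr(Hn n)\<le>sqrt(E n) / sqrt al"
proof -
note m = HD_V[OF n]
have nn:"0\<le>ah(Hn n)(Hn n)""0\<le>ip Om(Dn n)(Dn n)"using ah.nonneg[OF m(1)]L2.nonneg[OF V_L2[OF m(2)]] .
thus 1:"sqrt(ah(Hn n)(Hn n))\<le>sqrt(E n)""L2norm Om(Dn n)\<le>sqrt(E n)"using n by(auto simp: E_def L2norm_def)
show "h_norm Tr(Hn n)\<le>sqrt(E n) / sqrt al"
using h_norm_le[OF m(1)]divide_right_mono[OF 1(1),of "sqrt al"]pos(1)by simp
qed

lemma E_nonneg:"0\<le>E n"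
using ah.nonneg[OF HD_V(1)]L2.nonneg[OF V_L2[OF HD_V(2)]]by(auto simp: E_def)

text \<open>\<open>Z1\<close> is the time discretization defect of the exact solution,
  \<open>Z2\<close> the second difference of the projection error, kept without its division by
  \<open>k^2\<close>.\<close>

definition Z1 where "Z1 n = (%x. (1/4) * (W(tt n + k)x + 2 * W(tt n)x + W(tt n - k)x) - (u(tt n + k)x - 2 * u(tt n)x + u(tt n - k)x) / k\<^sup>2)"
definition Z2 where "Z2 n = (%x. rh(tt n + k)x - 2 * rh(tt n)x + rh(tt n - k)x)"

lemma defects:
assumes n:"Suc(Suc n)\<le>N"
shows "Z1(Suc n)\<in>L2S Om""Z2(Suc n)\<in>L2S Om"
and "v\<in>L2S Om==>ip Om(Z1(Suc n))v = (ip Om(W(tt(Suc(Suc n))))v + 2 * ip Om(W(tt(Suc n)))v + ip Om(W(tt n))v) / 4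
 - (ip Om(u(tt(Suc(Suc n))))v - 2 * ip Om(u(tt(Suc n)))v + ip Om(u(tt n))v) / k\<^sup>2"
and "v\<in>L2S Om==>ip Om(Z2(Suc n))v = ip Om(rh(tt(Suc(Suc n))))v - 2 * ip Om(rh(tt(Suc n)))v + ip Om(rh(tt n))v"
and "L2norm Om(Z1(Suc n))\<le>3 * k * (prim T(%r. L2norm Om(utttt r))(tt(Suc(Suc n))) - prim T(%r. L2norm Om(utttt r))(tt n))"
and "L2norm Om(Z2(Suc n))\<le>2 * ka * k * (prim T(%r. Hnorm Om(2 + ga)(utt r))(tt(Suc(Suc n))) - prim T(%r. Hnorm Om(2 + ga)(utt r))(tt n))"
proof -
have e:"tt(Suc n) + k = tt(Suc(Suc n))""tt(Suc n) - k = tt n"by(simp_all add: tt_Suc)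
have m:"tt n\<in>{0..T}""tt(Suc n)\<in>{0..T}""tt(Suc(Suc n))\<in>{0..T}"by(rule tt_mem,use n in simp)+
have c:"0\<le>tt(Suc n) - k""tt(Suc n) + k\<le>T"unfolding e using m by auto
note Wm = W(1)[OF m(3)]W(1)[OF m(2)]W(1)[OF m(1)]and um = u_L2[OF m(3)]u_L2[OF m(2)]u_L2[OF m(1)]
and rm = rh_L2[OF m(3)]rh_L2[OF m(2)]rh_L2[OF m(1)]
let ?a = "%x. 1/4 * W(tt(Suc(Suc n)))x + 1/2 * W(tt(Suc n))x + 1/4 * W(tt n)x"
let ?b = "%x. (1/k\<^sup>2) * u(tt(Suc(Suc n)))x + (-2/k\<^sup>2) * u(tt(Suc n))x + (1/k\<^sup>2) * u(tt n)x"
have e1:"Z1(Suc n) = (%x. ?a x - ?b x)"unfolding Z1_def e by(auto simp: fun_eq_iff add_divide_distrib diff_divide_distrib)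
have e2:"Z2(Suc n) = (%x. 1 * rh(tt(Suc(Suc n)))x + (-2) * rh(tt(Suc n))x + 1 * rh(tt n)x)"unfolding Z2_def e by auto
note am = L2.comb3(1)[OF Wm]and bm = L2.comb3(1)[OF um]
show "Z1(Suc n)\<in>L2S Om"unfolding e1 by(rule L2.diff_mem[OF am bm])
show "Z2(Suc n)\<in>L2S Om"unfolding e2 by(rule L2.comb3(1)[OF rm])
show "ip Om(Z1(Suc n))v = (ip Om(W(tt(Suc(Suc n))))v + 2 * ip Om(W(tt(Suc n)))v + ip Om(W(tt n))v) / 4
 - (ip Om(u(tt(Suc(Suc n))))v - 2 * ip Om(u(tt(Suc n)))v + ip Om(u(tt n))v) / k\<^sup>2"if v:"v\<in>L2S Om"
unfolding e1 L2.diff_left[OF am bm v]L2.comb3(2)[OF Wm v]L2.comb3(2)[OF um v]by(simp add: add_divide_distrib diff_divide_distrib)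
show "ip Om(Z2(Suc n))v = ip Om(rh(tt(Suc(Suc n))))v - 2 * ip Om(rh(tt(Suc n)))v + ip Om(rh(tt n))v"if v:"v\<in>L2S Om"
unfolding e2 L2.comb3(2)[OF rm v]by simp
show "L2norm Om(Z1(Suc n))\<le>3 * k * (prim T(%r. L2norm Om(utttt r))(tt(Suc(Suc n))) - prim T(%r. L2norm Om(utttt r))(tt n))"
using trapezoidal_defect[OF c k_pos]unfolding Z1_def e .
show "L2norm Om(Z2(Suc n))\<le>2 * ka * k * (prim T(%r. Hnorm Om(2 + ga)(utt r))(tt(Suc(Suc n))) - prim T(%r. Hnorm Om(2 + ga)(utt r))(tt n))"
using rh_second_difference[OF c k_pos]unfolding Z2_def e .
qed

text \<open>The discrete error is rewritten as \<open>U - u + rh\<close> in the inertia term and as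
  \<open>U - P\<close> in the form. Adding and subtracting the average of \<open>W\<close> separates
  the smoother residuals \<open>G\<close> from the time defect.\<close>

lemma error_equation:
assumes n:"Suc(Suc n)\<le>N"and v:"v\<in>V"
shows "(ip Om(xiz(Suc(Suc n)))v - 2 * ip Om(xiz(Suc n))v + ip Om(xiz n)v) / k\<^sup>2
 + (ah(xiz(Suc(Suc n)))v + 2 * ah(xiz(Suc n))v + ah(xiz n)v) / 4
= (G(Suc(Suc n))v + 2 * G(Suc n)v + G n v) / 4 + ip Om(Z1(Suc n))v + ip Om(Z2(Suc n))v / k\<^sup>2"
proof -
note vL = V_L2[OF v]
have le:"n\<le>N""Suc n\<le>N""Suc(Suc n)\<le>N"using n by auto
have g:"grid k f(Suc(Suc n))\<in>L2S Om""grid k f(Suc n)\<in>L2S Om""grid k f(Suc n - 1)\<in>L2S Om"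
using mem(1)[OF tt_mem[OF le(1)]]mem(1)[OF tt_mem[OF le(2)]]mem(1)[OF tt_mem[OF le(3)]]by(simp_all add: grid_def tt_def)
have UV:"U(Suc(Suc n))\<in>V""U(Suc n)\<in>V""U(Suc n - 1)\<in>V"using U_V le by auto
have "Suc n\<in>{1..N - 1}"using n by auto
hence "ip Om(dt2 k U(Suc n))v + ah(quarter U(Suc n))v = ip Om(quarter(grid k f)(Suc n))v"
using implicit v unfolding implicit_scheme_def by blast
hence s:"(ip Om(U(Suc(Suc n)))v - 2 * ip Om(U(Suc n))v + ip Om(U n)v) / k\<^sup>2
 + (ah(U(Suc(Suc n)))v + 2 * ah(U(Suc n))v + ah(U n)v) / 4
 = (ip Om(f(tt(Suc(Suc n))))v + 2 * ip Om(f(tt(Suc n)))v + ip Om(f(tt n))v) / 4"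
unfolding quarter_form(1)[OF ah.semidef_form_axioms UV v]quarter_form(2)[OF L2.semidef_form_axioms V_L2[OF UV(1)]V_L2[OF UV(2)]V_L2[OF UV(3)]vL]
 quarter_form(1)[OF L2.semidef_form_axioms g vL]by(simp add: grid_def tt_def)
show ?thesis
unfolding defects(3)[OF n vL]defects(4)[OF n vL]xiz_ip[OF le(1)vL]xiz_ip[OF le(2)vL]xiz_ip[OF le(3)vL]
 xiz_ah[OF le(1)v]xiz_ah[OF le(2)v]xiz_ah[OF le(3)v]G_def
using s by(simp add: add_divide_distrib diff_divide_distrib algebra_simps)
qed

text \<open>The test function is the difference of two consecutive half averages, which is also
  \<open>k/2\<close> times the sum of the two difference quotients. The first form makes the
  potential term an exact difference of energies, the second does the same for the kinetic
  term.\<close>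

lemma energy_step:
assumes n:"Suc(Suc n)\<le>N"
shows "E(Suc n) = E n + 2 * ((G(Suc(Suc n))(Hn(Suc n)) + 2 * G(Suc n)(Hn(Suc n)) + G n(Hn(Suc n))) / 4
 - (G(Suc(Suc n))(Hn n) + 2 * G(Suc n)(Hn n) + G n(Hn n)) / 4)
+ (k * (ip Om(Z1(Suc n))(Dn(Suc n)) + ip Om(Z1(Suc n))(Dn n)) + (ip Om(Z2(Suc n))(Dn(Suc n)) + ip Om(Z2(Suc n))(Dn n)) / k)"
proof -
have le:"n\<le>N""Suc n\<le>N""Suc(Suc n)\<le>N"using n by auto
note m = HD_V[OF le(3)]HD_V[OF le(2)]and d = V_L2[OF HD_V(2)[OF le(3)]]V_L2[OF HD_V(2)[OF le(2)]]
define v where "v = (%x. Hn(Suc n)x - Hn n x)"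
have v:"v\<in>V"unfolding v_def by(rule ah.diff_mem[OF m(1,3)])
note vL = V_L2[OF v]and z = defects(1,2)[OF n]
have ve:"v = (%x. (k/2) * (Dn(Suc n)x + Dn n x))"
using k_pos by(simp add: v_def Hn_def Dn_def half_def dt_half_def fun_eq_iff field_simps)
have ipv:"ip Om w v = (k/2) * (ip Om w(Dn(Suc n)) + ip Om w(Dn n))"if "w\<in>L2S Om"for w
unfolding ve L2.cmult_right[OF L2.add_mem[OF d]that]L2.add_right[OF d that] ..
have Gv:"G j v = G j(Hn(Suc n)) - G j(Hn n)"if j:"j\<le>N"for j
unfolding v_def G_def ah.diff_right[OF m(1,3)P_V[OF j]]L2.diff_right[OF V_L2[OF m(1)]V_L2[OF m(3)]mem(1)[OF tt_mem[OF j]]]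
 L2.diff_right[OF V_L2[OF m(1)]V_L2[OF m(3)]W(1)[OF tt_mem[OF j]]]by simp
have hs:"ah(Hn(Suc n))v = (ah(xiz(Suc(Suc n)))v + ah(xiz(Suc n))v) / 2""ah(Hn n)v = (ah(xiz(Suc n))v + ah(xiz n)v) / 2"
unfolding Hn_def by(rule half_form(3)[OF ah.semidef_form_axioms _ _ v];intro xiz_V le)+
have ds:"ip Om(Dn(Suc n))v = (ip Om(xiz(Suc(Suc n)))v - ip Om(xiz(Suc n))v) / k""ip Om(Dn n)v = (ip Om(xiz(Suc n))v - ip Om(xiz n)v) / k"
unfolding Dn_def by(rule half_form(4)[OF L2.semidef_form_axioms _ _ vL];intro V_L2 xiz_V le)+
have a:"ah(Hn(Suc n))v + ah(Hn n)v = ah(Hn(Suc n))(Hn(Suc n)) - ah(Hn n)(Hn n)"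
unfolding v_def ah.diff_right[OF m(1,3,1)]ah.diff_right[OF m(1,3,3)]using ah.sym[OF m(1,3)]by simp
have b:"ip Om(Dn(Suc n))v - ip Om(Dn n)v = (k/2) * (ip Om(Dn(Suc n))(Dn(Suc n)) - ip Om(Dn n)(Dn n))"
unfolding ipv[OF d(1)]ipv[OF d(2)]using L2.sym[OF d]by(simp add: algebra_simps)
have "(ip Om(Dn(Suc n))v - ip Om(Dn n)v) / k + (ah(Hn(Suc n))v + ah(Hn n)v) / 2
 = (ip Om(xiz(Suc(Suc n)))v - 2 * ip Om(xiz(Suc n))v + ip Om(xiz n)v) / k\<^sup>2
 + (ah(xiz(Suc(Suc n)))v + 2 * ah(xiz(Suc n))v + ah(xiz n)v) / 4"
unfolding hs ds by(simp add: power2_eq_square add_divide_distrib diff_divide_distrib)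
also have "... = (G(Suc(Suc n))v + 2 * G(Suc n)v + G n v) / 4 + ip Om(Z1(Suc n))v + ip Om(Z2(Suc n))v / k\<^sup>2"
by(rule error_equation[OF n v])
finally have "(1/2) * (ip Om(Dn(Suc n))(Dn(Suc n)) - ip Om(Dn n)(Dn n)) + (ah(Hn(Suc n))(Hn(Suc n)) - ah(Hn n)(Hn n)) / 2
 = (G(Suc(Suc n))v + 2 * G(Suc n)v + G n v) / 4 + ip Om(Z1(Suc n))v + ip Om(Z2(Suc n))v / k\<^sup>2"
unfolding a b using k_pos by simp
note half_eq = this
have "E(Suc n) - E n = 2 * ((1/2) * (ip Om(Dn(Suc n))(Dn(Suc n)) - ip Om(Dn n)(Dn n)) + (ah(Hn(Suc n))(Hn(Suc n)) - ah(Hn n)(Hn n)) / 2)"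
using n by(simp add: E_def diff_divide_distrib)
also have "... = 2 * ((G(Suc(Suc n))v + 2 * G(Suc n)v + G n v) / 4) + 2 * ip Om(Z1(Suc n))v + 2 * (ip Om(Z2(Suc n))v / k\<^sup>2)"
unfolding half_eq by(simp only: distrib_left)
also have "2 * ip Om(Z1(Suc n))v = k * (ip Om(Z1(Suc n))(Dn(Suc n)) + ip Om(Z1(Suc n))(Dn n))"
unfolding ipv[OF z(1)]by simp
also have "2 * (ip Om(Z2(Suc n))v / k\<^sup>2) = (ip Om(Z2(Suc n))(Dn(Suc n)) + ip Om(Z2(Suc n))(Dn n)) / k"
unfolding ipv[OF z(2)]using k_pos by(simp add: power2_eq_square field_simps)
finally show ?thesis unfolding Gv[OF le(1)]Gv[OF le(2)]Gv[OF le(3)]by(simp add: diff_divide_distrib add_divide_distrib algebra_simps)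
qed

text \<open>The scheme starts from the projection of \<open>u0\<close>, the error from that of
  \<open>u 0\<close>. These functions agree almost everywhere, so their projections differ by a null
  vector of \<open>ah\<close>, which is null in \<open>L^2\<close>.\<close>

lemma xiz_0:"L2norm Om(xiz 0) = 0"
proof -
have z:"0\<le>N""0\<in>{0..T}"using T by auto
have u0L:"u0\<in>L2S Om"using data by(simp add: smooth_data_def DA_pow_def)
have u0H:"u0\<in>H20 Om"by(rule H20_cong[OF u_0 mem(3)[OF z(2)]u0L])
let ?w = "%x. Rh u0 x - P 0 x"
have w:"?w\<in>V"by(rule ah.diff_mem[OF Rh(1)[OF u0H]P_V[OF z(1)]])
have "ah ?w ?w = a_form Om u0(Q ?w) - a_form Om(u 0)(Q ?w)"
using ah.diff_left[OF Rh(1)[OF u0H]P_V[OF z(1)]w]Rh(2)[OF u0H w]Rh(2)[OF mem(3)[OF z(2)]w]by(simp add: P_def tt_0)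
also have "... = 0"using Hs_cong(4)[OF u_0 u_L2[OF z(2)]u0L]by simp
finally have "L2norm Om ?w = 0"by(rule null_L2[OF w])
moreover have "L2norm Om(xiz 0) = L2norm Om ?w"
proof(rule L2norm_cong)
have "ae_eq Om(U 0)(Rh u0)"using implicit by(simp add: implicit_scheme_def)
thus "ae_eq Om(xiz 0) ?w"unfolding ae_eq_def xiz_def by eventually_elim simp
qed(rule V_L2[OF xiz_V[OF z(1)]]V_L2[OF w])+
ultimately show ?thesis by simp
qed

abbreviation M1 where "M1\<equiv>LTinfnorm T(Hnorm Om(2 + ga))ut"
abbreviation M3 where "M3\<equiv>LTinfnorm T(L2norm Om)uttt"

lemma Mg_nonneg:"0\<le>Mg"using f_bound_nonneg LTinf_bound(2)[OF LT(4)]by simp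

lemma Mgde_nonneg:"0\<le>Mg * de"by(rule mult_nonneg_nonneg[OF Mg_nonneg de_nonneg])

text \<open>The first step is tested with \<open>Hn 0\<close>. The factor \<open>3/2 * k^2\<close>
  is \<open>k/2\<close> times the defect bound \<open>3 * k\<close>, and in the projection term the
  step length of \<open>rh_difference\<close> cancels the division by \<open>k\<close>.\<close>

lemma initial_energy:"sqrt(E 0)\<le>Mg * de + 3/2 * k\<^sup>2 * M3 + ka * M1"
proof -
have le:"0\<le>N""Suc 0\<le>N"using N by auto
have t:"0\<in>{0..T}""k\<in>{0..T}"using tt_mem[OF le(1)]tt_mem[OF le(2)]by(simp_all add: tt_def)
have t1:"tt(Suc 0) = k"by(simp add: tt_def)
note m = HD_V[OF le(2)]and x0 = xiz_V[OF le(1)]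
note dL = V_L2[OF m(2)]and hL = V_L2[OF m(1)]and x0L = V_L2[OF x0]
let ?z1 = "%x. (1/2) * (W k x + W 0 x) - 2 / k * ((u k x - u 0 x) / k - ut 0 x)"and ?z2 = "%x. rh k x - rh 0 x"
let ?a = "%x. 1/2 * W k x + 1/2 * W 0 x + 0 * W 0 x"and ?b = "%x. (2/k\<^sup>2) * u k x + (-2/k\<^sup>2) * u 0 x + (-2/k) * ut 0 x"
have e1:"?z1 = (%x. ?a x - ?b x)"
by(auto simp: fun_eq_iff add_divide_distrib diff_divide_distrib power2_eq_square algebra_simps)
note Wm = W(1)[OF t(2)]W(1)[OF t(1)]W(1)[OF t(1)]and um = u_L2[OF t(2)]u_L2[OF t(1)]mem(4)[OF t(1)]
note am = L2.comb3(1)[OF Wm]and bm = L2.comb3(1)[OF um]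
have z1:"?z1\<in>L2S Om"unfolding e1 by(rule L2.diff_mem[OF am bm])
have z2:"?z2\<in>L2S Om"by(intro L2.diff_mem rh_L2 t)
have z1h:"ip Om ?z1(Hn 0) = (ip Om(W k)(Hn 0) + ip Om(W 0)(Hn 0)) / 2 - 2 / k * ((ip Om(u k)(Hn 0) - ip Om(u 0)(Hn 0)) / k - ip Om(ut 0)(Hn 0))"
unfolding e1 L2.diff_left[OF am bm hL]L2.comb3(2)[OF Wm hL]L2.comb3(2)[OF um hL]
by(simp add: add_divide_distrib diff_divide_distrib power2_eq_square algebra_simps)
have z2h:"ip Om ?z2(Hn 0) = ip Om(rh k)(Hn 0) - ip Om(rh 0)(Hn 0)"by(rule L2.diff_left[OF rh_L2[OF t(2)]rh_L2[OF t(1)]hL])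
\<comment> \<open>Since \<open>xiz 0\<close> is null in \<open>L^2\<close>, pairing with
  \<open>Hn 0\<close> is \<open>k/2\<close> times pairing with \<open>Dn 0\<close>, so the defects
  are measured against the kinetic energy.\<close>
have he:"Hn 0 = (%x. (k/2) * Dn 0 x + xiz 0 x)"
using k_pos by(simp add: Hn_def Dn_def half_def dt_half_def fun_eq_iff field_simps)
have hd:"ip Om w(Hn 0) = (k/2) * ip Om w(Dn 0)"if w:"w\<in>L2S Om"for w
unfolding he L2.add_right[OF L2.cmult_mem[OF dL]x0L w]L2.cmult_right[OF dL w]using null_ip(2)[OF x0L w xiz_0]by simp
have v0L:"v0\<in>L2S Om"using data by(simp add: smooth_data_def DA_pow_def)
have fm:"grid k f(Suc 0)\<in>L2S Om""grid k f 0\<in>L2S Om"using mem(1)[OF t(1)]mem(1)[OF t(2)]by(simp_all add: grid_def)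
have rhs:"ip Om(%x. half(grid k f)0 x + 2 / k * v0 x)(Hn 0) = (ip Om(f k)(Hn 0) + ip Om(f 0)(Hn 0)) / 2 + 2 / k * ip Om(ut 0)(Hn 0)"
unfolding L2.add_left[OF half_form(1)[OF L2.semidef_form_axioms fm]L2.cmult_mem[OF v0L]hL]L2.cmult_left[OF v0L hL]
 half_form(3)[OF L2.semidef_form_axioms fm hL]ip_cong[OF ut_0 ae_eq_refl mem(4)[OF t(1)]v0L hL hL]by(simp add: grid_def)
have s:"2 / k * ((ip Om(U(Suc 0))(Hn 0) - ip Om(U 0)(Hn 0)) / k) + (ah(U(Suc 0))(Hn 0) + ah(U 0)(Hn 0)) / 2
 = (ip Om(f k)(Hn 0) + ip Om(f 0)(Hn 0)) / 2 + 2 / k * ip Om(ut 0)(Hn 0)"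
proof -
have "2 / k * ip Om(dt_half k U 0)(Hn 0) + ah(half U 0)(Hn 0) = ip Om(%x. half(grid k f)0 x + 2 / k * v0 x)(Hn 0)"
 using implicit m(1)unfolding implicit_scheme_def by blast
thus ?thesis
 unfolding rhs half_form(4)[OF L2.semidef_form_axioms V_L2[OF U_V[OF le(2)]]V_L2[OF U_V[OF le(1)]]hL]
 half_form(3)[OF ah.semidef_form_axioms U_V[OF le(2)]U_V[OF le(1)]m(1)] .
qed
have dh:"ip Om(Dn 0)(Hn 0) = (ip Om(xiz(Suc 0))(Hn 0) - ip Om(xiz 0)(Hn 0)) / k"
unfolding Dn_def by(rule half_form(4)[OF L2.semidef_form_axioms V_L2[OF xiz_V[OF le(2)]]x0L hL])
have hh:"ah(Hn 0)(Hn 0) = (ah(xiz(Suc 0))(Hn 0) + ah(xiz 0)(Hn 0)) / 2"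
using half_form(3)[OF ah.semidef_form_axioms xiz_V[OF le(2)]x0 m(1)]by(simp add: Hn_def)
have "2 / k * ip Om(Dn 0)(Hn 0) + ah(Hn 0)(Hn 0)
 = (G(Suc 0)(Hn 0) + G 0(Hn 0)) / 2 + ip Om ?z1(Hn 0) + 2 / k\<^sup>2 * ip Om ?z2(Hn 0)"
unfolding dh hh z1h z2h xiz_ip[OF le(2)hL]xiz_ip[OF le(1)hL]xiz_ah[OF le(2)m(1)]xiz_ah[OF le(1)m(1)]G_def t1 tt_0
using s by(simp add: add_divide_distrib diff_divide_distrib power2_eq_square algebra_simps)
hence "E 0 = (G(Suc 0)(Hn 0) + G 0(Hn 0)) / 2 + (k/2) * ip Om ?z1(Dn 0) + (1 / k) * ip Om ?z2(Dn 0)"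
unfolding hd[OF dL]hd[OF z1]hd[OF z2]using k_pos le by(simp add: E_def power2_eq_square)
moreover have "G(Suc 0)(Hn 0)\<le>Mg * de * sqrt(E 0)""G 0(Hn 0)\<le>Mg * de * sqrt(E 0)"
proof -
note e = mult_left_mono[OF E_bounds(1)[OF le(2)]Mgde_nonneg]
show "G(Suc 0)(Hn 0)\<le>Mg * de * sqrt(E 0)"by(rule order_trans[OF abs_le_D1[OF G_bound[OF le(2)m(1)]]e])
show "G 0(Hn 0)\<le>Mg * de * sqrt(E 0)"by(rule order_trans[OF abs_le_D1[OF G_bound[OF le(1)m(1)]]e])
qed
moreover have "(k/2) * ip Om ?z1(Dn 0)\<le>(3/2 * k\<^sup>2 * M3) * sqrt(E 0)"
proof -
have "ip Om ?z1(Dn 0)\<le>L2norm Om ?z1 * L2norm Om(Dn 0)"using L2.cauchy_schwarz[OF z1 dL]by linarith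
also have "...\<le>(3 * k * M3) * sqrt(E 0)"
 using first_step_defect[OF k_pos]t(2)E_bounds(2)[OF le(2)]by(intro mult_mono')auto
finally have "(k/2) * ip Om ?z1(Dn 0)\<le>(k/2) * ((3 * k * M3) * sqrt(E 0))"using k_pos by(intro mult_left_mono)auto
thus ?thesis by(simp add: power2_eq_square ac_simps)
qed
moreover have "(1 / k) * ip Om ?z2(Dn 0)\<le>(ka * M1) * sqrt(E 0)"
proof -
have "ip Om ?z2(Dn 0)\<le>L2norm Om ?z2 * L2norm Om(Dn 0)"using L2.cauchy_schwarz[OF z2 dL]by linarith
also have "...\<le>(ka * M1 * k) * sqrt(E 0)"
 using rh_difference[OF t]k_pos E_bounds(2)[OF le(2)]by(intro mult_mono')auto
finally have "(1 / k) * ip Om ?z2(Dn 0)\<le>(1 / k) * ((ka * M1 * k) * sqrt(E 0))"using k_pos by(intro mult_left_mono)auto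
thus ?thesis using k_pos by simp
qed
moreover have "e\<le>c + d + d'"if "e = (a + b) / 2 + x + y""a\<le>c""b\<le>c""x\<le>d""y\<le>d'"for a b c d d' e x y :: real
using that by(simp add: field_simps)
ultimately have "E 0\<le>Mg * de * sqrt(E 0) + (3/2 * k\<^sup>2 * M3) * sqrt(E 0) + (ka * M1) * sqrt(E 0)"by blast
hence "E 0\<le>(Mg * de + 3/2 * k\<^sup>2 * M3 + ka * M1) * sqrt(E 0)"by(simp only: distrib_right)
hence *:"sqrt(E 0) * sqrt(E 0)\<le>(Mg * de + 3/2 * k\<^sup>2 * M3 + ka * M1) * sqrt(E 0)"using E_nonneg[of 0]by simp
show ?thesis
proof(cases "E 0 = 0")
case True
have "0\<le>Mg * de""0\<le>3/2 * k\<^sup>2 * M3""0\<le>ka * M1"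
 using Mgde_nonneg LTinf_bound(2)[OF LT(5)]mult_nonneg_nonneg[OF ka_nonneg LTinf_bound(2)[OF LT(2)]]by simp_all
thus ?thesis using True by simp
next
case False
hence "0 < sqrt(E 0)"using E_nonneg[of 0]by simp
thus ?thesis by(rule mult_right_le_imp_le[OF *])
qed
qed

abbreviation q where "q n\<equiv>prim T(%r. L2norm Om(utttt r))(tt n)"
abbreviation r where "r n\<equiv>prim T(%r. Hnorm Om(2 + ga)(utt r))(tt n)"

lemma pqr_mono:
assumes "i\<le>j"shows "p i\<le>p j""q i\<le>q j""r i\<le>r j"
proof -
note t = tt_mono[OF assms]
have H0:"0\<le>Hnorm Om(2 + ga)v"for v by(simp add: Hnorm_def sum_nonneg)
show "p i\<le>p j"
by(rule prim_mono[OF Bochner_Integration.integrable_add[OF pairableD(3)[OF pft]pairableD(3)[OF puttt]]_ t])simp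
show "q i\<le>q j"by(rule prim_mono[OF pairableD(3)[OF putttt]L2norm_nonneg t])
show "r i\<le>r j"
by(rule prim_mono[OF L2_integrable[OF finite_tm LTinf_L2[OF LT(3)]]H0 t])(use Hnorm_triangle_rev H0 in auto)
qed

lemma pqr_0:"p 0 = 0""q 0 = 0""r 0 = 0"by(simp_all add: tt_0 prim_0)

lemma pqr_nonneg:"0\<le>p n""0\<le>q n""0\<le>r n"
using pqr_mono[of 0 n]pqr_0 by simp_all

text \<open>The residuals \<open>G\<close> are tested with increments of \<open>Hn\<close> and carry
  no factor \<open>k\<close>, so they are summed by parts; two consecutive averages span four time
  levels, whence \<open>p (i + 3) - p i\<close>. The defects are paired with \<open>Dn\<close> and
  summed directly. Telescoping doubles the coefficients 3 and 2 to 6 and 4.\<close>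

lemma energy_bound:
assumes m:"m\<le>N - 1"
shows "sqrt(E m)\<le>sqrt(E 0) + (4 * (Mg * de) + 2 * (3 * (de * p N)) + 2 * (6 * (k\<^sup>2 * q N) + 4 * (ka * r N)))"
proof(rule discrete_energy[where M = "N - 1"and F = "%i j. (G(Suc(Suc i))(Hn j) + 2 * G(Suc i)(Hn j) + G i(Hn j)) / 4"
 and d = "%i. de * (p(i + 3) - p i)"and r = "%i. 3 * k\<^sup>2 * (q(i + 2) - q i) + 2 * ka * (r(i + 2) - r i)"
 and R = "%n. k * (ip Om(Z1(Suc n))(Dn(Suc n)) + ip Om(Z1(Suc n))(Dn n)) + (ip Om(Z2(Suc n))(Dn(Suc n)) + ip Om(Z2(Suc n))(Dn n)) / k"])
show "0\<le>E n"for n by(rule E_nonneg)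
fix i assume "i < N - 1"
hence i:"Suc(Suc i)\<le>N"by simp
show "E(Suc i) = E i + 2 * ((G(Suc(Suc i))(Hn(Suc i)) + 2 * G(Suc i)(Hn(Suc i)) + G i(Hn(Suc i))) / 4
 - (G(Suc(Suc i))(Hn i) + 2 * G(Suc i)(Hn i) + G i(Hn i)) / 4)
+ (k * (ip Om(Z1(Suc i))(Dn(Suc i)) + ip Om(Z1(Suc i))(Dn i)) + (ip Om(Z2(Suc i))(Dn(Suc i)) + ip Om(Z2(Suc i))(Dn i)) / k)"
by(rule energy_step[OF i])
show "0\<le>de * (p(i + 3) - p i)"using pqr_mono(1)[of i "i + 3"]by(intro mult_nonneg_nonneg de_nonneg)simp
show "0\<le>3 * k\<^sup>2 * (q(i + 2) - q i) + 2 * ka * (r(i + 2) - r i)"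
using pqr_mono(2,3)[of i "i + 2"]
by(intro add_nonneg_nonneg mult_nonneg_nonneg[OF mult_nonneg_nonneg[OF _ ka_nonneg]]mult_nonneg_nonneg[of "3 * k\<^sup>2"])auto
show "\<bar>(G(Suc(Suc i))(Hn j) + 2 * G(Suc i)(Hn j) + G i(Hn j)) / 4\<bar>\<le>Mg * de * sqrt(E j)"if "j\<le>N - 1"for j
proof -
have j:"Suc j\<le>N"using that N by simp
have b:"\<bar>G l(Hn j)\<bar>\<le>Mg * de * sqrt(E j)"if l:"l\<le>N"for l
 by(rule order_trans[OF G_bound[OF l HD_V(1)[OF j]]mult_left_mono[OF E_bounds(1)[OF j]Mgde_nonneg]])
have *:"\<bar>(a + 2 * b + c) / 4\<bar>\<le>x"if "\<bar>a\<bar>\<le>x""\<bar>b\<bar>\<le>x""\<bar>c\<bar>\<le>x"for a b c x :: real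
 using that by(simp add: abs_le_iff)
show ?thesis by(rule *;rule b)(use i in simp_all)
qed
let ?s = "sqrt(E(Suc i)) + sqrt(E i)"
show "\<bar>k * (ip Om(Z1(Suc i))(Dn(Suc i)) + ip Om(Z1(Suc i))(Dn i)) + (ip Om(Z2(Suc i))(Dn(Suc i)) + ip Om(Z2(Suc i))(Dn i)) / k\<bar>
 \<le>(3 * k\<^sup>2 * (q(i + 2) - q i) + 2 * ka * (r(i + 2) - r i)) * ?s"
proof -
have i':"Suc i\<le>N"using i by simp
have s0:"0\<le>?s"using E_nonneg by simp
have b:"\<bar>ip Om z(Dn(Suc i)) + ip Om z(Dn i)\<bar>\<le>L2norm Om z * ?s"if z:"z\<in>L2S Om"for z
proof -
 have "\<bar>ip Om z(Dn j)\<bar>\<le>L2norm Om z * sqrt(E j)"if j:"Suc j\<le>N"for j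
 using L2.cauchy_schwarz[OF z V_L2[OF HD_V(2)[OF j]]]mult_left_mono[OF E_bounds(2)[OF j]L2norm_nonneg[of Om z]]by linarith
 from this[OF i]this[OF i']show ?thesis unfolding distrib_left by linarith
qed
have "k * \<bar>ip Om(Z1(Suc i))(Dn(Suc i)) + ip Om(Z1(Suc i))(Dn i)\<bar>\<le>k * ((3 * k * (q(Suc(Suc i)) - q i)) * ?s)"
 using order_trans[OF b[OF defects(1)[OF i]]mult_right_mono[OF defects(5)[OF i]s0]]k_pos by(intro mult_left_mono)auto
moreover have "\<bar>ip Om(Z2(Suc i))(Dn(Suc i)) + ip Om(Z2(Suc i))(Dn i)\<bar> / k\<le>((2 * ka * k * (r(Suc(Suc i)) - r i)) * ?s) / k"
 using order_trans[OF b[OF defects(2)[OF i]]mult_right_mono[OF defects(6)[OF i]s0]]k_pos by(intro divide_right_mono)auto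
moreover have "\<bar>k * a + b / k\<bar>\<le>k * \<bar>a\<bar> + \<bar>b\<bar> / k"for a b
 using abs_triangle_ineq[of "k * a""b / k"]k_pos by(simp add: abs_mult abs_divide)
ultimately have "\<bar>k * (ip Om(Z1(Suc i))(Dn(Suc i)) + ip Om(Z1(Suc i))(Dn i)) + (ip Om(Z2(Suc i))(Dn(Suc i)) + ip Om(Z2(Suc i))(Dn i)) / k\<bar>
 \<le>k * ((3 * k * (q(Suc(Suc i)) - q i)) * ?s) + ((2 * ka * k * (r(Suc(Suc i)) - r i)) * ?s) / k"
 by(meson add_mono order_trans)
also have "... = (3 * k\<^sup>2 * (q(i + 2) - q i) + 2 * ka * (r(i + 2) - r i)) * ?s"
 using k_pos by(simp add: power2_eq_square distrib_right mult.assoc)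
finally show ?thesis .
qed
next
fix i assume i:"Suc i < N - 1"
have V:"Hn(Suc i)\<in>V"by(rule HD_V(1))(use i in simp)
define s where "s = de * sqrt(ah(Hn(Suc i))(Hn(Suc i)))"
have s0:"0\<le>s"unfolding s_def by(rule mult_nonneg_nonneg[OF de_nonneg])(simp add: ah.nonneg[OF V])
have g:"\<bar>G(Suc n)(Hn(Suc i)) - G n(Hn(Suc i))\<bar>\<le>(p(Suc n) - p n) * s"if "n\<le>i + 2"for n
using G_increment[OF _ V,of n]that i by(simp add: s_def mult.assoc)
have nn:"0\<le>(p(Suc n) - p n) * s"for n using pqr_mono(1)[of n "Suc n"]s0 by simp
have a:"\<bar>(d + 2 * c + b) / 4 - (c + 2 * b + a) / 4\<bar>\<le>x + y + z"
if "\<bar>d - c\<bar>\<le>x""\<bar>c - b\<bar>\<le>y""\<bar>b - a\<bar>\<le>z""0\<le>x""0\<le>y""0\<le>z"for a b c d x y z :: real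
using that by(simp add: abs_le_iff)(auto simp: field_simps)
have "\<bar>(G(Suc(Suc(Suc i)))(Hn(Suc i)) + 2 * G(Suc(Suc i))(Hn(Suc i)) + G(Suc i)(Hn(Suc i))) / 4
 - (G(Suc(Suc i))(Hn(Suc i)) + 2 * G(Suc i)(Hn(Suc i)) + G i(Hn(Suc i))) / 4\<bar>
\<le>(p(Suc(Suc(Suc i))) - p(Suc(Suc i))) * s + (p(Suc(Suc i)) - p(Suc i)) * s + (p(Suc i) - p i) * s"
by(rule a[OF g g g nn nn nn])auto
also have "... = (p(i + 3) - p i) * s"by(simp add: eval_nat_numeral algebra_simps)
also have "...\<le>(p(i + 3) - p i) * (de * sqrt(E(Suc i)))"
unfolding s_def using de_nonneg pqr_mono(1)[of i "i + 3"]i by(intro mult_left_mono E_bounds)auto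
finally show "\<bar>(G(Suc(Suc(Suc i)))(Hn(Suc i)) + 2 * G(Suc(Suc i))(Hn(Suc i)) + G(Suc i)(Hn(Suc i))) / 4
 - (G(Suc(Suc i))(Hn(Suc i)) + 2 * G(Suc i)(Hn(Suc i)) + G i(Hn(Suc i))) / 4\<bar>
\<le>de * (p(i + 3) - p i) * sqrt(E(Suc i))"by(simp only: ac_simps)
next
show "0\<le>Mg * de"by(rule Mgde_nonneg)
show "0\<le>3 * (de * p N)"by(intro mult_nonneg_nonneg de_nonneg pqr_nonneg)simp
show "(\<Sum>i<m. de * (p(i + 3) - p i))\<le>3 * (de * p N)"if "Suc m\<le>N - 1"for m
proof -
have m:"m + 2\<le>N"using that by simp
have "(\<Sum>i<m. p(i + 3) - p i)\<le>3 * p N"by(intro telescope_three pqr_mono pqr_nonneg m)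
hence "de * (\<Sum>i<m. p(i + 3) - p i)\<le>de * (3 * p N)"by(rule mult_left_mono[OF _ de_nonneg])
thus ?thesis by(simp only: sum_distrib_left mult.left_commute[of 3])
qed
show "(\<Sum>i<m. 3 * k\<^sup>2 * (q(i + 2) - q i) + 2 * ka * (r(i + 2) - r i))\<le>6 * (k\<^sup>2 * q N) + 4 * (ka * r N)"if "m\<le>N - 1"for m
proof -
have m:"m + 1\<le>N"using that N by simp
have "3 * k\<^sup>2 * (\<Sum>i<m. q(i + 2) - q i)\<le>3 * k\<^sup>2 * (2 * q N)"
 by(intro mult_left_mono telescope_two pqr_mono pqr_nonneg m)simp_all
moreover have "2 * ka * (\<Sum>i<m. r(i + 2) - r i)\<le>2 * ka * (2 * r N)"
 by(intro mult_left_mono telescope_two pqr_mono pqr_nonneg m)(use ka_nonneg in simp_all)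
ultimately show ?thesis by(simp add: sum.distrib sum_distrib_left mult.assoc)
qed
qed(use m in simp)

section \<open>Assembling the error bound\<close>

lemma error_split:
assumes c:"!!psz g. psz\<in>DA Om==>psz\<in>Hs Om(2 + ga)&(has_bilaplacian Om psz g-->Hnorm Om(2 + ga)psz\<le>c * (L2norm Om psz + L2norm Om g))"
and c0:"0\<le>c"and m:"Suc m\<le>N"
shows "L2norm Om(%x. dt_half k(grid k u)m x - dt_half k U m x)\<le>ka * M1 + sqrt(E m)"
and "h_norm Tr(%x. half(grid k u)m x - half U m x)
 \<le>C2 * H powr ga * (c * (LTinfnorm T(Hnorm Om(2 + ga))u + Mg)) + sqrt(E m) / sqrt al"
proof -
have m':"m\<le>N"using m by simp
note t = tt_mem[OF m]tt_mem[OF m']and HD = HD_V[OF m]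
let ?a = "%x. (1 / k) * (rh(tt(Suc m))x - rh(tt m)x)"
have d:"(%x. rh(tt(Suc m))x - rh(tt m)x)\<in>L2S Om"by(intro L2.diff_mem rh_L2 t)
have e:"(%x. dt_half k(grid k u)m x - dt_half k U m x) = (%x. ?a x - Dn m x)"
using k_pos by(simp add: dt_half_def grid_def Dn_def xiz_def rh_def P_def tt_def fun_eq_iff field_simps)
have "L2norm Om(%x. dt_half k(grid k u)m x - dt_half k U m x)\<le>L2norm Om ?a + L2norm Om(Dn m)"
unfolding e by(rule L2.nrm_diff[OF L2.cmult_mem[OF d]V_L2[OF HD(2)]])
also have "L2norm Om ?a\<le>(1 / k) * (ka * M1 * k)"
proof -
have "\<bar>tt(Suc m) - tt m\<bar> = k"using k_pos by(simp add: tt_Suc)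
hence "L2norm Om(%x. rh(tt(Suc m))x - rh(tt m)x)\<le>ka * M1 * k"using rh_difference[OF t(2,1)]by metis
moreover have "L2norm Om ?a = (1 / k) * L2norm Om(%x. rh(tt(Suc m))x - rh(tt m)x)"
 unfolding L2.nrm_cmult[OF d]using k_pos by simp
ultimately show ?thesis using k_pos by(metis mult_left_mono less_imp_le zero_less_divide_1_iff)
qed
finally show "L2norm Om(%x. dt_half k(grid k u)m x - dt_half k U m x)\<le>ka * M1 + sqrt(E m)"
using E_bounds(2)[OF m]k_pos by simp
let ?K = "c * (LTinfnorm T(Hnorm Om(2 + ga))u + Mg)"
have rhH:"rh s\<in>Hpw Tr 2""h_norm Tr(rh s)\<le>C2 * H powr ga * ?K"if s:"s\<in>{0..T}"for s
proof -
note reg = u_regular[OF c s c0]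
show "rh s\<in>Hpw Tr 2"unfolding rh_def by(intro h.diff_mem Hs_Hpw[OF H20_D[OF mem(3)[OF s]]]V_H Rh(1)mem(3)s)
have "h_norm Tr(rh s)\<le>C2 * H powr ga * Hnorm Om(2 + ga)(u s)"unfolding rh_def by(rule Rh_error(2))(use reg(1)in auto)
also have "...\<le>C2 * H powr ga * ?K"by(intro mult_left_mono reg(2)mult_nonneg_nonneg)(use pos in simp_all)
finally show "h_norm Tr(rh s)\<le>C2 * H powr ga * ?K" .
qed
let ?b = "%x. (1 / 2) * (rh(tt(Suc m))x + rh(tt m)x)"
have bH:"(%x. rh(tt(Suc m))x + rh(tt m)x)\<in>Hpw Tr 2"by(intro h.add_mem rhH t)
have e2:"(%x. half(grid k u)m x - half U m x) = (%x. ?b x - Hn m x)"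
by(simp add: half_def grid_def Hn_def xiz_def rh_def P_def tt_def fun_eq_iff field_simps)
have "h_norm Tr(%x. half(grid k u)m x - half U m x)\<le>h_norm Tr ?b + h_norm Tr(Hn m)"
unfolding e2 by(rule h.nrm_diff[OF h.cmult_mem[OF bH]V_H[OF HD(1)]])
also have "h_norm Tr ?b\<le>C2 * H powr ga * ?K"
unfolding h.nrm_cmult[OF bH]using h.nrm_add[OF rhH(1)[OF t(1)]rhH(1)[OF t(2)]]rhH(2)[OF t(1)]rhH(2)[OF t(2)]by simp
finally show "h_norm Tr(%x. half(grid k u)m x - half U m x)\<le>C2 * H powr ga * ?K + sqrt(E m) / sqrt al"
using E_bounds(3)[OF m]by linarith
qed

text \<open>In \<open>A\<close>, the 5 collects the residual bound of the initial energy and four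
  times that of the later steps, the single \<open>b\<close> is the initial projection term, and 6
  and 8 are the doubled 3 and 4 of \<open>energy_bound\<close>. In \<open>B\<close>,
  \<open>3/2\<close> comes from the first step and 12 is the doubled 6.\<close>

lemma error_bound:
assumes c:"!!psz g. psz\<in>DA Om==>psz\<in>Hs Om(2 + ga)&(has_bilaplacian Om psz g-->Hnorm Om(2 + ga)psz\<le>c * (L2norm Om psz + L2norm Om g))"
and c0:"0\<le>c"and m:"m\<in>{1..N - 1}"
defines "a\<equiv>C1 0 * (1 + diameter(closure Om))\<^sup>2 / sqrt al"and "b\<equiv>C2 * (1 + diameter(closure Om))"
defines "A\<equiv>5 * a + b + 6 * a * sqrt T + 8 * b * sqrt T"and "B\<equiv>3 / 2 + 12 * sqrt T"
shows "L2norm Om(%x. dt_half k(grid k u)m x - dt_half k U m x) + h_norm Tr(%x. half(grid k u)m x - half U m x)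
\<le>(b + C2 * c + (1 + 1 / sqrt al) * (A + B)) * (H powr ga * L_fu Om T ga f ft u ut utt uttt + k\<^sup>2 * M_u Om T uttt utttt)"
proof -
let ?L = "L_fu Om T ga f ft u ut utt uttt"and ?M = "M_u Om T uttt utttt"and ?h = "H powr ga"and ?s = "sqrt T"
have m':"m\<le>N - 1""Suc m\<le>N"using m N by auto
have H0:"0\<le>Hnorm Om(2 + ga)v"for v by(simp add: Hnorm_def sum_nonneg)
have LT2:"0\<le>LT2norm T nuz g"for nuz g by(simp add: LT2norm_def)
note nonneg = f_bound_nonneg LTinf_bound(2)[OF LT(1)]LTinf_bound(2)[OF LT(2)]LTinf_bound(2)[OF LT(4)]LTinf_bound(2)[OF LT(5)]
LT2[of "L2norm Om"ft]LT2[of "Hnorm Om(2 + ga)"utt]LT2[of "L2norm Om"uttt]LT2[of "L2norm Om"utttt]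
have parts:"Mg\<le>?L""M1\<le>?L""LTinfnorm T(Hnorm Om(2 + ga))u + Mg\<le>?L""M3\<le>?M""0\<le>?L""0\<le>?M"
"LT2norm T(L2norm Om)ft + LT2norm T(L2norm Om)uttt\<le>?L""LT2norm T(Hnorm Om(2 + ga))utt\<le>?L""LT2norm T(L2norm Om)utttt\<le>?M"
using nonneg unfolding L_fu_def M_u_def by linarith+
have s0:"0\<le>?s"using T by simp
have pN:"p N\<le>?s * ?L"
proof -
have "p N = prim T(%r. L2norm Om(ft r))T + prim T(%r. L2norm Om(uttt r))T"
 unfolding tt_N using prim_lin[OF pairableD(3)[OF pft]pairableD(3)[OF puttt],of 1 T]by simp
also have "...\<le>?s * LT2norm T(L2norm Om)ft + ?s * LT2norm T(L2norm Om)uttt"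
 by(intro add_mono prim_LT2norm[where nuz = "L2norm Om"and g = ft]prim_LT2norm[where nuz = "L2norm Om"and g = uttt]
  T pairableD(2)[OF pft]pairableD(2)[OF puttt]L2norm_nonneg)
also have "...\<le>?s * ?L"unfolding distrib_left[symmetric]by(rule mult_left_mono[OF parts(7)s0])
finally show ?thesis .
qed
have rN:"r N\<le>?s * ?L"unfolding tt_N
by(rule order_trans[OF prim_LT2norm[where nuz = "Hnorm Om(2 + ga)"and g = utt,OF T LTinf_L2[OF LT(3)]H0]mult_left_mono[OF parts(8)s0]])(use Hnorm_triangle_rev H0 in auto)
have qN:"q N\<le>?s * ?M"unfolding tt_N
by(rule order_trans[OF prim_LT2norm[where nuz = "L2norm Om"and g = utttt,OF T pairableD(2)[OF putttt]L2norm_nonneg]mult_left_mono[OF parts(9)s0]])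
\<comment> \<open>Adding 1 makes the bound at least 1, so that every power of the mesh size with
  exponent between 0 and 1 is at most \<open>e\<close>.\<close>
define e where "e = 1 + diameter(closure Om)"
have e:"1\<le>e""H\<le>e"using mesh_size_pos mesh_size_le by(simp_all add: e_def)
have pw:"H powr y\<le>e"if "0\<le>y""y\<le>1"for y
proof -
have "H powr y\<le>e powr y"using e mesh_size_pos that by(intro powr_mono2)auto
also have "...\<le>e powr 1"using e that by(intro powr_mono)auto
finally show ?thesis using e by simp
qed
\<comment> \<open>One factor \<open>H powr ga\<close> is kept from the square; the exponents
  \<open>1 - ga\<close> and 1 that remain lie between 0 and 1.\<close>
have h2:"H\<^sup>2\<le>e\<^sup>2 * ?h"
proof -
have "H\<^sup>2 = H powr(ga + (1 - ga) + 1)"using mesh_size_pos by simp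
also have "... = ?h * H powr(1 - ga) * H powr 1"by(simp only: powr_add)
also have "...\<le>?h * e * e"using pw[of "1 - ga"]pw[of 1]ga e by(intro mult_mono)auto
finally show ?thesis by(simp add: power2_eq_square ac_simps)
qed
have de:"de\<le>a * ?h"
proof -
have "C1 0 * H\<^sup>2 / sqrt al\<le>C1 0 * (e\<^sup>2 * ?h) / sqrt al"using h2 pos by(intro divide_right_mono mult_left_mono)auto
thus ?thesis by(simp add: a_def e_def ac_simps)
qed
have ka:"ka\<le>b * ?h"
proof -
have "H powr(2 * ga) = ?h * ?h"by(simp add: powr_add[symmetric])
also have "...\<le>e * ?h"using pw[of ga]ga by(intro mult_right_mono)auto
finally have "C2 * H powr(2 * ga)\<le>C2 * (e * ?h)"using pos by(intro mult_left_mono)auto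
thus ?thesis by(simp add: b_def e_def ac_simps)
qed
define x where "x = ?h * ?L"
define y where "y = k\<^sup>2 * ?M"
have x0:"0\<le>x"and y0:"0\<le>y"using parts by(simp_all add: x_def y_def)
have ab:"0\<le>a""0\<le>b"using pos e by(simp_all add: a_def b_def e_def)
have t1:"Mg * de\<le>a * x"
using mult_mono[OF parts(1)de parts(5)de_nonneg]by(simp add: x_def ac_simps)
have t2:"ka * M1\<le>b * x"
using mult_mono[OF ka parts(2)order_trans[OF ka_nonneg ka]nonneg(3)]by(simp add: x_def ac_simps)
have t3:"de * p N\<le>a * ?s * x"
using mult_mono[OF de pN order_trans[OF de_nonneg de]pqr_nonneg(1)]by(simp add: x_def ac_simps)
have t4:"ka * r N\<le>b * ?s * x"
using mult_mono[OF ka rN order_trans[OF ka_nonneg ka]pqr_nonneg(3)]by(simp add: x_def ac_simps)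
have t5:"k\<^sup>2 * q N\<le>?s * y"
using mult_left_mono[OF qN,of "k\<^sup>2"]by(simp add: y_def ac_simps)
have t6:"k\<^sup>2 * M3\<le>y"using mult_left_mono[OF parts(4),of "k\<^sup>2"]by(simp add: y_def)
have E:"sqrt(E m)\<le>A * x + B * y"
proof -
have "sqrt(E m)\<le>(Mg * de + 3/2 * (k\<^sup>2 * M3) + ka * M1) + (4 * (Mg * de) + 2 * (3 * (de * p N)) + 2 * (6 * (k\<^sup>2 * q N) + 4 * (ka * r N)))"
 using energy_bound[OF m'(1)]initial_energy by(simp only: mult.assoc)
also have "...\<le>(a * x + 3/2 * y + b * x) + (4 * (a * x) + 2 * (3 * (a * ?s * x)) + 2 * (6 * (?s * y) + 4 * (b * ?s * x)))"
 by(intro add_mono mult_left_mono t1 t2 t3 t4 t5 t6)simp_all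
also have "... = A * x + B * y"by(simp add: A_def B_def algebra_simps)
finally show ?thesis .
qed
have AB:"0\<le>A""0\<le>B"using ab s0 by(simp_all add: A_def B_def)
have t7:"C2 * ?h * (c * (LTinfnorm T(Hnorm Om(2 + ga))u + Mg))\<le>C2 * c * x"
proof -
have "C2 * ?h * (c * (LTinfnorm T(Hnorm Om(2 + ga))u + Mg))\<le>C2 * ?h * (c * ?L)"
 using parts(3)c0 pos by(intro mult_left_mono)auto
thus ?thesis by(simp add: x_def ac_simps)
qed
have "L2norm Om(%x. dt_half k(grid k u)m x - dt_half k U m x) + h_norm Tr(%x. half(grid k u)m x - half U m x)
 \<le>(ka * M1 + sqrt(E m)) + (C2 * ?h * (c * (LTinfnorm T(Hnorm Om(2 + ga))u + Mg)) + sqrt(E m) / sqrt al)"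
by(rule add_mono[OF error_split(1)[OF c c0 m'(2)]error_split(2)[OF c c0 m'(2)]])
also have "...\<le>(b * x + (A * x + B * y)) + (C2 * c * x + (A * x + B * y) / sqrt al)"
by(intro add_mono t2 E t7 divide_right_mono)(use pos in simp)
also have "... = (b + C2 * c) * x + (1 + 1 / sqrt al) * (A * x + B * y)"by(simp add: algebra_simps add_divide_distrib)
also have "...\<le>(b + C2 * c) * (x + y) + (1 + 1 / sqrt al) * ((A + B) * (x + y))"
proof(intro add_mono mult_left_mono)
have "0\<le>A * y + B * x"using AB x0 y0 by simp
thus "A * x + B * y\<le>(A + B) * (x + y)"by(simp add: algebra_simps)
qed(use x0 y0 ab c0 pos in auto)
also have "... = (b + C2 * c + (1 + 1 / sqrt al) * (A + B)) * (x + y)"by(simp only: distrib_right mult.assoc)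
finally show ?thesis by(simp only: x_def y_def)
qed

end

theorem theorem4p3:
  fixes \<Omega> :: "pt set" and \<gamma>\<^sub>0 T \<alpha> \<beta> C2 :: real and C1 :: "real \<Rightarrow> real"
    and lam :: "nat \<Rightarrow> real" and psi :: "nat \<Rightarrow> fld"
  assumes "polygonal_lipschitz_domain \<Omega>"
    and "eigensystem \<Omega> lam psi"
    and "1/2 < \<gamma>\<^sub>0" and "\<gamma>\<^sub>0 \<le> 1" and "elliptic_regularity \<Omega> \<gamma>\<^sub>0"
    and "0 < T" and "0 < \<alpha>" and "0 < \<beta>" and "\<And>s. s \<in> {0..2} \<Longrightarrow> 0 < C1 s" and "0 < C2"
  shows "\<exists>C>0. \<forall>(\<T> :: pt set set) (\<kappa> :: real) (V :: fld set) (ah :: fld \<Rightarrow> fld \<Rightarrow> real)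
      (IM :: fld \<Rightarrow> fld) (J :: fld \<Rightarrow> fld) (Rh :: fld \<Rightarrow> fld)
      (N :: nat) (k :: real) (h :: real) (u0 :: fld) (v0 :: fld)
      (f :: real \<Rightarrow> fld) (ft :: real \<Rightarrow> fld) (ftt :: real \<Rightarrow> fld) (fttt :: real \<Rightarrow> fld)
      (u :: real \<Rightarrow> fld) (ut :: real \<Rightarrow> fld) (utt :: real \<Rightarrow> fld) (uttt :: real \<Rightarrow> fld)
      (utttt :: real \<Rightarrow> fld) (U :: nat \<Rightarrow> fld).
    mesh_triangulation \<Omega> \<T> \<and> shape_regular \<kappa> \<T> \<and> h = mesh_size \<T> \<and>
    fin_dim_space V \<and> V \<subseteq> Hpw \<T> 2 \<and> discrete_form \<Omega> \<T> V ah \<alpha> \<beta> \<and>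
    morley_interpolation \<Omega> \<T> IM \<and> companion \<Omega> \<T> J \<and>
    smoother_estimate \<Omega> \<T> V (J \<circ> IM) C1 \<and>
    ritz_projection \<Omega> V ah (J \<circ> IM) Rh \<and> ritz_estimate \<Omega> \<T> \<gamma>\<^sub>0 Rh C2 \<and>
    0 < N \<and> k = T / real N \<and>
    smooth_data \<Omega> T lam psi u0 v0 f ft ftt fttt \<and>
    weak_solution \<Omega> T u0 v0 f u ut \<and> regular_solution \<Omega> T \<gamma>\<^sub>0 u ut utt uttt utttt \<and>
    implicit_scheme \<Omega> V ah Rh k N u0 v0 f U
    \<longrightarrow> (\<forall>m \<in> {1..N - 1}.
          L2norm \<Omega> (\<lambda>x. dt_half k (grid k u) m x - dt_half k U m x) +
          h_norm \<T> (\<lambda>x. half (grid k u) m x - half U m x)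
          \<le> C * (h powr \<gamma>\<^sub>0 * L_fu \<Omega> T \<gamma>\<^sub>0 f ft u ut utt uttt + k\<^sup>2 * M_u \<Omega> T uttt utttt))"
proof -
  obtain c1 where c1: "\<And>\<psi>. \<psi> \<in> DA \<Omega> \<Longrightarrow> \<psi> \<in> Hs \<Omega> (2 + \<gamma>\<^sub>0) \<and>
     (\<forall>g. has_bilaplacian \<Omega> \<psi> g \<longrightarrow> Hnorm \<Omega> (2 + \<gamma>\<^sub>0) \<psi> \<le> c1 * (L2norm \<Omega> \<psi> + L2norm \<Omega> g))"
    using assms(5) unfolding elliptic_regularity_def by blast
  \<comment> \<open>The regularity constant may be negative as given; a nonnegative one is needed to
    insert upper bounds for the norms it multiplies.\<close>
  define c where "c = max c1 0"
  have c0: "0 \<le> c" by (simp add: c_def)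
  have c: "\<psi> \<in> Hs \<Omega> (2 + \<gamma>\<^sub>0) \<and> (has_bilaplacian \<Omega> \<psi> g \<longrightarrow> Hnorm \<Omega> (2 + \<gamma>\<^sub>0) \<psi> \<le> c * (L2norm \<Omega> \<psi> + L2norm \<Omega> g))"
    if "\<psi> \<in> DA \<Omega>" for \<psi> g
  proof -
    have "c1 * (L2norm \<Omega> \<psi> + L2norm \<Omega> g) \<le> c * (L2norm \<Omega> \<psi> + L2norm \<Omega> g)"
      by (intro mult_right_mono) (simp_all add: c_def)
    then show ?thesis using c1[OF that] order_trans by blast
  qed
  \<comment> \<open>All ingredients of the constant are fixed by the domain, the final time and the
    given bounds, before the mesh, the time step and the data are chosen.\<close>
  define a where "a = C1 0 * (1 + diameter (closure \<Omega>))\<^sup>2 / sqrt \<alpha>"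
  define b where "b = C2 * (1 + diameter (closure \<Omega>))"
  define A where "A = 5 * a + b + 6 * a * sqrt T + 8 * b * sqrt T"
  define B where "B = 3 / 2 + 12 * sqrt T"
  define C where "C = b + C2 * c + (1 + 1 / sqrt \<alpha>) * (A + B)"
  have op: "open \<Omega>" "bounded \<Omega>" using assms(1) by (simp_all add: polygonal_lipschitz_domain_def)
  have C10: "0 < C1 0" using assms(9)[of 0] by simp
  have diam: "0 \<le> diameter (closure \<Omega>)" by (rule diameter_ge_0[OF bounded_closure[OF op(2)]])
  have ab: "0 \<le> a" "0 < b" using C10 diam assms(7,10) by (simp_all add: a_def b_def)
  have "0 \<le> A + B" using ab assms(6) by (simp add: A_def B_def)
  then have C: "0 < C" using ab c0 assms(7,10) unfolding C_def by (intro add_pos_nonneg) auto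
  show ?thesis
  proof (rule exI[of _ C], intro conjI C allI impI ballI, elim conjE)
    fix \<T> \<kappa> V ah IM J Rh N k h u0 v0 f ft ftt fttt u ut utt uttt utttt U m
    assume h1: "mesh_triangulation \<Omega> \<T>" and hh: "h = mesh_size \<T>" and h3: "fin_dim_space V" and h4: "V \<subseteq> Hpw \<T> 2"
      and h5: "discrete_form \<Omega> \<T> V ah \<alpha> \<beta>" and h6: "morley_interpolation \<Omega> \<T> IM" and h7: "companion \<Omega> \<T> J"
      and h8: "smoother_estimate \<Omega> \<T> V (J \<circ> IM) C1" and h9: "ritz_projection \<Omega> V ah (J \<circ> IM) Rh"
      and h10: "ritz_estimate \<Omega> \<T> \<gamma>\<^sub>0 Rh C2" and h11: "0 < N" and h12: "k = T / real N"
      and h13: "smooth_data \<Omega> T lam psi u0 v0 f ft ftt fttt" and h14: "weak_solution \<Omega> T u0 v0 f u ut"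
      and h15: "regular_solution \<Omega> T \<gamma>\<^sub>0 u ut utt uttt utttt" and h16: "implicit_scheme \<Omega> V ah Rh k N u0 v0 f U"
    assume m: "m \<in> {1..N - 1}"
    have Q: "(J \<circ> IM) v \<in> H20 \<Omega>" if "v \<in> V" for v
    proof -
      have "IM v \<in> morley \<Omega> \<T>" using h6 h4 that unfolding morley_interpolation_def by blast
      then show ?thesis using h7 unfolding companion_def by simp
    qed
    have g0: "0 < \<gamma>\<^sub>0" using assms(3) by simp
    interpret scheme \<Omega> lam psi T \<gamma>\<^sub>0 u0 v0 f ft ftt fttt u ut utt uttt utttt \<T> V ah "J \<circ> IM" Rh N k \<alpha> \<beta> C2 C1 U
      by (unfold_locales; (rule op assms(2,6) h13 h14 h15 h1 assms(1) h3 h4 h5 Q h8 h9 h10 h11 h12 h16 assms(7) C10 assms(10) g0 assms(4); assumption?))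
    show "L2norm \<Omega> (\<lambda>x. dt_half k (grid k u) m x - dt_half k U m x) + h_norm \<T> (\<lambda>x. half (grid k u) m x - half U m x)
        \<le> C * (h powr \<gamma>\<^sub>0 * L_fu \<Omega> T \<gamma>\<^sub>0 f ft u ut utt uttt + k\<^sup>2 * M_u \<Omega> T uttt utttt)"
      unfolding hh C_def A_def B_def a_def b_def by (rule error_bound[OF c c0 m])
  qed
qed

end
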